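(* Let $\Omega^1$ be a pivotal $A$-bimodule with dual $\mathfrak{X}^1$. The category of left $H(\Omega^1)$-modules is isomorphic to the category ${}^{\mathfrak{X}^1}_{A}I\mathcal{M}^{\Omega^1}_{A}$ of pairs $(M,\sigma)$, with $M$ an $A$-bimodule and $\sigma:M\otimes\Omega^1\to\Omega^1\otimes M$ an invertible bimodule map, such that the bimodule maps $$(\mathrm{ev}\otimes\mathrm{id}_{M\otimes\mathfrak{X}^1})(\mathrm{id}_{\mathfrak{X}^1}\otimes\sigma\otimes\mathrm{id}_{\mathfrak{X}^1})(\mathrm{id}_{\mathfrak{X}^1\otimes M}\otimes\mathrm{coev}):\ \mathfrak{X}^1\otimes M\to M\otimes\mathfrak{X}^1,$$ $$(\mathrm{id}_{\mathfrak{X}^1\otimes M}\otimes\underline{\mathrm{ev}})(\mathrm{id}_{\mathfrak{X}^1}\otimes\sigma^{-1}\otimes\mathrm{id}_{\mathfrak{X}^1})(\underline{\mathrm{coev}}\otimes\mathrm{id}_{M\otimes\mathfrak{X}^1}):\ M\otimes\mathfrak{X}^1\to\mathfrak{X}^1\otimes M$$ are inverse to each other.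
   Context: Conventions. $\mathbb{K}$ is a field, $A$ a unital associative $\mathbb{K}$-algebra, $\otimes$ means $\otimes_A$. $A^{op}=\{\overline{a}: a\in A\}$ with $\overline{a}\,\overline{b}=\overline{ba}$; $A^e=A\otimes_{\mathbb{K}}A^{op}$ with elements written $a\overline{b}$. $A$-bimodules are identified with left $A^e$-modules via $(a\overline{b})m=amb$. Summation over repeated dual-basis indices is implicit. $T_{A^e}(V)$ is the tensor algebra of an $A^e$-bimodule $V$. Morphisms in ${}^{\mathfrak{X}^1}_{A}I\mathcal{M}^{\Omega^1}_{A}$ from $(M,\sigma_M)$ to $(N,\sigma_N)$ are bimodule maps $f:M\to N$ with $\sigma_N(f\otimes\mathrm{id}_{\Omega^1})=(\mathrm{id}_{\Omega^1}\otimes f)\sigma_M$. Pivotal bimodules. $\Omega^1$ is pivotal if it is finitely generated projective on both sides and its left dual $\mathrm{Hom}_A(\Omega^1,A)$ and right dual ${}_A\mathrm{Hom}(\Omega^1,A)$ are isomorphic as bimodules. Fixing such an isomorphism, a single bimodule $\mathfrak{X}^1$ is both left and right dual of $\Omega^1$, with bimodule maps $\mathrm{ev}:\mathfrak{X}^1\otimes\Omega^1\to A$, $\mathrm{coev}:A\to\Omega^1\otimes\mathfrak{X}^1$, $\mathrm{coev}(1)=\omega_i\otimes x_i$, $\underline{\mathrm{ev}}:\Omega^1\otimes\mathfrak{X}^1\to A$, $\underline{\mathrm{coev}}:A\to\mathfrak{X}^1\otimes\Omega^1$, $\underline{\mathrm{coev}}(1)=y_j\otimes\rho_j$, satisfying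 $\omega=\omega_i\,\mathrm{ev}(x_i\otimes\omega)=\underline{\mathrm{ev}}(\omega\otimes y_j)\rho_j$ and $x=\mathrm{ev}(x\otimes\omega_i)x_i=y_j\,\underline{\mathrm{ev}}(\rho_j\otimes x)$. The algebra $H(\Omega^1)$. Let $\mathfrak{Z}=(\mathfrak{X}^1\otimes_{\mathbb{K}}\Omega^1)\oplus(\Omega^1\otimes_{\mathbb{K}}\mathfrak{X}^1)$; write $(x,\omega)$ for $x\otimes_{\mathbb{K}}\omega$ in the first summand and $(\omega,x)$ for $\omega\otimes_{\mathbb{K}}x$ in the second. $\mathfrak{Z}$ is an $A^e$-bimodule via $a\overline{a'}(x,\omega)b\overline{b'}=(axb,b'\omega a')$ and $a\overline{a'}(\omega,x)b\overline{b'}=(a\omega b,b'xa')$. $H(\Omega^1)$ is the quotient of $T_{A^e}(\mathfrak{Z})$ (product $\bullet$) by the ideal generated by, for all $x\in\mathfrak{X}^1$, $\omega\in\Omega^1$, $$(\omega_i,x)\bullet(x_i,\omega)=\overline{\underline{\mathrm{ev}}(\omega\otimes x)},\qquad (x,\rho_j)\bullet(\omega,y_j)=\mathrm{ev}(x\otimes\omega),$$ $$(y_j,\omega)\bullet(\rho_j,x)=\overline{\mathrm{ev}(x\otimes\omega)},\qquad (\omega,x_i)\bullet(x,\omega_i)=\underline{\mathrm{ev}}(\omega\otimes x).$$ *)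

theory Defs
  imports "HOL-Algebra.Free_Abelian_Groups" "HOL-Algebra.Generated_Groups"
    "HOL-Algebra.Module" "HOL-Algebra.QuotRing"
begin

text \<open>
  Abelian groups underlying modules are \<open>comm_group\<close>s, written multiplicatively, in line with
  \<^const>\<open>free_Abelian_group\<close>; only rings use the additive notation of \<open>HOL-Algebra\<close>.
  All rings are unital and associative, possibly zero and possibly non-commutative.
\<close>

section \<open>Categories and isomorphisms of categories\<close>

record ('o, 'f) cat =
  Obj :: "'o set"
  Hom :: "'o \<Rightarrow> 'o \<Rightarrow> 'f set"
  Comp :: "'o \<Rightarrow> 'o \<Rightarrow> 'o \<Rightarrow> 'f \<Rightarrow> 'f \<Rightarrow> 'f"
  Ident :: "'o \<Rightarrow> 'f"

text \<open>\<open>Comp C X Y Z g f\<close> is \<open>g \<circ> f\<close> for \<open>f : X \<rightarrow> Y\<close> and \<open>g : Y \<rightarrow> Z\<close>. Hom-sets need not be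
  disjoint: an arrow is always considered together with its source and target.\<close>

locale category =
  fixes C :: "('o, 'f) cat"
  assumes comp_closed: "\<lbrakk>X \<in> Obj C; Y \<in> Obj C; Z \<in> Obj C; f \<in> Hom C X Y; g \<in> Hom C Y Z\<rbrakk>
      \<Longrightarrow> Comp C X Y Z g f \<in> Hom C X Z"
    and ident_closed: "X \<in> Obj C \<Longrightarrow> Ident C X \<in> Hom C X X"
    and comp_ident_right: "\<lbrakk>X \<in> Obj C; Y \<in> Obj C; f \<in> Hom C X Y\<rbrakk>
      \<Longrightarrow> Comp C X X Y f (Ident C X) = f"
    and comp_ident_left: "\<lbrakk>X \<in> Obj C; Y \<in> Obj C; f \<in> Hom C X Y\<rbrakk>
      \<Longrightarrow> Comp C X Y Y (Ident C Y) f = f"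
    and comp_assoc: "\<lbrakk>V \<in> Obj C; X \<in> Obj C; Y \<in> Obj C; Z \<in> Obj C;
        f \<in> Hom C V X; g \<in> Hom C X Y; h \<in> Hom C Y Z\<rbrakk>
      \<Longrightarrow> Comp C V Y Z h (Comp C V X Y g f) = Comp C V X Z (Comp C X Y Z h g) f"

locale category_functor = C: category C + D: category D
  for C :: "('o1, 'f1) cat" and D :: "('o2, 'f2) cat" +
  fixes Fo :: "'o1 \<Rightarrow> 'o2" and Fa :: "'o1 \<Rightarrow> 'o1 \<Rightarrow> 'f1 \<Rightarrow> 'f2"
  assumes obj_closed: "X \<in> Obj C \<Longrightarrow> Fo X \<in> Obj D"
    and arr_closed: "\<lbrakk>X \<in> Obj C; Y \<in> Obj C; f \<in> Hom C X Y\<rbrakk> \<Longrightarrow> Fa X Y f \<in> Hom D (Fo X) (Fo Y)"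
    and preserves_ident: "X \<in> Obj C \<Longrightarrow> Fa X X (Ident C X) = Ident D (Fo X)"
    and preserves_comp: "\<lbrakk>X \<in> Obj C; Y \<in> Obj C; Z \<in> Obj C; f \<in> Hom C X Y; g \<in> Hom C Y Z\<rbrakk>
      \<Longrightarrow> Fa X Z (Comp C X Y Z g f) = Comp D (Fo X) (Fo Y) (Fo Z) (Fa Y Z g) (Fa X Y f)"

definition isomorphic_categories :: "('o1, 'f1) cat \<Rightarrow> ('o2, 'f2) cat \<Rightarrow> bool" where
  "isomorphic_categories C D \<longleftrightarrow> (\<exists>Fo Fa Go Ga.
     category_functor C D Fo Fa \<and> category_functor D C Go Ga \<and>
     (\<forall>X\<in>Obj C. Go (Fo X) = X) \<and>
     (\<forall>X\<in>Obj C. \<forall>Y\<in>Obj C. \<forall>f\<in>Hom C X Y. Ga (Fo X) (Fo Y) (Fa X Y f) = f) \<and>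
     (\<forall>X\<in>Obj D. Fo (Go X) = X) \<and>
     (\<forall>X\<in>Obj D. \<forall>Y\<in>Obj D. \<forall>f\<in>Hom D X Y. Fa (Go X) (Go Y) (Ga X Y f) = f))"

section \<open>Algebras, modules and bimodules\<close>

locale assoc_algebra =
  fixes K :: "('k, 'kx) ring_scheme" and A :: "('k, 'a, 'ax) module_scheme"
  assumes scalar_field: "field K"
    and ring: "ring A"
    and vector_space: "module K A"
    and smult_mult_left: "\<lbrakk>c \<in> carrier K; x \<in> carrier A; y \<in> carrier A\<rbrakk>
      \<Longrightarrow> (c \<odot>\<^bsub>A\<^esub> x) \<otimes>\<^bsub>A\<^esub> y = c \<odot>\<^bsub>A\<^esub> (x \<otimes>\<^bsub>A\<^esub> y)"
    and smult_mult_right: "\<lbrakk>c \<in> carrier K; x \<in> carrier A; y \<in> carrier A\<rbrakk>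
      \<Longrightarrow> x \<otimes>\<^bsub>A\<^esub> (c \<odot>\<^bsub>A\<^esub> y) = c \<odot>\<^bsub>A\<^esub> (x \<otimes>\<^bsub>A\<^esub> y)"

definition opp :: "('k, 'a, 'ax) module_scheme \<Rightarrow> ('k, 'a, 'ax) module_scheme" where
  "opp A = A\<lparr>monoid.mult := (\<lambda>x y. y \<otimes>\<^bsub>A\<^esub> x)\<rparr>"

record ('r, 'm) lmod = "'m monoid" +
  act :: "'r \<Rightarrow> 'm \<Rightarrow> 'm"

locale left_module =
  fixes R :: "('r, 'rx) ring_scheme" and M :: "('r, 'm) lmod"
  assumes ring: "ring R"
    and group: "comm_group M"
    and act_closed: "\<lbrakk>r \<in> carrier R; m \<in> carrier M\<rbrakk> \<Longrightarrow> act M r m \<in> carrier M"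
    and act_add_left: "\<lbrakk>r \<in> carrier R; s \<in> carrier R; m \<in> carrier M\<rbrakk>
      \<Longrightarrow> act M (r \<oplus>\<^bsub>R\<^esub> s) m = act M r m \<otimes>\<^bsub>M\<^esub> act M s m"
    and act_add_right: "\<lbrakk>r \<in> carrier R; m \<in> carrier M; n \<in> carrier M\<rbrakk>
      \<Longrightarrow> act M r (m \<otimes>\<^bsub>M\<^esub> n) = act M r m \<otimes>\<^bsub>M\<^esub> act M r n"
    and act_mult: "\<lbrakk>r \<in> carrier R; s \<in> carrier R; m \<in> carrier M\<rbrakk>
      \<Longrightarrow> act M (r \<otimes>\<^bsub>R\<^esub> s) m = act M r (act M s m)"
    and act_one: "m \<in> carrier M \<Longrightarrow> act M \<one>\<^bsub>R\<^esub> m = m"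

record ('r, 'm) bimod = "'m monoid" +
  lact :: "'r \<Rightarrow> 'm \<Rightarrow> 'm"  (infixr \<open>\<rhd>\<index>\<close> 75)
  ract :: "'m \<Rightarrow> 'r \<Rightarrow> 'm"  (infixl \<open>\<lhd>\<index>\<close> 75)

locale bimodule =
  fixes R :: "('r, 'rx) ring_scheme" and M :: "('r, 'm) bimod"
  assumes ring: "ring R"
    and group: "comm_group M"
    and lact_closed: "\<lbrakk>r \<in> carrier R; m \<in> carrier M\<rbrakk> \<Longrightarrow> r \<rhd>\<^bsub>M\<^esub> m \<in> carrier M"
    and lact_add_left: "\<lbrakk>r \<in> carrier R; s \<in> carrier R; m \<in> carrier M\<rbrakk>
      \<Longrightarrow> (r \<oplus>\<^bsub>R\<^esub> s) \<rhd>\<^bsub>M\<^esub> m = (r \<rhd>\<^bsub>M\<^esub> m) \<otimes>\<^bsub>M\<^esub> (s \<rhd>\<^bsub>M\<^esub> m)"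
    and lact_add_right: "\<lbrakk>r \<in> carrier R; m \<in> carrier M; n \<in> carrier M\<rbrakk>
      \<Longrightarrow> r \<rhd>\<^bsub>M\<^esub> (m \<otimes>\<^bsub>M\<^esub> n) = (r \<rhd>\<^bsub>M\<^esub> m) \<otimes>\<^bsub>M\<^esub> (r \<rhd>\<^bsub>M\<^esub> n)"
    and lact_mult: "\<lbrakk>r \<in> carrier R; s \<in> carrier R; m \<in> carrier M\<rbrakk>
      \<Longrightarrow> (r \<otimes>\<^bsub>R\<^esub> s) \<rhd>\<^bsub>M\<^esub> m = r \<rhd>\<^bsub>M\<^esub> (s \<rhd>\<^bsub>M\<^esub> m)"
    and lact_one: "m \<in> carrier M \<Longrightarrow> \<one>\<^bsub>R\<^esub> \<rhd>\<^bsub>M\<^esub> m = m"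
    and ract_closed: "\<lbrakk>r \<in> carrier R; m \<in> carrier M\<rbrakk> \<Longrightarrow> m \<lhd>\<^bsub>M\<^esub> r \<in> carrier M"
    and ract_add_right: "\<lbrakk>r \<in> carrier R; s \<in> carrier R; m \<in> carrier M\<rbrakk>
      \<Longrightarrow> m \<lhd>\<^bsub>M\<^esub> (r \<oplus>\<^bsub>R\<^esub> s) = (m \<lhd>\<^bsub>M\<^esub> r) \<otimes>\<^bsub>M\<^esub> (m \<lhd>\<^bsub>M\<^esub> s)"
    and ract_add_left: "\<lbrakk>r \<in> carrier R; m \<in> carrier M; n \<in> carrier M\<rbrakk>
      \<Longrightarrow> (m \<otimes>\<^bsub>M\<^esub> n) \<lhd>\<^bsub>M\<^esub> r = (m \<lhd>\<^bsub>M\<^esub> r) \<otimes>\<^bsub>M\<^esub> (n \<lhd>\<^bsub>M\<^esub> r)"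
    and ract_mult: "\<lbrakk>r \<in> carrier R; s \<in> carrier R; m \<in> carrier M\<rbrakk>
      \<Longrightarrow> m \<lhd>\<^bsub>M\<^esub> (r \<otimes>\<^bsub>R\<^esub> s) = (m \<lhd>\<^bsub>M\<^esub> r) \<lhd>\<^bsub>M\<^esub> s"
    and ract_one: "m \<in> carrier M \<Longrightarrow> m \<lhd>\<^bsub>M\<^esub> \<one>\<^bsub>R\<^esub> = m"
    and lact_ract: "\<lbrakk>r \<in> carrier R; s \<in> carrier R; m \<in> carrier M\<rbrakk>
      \<Longrightarrow> (r \<rhd>\<^bsub>M\<^esub> m) \<lhd>\<^bsub>M\<^esub> s = r \<rhd>\<^bsub>M\<^esub> (m \<lhd>\<^bsub>M\<^esub> s)"

text \<open>A bimodule over the \<open>K\<close>-algebra \<open>A\<close>: the two induced \<open>K\<close>-actions coincide, which is what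
  makes it the same thing as a left module over \<open>A \<otimes>\<^sub>K A\<^sup>o\<^sup>p\<close>.\<close>

locale algebra_bimodule = bimodule A M
  for K :: "('k, 'kx) ring_scheme" and A :: "('k, 'a, 'ax) module_scheme" and M :: "('a, 'm) bimod" +
  assumes central: "\<lbrakk>c \<in> carrier K; m \<in> carrier M\<rbrakk>
      \<Longrightarrow> (c \<odot>\<^bsub>A\<^esub> \<one>\<^bsub>A\<^esub>) \<rhd>\<^bsub>M\<^esub> m = m \<lhd>\<^bsub>M\<^esub> (c \<odot>\<^bsub>A\<^esub> \<one>\<^bsub>A\<^esub>)"

definition left_hom :: "('r, 'rx) ring_scheme \<Rightarrow> ('r, 'm) bimod \<Rightarrow> ('r, 'n) bimod \<Rightarrow> ('m \<Rightarrow> 'n) set" where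
  "left_hom R M N =
     {f \<in> hom M N. \<forall>r\<in>carrier R. \<forall>m\<in>carrier M. f (r \<rhd>\<^bsub>M\<^esub> m) = r \<rhd>\<^bsub>N\<^esub> f m}"

definition right_hom :: "('r, 'rx) ring_scheme \<Rightarrow> ('r, 'm) bimod \<Rightarrow> ('r, 'n) bimod \<Rightarrow> ('m \<Rightarrow> 'n) set" where
  "right_hom R M N =
     {f \<in> hom M N. \<forall>r\<in>carrier R. \<forall>m\<in>carrier M. f (m \<lhd>\<^bsub>M\<^esub> r) = f m \<lhd>\<^bsub>N\<^esub> r}"

definition bimod_hom :: "('r, 'rx) ring_scheme \<Rightarrow> ('r, 'm) bimod \<Rightarrow> ('r, 'n) bimod \<Rightarrow> ('m \<Rightarrow> 'n) set" where
  "bimod_hom R M N = left_hom R M N \<inter> right_hom R M N"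

definition regular :: "('a, 'ax) ring_scheme \<Rightarrow> ('a, 'a) bimod" where
  "regular A = \<lparr>carrier = carrier A, monoid.mult = add A, one = zero A,
     lact = monoid.mult A, ract = monoid.mult A\<rparr>"

section \<open>Finitely generated projective bimodules, duals and pivotality\<close>

definition free_bimod :: "('a, 'ax) ring_scheme \<Rightarrow> nat \<Rightarrow> ('a, nat \<Rightarrow> 'a) bimod" where
  "free_bimod A n = \<lparr>carrier = {..<n} \<rightarrow>\<^sub>E carrier A,
     monoid.mult = (\<lambda>f g. \<lambda>i\<in>{..<n}. f i \<oplus>\<^bsub>A\<^esub> g i),
     one = (\<lambda>i\<in>{..<n}. \<zero>\<^bsub>A\<^esub>),
     lact = (\<lambda>a f. \<lambda>i\<in>{..<n}. a \<otimes>\<^bsub>A\<^esub> f i),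
     ract = (\<lambda>f a. \<lambda>i\<in>{..<n}. f i \<otimes>\<^bsub>A\<^esub> a)\<rparr>"

text \<open>Finitely generated projective: a direct summand of some \<open>A\<^sup>n\<close>.\<close>

definition left_fgp :: "('a, 'ax) ring_scheme \<Rightarrow> ('a, 'w) bimod \<Rightarrow> bool" where
  "left_fgp A W \<longleftrightarrow> (\<exists>n. \<exists>\<iota>\<in>left_hom A W (free_bimod A n). \<exists>\<pi>\<in>left_hom A (free_bimod A n) W.
     \<forall>w\<in>carrier W. \<pi> (\<iota> w) = w)"

definition right_fgp :: "('a, 'ax) ring_scheme \<Rightarrow> ('a, 'w) bimod \<Rightarrow> bool" where
  "right_fgp A W \<longleftrightarrow> (\<exists>n. \<exists>\<iota>\<in>right_hom A W (free_bimod A n). \<exists>\<pi>\<in>right_hom A (free_bimod A n) W.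
     \<forall>w\<in>carrier W. \<pi> (\<iota> w) = w)"

text \<open>The left dual consists of the right \<open>A\<close>-linear maps \<open>W \<rightarrow> A\<close>, with
  \<open>(a f)(w) = a f(w)\<close> and \<open>(f a)(w) = f(a w)\<close>.\<close>

definition left_dual :: "('a, 'ax) ring_scheme \<Rightarrow> ('a, 'w) bimod \<Rightarrow> ('a, 'w \<Rightarrow> 'a) bimod" where
  "left_dual A W = \<lparr>carrier = right_hom A W (regular A) \<inter> extensional (carrier W),
     monoid.mult = (\<lambda>f g. \<lambda>w\<in>carrier W. f w \<oplus>\<^bsub>A\<^esub> g w),
     one = (\<lambda>w\<in>carrier W. \<zero>\<^bsub>A\<^esub>),
     lact = (\<lambda>a f. \<lambda>w\<in>carrier W. a \<otimes>\<^bsub>A\<^esub> f w),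
     ract = (\<lambda>f a. \<lambda>w\<in>carrier W. f (a \<rhd>\<^bsub>W\<^esub> w))\<rparr>"

text \<open>The right dual consists of the left \<open>A\<close>-linear maps \<open>W \<rightarrow> A\<close>, with
  \<open>(a f)(w) = f(w a)\<close> and \<open>(f a)(w) = f(w) a\<close>.\<close>

definition right_dual :: "('a, 'ax) ring_scheme \<Rightarrow> ('a, 'w) bimod \<Rightarrow> ('a, 'w \<Rightarrow> 'a) bimod" where
  "right_dual A W = \<lparr>carrier = left_hom A W (regular A) \<inter> extensional (carrier W),
     monoid.mult = (\<lambda>f g. \<lambda>w\<in>carrier W. f w \<oplus>\<^bsub>A\<^esub> g w),
     one = (\<lambda>w\<in>carrier W. \<zero>\<^bsub>A\<^esub>),
     lact = (\<lambda>a f. \<lambda>w\<in>carrier W. f (w \<lhd>\<^bsub>W\<^esub> a)),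
     ract = (\<lambda>f a. \<lambda>w\<in>carrier W. f w \<otimes>\<^bsub>A\<^esub> a)\<rparr>"

definition pivotal :: "('a, 'ax) ring_scheme \<Rightarrow> ('a, 'w) bimod \<Rightarrow> bool" where
  "pivotal A W \<longleftrightarrow> left_fgp A W \<and> right_fgp A W \<and>
     (\<exists>\<theta>\<in>bimod_hom A (left_dual A W) (right_dual A W).
        bij_betw \<theta> (carrier (left_dual A W)) (carrier (right_dual A W)))"

section \<open>Abelian groups given by generators and relations\<close>

text \<open>The relators \<open>Rel\<close> are elements of the free abelian group on \<open>S\<close>.\<close>

definition relations :: "'s set \<Rightarrow> ('s \<Rightarrow>\<^sub>0 int) set \<Rightarrow> ('s \<Rightarrow>\<^sub>0 int) set" where
  "relations S Rel = generate (free_Abelian_group S) Rel"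

definition presented_group :: "'s set \<Rightarrow> ('s \<Rightarrow>\<^sub>0 int) set \<Rightarrow> ('s \<Rightarrow>\<^sub>0 int) set monoid" where
  "presented_group S Rel = free_Abelian_group S Mod relations S Rel"

definition generator :: "'s set \<Rightarrow> ('s \<Rightarrow>\<^sub>0 int) set \<Rightarrow> 's \<Rightarrow> ('s \<Rightarrow>\<^sub>0 int) set" where
  "generator S Rel s = relations S Rel #>\<^bsub>free_Abelian_group S\<^esub> frag_of s"

text \<open>The group homomorphism with prescribed values on the generators. It is unique if it exists,
  and it exists iff the extension of \<open>f\<close> to the free group kills all relators.\<close>

definition lift :: "'s set \<Rightarrow> ('s \<Rightarrow>\<^sub>0 int) set \<Rightarrow> ('g, 'gx) monoid_scheme \<Rightarrow> ('s \<Rightarrow> 'g)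
    \<Rightarrow> ('s \<Rightarrow>\<^sub>0 int) set \<Rightarrow> 'g" where
  "lift S Rel G f = (THE h. h \<in> hom (presented_group S Rel) G \<and>
     h \<in> extensional (carrier (presented_group S Rel)) \<and>
     (\<forall>s\<in>S. h (generator S Rel s) = f s))"

section \<open>Tensor products of bimodules\<close>

type_synonym ('m, 'n) tens = "('m \<times> 'n \<Rightarrow>\<^sub>0 int) set"

definition tensor_rel ::
  "('r, 'rx) ring_scheme \<Rightarrow> ('r, 'm) bimod \<Rightarrow> ('r, 'n) bimod \<Rightarrow> ('m \<times> 'n \<Rightarrow>\<^sub>0 int) set" where
  "tensor_rel R M N =
     {frag_of (m \<otimes>\<^bsub>M\<^esub> m', n) - frag_of (m, n) - frag_of (m', n) | m m' n.
        m \<in> carrier M \<and> m' \<in> carrier M \<and> n \<in> carrier N} \<union>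
     {frag_of (m, n \<otimes>\<^bsub>N\<^esub> n') - frag_of (m, n) - frag_of (m, n') | m n n'.
        m \<in> carrier M \<and> n \<in> carrier N \<and> n' \<in> carrier N} \<union>
     {frag_of (m \<lhd>\<^bsub>M\<^esub> r, n) - frag_of (m, r \<rhd>\<^bsub>N\<^esub> n) | m r n.
        m \<in> carrier M \<and> r \<in> carrier R \<and> n \<in> carrier N}"

definition tensor_group ::
  "('r, 'rx) ring_scheme \<Rightarrow> ('r, 'm) bimod \<Rightarrow> ('r, 'n) bimod \<Rightarrow> ('m, 'n) tens monoid" where
  "tensor_group R M N = presented_group (carrier M \<times> carrier N) (tensor_rel R M N)"

definition elt ::
  "('r, 'rx) ring_scheme \<Rightarrow> ('r, 'm) bimod \<Rightarrow> ('r, 'n) bimod \<Rightarrow> 'm \<Rightarrow> 'n \<Rightarrow> ('m, 'n) tens" where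
  "elt R M N m n = generator (carrier M \<times> carrier N) (tensor_rel R M N) (m, n)"

definition tensor_lift ::
  "('r, 'rx) ring_scheme \<Rightarrow> ('r, 'm) bimod \<Rightarrow> ('r, 'n) bimod \<Rightarrow> ('g, 'gx) monoid_scheme
    \<Rightarrow> ('m \<Rightarrow> 'n \<Rightarrow> 'g) \<Rightarrow> ('m, 'n) tens \<Rightarrow> 'g" where
  "tensor_lift R M N G \<beta> =
     lift (carrier M \<times> carrier N) (tensor_rel R M N) G (\<lambda>(m, n). \<beta> m n)"

text \<open>\<open>M \<boxtimes>\<^bsub>R\<^esub> N\<close> is the bimodule \<open>M \<otimes>\<^sub>R N\<close>, with elementary tensors \<open>elt R M N m n\<close>.\<close>

definition tensor ::
  "('r, 'rx) ring_scheme \<Rightarrow> ('r, 'm) bimod \<Rightarrow> ('r, 'n) bimod \<Rightarrow> ('r, ('m, 'n) tens) bimod"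
  (\<open>(_ \<boxtimes>\<index> _)\<close> [76, 75] 75) where
  "tensor R M N = \<lparr>carrier = carrier (tensor_group R M N),
     monoid.mult = monoid.mult (tensor_group R M N), one = one (tensor_group R M N),
     lact = (\<lambda>r. tensor_lift R M N (tensor_group R M N) (\<lambda>m n. elt R M N (r \<rhd>\<^bsub>M\<^esub> m) n)),
     ract = (\<lambda>t r. tensor_lift R M N (tensor_group R M N) (\<lambda>m n. elt R M N m (n \<lhd>\<^bsub>N\<^esub> r)) t)\<rparr>"

text \<open>\<open>f \<otimes> g : M \<otimes> N \<rightarrow> M' \<otimes> N'\<close>.\<close>

definition tensor_map ::
  "('r, 'rx) ring_scheme \<Rightarrow> ('r, 'm) bimod \<Rightarrow> ('r, 'n) bimod \<Rightarrow> ('r, 'm2) bimod \<Rightarrow> ('r, 'n2) bimod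
    \<Rightarrow> ('m \<Rightarrow> 'm2) \<Rightarrow> ('n \<Rightarrow> 'n2) \<Rightarrow> ('m, 'n) tens \<Rightarrow> ('m2, 'n2) tens" where
  "tensor_map R M N M' N' f g =
     tensor_lift R M N (M' \<boxtimes>\<^bsub>R\<^esub> N') (\<lambda>m n. elt R M' N' (f m) (g n))"

text \<open>The associativity and unit isomorphisms, which are usually left implicit.\<close>

definition assoc ::
  "('r, 'rx) ring_scheme \<Rightarrow> ('r, 'l) bimod \<Rightarrow> ('r, 'm) bimod \<Rightarrow> ('r, 'n) bimod
    \<Rightarrow> (('l, 'm) tens, 'n) tens \<Rightarrow> ('l, ('m, 'n) tens) tens" where
  "assoc R L M N = tensor_lift R (L \<boxtimes>\<^bsub>R\<^esub> M) N (L \<boxtimes>\<^bsub>R\<^esub> (M \<boxtimes>\<^bsub>R\<^esub> N))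
     (\<lambda>t n. tensor_lift R L M (L \<boxtimes>\<^bsub>R\<^esub> (M \<boxtimes>\<^bsub>R\<^esub> N))
       (\<lambda>l m. elt R L (M \<boxtimes>\<^bsub>R\<^esub> N) l (elt R M N m n)) t)"

definition assoc_inv ::
  "('r, 'rx) ring_scheme \<Rightarrow> ('r, 'l) bimod \<Rightarrow> ('r, 'm) bimod \<Rightarrow> ('r, 'n) bimod
    \<Rightarrow> ('l, ('m, 'n) tens) tens \<Rightarrow> (('l, 'm) tens, 'n) tens" where
  "assoc_inv R L M N = tensor_lift R L (M \<boxtimes>\<^bsub>R\<^esub> N) ((L \<boxtimes>\<^bsub>R\<^esub> M) \<boxtimes>\<^bsub>R\<^esub> N)
     (\<lambda>l t. tensor_lift R M N ((L \<boxtimes>\<^bsub>R\<^esub> M) \<boxtimes>\<^bsub>R\<^esub> N)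
       (\<lambda>m n. elt R (L \<boxtimes>\<^bsub>R\<^esub> M) N (elt R L M l m) n) t)"

definition lunit :: "('r, 'rx) ring_scheme \<Rightarrow> ('r, 'm) bimod \<Rightarrow> ('r, 'm) tens \<Rightarrow> 'm" where
  "lunit R M = tensor_lift R (regular R) M M (\<lambda>r m. r \<rhd>\<^bsub>M\<^esub> m)"

definition lunit_inv :: "('r, 'rx) ring_scheme \<Rightarrow> ('r, 'm) bimod \<Rightarrow> 'm \<Rightarrow> ('r, 'm) tens" where
  "lunit_inv R M m = elt R (regular R) M \<one>\<^bsub>R\<^esub> m"

definition runit :: "('r, 'rx) ring_scheme \<Rightarrow> ('r, 'm) bimod \<Rightarrow> ('m, 'r) tens \<Rightarrow> 'm" where
  "runit R M = tensor_lift R M (regular R) M (\<lambda>m r. m \<lhd>\<^bsub>M\<^esub> r)"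

definition runit_inv :: "('r, 'rx) ring_scheme \<Rightarrow> ('r, 'm) bimod \<Rightarrow> 'm \<Rightarrow> ('m, 'r) tens" where
  "runit_inv R M m = elt R M (regular R) m \<one>\<^bsub>R\<^esub>"

section \<open>The dual of a pivotal bimodule\<close>

text \<open>
  The bimodule \<open>X\<close> that is both left and right dual of \<open>W\<close>, with (co)evaluations
  \<open>ev : X \<otimes> W \<rightarrow> A\<close>, \<open>coev : A \<rightarrow> W \<otimes> X\<close> and \<open>uev : W \<otimes> X \<rightarrow> A\<close>, \<open>ucoev : A \<rightarrow> X \<otimes> W\<close>
  (the \<open>u\<close> stands for underlined), together with chosen expressions
  \<open>coev(1) = \<Sum>i<coev_len. \<omega>\<^sub>i \<otimes> x\<^sub>i\<close> and \<open>ucoev(1) = \<Sum>j<ucoev_len. y\<^sub>j \<otimes> \<rho>\<^sub>j\<close>.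
\<close>

record ('a, 'w, 'x) dual_data =
  dualX :: "('a, 'x) bimod"
  ev :: "('x, 'w) tens \<Rightarrow> 'a"
  coev :: "'a \<Rightarrow> ('w, 'x) tens"
  uev :: "('w, 'x) tens \<Rightarrow> 'a"
  ucoev :: "'a \<Rightarrow> ('x, 'w) tens"
  coev_len :: nat
  basis_omega :: "nat \<Rightarrow> 'w"
  basis_x :: "nat \<Rightarrow> 'x"
  ucoev_len :: nat
  basis_y :: "nat \<Rightarrow> 'x"
  basis_rho :: "nat \<Rightarrow> 'w"

definition ev2 :: "('a, 'ax) ring_scheme \<Rightarrow> ('a, 'w) bimod \<Rightarrow> ('a, 'w, 'x) dual_data \<Rightarrow> 'x \<Rightarrow> 'w \<Rightarrow> 'a" where
  "ev2 A W D x w = ev D (elt A (dualX D) W x w)"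

definition uev2 :: "('a, 'ax) ring_scheme \<Rightarrow> ('a, 'w) bimod \<Rightarrow> ('a, 'w, 'x) dual_data \<Rightarrow> 'w \<Rightarrow> 'x \<Rightarrow> 'a" where
  "uev2 A W D w x = uev D (elt A W (dualX D) w x)"

locale pivotal_dual =
  fixes K :: "('k, 'kx) ring_scheme" and A :: "('k, 'a, 'ax) module_scheme"
    and W :: "('a, 'w) bimod" and D :: "('a, 'w, 'x) dual_data"
  assumes dual_bimodule: "algebra_bimodule K A (dualX D)"
    and ev_hom: "ev D \<in> bimod_hom A (dualX D \<boxtimes>\<^bsub>A\<^esub> W) (regular A)"
    and coev_hom: "coev D \<in> bimod_hom A (regular A) (W \<boxtimes>\<^bsub>A\<^esub> dualX D)"
    and uev_hom: "uev D \<in> bimod_hom A (W \<boxtimes>\<^bsub>A\<^esub> dualX D) (regular A)"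
    and ucoev_hom: "ucoev D \<in> bimod_hom A (regular A) (dualX D \<boxtimes>\<^bsub>A\<^esub> W)"
    and basis_omega_closed: "i < coev_len D \<Longrightarrow> basis_omega D i \<in> carrier W"
    and basis_x_closed: "i < coev_len D \<Longrightarrow> basis_x D i \<in> carrier (dualX D)"
    and basis_y_closed: "j < ucoev_len D \<Longrightarrow> basis_y D j \<in> carrier (dualX D)"
    and basis_rho_closed: "j < ucoev_len D \<Longrightarrow> basis_rho D j \<in> carrier W"
    and coev_one: "coev D \<one>\<^bsub>A\<^esub> = finprod (W \<boxtimes>\<^bsub>A\<^esub> dualX D)
      (\<lambda>i. elt A W (dualX D) (basis_omega D i) (basis_x D i)) {..<coev_len D}"
    and ucoev_one: "ucoev D \<one>\<^bsub>A\<^esub> = finprod (dualX D \<boxtimes>\<^bsub>A\<^esub> W)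
      (\<lambda>j. elt A (dualX D) W (basis_y D j) (basis_rho D j)) {..<ucoev_len D}"
    and omega_coev: "w \<in> carrier W \<Longrightarrow>
      w = finprod W (\<lambda>i. basis_omega D i \<lhd>\<^bsub>W\<^esub> ev2 A W D (basis_x D i) w) {..<coev_len D}"
    and omega_ucoev: "w \<in> carrier W \<Longrightarrow>
      w = finprod W (\<lambda>j. uev2 A W D w (basis_y D j) \<rhd>\<^bsub>W\<^esub> basis_rho D j) {..<ucoev_len D}"
    and x_coev: "x \<in> carrier (dualX D) \<Longrightarrow>
      x = finprod (dualX D)
        (\<lambda>i. ev2 A W D x (basis_omega D i) \<rhd>\<^bsub>dualX D\<^esub> basis_x D i) {..<coev_len D}"
    and x_ucoev: "x \<in> carrier (dualX D) \<Longrightarrow>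
      x = finprod (dualX D)
        (\<lambda>j. basis_y D j \<lhd>\<^bsub>dualX D\<^esub> uev2 A W D (basis_rho D j) x) {..<ucoev_len D}"

section \<open>The enveloping algebra and bimodules over it\<close>

definition scalars ::
  "('k, 'a, 'ax) module_scheme \<Rightarrow> ('a, 'm) bimod \<Rightarrow> ('k, 'm) bimod" where
  "scalars A M = \<lparr>carrier = carrier M, monoid.mult = monoid.mult M, one = one M,
     lact = (\<lambda>c m. (c \<odot>\<^bsub>A\<^esub> \<one>\<^bsub>A\<^esub>) \<rhd>\<^bsub>M\<^esub> m),
     ract = (\<lambda>m c. m \<lhd>\<^bsub>M\<^esub> (c \<odot>\<^bsub>A\<^esub> \<one>\<^bsub>A\<^esub>))\<rparr>"

text \<open>\<open>A \<otimes>\<^sub>K A\<^sup>o\<^sup>p\<close>; \<open>env_elt K A a b\<close> is \<open>a \<otimes>\<^sub>K b\<close>, where the second factor is the element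
  of \<open>A\<^sup>o\<^sup>p\<close> corresponding to \<open>b\<close>.\<close>

definition env_elt :: "('k, 'kx) ring_scheme \<Rightarrow> ('k, 'a, 'ax) module_scheme \<Rightarrow> 'a \<Rightarrow> 'a \<Rightarrow> ('a, 'a) tens" where
  "env_elt K A a b = elt K (scalars A (regular A)) (scalars (opp A) (regular (opp A))) a b"

definition env_group :: "('k, 'kx) ring_scheme \<Rightarrow> ('k, 'a, 'ax) module_scheme \<Rightarrow> ('a, 'a) tens monoid" where
  "env_group K A = tensor_group K (scalars A (regular A)) (scalars (opp A) (regular (opp A)))"

definition env_lift ::
  "('k, 'kx) ring_scheme \<Rightarrow> ('k, 'a, 'ax) module_scheme \<Rightarrow> ('g, 'gx) monoid_scheme
    \<Rightarrow> ('a \<Rightarrow> 'a \<Rightarrow> 'g) \<Rightarrow> ('a, 'a) tens \<Rightarrow> 'g" where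
  "env_lift K A G \<beta> =
     tensor_lift K (scalars A (regular A)) (scalars (opp A) (regular (opp A))) G \<beta>"

definition env :: "('k, 'kx) ring_scheme \<Rightarrow> ('k, 'a, 'ax) module_scheme \<Rightarrow> ('a, 'a) tens ring" where
  "env K A = \<lparr>carrier = carrier (env_group K A),
     monoid.mult = (\<lambda>e e'. env_lift K A (env_group K A)
       (\<lambda>a b. env_lift K A (env_group K A)
         (\<lambda>a' b'. env_elt K A (a \<otimes>\<^bsub>A\<^esub> a') (b \<otimes>\<^bsub>opp A\<^esub> b')) e') e),
     one = env_elt K A \<one>\<^bsub>A\<^esub> \<one>\<^bsub>A\<^esub>,
     zero = one (env_group K A),
     add = monoid.mult (env_group K A)\<rparr>"

text \<open>\<open>P \<otimes>\<^sub>K Q\<close> with the actions \<open>(a \<otimes> a') (p \<otimes> q) (b \<otimes> b') = a p b \<otimes> b' q a'\<close>.\<close>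

definition kelt ::
  "('k, 'kx) ring_scheme \<Rightarrow> ('k, 'a, 'ax) module_scheme \<Rightarrow> ('a, 'p) bimod \<Rightarrow> ('a, 'q) bimod
    \<Rightarrow> 'p \<Rightarrow> 'q \<Rightarrow> ('p, 'q) tens" where
  "kelt K A P Q p q = elt K (scalars A P) (scalars A Q) p q"

definition env_bimod ::
  "('k, 'kx) ring_scheme \<Rightarrow> ('k, 'a, 'ax) module_scheme \<Rightarrow> ('a, 'p) bimod \<Rightarrow> ('a, 'q) bimod
    \<Rightarrow> (('a, 'a) tens, ('p, 'q) tens) bimod" where
  "env_bimod K A P Q = (let G = tensor_group K (scalars A P) (scalars A Q) in
     \<lparr>carrier = carrier G, monoid.mult = monoid.mult G, one = one G,
      lact = (\<lambda>e t. env_lift K A G (\<lambda>a a'. tensor_lift K (scalars A P) (scalars A Q) G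
        (\<lambda>p q. kelt K A P Q (a \<rhd>\<^bsub>P\<^esub> p) (q \<lhd>\<^bsub>Q\<^esub> a')) t) e),
      ract = (\<lambda>t e. env_lift K A G (\<lambda>b b'. tensor_lift K (scalars A P) (scalars A Q) G
        (\<lambda>p q. kelt K A P Q (p \<lhd>\<^bsub>P\<^esub> b) (b' \<rhd>\<^bsub>Q\<^esub> q)) t) e)\<rparr>)"

definition bimod_sum :: "('r, 'm) bimod \<Rightarrow> ('r, 'n) bimod \<Rightarrow> ('r, 'm \<times> 'n) bimod" where
  "bimod_sum M N = \<lparr>carrier = carrier (M \<times>\<times> N), monoid.mult = monoid.mult (M \<times>\<times> N),
     one = one (M \<times>\<times> N),
     lact = (\<lambda>r (m, n). (r \<rhd>\<^bsub>M\<^esub> m, r \<rhd>\<^bsub>N\<^esub> n)),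
     ract = (\<lambda>(m, n) r. (m \<lhd>\<^bsub>M\<^esub> r, n \<lhd>\<^bsub>N\<^esub> r))\<rparr>"

section \<open>The tensor algebra of a bimodule\<close>

text \<open>
  The word \<open>(r, [v\<^sub>1, \<dots>, v\<^sub>n])\<close> stands for \<open>r \<otimes> v\<^sub>1 \<otimes> \<dots> \<otimes> v\<^sub>n\<close>. The relators are homogeneous,
  so the group they present is the direct sum over \<open>n\<close> of \<open>R \<otimes>\<^sub>R V \<otimes>\<^sub>R \<dots> \<otimes>\<^sub>R V\<close> (\<open>n\<close> factors \<open>V\<close>),
  i.e. of \<open>R\<close> for \<open>n = 0\<close> and of the \<open>n\<close>-th tensor power of \<open>V\<close> over \<open>R\<close> for \<open>n > 0\<close>; the leading
  factor \<open>R\<close> serves to treat all degrees uniformly.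
\<close>

definition tensor_words :: "('r, 'rx) ring_scheme \<Rightarrow> ('r, 'v) bimod \<Rightarrow> ('r \<times> 'v list) set" where
  "tensor_words R V = carrier R \<times> lists (carrier V)"

definition tensor_word_rel ::
  "('r, 'rx) ring_scheme \<Rightarrow> ('r, 'v) bimod \<Rightarrow> ('r \<times> 'v list \<Rightarrow>\<^sub>0 int) set" where
  "tensor_word_rel R V =
     {frag_of (r \<oplus>\<^bsub>R\<^esub> s, vs) - frag_of (r, vs) - frag_of (s, vs) | r s vs.
        r \<in> carrier R \<and> s \<in> carrier R \<and> vs \<in> lists (carrier V)} \<union>
     {frag_of (r, us @ [v \<otimes>\<^bsub>V\<^esub> v'] @ vs) - frag_of (r, us @ [v] @ vs) - frag_of (r, us @ [v'] @ vs)
        | r us v v' vs. r \<in> carrier R \<and> us \<in> lists (carrier V) \<and> vs \<in> lists (carrier V) \<and>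
          v \<in> carrier V \<and> v' \<in> carrier V} \<union>
     {frag_of (r \<otimes>\<^bsub>R\<^esub> s, v # vs) - frag_of (r, (s \<rhd>\<^bsub>V\<^esub> v) # vs) | r s v vs.
        r \<in> carrier R \<and> s \<in> carrier R \<and> v \<in> carrier V \<and> vs \<in> lists (carrier V)} \<union>
     {frag_of (r, us @ [v \<lhd>\<^bsub>V\<^esub> s, v'] @ vs) - frag_of (r, us @ [v, s \<rhd>\<^bsub>V\<^esub> v'] @ vs)
        | r us v s v' vs. r \<in> carrier R \<and> s \<in> carrier R \<and> us \<in> lists (carrier V) \<and>
          vs \<in> lists (carrier V) \<and> v \<in> carrier V \<and> v' \<in> carrier V}"

definition tensor_word ::
  "('r, 'rx) ring_scheme \<Rightarrow> ('r, 'v) bimod \<Rightarrow> 'r \<times> 'v list \<Rightarrow> ('r \<times> 'v list \<Rightarrow>\<^sub>0 int) set" where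
  "tensor_word R V = generator (tensor_words R V) (tensor_word_rel R V)"

text \<open>Concatenation; the leading coefficient of the second word is absorbed by the first word.\<close>

definition word_mult ::
  "('r, 'rx) ring_scheme \<Rightarrow> ('r, 'v) bimod \<Rightarrow> 'r \<times> 'v list \<Rightarrow> 'r \<times> 'v list \<Rightarrow> 'r \<times> 'v list" where
  "word_mult R V p q = (case (p, q) of ((r, us), (s, vs)) \<Rightarrow>
     if us = [] then (r \<otimes>\<^bsub>R\<^esub> s, vs) else (r, butlast us @ [last us \<lhd>\<^bsub>V\<^esub> s] @ vs))"

definition tensor_algebra ::
  "('r, 'rx) ring_scheme \<Rightarrow> ('r, 'v) bimod \<Rightarrow> ('r \<times> 'v list \<Rightarrow>\<^sub>0 int) set ring" where
  "tensor_algebra R V =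
     (let S = tensor_words R V; Rel = tensor_word_rel R V; G = presented_group S Rel in
      \<lparr>carrier = carrier G,
       monoid.mult = (\<lambda>t u. lift S Rel G (\<lambda>p. lift S Rel G
         (\<lambda>q. tensor_word R V (word_mult R V p q)) u) t),
       one = tensor_word R V (\<one>\<^bsub>R\<^esub>, []),
       zero = one G,
       add = monoid.mult G\<rparr>)"

section \<open>The algebra \<open>H\<close>\<close>

type_synonym ('w, 'x) zz = "('x, 'w) tens \<times> ('w, 'x) tens"

definition Z_bimod ::
  "('k, 'kx) ring_scheme \<Rightarrow> ('k, 'a, 'ax) module_scheme \<Rightarrow> ('a, 'w) bimod \<Rightarrow> ('a, 'w, 'x) dual_data
    \<Rightarrow> (('a, 'a) tens, ('w, 'x) zz) bimod" where
  "Z_bimod K A W D = bimod_sum (env_bimod K A (dualX D) W) (env_bimod K A W (dualX D))"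

type_synonym ('a, 'w, 'x) tz = "(('a, 'a) tens \<times> ('w, 'x) zz list \<Rightarrow>\<^sub>0 int) set"

definition TZ ::
  "('k, 'kx) ring_scheme \<Rightarrow> ('k, 'a, 'ax) module_scheme \<Rightarrow> ('a, 'w) bimod \<Rightarrow> ('a, 'w, 'x) dual_data
    \<Rightarrow> ('a, 'w, 'x) tz ring" where
  "TZ K A W D = tensor_algebra (env K A) (Z_bimod K A W D)"

text \<open>The images in the tensor algebra of \<open>a\<close>, of the element of \<open>A\<^sup>o\<^sup>p\<close> corresponding to \<open>a\<close>,
  and of the generators \<open>(x, \<omega>)\<close> and \<open>(\<omega>, x)\<close>.\<close>

definition in_A ::
  "('k, 'kx) ring_scheme \<Rightarrow> ('k, 'a, 'ax) module_scheme \<Rightarrow> ('a, 'w) bimod \<Rightarrow> ('a, 'w, 'x) dual_data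
    \<Rightarrow> 'a \<Rightarrow> ('a, 'w, 'x) tz" where
  "in_A K A W D a = tensor_word (env K A) (Z_bimod K A W D) (env_elt K A a \<one>\<^bsub>A\<^esub>, [])"

definition in_Aop ::
  "('k, 'kx) ring_scheme \<Rightarrow> ('k, 'a, 'ax) module_scheme \<Rightarrow> ('a, 'w) bimod \<Rightarrow> ('a, 'w, 'x) dual_data
    \<Rightarrow> 'a \<Rightarrow> ('a, 'w, 'x) tz" where
  "in_Aop K A W D a = tensor_word (env K A) (Z_bimod K A W D) (env_elt K A \<one>\<^bsub>A\<^esub> a, [])"

definition gen_xw ::
  "('k, 'kx) ring_scheme \<Rightarrow> ('k, 'a, 'ax) module_scheme \<Rightarrow> ('a, 'w) bimod \<Rightarrow> ('a, 'w, 'x) dual_data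
    \<Rightarrow> 'x \<Rightarrow> 'w \<Rightarrow> ('a, 'w, 'x) tz" where
  "gen_xw K A W D x w = tensor_word (env K A) (Z_bimod K A W D)
     (\<one>\<^bsub>env K A\<^esub>, [(kelt K A (dualX D) W x w, one (env_bimod K A W (dualX D)))])"

definition gen_wx ::
  "('k, 'kx) ring_scheme \<Rightarrow> ('k, 'a, 'ax) module_scheme \<Rightarrow> ('a, 'w) bimod \<Rightarrow> ('a, 'w, 'x) dual_data
    \<Rightarrow> 'w \<Rightarrow> 'x \<Rightarrow> ('a, 'w, 'x) tz" where
  "gen_wx K A W D w x = tensor_word (env K A) (Z_bimod K A W D)
     (\<one>\<^bsub>env K A\<^esub>, [(one (env_bimod K A (dualX D) W), kelt K A W (dualX D) w x)])"

definition H_relators ::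
  "('k, 'kx) ring_scheme \<Rightarrow> ('k, 'a, 'ax) module_scheme \<Rightarrow> ('a, 'w) bimod \<Rightarrow> ('a, 'w, 'x) dual_data
    \<Rightarrow> ('a, 'w, 'x) tz set" where
  "H_relators K A W D =
    (let T = TZ K A W D; xw = gen_xw K A W D; wx = gen_wx K A W D;
         I = {..<coev_len D}; J = {..<ucoev_len D};
         om = basis_omega D; xi = basis_x D; y = basis_y D; \<rho> = basis_rho D in
     \<Union>x\<in>carrier (dualX D). \<Union>w\<in>carrier W.
      {(\<Oplus>\<^bsub>T\<^esub>i\<in>I. wx (om i) x \<otimes>\<^bsub>T\<^esub> xw (xi i) w) \<ominus>\<^bsub>T\<^esub> in_Aop K A W D (uev2 A W D w x),
       (\<Oplus>\<^bsub>T\<^esub>j\<in>J. xw x (\<rho> j) \<otimes>\<^bsub>T\<^esub> wx w (y j)) \<ominus>\<^bsub>T\<^esub> in_A K A W D (ev2 A W D x w),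
       (\<Oplus>\<^bsub>T\<^esub>j\<in>J. xw (y j) w \<otimes>\<^bsub>T\<^esub> wx (\<rho> j) x) \<ominus>\<^bsub>T\<^esub> in_Aop K A W D (ev2 A W D x w),
       (\<Oplus>\<^bsub>T\<^esub>i\<in>I. wx w (xi i) \<otimes>\<^bsub>T\<^esub> xw x (om i)) \<ominus>\<^bsub>T\<^esub> in_A K A W D (uev2 A W D w x)})"

definition H_algebra ::
  "('k, 'kx) ring_scheme \<Rightarrow> ('k, 'a, 'ax) module_scheme \<Rightarrow> ('a, 'w) bimod \<Rightarrow> ('a, 'w, 'x) dual_data
    \<Rightarrow> ('a, 'w, 'x) tz set ring" where
  "H_algebra K A W D = TZ K A W D Quot (genideal (TZ K A W D) (H_relators K A W D))"

section \<open>The two categories\<close>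

text \<open>
  Modules are records of total functions. For equality of objects to be equality of modules,
  operations are required to be \<^const>\<open>undefined\<close> outside the carriers, and likewise maps
  are required to be \<^const>\<open>extensional\<close>.
\<close>

definition lmod_extensional :: "('r, 'rx) ring_scheme \<Rightarrow> ('r, 'm) lmod \<Rightarrow> bool" where
  "lmod_extensional R M \<longleftrightarrow>
     (\<forall>m n. \<not> (m \<in> carrier M \<and> n \<in> carrier M) \<longrightarrow> m \<otimes>\<^bsub>M\<^esub> n = undefined) \<and>
     (\<forall>r m. \<not> (r \<in> carrier R \<and> m \<in> carrier M) \<longrightarrow> act M r m = undefined)"

definition bimod_extensional :: "('r, 'rx) ring_scheme \<Rightarrow> ('r, 'm) bimod \<Rightarrow> bool" where
  "bimod_extensional R M \<longleftrightarrow>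
     (\<forall>m n. \<not> (m \<in> carrier M \<and> n \<in> carrier M) \<longrightarrow> m \<otimes>\<^bsub>M\<^esub> n = undefined) \<and>
     (\<forall>r m. \<not> (r \<in> carrier R \<and> m \<in> carrier M) \<longrightarrow>
        r \<rhd>\<^bsub>M\<^esub> m = undefined \<and> m \<lhd>\<^bsub>M\<^esub> r = undefined)"

definition lmod_category :: "('r, 'rx) ring_scheme \<Rightarrow> (('r, 'm) lmod, 'm \<Rightarrow> 'm) cat" where
  "lmod_category R = \<lparr>Obj = {M. left_module R M \<and> lmod_extensional R M},
     Hom = (\<lambda>M N. {f \<in> hom M N \<inter> extensional (carrier M).
       \<forall>r\<in>carrier R. \<forall>m\<in>carrier M. f (act M r m) = act N r (f m)}),
     Comp = (\<lambda>L M N g f. compose (carrier L) g f),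
     Ident = (\<lambda>M. \<lambda>m\<in>carrier M. m)\<rparr>"

text \<open>The map \<open>(ev \<otimes> id) (id \<otimes> \<sigma> \<otimes> id) (id \<otimes> coev) : X \<otimes> M \<rightarrow> M \<otimes> X\<close>.\<close>

definition sigma_dual ::
  "('a, 'ax) ring_scheme \<Rightarrow> ('a, 'w) bimod \<Rightarrow> ('a, 'w, 'x) dual_data \<Rightarrow> ('a, 'm) bimod
    \<Rightarrow> (('m, 'w) tens \<Rightarrow> ('w, 'm) tens) \<Rightarrow> ('x, 'm) tens \<Rightarrow> ('m, 'x) tens" where
  "sigma_dual A W D M \<sigma> = (let X = dualX D in
       lunit A (M \<boxtimes>\<^bsub>A\<^esub> X)
     \<circ> tensor_map A (X \<boxtimes>\<^bsub>A\<^esub> W) (M \<boxtimes>\<^bsub>A\<^esub> X) (regular A) (M \<boxtimes>\<^bsub>A\<^esub> X) (ev D) id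
     \<circ> assoc A (X \<boxtimes>\<^bsub>A\<^esub> W) M X
     \<circ> tensor_map A (X \<boxtimes>\<^bsub>A\<^esub> (W \<boxtimes>\<^bsub>A\<^esub> M)) X ((X \<boxtimes>\<^bsub>A\<^esub> W) \<boxtimes>\<^bsub>A\<^esub> M) X (assoc_inv A X W M) id
     \<circ> tensor_map A (X \<boxtimes>\<^bsub>A\<^esub> (M \<boxtimes>\<^bsub>A\<^esub> W)) X (X \<boxtimes>\<^bsub>A\<^esub> (W \<boxtimes>\<^bsub>A\<^esub> M)) X
         (tensor_map A X (M \<boxtimes>\<^bsub>A\<^esub> W) X (W \<boxtimes>\<^bsub>A\<^esub> M) id \<sigma>) id
     \<circ> tensor_map A ((X \<boxtimes>\<^bsub>A\<^esub> M) \<boxtimes>\<^bsub>A\<^esub> W) X (X \<boxtimes>\<^bsub>A\<^esub> (M \<boxtimes>\<^bsub>A\<^esub> W)) X (assoc A X M W) id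
     \<circ> assoc_inv A (X \<boxtimes>\<^bsub>A\<^esub> M) W X
     \<circ> tensor_map A (X \<boxtimes>\<^bsub>A\<^esub> M) (regular A) (X \<boxtimes>\<^bsub>A\<^esub> M) (W \<boxtimes>\<^bsub>A\<^esub> X) id (coev D)
     \<circ> runit_inv A (X \<boxtimes>\<^bsub>A\<^esub> M))"

text \<open>The map \<open>(id \<otimes> uev) (id \<otimes> \<sigma>' \<otimes> id) (ucoev \<otimes> id) : M \<otimes> X \<rightarrow> X \<otimes> M\<close>, to be used
  with \<open>\<sigma>' = \<sigma>\<^sup>-\<^sup>1\<close>.\<close>

definition sigma_inv_dual ::
  "('a, 'ax) ring_scheme \<Rightarrow> ('a, 'w) bimod \<Rightarrow> ('a, 'w, 'x) dual_data \<Rightarrow> ('a, 'm) bimod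
    \<Rightarrow> (('w, 'm) tens \<Rightarrow> ('m, 'w) tens) \<Rightarrow> ('m, 'x) tens \<Rightarrow> ('x, 'm) tens" where
  "sigma_inv_dual A W D M \<sigma>' = (let X = dualX D in
       runit A (X \<boxtimes>\<^bsub>A\<^esub> M)
     \<circ> tensor_map A (X \<boxtimes>\<^bsub>A\<^esub> M) (W \<boxtimes>\<^bsub>A\<^esub> X) (X \<boxtimes>\<^bsub>A\<^esub> M) (regular A) id (uev D)
     \<circ> assoc A (X \<boxtimes>\<^bsub>A\<^esub> M) W X
     \<circ> tensor_map A (X \<boxtimes>\<^bsub>A\<^esub> (M \<boxtimes>\<^bsub>A\<^esub> W)) X ((X \<boxtimes>\<^bsub>A\<^esub> M) \<boxtimes>\<^bsub>A\<^esub> W) X (assoc_inv A X M W) id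
     \<circ> tensor_map A (X \<boxtimes>\<^bsub>A\<^esub> (W \<boxtimes>\<^bsub>A\<^esub> M)) X (X \<boxtimes>\<^bsub>A\<^esub> (M \<boxtimes>\<^bsub>A\<^esub> W)) X
         (tensor_map A X (W \<boxtimes>\<^bsub>A\<^esub> M) X (M \<boxtimes>\<^bsub>A\<^esub> W) id \<sigma>') id
     \<circ> tensor_map A ((X \<boxtimes>\<^bsub>A\<^esub> W) \<boxtimes>\<^bsub>A\<^esub> M) X (X \<boxtimes>\<^bsub>A\<^esub> (W \<boxtimes>\<^bsub>A\<^esub> M)) X (assoc A X W M) id
     \<circ> assoc_inv A (X \<boxtimes>\<^bsub>A\<^esub> W) M X
     \<circ> tensor_map A (regular A) (M \<boxtimes>\<^bsub>A\<^esub> X) (X \<boxtimes>\<^bsub>A\<^esub> W) (M \<boxtimes>\<^bsub>A\<^esub> X) (ucoev D) id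
     \<circ> lunit_inv A (M \<boxtimes>\<^bsub>A\<^esub> X))"

type_synonym ('a, 'm, 'w) im_obj = "('a, 'm) bimod \<times> (('m, 'w) tens \<Rightarrow> ('w, 'm) tens)"

definition IM_objects ::
  "('k, 'kx) ring_scheme \<Rightarrow> ('k, 'a, 'ax) module_scheme \<Rightarrow> ('a, 'w) bimod \<Rightarrow> ('a, 'w, 'x) dual_data
    \<Rightarrow> ('a, 'm, 'w) im_obj set" where
  "IM_objects K A W D = {(M, \<sigma>).
     algebra_bimodule K A M \<and> bimod_extensional A M \<and>
     \<sigma> \<in> bimod_hom A (M \<boxtimes>\<^bsub>A\<^esub> W) (W \<boxtimes>\<^bsub>A\<^esub> M) \<inter> extensional (carrier (M \<boxtimes>\<^bsub>A\<^esub> W)) \<and>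
     bij_betw \<sigma> (carrier (M \<boxtimes>\<^bsub>A\<^esub> W)) (carrier (W \<boxtimes>\<^bsub>A\<^esub> M)) \<and>
     (let \<phi> = sigma_dual A W D M \<sigma>;
          \<psi> = sigma_inv_dual A W D M (inv_into (carrier (M \<boxtimes>\<^bsub>A\<^esub> W)) \<sigma>) in
      (\<forall>t\<in>carrier (dualX D \<boxtimes>\<^bsub>A\<^esub> M). \<psi> (\<phi> t) = t) \<and>
      (\<forall>t\<in>carrier (M \<boxtimes>\<^bsub>A\<^esub> dualX D). \<phi> (\<psi> t) = t))}"

definition IM_category ::
  "('k, 'kx) ring_scheme \<Rightarrow> ('k, 'a, 'ax) module_scheme \<Rightarrow> ('a, 'w) bimod \<Rightarrow> ('a, 'w, 'x) dual_data
    \<Rightarrow> (('a, 'm, 'w) im_obj, 'm \<Rightarrow> 'm) cat" where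
  "IM_category K A W D = \<lparr>Obj = IM_objects K A W D,
     Hom = (\<lambda>(M, \<sigma>\<^sub>M) (N, \<sigma>\<^sub>N). {f \<in> bimod_hom A M N \<inter> extensional (carrier M).
       \<forall>t\<in>carrier (M \<boxtimes>\<^bsub>A\<^esub> W).
         \<sigma>\<^sub>N (tensor_map A M W N W f id t) = tensor_map A W M W N id f (\<sigma>\<^sub>M t)}),
     Comp = (\<lambda>(L, _) _ _ g f. compose (carrier L) g f),
     Ident = (\<lambda>(M, _). \<lambda>m\<in>carrier M. m)\<rparr>"

end

theory Submission
  imports Defs
begin

text \<open>
  A left \<open>H\<close>-module is a bimodule \<open>M\<close> (the action of \<open>A\<^sup>e\<close>) with operators \<open>(x, \<omega>)\<close> and \<open>(\<omega>, x)\<close> on \<open>M\<close>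
  that are compatible with the actions of \<open>A\<close> and satisfy the four relations. The operators and the
  braiding \<open>\<sigma>\<close> determine each other by
  \<open>(x, \<omega>) m = (ev \<otimes> id) (x \<otimes> \<sigma> (m \<otimes> \<omega>))\<close>, \<open>(\<omega>, x) m = (id \<otimes> uev) (\<sigma>\<^sup>-\<^sup>1 (\<omega> \<otimes> m) \<otimes> x)\<close> and
  \<open>\<sigma> (m \<otimes> \<omega>) = \<Sum>\<^sub>i \<omega>\<^sub>i \<otimes> (x\<^sub>i, \<omega>) m\<close>, \<open>\<sigma>\<^sup>-\<^sup>1 (\<omega> \<otimes> m) = \<Sum>\<^sub>j (\<omega>, y\<^sub>j) m \<otimes> \<rho>\<^sub>j\<close>.
  The first two relations say that these two formulas define mutually inverse maps. In the same terms
  the maps of the theorem are \<open>x \<otimes> m \<mapsto> \<Sum>\<^sub>i (x, \<omega>\<^sub>i) m \<otimes> x\<^sub>i\<close> and \<open>m \<otimes> x \<mapsto> \<Sum>\<^sub>j y\<^sub>j \<otimes> (\<rho>\<^sub>j, x) m\<close>, and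
  the last two relations say that these are mutually inverse. To turn operators into an action of \<open>H\<close>,
  the universal properties of the enveloping algebra, the tensor algebra and the quotient are applied
  to the ring of additive endomorphisms of \<open>M\<close>.
\<close>

section \<open>Presented abelian groups\<close>

text \<open>Passing between the two kinds of objects keeps the carrier, and arrows on both sides are
  maps of carriers, so the isomorphism can be the identity on arrows. What remains is a bijection on
  objects under which Hom sets coincide literally; here the undefined values outside carriers
  matter, since a module has to be recovered as the same record. The obstacle is that all algebras
  and tensor products are abelian groups given by generators and relations, and maps out of them are
  \<open>lift\<close>s, given by a description that says nothing until all relators are known to be
  killed. Well-definedness is therefore reduced once and for all to equations between generators
  (\<open>compat\<close>), and homomorphisms are compared on generators. Values of \<sigma> are not
  elementary tensors; they are handled by keeping the tensor as a variable and contracting it with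
  elements of the dual. The braiding is built from the operators (x, \<omega>) alone: the operators
  (\<omega>, x) are then forced, because they are read off from its inverse.\<close>

lemma hom_one_comm: "h \<in> hom G H \<Longrightarrow> comm_group G \<Longrightarrow> comm_group H \<Longrightarrow> h \<one>\<^bsub>G\<^esub> = \<one>\<^bsub>H\<^esub>"
  by (meson comm_group.axioms(2) hom_one)

lemma hom_finprod:
  assumes h: "h \<in> hom G H" and G: "comm_group G" and H: "comm_group H"
    and f: "\<And>i. i \<in> I \<Longrightarrow> f i \<in> carrier G"
  shows "h (finprod G f I) = finprod H (\<lambda>i. h (f i)) I"
proof -
  interpret G: comm_group G by fact
  interpret H: comm_group H by fact
  show ?thesis
  proof (cases "finite I")
    case True
    then show ?thesis using f
    proof (induction I)
      case empty
      then show ?case using hom_one_comm[OF h G H] by simp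
    next
      case (insert i I)
      then have "finprod G f I \<in> carrier G" by (auto intro: G.finprod_closed)
      with insert show ?case
        using hom_in_carrier[OF h] by (simp add: hom_mult[OF h] Pi_iff)
    qed
  next
    case False
    then show ?thesis using hom_one_comm[OF h G H] by simp
  qed
qed

lemma hom_comp: "f \<in> hom G H \<Longrightarrow> g \<in> hom H L \<Longrightarrow> (\<lambda>x. g (f x)) \<in> hom G L"
  using hom_compose[of f G H g L] by (simp add: comp_def)

lemma hom_restrictI: "monoid G \<Longrightarrow> f \<in> hom G H \<Longrightarrow> restrict f (carrier G) \<in> hom G H"
  by (auto simp: hom_def Pi_iff monoid.m_closed)

lemma hom_pointwise_mult:
  "f \<in> hom G H \<Longrightarrow> g \<in> hom G H \<Longrightarrow> comm_group H \<Longrightarrow> (\<lambda>x. f x \<otimes>\<^bsub>H\<^esub> g x) \<in> hom G H"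
  by (rule comm_group.hom_group_mult)

lemma hom_pointwise_finprod:
  assumes f: "\<And>i. i \<in> I \<Longrightarrow> f i \<in> hom G H" and G: "comm_group G" and H: "comm_group H"
  shows "(\<lambda>x. finprod H (\<lambda>i. f i x) I) \<in> hom G H"
proof -
  interpret G: comm_group G by fact
  interpret H: comm_group H by fact
  show ?thesis
  proof (cases "finite I")
    case True
    then show ?thesis using f
      by (induction I)
        (auto simp: hom_def Pi_iff H.m_ac cong: H.finprod_cong)
  next
    case False
    then show ?thesis by (simp add: hom_def)
  qed
qed

lemma (in group) mult_inv_eq_one_iff:
  "x \<in> carrier G \<Longrightarrow> y \<in> carrier G \<Longrightarrow> x \<otimes> inv y = \<one> \<longleftrightarrow> x = y"
  using inv_solve_right[of \<one> x y] by auto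

lemma (in comm_group) mult_inv_inv_eq_one_iff:
  "x \<in> carrier G \<Longrightarrow> y \<in> carrier G \<Longrightarrow> z \<in> carrier G \<Longrightarrow>
    x \<otimes> inv y \<otimes> inv z = \<one> \<longleftrightarrow> x = y \<otimes> z"
  using mult_inv_eq_one_iff[of x "y \<otimes> z"] by (simp add: inv_mult m_assoc)

text \<open>All relators in use have one of the shapes \<open>a - b - c\<close> and \<open>a - b\<close>, so that a map of generators
  kills them iff it satisfies the equations \<open>f a = f b \<cdot> f c\<close> and \<open>f a = f b\<close>.\<close>

definition relators :: "('s \<times> 's \<times> 's) set \<Rightarrow> ('s \<times> 's) set \<Rightarrow> ('s \<Rightarrow>\<^sub>0 int) set" where
  "relators T U = {frag_of a - frag_of b - frag_of c | a b c. (a, b, c) \<in> T} \<union>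
     {frag_of a - frag_of b | a b. (a, b) \<in> U}"

definition compat ::
  "('s \<times> 's \<times> 's) set \<Rightarrow> ('s \<times> 's) set \<Rightarrow> ('g, 'gx) monoid_scheme \<Rightarrow> ('s \<Rightarrow> 'g) \<Rightarrow> bool" where
  "compat T U G f \<longleftrightarrow> (\<forall>a b c. (a, b, c) \<in> T \<longrightarrow> f a = f b \<otimes>\<^bsub>G\<^esub> f c) \<and>
     (\<forall>a b. (a, b) \<in> U \<longrightarrow> f a = f b)"

text \<open>The closure conditions place the relators inside the free group on \<open>S\<close>, so
  that \<open>generate\<close> yields a subgroup of it and the quotient is a group.\<close>

locale presentation =
  fixes S :: "'s set" and T :: "('s \<times> 's \<times> 's) set" and U :: "('s \<times> 's) set"
  assumes T_closed: "T \<subseteq> S \<times> S \<times> S" and U_closed: "U \<subseteq> S \<times> S"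
begin

abbreviation "N \<equiv> relations S (relators T U)"
abbreviation "P \<equiv> presented_group S (relators T U)"
abbreviation "gen \<equiv> generator S (relators T U)"

lemma relators_subset: "relators T U \<subseteq> carrier (free_Abelian_group S)"
proof
  fix r assume "r \<in> relators T U"
  then show "r \<in> carrier (free_Abelian_group S)"
    using T_closed U_closed unfolding relators_def
    by (auto dest!: subsetD[OF keys_diff])
qed

lemma N_normal: "N \<lhd> free_Abelian_group S"
  unfolding relations_def
  by (intro comm_group.subgroup_imp_normal abelian_free_Abelian_group
      group.generate_is_subgroup relators_subset group_free_Abelian_group)

lemma P_group: "comm_group P"
  unfolding presented_group_def
  by (intro comm_group.abelian_FactGroup abelian_free_Abelian_group normal_imp_subgroup N_normal)

lemma coset_hom: "(\<lambda>c. N #>\<^bsub>free_Abelian_group S\<^esub> c) \<in> hom (free_Abelian_group S) P"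
  unfolding presented_group_def by (rule normal.r_coset_hom_Mod[OF N_normal])

lemma gen_closed: "s \<in> S \<Longrightarrow> gen s \<in> carrier P"
  unfolding generator_def using hom_in_carrier[OF coset_hom] by simp

lemma P_cases:
  assumes "t \<in> carrier P"
  obtains c where "c \<in> carrier (free_Abelian_group S)" "t = N #>\<^bsub>free_Abelian_group S\<^esub> c"
  using assms unfolding presented_group_def by (auto simp: carrier_FactGroup)

text \<open>Cosets lift to the free group, whose elements arise from zero and single generators by
  differences; the case \<open>diff\<close> thus covers products and inverses at once. The neutral
  element has its own case because \<open>S\<close> may be empty.\<close>

lemma P_induct [consumes 1, case_names gen one diff]:
  assumes t: "t \<in> carrier P"
    and gen: "\<And>s. s \<in> S \<Longrightarrow> Q (gen s)"
    and one: "Q \<one>\<^bsub>P\<^esub>"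
    and diff: "\<And>t u. t \<in> carrier P \<Longrightarrow> u \<in> carrier P \<Longrightarrow> Q t \<Longrightarrow> Q u \<Longrightarrow> Q (t \<otimes>\<^bsub>P\<^esub> inv\<^bsub>P\<^esub> u)"
  shows "Q t"
proof -
  interpret P: comm_group P by (rule P_group)
  interpret F: comm_group "free_Abelian_group S" by (rule abelian_free_Abelian_group)
  interpret h: group_hom "free_Abelian_group S" P "\<lambda>c. N #>\<^bsub>free_Abelian_group S\<^esub> c"
    using coset_hom by unfold_locales
  obtain c where c: "c \<in> carrier (free_Abelian_group S)" "t = N #>\<^bsub>free_Abelian_group S\<^esub> c"
    using t by (rule P_cases)
  have "Poly_Mapping.keys c \<subseteq> S" using c by simp
  then have "Q (N #>\<^bsub>free_Abelian_group S\<^esub> c)"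
  proof (induction c rule: free_Abelian_group_induct [consumes 1, case_names zero diff single])
    case zero
    then show ?case using one h.hom_one by simp
  next
    case (diff x y)
    then have xy: "x \<in> carrier (free_Abelian_group S)" "y \<in> carrier (free_Abelian_group S)" by auto
    have "x - y = x \<otimes>\<^bsub>free_Abelian_group S\<^esub> inv\<^bsub>free_Abelian_group S\<^esub> y"
      using diff by simp
    then have "N #>\<^bsub>free_Abelian_group S\<^esub> (x - y) =
        (N #>\<^bsub>free_Abelian_group S\<^esub> x) \<otimes>\<^bsub>P\<^esub> inv\<^bsub>P\<^esub> (N #>\<^bsub>free_Abelian_group S\<^esub> y)"
      using h.hom_mult[OF xy(1) F.inv_closed[OF xy(2)]] h.hom_inv[OF xy(2)] diff(2)
      by (simp del: mult_free_Abelian_group inv_free_Abelian_group)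
    then show ?case using assms(4)[OF h.hom_closed[OF xy(1)] h.hom_closed[OF xy(2)]] diff by simp
  next
    case (single a)
    then show ?case using gen unfolding generator_def by simp
  qed
  then show ?thesis using c by simp
qed

lemma P_hom_eqI:
  assumes f: "f \<in> hom P G" and g: "g \<in> hom P G" and G: "comm_group G"
    and eq: "\<And>s. s \<in> S \<Longrightarrow> f (gen s) = g (gen s)" and t: "t \<in> carrier P"
  shows "f t = g t"
proof -
  interpret P: comm_group P by (rule P_group)
  interpret G: comm_group G by fact
  interpret f: group_hom P G f using f by unfold_locales
  interpret g: group_hom P G g using g by unfold_locales
  show ?thesis using t by (induction t rule: P_induct) (simp_all add: eq)
qed

text \<open>A relator lies in \<open>N\<close>, so its coset is neutral; read in the quotient, this
  is the required equation between generators.\<close>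

lemma gen_compat: "compat T U P gen"
proof -
  interpret P: comm_group P by (rule P_group)
  interpret F: comm_group "free_Abelian_group S" by (rule abelian_free_Abelian_group)
  interpret N: normal N "free_Abelian_group S" by (rule N_normal)
  let ?h = "\<lambda>c. N #>\<^bsub>free_Abelian_group S\<^esub> c"
  interpret h: group_hom "free_Abelian_group S" P ?h
    using coset_hom by unfold_locales
  have kill: "?h r = \<one>\<^bsub>P\<^esub>" if "r \<in> relators T U" for r
  proof -
    have "r \<in> N" using that unfolding relations_def by (rule generate.incl)
    then have "?h r = N"
      using N.subset N.subgroup_axioms by (meson F.coset_join2 subsetD)
    then show ?thesis by (simp add: presented_group_def)
  qed
  have ha: "?h (frag_of a) = gen a" for a by (simp add: generator_def)
  have dif: "?h (x - y) = ?h x \<otimes>\<^bsub>P\<^esub> inv\<^bsub>P\<^esub> ?h y"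
    if "Poly_Mapping.keys x \<subseteq> S" "Poly_Mapping.keys y \<subseteq> S" for x y
    using h.hom_mult[of x "- y"] h.hom_inv[of y] that by simp
  have kd: "Poly_Mapping.keys (frag_of a - frag_of b) \<subseteq> S" if "a \<in> S" "b \<in> S" for a b :: 's
    using that by (auto dest!: subsetD[OF keys_diff])
  show ?thesis unfolding compat_def
  proof (intro conjI allI impI)
    fix a b c assume t: "(a, b, c) \<in> T"
    then have abc: "a \<in> S" "b \<in> S" "c \<in> S" using T_closed by auto
    have "frag_of a - frag_of b - frag_of c \<in> relators T U" using t unfolding relators_def by blast
    from kill[OF this] have *: "gen a \<otimes>\<^bsub>P\<^esub> inv\<^bsub>P\<^esub> gen b \<otimes>\<^bsub>P\<^esub> inv\<^bsub>P\<^esub> gen c = \<one>\<^bsub>P\<^esub>"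
      using abc kd by (simp add: dif ha)
    show "gen a = gen b \<otimes>\<^bsub>P\<^esub> gen c"
      using * gen_closed abc by (simp add: P.mult_inv_inv_eq_one_iff)
  next
    fix a b assume t: "(a, b) \<in> U"
    then have ab: "a \<in> S" "b \<in> S" using U_closed by auto
    have "frag_of a - frag_of b \<in> relators T U" using t unfolding relators_def by blast
    from kill[OF this] have *: "gen a \<otimes>\<^bsub>P\<^esub> inv\<^bsub>P\<^esub> gen b = \<one>\<^bsub>P\<^esub>"
      using ab by (simp add: dif ha)
    show "gen a = gen b"
      using * gen_closed ab by (simp add: P.mult_inv_eq_one_iff)
  qed
qed

text \<open>By \<open>compat\<close>, the extension of \<open>f\<close> to the free group kills the
  relators, hence the subgroup \<open>N\<close> they generate, and so factors through the quotient.
  Restricting the factor to the carrier makes it the one map that meets the description in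
  \<open>lift\<close>.\<close>

lemma lift_spec:
  assumes G: "comm_group G" and f: "f \<in> S \<rightarrow> carrier G" and r: "compat T U G f"
  shows "lift S (relators T U) G f \<in> hom P G \<and>
    lift S (relators T U) G f \<in> extensional (carrier P) \<and>
    (\<forall>s\<in>S. lift S (relators T U) G f (gen s) = f s)"
proof -
  interpret P: comm_group P by (rule P_group)
  interpret G: comm_group G by fact
  interpret F: comm_group "free_Abelian_group S" by (rule abelian_free_Abelian_group)
  obtain h where h: "h \<in> hom (free_Abelian_group S) G" "\<And>s. s \<in> S \<Longrightarrow> h (frag_of s) = f s"
    using G.free_Abelian_group_universal[of f S] f by auto
  interpret h: group_hom "free_Abelian_group S" G h using h by unfold_locales
  have dif: "h (x - y) = h x \<otimes>\<^bsub>G\<^esub> inv\<^bsub>G\<^esub> h y"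
    if "Poly_Mapping.keys x \<subseteq> S" "Poly_Mapping.keys y \<subseteq> S" for x y
    using h.hom_mult[of x "- y"] h.hom_inv[of y] that by simp
  have kd: "Poly_Mapping.keys (frag_of a - frag_of b) \<subseteq> S" if "a \<in> S" "b \<in> S" for a b :: 's
    using that by (auto dest!: subsetD[OF keys_diff])
  have "relators T U \<subseteq> kernel (free_Abelian_group S) G h"
  proof
    fix x assume x: "x \<in> relators T U"
    then have "x \<in> carrier (free_Abelian_group S)" using relators_subset by blast
    moreover have "h x = \<one>\<^bsub>G\<^esub>"
    proof -
      from x consider a b c where "(a, b, c) \<in> T" "x = frag_of a - frag_of b - frag_of c"
        | a b where "(a, b) \<in> U" "x = frag_of a - frag_of b"
        unfolding relators_def by blast
      then show ?thesis
      proof cases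
        case 1
        then have abc: "a \<in> S" "b \<in> S" "c \<in> S" using T_closed by auto
        have fc: "f a \<in> carrier G" "f b \<in> carrier G" "f c \<in> carrier G" using f abc by auto
        have "f a = f b \<otimes>\<^bsub>G\<^esub> f c" using r 1 unfolding compat_def by auto
        then have "f a \<otimes>\<^bsub>G\<^esub> inv\<^bsub>G\<^esub> f b \<otimes>\<^bsub>G\<^esub> inv\<^bsub>G\<^esub> f c = \<one>\<^bsub>G\<^esub>"
          using fc by (simp add: G.mult_inv_inv_eq_one_iff)
        then show ?thesis using 1 abc kd by (simp add: dif h)
      next
        case 2
        then have ab: "a \<in> S" "b \<in> S" using U_closed by auto
        have "f a = f b" using r 2 unfolding compat_def by auto
        moreover have "f b \<in> carrier G" using f ab by auto
        ultimately show ?thesis using 2 ab by (simp add: dif h)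
      qed
    qed
    ultimately show "x \<in> kernel (free_Abelian_group S) G h" by (simp add: kernel_def)
  qed
  then have "N \<subseteq> kernel (free_Abelian_group S) G h"
    unfolding relations_def by (intro F.generate_subgroup_incl h.subgroup_kernel)
  then obtain g where g: "g \<in> hom P G"
      "\<And>x. x \<in> carrier (free_Abelian_group S) \<Longrightarrow> g (N #>\<^bsub>free_Abelian_group S\<^esub> x) = h x"
    using h.FactGroup_universal_kernel[OF N_normal] unfolding presented_group_def by metis
  let ?g = "restrict g (carrier P)"
  have g': "?g \<in> hom P G" by (rule hom_restrictI[OF P.monoid_axioms g(1)])
  have gg: "?g (gen s) = f s" if "s \<in> S" for s
    using gen_closed[OF that] g(2)[of "frag_of s"] h(2) that by (simp add: generator_def)
  have "lift S (relators T U) G f = ?g" unfolding lift_def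
  proof (rule the_equality)
    show "?g \<in> hom P G \<and> ?g \<in> extensional (carrier P) \<and> (\<forall>s\<in>S. ?g (gen s) = f s)"
      using g' gg by auto
    show "k = ?g" if k: "k \<in> hom P G \<and> k \<in> extensional (carrier P) \<and> (\<forall>s\<in>S. k (gen s) = f s)" for k
    proof (rule extensionalityI)
      show "k \<in> extensional (carrier P)" "?g \<in> extensional (carrier P)" using k by auto
      show "k x = ?g x" if "x \<in> carrier P" for x
        using P_hom_eqI[of k G ?g x] k g' gg G that by auto
    qed
  qed
  then show ?thesis using g' gg by simp
qed

lemmas lift_hom = lift_spec[THEN conjunct1]
lemmas lift_extensional = lift_spec[THEN conjunct2, THEN conjunct1]
lemmas lift_gen = lift_spec[THEN conjunct2, THEN conjunct2, rule_format]

end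

text \<open>Biadditive maps out of two presented groups, as the iterated lifts that define the
  multiplications and actions.\<close>

locale presentation2 = L: presentation S1 T1 U1 + R: presentation S2 T2 U2
  for S1 :: "'s set" and T1 U1 and S2 :: "'t set" and T2 U2 +
  fixes G :: "('g, 'gx) monoid_scheme" and \<beta> :: "'s \<Rightarrow> 't \<Rightarrow> 'g"
  assumes G: "comm_group G"
    and \<beta>_closed: "\<And>p q. p \<in> S1 \<Longrightarrow> q \<in> S2 \<Longrightarrow> \<beta> p q \<in> carrier G"
    and \<beta>_left: "\<And>q. q \<in> S2 \<Longrightarrow> compat T1 U1 G (\<lambda>p. \<beta> p q)"
    and \<beta>_right: "\<And>p. p \<in> S1 \<Longrightarrow> compat T2 U2 G (\<beta> p)"
begin

definition "bilift t u = lift S1 (relators T1 U1) G (\<lambda>p. lift S2 (relators T2 U2) G (\<beta> p) u) t"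

lemma inner_hom: "p \<in> S1 \<Longrightarrow> lift S2 (relators T2 U2) G (\<beta> p) \<in> hom R.P G"
  using \<beta>_closed \<beta>_right by (intro R.lift_hom G) auto

lemma inner_gen: "p \<in> S1 \<Longrightarrow> q \<in> S2 \<Longrightarrow> lift S2 (relators T2 U2) G (\<beta> p) (R.gen q) = \<beta> p q"
  using \<beta>_closed \<beta>_right by (intro R.lift_gen G) auto

lemma inner_closed: "u \<in> carrier R.P \<Longrightarrow> (\<lambda>p. lift S2 (relators T2 U2) G (\<beta> p) u) \<in> S1 \<rightarrow> carrier G"
  using hom_in_carrier[OF inner_hom] by auto

text \<open>This is what lets the outer lift exist. Each equation compares two homomorphisms in
  \<open>u\<close>, which agree on the generators of the second group by
  \<open>\<beta>_left\<close>.\<close>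

lemma inner_compat:
  assumes u: "u \<in> carrier R.P"
  shows "compat T1 U1 G (\<lambda>p. lift S2 (relators T2 U2) G (\<beta> p) u)"
  unfolding compat_def
proof (intro conjI allI impI)
  fix a b c assume t: "(a, b, c) \<in> T1"
  then have abc: "a \<in> S1" "b \<in> S1" "c \<in> S1" using L.T_closed by auto
  show "lift S2 (relators T2 U2) G (\<beta> a) u =
      lift S2 (relators T2 U2) G (\<beta> b) u \<otimes>\<^bsub>G\<^esub> lift S2 (relators T2 U2) G (\<beta> c) u"
  proof (rule R.P_hom_eqI[OF _ _ G _ u])
    show "lift S2 (relators T2 U2) G (\<beta> a) (R.gen s) =
        lift S2 (relators T2 U2) G (\<beta> b) (R.gen s) \<otimes>\<^bsub>G\<^esub> lift S2 (relators T2 U2) G (\<beta> c) (R.gen s)"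
      if "s \<in> S2" for s
      using \<beta>_left[OF that] t that abc by (auto simp: inner_gen compat_def)
  qed (use abc in \<open>auto intro!: hom_pointwise_mult inner_hom G\<close>)
next
  fix a b assume t: "(a, b) \<in> U1"
  then have ab: "a \<in> S1" "b \<in> S1" using L.U_closed by auto
  show "lift S2 (relators T2 U2) G (\<beta> a) u = lift S2 (relators T2 U2) G (\<beta> b) u"
  proof (rule R.P_hom_eqI[OF _ _ G _ u])
    show "lift S2 (relators T2 U2) G (\<beta> a) (R.gen s) = lift S2 (relators T2 U2) G (\<beta> b) (R.gen s)"
      if "s \<in> S2" for s
      using \<beta>_left[OF that] t that ab by (auto simp: inner_gen compat_def)
  qed (use ab in \<open>auto intro!: inner_hom\<close>)
qed

lemma bilift_hom_left: "u \<in> carrier R.P \<Longrightarrow> (\<lambda>t. bilift t u) \<in> hom L.P G"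
  unfolding bilift_def by (intro L.lift_hom G inner_closed inner_compat)

lemma bilift_gen_left:
  "p \<in> S1 \<Longrightarrow> u \<in> carrier R.P \<Longrightarrow> bilift (L.gen p) u = lift S2 (relators T2 U2) G (\<beta> p) u"
  unfolding bilift_def by (intro L.lift_gen G inner_closed inner_compat)

lemma bilift_gen: "p \<in> S1 \<Longrightarrow> q \<in> S2 \<Longrightarrow> bilift (L.gen p) (R.gen q) = \<beta> p q"
  using R.gen_closed by (simp add: bilift_gen_left inner_gen)

text \<open>The outer lift is additive in \<open>t\<close> by construction; additivity in
  \<open>u\<close> is transferred from the inner lift, which is the value at a generator of the
  first group.\<close>

lemma bilift_hom_right:
  assumes t: "t \<in> carrier L.P" shows "bilift t \<in> hom R.P G"
proof (rule homI)
  interpret RP: comm_group R.P by (rule R.P_group)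
  show "bilift t u \<in> carrier G" if "u \<in> carrier R.P" for u
    using hom_in_carrier[OF bilift_hom_left[OF that] t] .
  fix u v assume uv: "u \<in> carrier R.P" "v \<in> carrier R.P"
  show "bilift t (u \<otimes>\<^bsub>R.P\<^esub> v) = bilift t u \<otimes>\<^bsub>G\<^esub> bilift t v"
  proof (rule L.P_hom_eqI[OF _ _ G _ t])
    fix s assume s: "s \<in> S1"
    show "bilift (L.gen s) (u \<otimes>\<^bsub>R.P\<^esub> v) = bilift (L.gen s) u \<otimes>\<^bsub>G\<^esub> bilift (L.gen s) v"
      using hom_mult[OF inner_hom[OF s] uv] uv s by (simp add: bilift_gen_left)
  qed (use uv in \<open>auto intro!: hom_pointwise_mult bilift_hom_left G\<close>)
qed

end

section \<open>Rings presented by a monoid of generators\<close>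

locale ring_presentation = presentation S T U for S :: "'s set" and T and U +
  fixes mul :: "'s \<Rightarrow> 's \<Rightarrow> 's" and e :: 's
  assumes mul_closed: "p \<in> S \<Longrightarrow> q \<in> S \<Longrightarrow> mul p q \<in> S"
    and e_closed: "e \<in> S"
    and mul_assoc: "p \<in> S \<Longrightarrow> q \<in> S \<Longrightarrow> r \<in> S \<Longrightarrow> mul (mul p q) r = mul p (mul q r)"
    and e_left: "p \<in> S \<Longrightarrow> mul e p = p"
    and e_right: "p \<in> S \<Longrightarrow> mul p e = p"
    and mul_left_compat: "p \<in> S \<Longrightarrow> compat T U P (\<lambda>q. gen (mul p q))"
    and mul_right_compat: "q \<in> S \<Longrightarrow> compat T U P (\<lambda>p. gen (mul p q))"
begin

sublocale mult: presentation2 S T U S T U P "\<lambda>p q. gen (mul p q)"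
  by (intro presentation2.intro presentation2_axioms.intro presentation_axioms P_group
      gen_closed mul_closed mul_left_compat mul_right_compat)

text \<open>The product is written in the shape of the products of \<open>env\<close> and
  \<open>tensor_algebra\<close>, so that both become instances by unfolding: the first with pairs
  multiplied componentwise (reversed in the second entry), the second with words.\<close>

definition PR :: "('s \<Rightarrow>\<^sub>0 int) set ring" where
  "PR = \<lparr>carrier = carrier P,
     monoid.mult = (\<lambda>t u. lift S (relators T U) P (\<lambda>p. lift S (relators T U) P
       (\<lambda>q. gen (mul p q)) u) t),
     one = gen e, zero = one P, add = monoid.mult P\<rparr>"

lemma PR_simps: "carrier PR = carrier P" "\<one>\<^bsub>PR\<^esub> = gen e" "\<zero>\<^bsub>PR\<^esub> = \<one>\<^bsub>P\<^esub>"
    "x \<oplus>\<^bsub>PR\<^esub> y = x \<otimes>\<^bsub>P\<^esub> y" "t \<otimes>\<^bsub>PR\<^esub> u = mult.bilift t u"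
  by (simp_all add: PR_def mult.bilift_def)

lemma add_monoid_PR: "add_monoid PR = P"
  by (simp add: PR_def)

lemma PR_gen_mult: "p \<in> S \<Longrightarrow> q \<in> S \<Longrightarrow> gen p \<otimes>\<^bsub>PR\<^esub> gen q = gen (mul p q)"
  by (simp add: PR_simps mult.bilift_gen)

lemma PR_hom_left: "u \<in> carrier P \<Longrightarrow> (\<lambda>t. t \<otimes>\<^bsub>PR\<^esub> u) \<in> hom P P"
  unfolding PR_simps by (rule mult.bilift_hom_left)

lemma PR_hom_right: "t \<in> carrier P \<Longrightarrow> (\<lambda>u. t \<otimes>\<^bsub>PR\<^esub> u) \<in> hom P P"
  unfolding PR_simps using mult.bilift_hom_right by (simp add: eta_contract_eq)

lemma PR_closed: "t \<in> carrier P \<Longrightarrow> u \<in> carrier P \<Longrightarrow> t \<otimes>\<^bsub>PR\<^esub> u \<in> carrier P"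
  using hom_in_carrier[OF PR_hom_left] .

text \<open>Both sides of the associative law are additive in each factor, so the factors may be
  replaced by generators one at a time, which leaves the associativity of \<open>mul\<close>. The
  unit laws are treated in the same way, and distributivity is the additivity itself.\<close>

lemma PR_ring: "ring PR"
proof (rule ringI)
  note G = P_group
  show "abelian_group PR"
    by (rule comm_group_abelian_groupI) (unfold add_monoid_PR, rule P_group)
  have left: "\<one>\<^bsub>PR\<^esub> \<otimes>\<^bsub>PR\<^esub> t = t" if t: "t \<in> carrier P" for t
    by (rule P_hom_eqI[OF PR_hom_right _ G _ t])
      (use e_closed gen_closed in \<open>auto simp: PR_simps(2) PR_gen_mult e_left intro: homI\<close>)
  have right: "t \<otimes>\<^bsub>PR\<^esub> \<one>\<^bsub>PR\<^esub> = t" if t: "t \<in> carrier P" for t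
    by (rule P_hom_eqI[OF PR_hom_left _ G _ t])
      (use e_closed gen_closed in \<open>auto simp: PR_simps(2) PR_gen_mult e_right intro: homI\<close>)
  have assoc: "(t \<otimes>\<^bsub>PR\<^esub> u) \<otimes>\<^bsub>PR\<^esub> v = t \<otimes>\<^bsub>PR\<^esub> (u \<otimes>\<^bsub>PR\<^esub> v)"
    if t: "t \<in> carrier P" and u: "u \<in> carrier P" and v: "v \<in> carrier P" for t u v
  proof (rule P_hom_eqI[OF _ _ G _ t])
    show "(\<lambda>t. (t \<otimes>\<^bsub>PR\<^esub> u) \<otimes>\<^bsub>PR\<^esub> v) \<in> hom P P" "(\<lambda>t. t \<otimes>\<^bsub>PR\<^esub> (u \<otimes>\<^bsub>PR\<^esub> v)) \<in> hom P P"
      using u v by (auto intro!: PR_hom_left PR_closed hom_comp[OF PR_hom_left PR_hom_left])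
    fix p assume p: "p \<in> S"
    show "(gen p \<otimes>\<^bsub>PR\<^esub> u) \<otimes>\<^bsub>PR\<^esub> v = gen p \<otimes>\<^bsub>PR\<^esub> (u \<otimes>\<^bsub>PR\<^esub> v)"
    proof (rule P_hom_eqI[OF _ _ G _ u])
      show "(\<lambda>u. (gen p \<otimes>\<^bsub>PR\<^esub> u) \<otimes>\<^bsub>PR\<^esub> v) \<in> hom P P" "(\<lambda>u. gen p \<otimes>\<^bsub>PR\<^esub> (u \<otimes>\<^bsub>PR\<^esub> v)) \<in> hom P P"
        using p v gen_closed
        by (auto intro!: hom_comp[OF PR_hom_right PR_hom_left] hom_comp[OF PR_hom_left PR_hom_right])
      fix q assume q: "q \<in> S"
      show "(gen p \<otimes>\<^bsub>PR\<^esub> gen q) \<otimes>\<^bsub>PR\<^esub> v = gen p \<otimes>\<^bsub>PR\<^esub> (gen q \<otimes>\<^bsub>PR\<^esub> v)"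
      proof (rule P_hom_eqI[OF _ _ G _ v])
        show "(\<lambda>v. (gen p \<otimes>\<^bsub>PR\<^esub> gen q) \<otimes>\<^bsub>PR\<^esub> v) \<in> hom P P"
            "(\<lambda>v. gen p \<otimes>\<^bsub>PR\<^esub> (gen q \<otimes>\<^bsub>PR\<^esub> v)) \<in> hom P P"
          using p q gen_closed by (auto intro!: PR_hom_right PR_closed hom_comp[OF PR_hom_right PR_hom_right])
        fix r assume "r \<in> S"
        with p q show "(gen p \<otimes>\<^bsub>PR\<^esub> gen q) \<otimes>\<^bsub>PR\<^esub> gen r = gen p \<otimes>\<^bsub>PR\<^esub> (gen q \<otimes>\<^bsub>PR\<^esub> gen r)"
          by (simp add: PR_gen_mult mul_closed mul_assoc)
      qed
    qed
  qed
  show "monoid PR"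
    by (rule monoidI) (use PR_closed gen_closed e_closed left right assoc in \<open>auto simp: PR_simps(1,2)\<close>)
  show "(x \<oplus>\<^bsub>PR\<^esub> y) \<otimes>\<^bsub>PR\<^esub> z = x \<otimes>\<^bsub>PR\<^esub> z \<oplus>\<^bsub>PR\<^esub> y \<otimes>\<^bsub>PR\<^esub> z"
    if "x \<in> carrier PR" "y \<in> carrier PR" "z \<in> carrier PR" for x y z
    using that hom_mult[OF PR_hom_left[of z], of x y] by (simp add: PR_simps(1,4))
  show "z \<otimes>\<^bsub>PR\<^esub> (x \<oplus>\<^bsub>PR\<^esub> y) = z \<otimes>\<^bsub>PR\<^esub> x \<oplus>\<^bsub>PR\<^esub> z \<otimes>\<^bsub>PR\<^esub> y"
    if "x \<in> carrier PR" "y \<in> carrier PR" "z \<in> carrier PR" for x y z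
    using that hom_mult[OF PR_hom_right[of z], of x y] by (simp add: PR_simps(1,4))
qed

text \<open>Because multiplication in \<open>Q\<close> distributes over addition, both sides of the
  multiplicativity of the lift are additive in each factor and may be compared on pairs of
  generators.\<close>

lemma lift_ring_hom:
  assumes Q: "ring Q" and f: "f \<in> S \<rightarrow> carrier Q" "compat T U (add_monoid Q) f"
    and mul: "\<And>p q. p \<in> S \<Longrightarrow> q \<in> S \<Longrightarrow> f (mul p q) = f p \<otimes>\<^bsub>Q\<^esub> f q" and one: "f e = \<one>\<^bsub>Q\<^esub>"
  shows "lift S (relators T U) (add_monoid Q) f \<in> ring_hom PR Q" (is "?h \<in> _")
proof -
  interpret Q: ring Q by fact
  have G: "comm_group (add_monoid Q)" by (rule Q.a_comm_group)
  have f': "f \<in> S \<rightarrow> carrier (add_monoid Q)" using f by simp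
  have h: "?h \<in> hom P (add_monoid Q)" by (rule lift_hom[OF G f' f(2)])
  have hg: "?h (gen s) = f s" if "s \<in> S" for s by (rule lift_gen[OF G f' f(2) that])
  have hc: "?h t \<in> carrier Q" if "t \<in> carrier P" for t
    using hom_in_carrier[OF h that] by simp
  have lm: "(\<lambda>x. x \<otimes>\<^bsub>Q\<^esub> c) \<in> hom (add_monoid Q) (add_monoid Q)"
    and rm: "(\<lambda>x. c \<otimes>\<^bsub>Q\<^esub> x) \<in> hom (add_monoid Q) (add_monoid Q)" if "c \<in> carrier Q" for c
    using that by (auto intro!: homI simp: Q.l_distr Q.r_distr)
  show ?thesis
  proof (rule ring_hom_memI)
    show "?h (t \<otimes>\<^bsub>PR\<^esub> u) = ?h t \<otimes>\<^bsub>Q\<^esub> ?h u" if "t \<in> carrier PR" and "u \<in> carrier PR" for t u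
    proof -
      have t: "t \<in> carrier P" and u: "u \<in> carrier P" using that by (auto simp: PR_simps)
      show ?thesis
      proof (rule P_hom_eqI[OF _ _ G _ t])
        show "(\<lambda>t. ?h (t \<otimes>\<^bsub>PR\<^esub> u)) \<in> hom P (add_monoid Q)" by (rule hom_comp[OF PR_hom_left[OF u] h])
        show "(\<lambda>t. ?h t \<otimes>\<^bsub>Q\<^esub> ?h u) \<in> hom P (add_monoid Q)" by (rule hom_comp[OF h lm[OF hc[OF u]]])
        fix p assume p: "p \<in> S"
        show "?h (gen p \<otimes>\<^bsub>PR\<^esub> u) = ?h (gen p) \<otimes>\<^bsub>Q\<^esub> ?h u"
        proof (rule P_hom_eqI[OF _ _ G _ u])
          show "(\<lambda>u. ?h (gen p \<otimes>\<^bsub>PR\<^esub> u)) \<in> hom P (add_monoid Q)"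
            by (rule hom_comp[OF PR_hom_right[OF gen_closed[OF p]] h])
          show "(\<lambda>u. ?h (gen p) \<otimes>\<^bsub>Q\<^esub> ?h u) \<in> hom P (add_monoid Q)"
            by (rule hom_comp[OF h rm[OF hc[OF gen_closed[OF p]]]])
          fix q assume "q \<in> S"
          with p show "?h (gen p \<otimes>\<^bsub>PR\<^esub> gen q) = ?h (gen p) \<otimes>\<^bsub>Q\<^esub> ?h (gen q)"
            by (simp add: PR_gen_mult hg mul mul_closed)
        qed
      qed
    qed
    show "?h (t \<oplus>\<^bsub>PR\<^esub> u) = ?h t \<oplus>\<^bsub>Q\<^esub> ?h u" if "t \<in> carrier PR" and "u \<in> carrier PR" for t u
      using hom_mult[OF h, of t u] that by (simp add: PR_simps)
  qed (use hc hg e_closed one in \<open>auto simp: PR_simps\<close>)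
qed

end

context ring_presentation
begin

text \<open>Compared with \<open>P_induct\<close> the case of the neutral element is absorbed:
  \<open>e\<close> is a generator, and zero is the sum of \<open>gen e\<close> and its
  negative.\<close>

lemma PR_induct [consumes 1, case_names gen add neg]:
  assumes t: "t \<in> carrier PR"
    and gen: "\<And>s. s \<in> S \<Longrightarrow> Q (gen s)"
    and add: "\<And>x y. x \<in> carrier PR \<Longrightarrow> y \<in> carrier PR \<Longrightarrow> Q x \<Longrightarrow> Q y \<Longrightarrow> Q (x \<oplus>\<^bsub>PR\<^esub> y)"
    and neg: "\<And>x. x \<in> carrier PR \<Longrightarrow> Q x \<Longrightarrow> Q (\<ominus>\<^bsub>PR\<^esub> x)"
  shows "Q t"
proof -
  interpret PR: ring PR by (rule PR_ring)
  have inv: "inv\<^bsub>P\<^esub> x = \<ominus>\<^bsub>PR\<^esub> x" for x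
    by (simp only: a_inv_def add_monoid_PR)
  have diff: "Q (x \<otimes>\<^bsub>P\<^esub> inv\<^bsub>P\<^esub> y)" if "x \<in> carrier PR" "y \<in> carrier PR" "Q x" "Q y" for x y
    using add[of x "\<ominus>\<^bsub>PR\<^esub> y"] neg[of y] that by (simp add: inv PR_simps(4))
  have e: "gen e \<in> carrier PR" using gen_closed[OF e_closed] by (simp add: PR_simps)
  have "gen e \<oplus>\<^bsub>PR\<^esub> \<ominus>\<^bsub>PR\<^esub> gen e = \<one>\<^bsub>P\<^esub>" using PR.r_neg[OF e] by (simp add: PR_simps(3))
  then have one: "Q \<one>\<^bsub>P\<^esub>" using add[OF e PR.a_inv_closed[OF e] gen[OF e_closed] neg[OF e gen[OF e_closed]]] by simp
  show ?thesis
    using t unfolding PR_simps(1)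
    by (induction t rule: P_induct) (auto intro: gen one diff simp: PR_simps(1))
qed

end

section \<open>Endomorphism rings\<close>

text \<open>Additive endomorphisms cut down to the carrier, so that equality in the ring is equality
  on \<open>M\<close>. An action of a ring on \<open>M\<close> becomes a ring homomorphism into
  \<open>End M\<close>, and the universal properties of the rings at hand apply.\<close>

definition End :: "('m, 'mx) monoid_scheme \<Rightarrow> ('m \<Rightarrow> 'm) ring" where
  "End M = \<lparr>carrier = hom M M \<inter> extensional (carrier M),
     monoid.mult = (\<lambda>f g. compose (carrier M) f g),
     one = (\<lambda>m\<in>carrier M. m), zero = (\<lambda>m\<in>carrier M. \<one>\<^bsub>M\<^esub>),
     add = (\<lambda>f g. \<lambda>m\<in>carrier M. f m \<otimes>\<^bsub>M\<^esub> g m)\<rparr>"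

lemma End_simps:
  "f \<in> carrier (End M) \<longleftrightarrow> f \<in> hom M M \<and> f \<in> extensional (carrier M)"
  "f \<otimes>\<^bsub>End M\<^esub> g = compose (carrier M) f g"
  "\<one>\<^bsub>End M\<^esub> = (\<lambda>m\<in>carrier M. m)" "\<zero>\<^bsub>End M\<^esub> = (\<lambda>m\<in>carrier M. \<one>\<^bsub>M\<^esub>)"
  "f \<oplus>\<^bsub>End M\<^esub> g = (\<lambda>m\<in>carrier M. f m \<otimes>\<^bsub>M\<^esub> g m)"
  by (simp_all add: End_def)

lemma End_apply:
  assumes "m \<in> carrier M"
  shows "(f \<otimes>\<^bsub>End M\<^esub> g) m = f (g m)" "\<one>\<^bsub>End M\<^esub> m = m" "\<zero>\<^bsub>End M\<^esub> m = \<one>\<^bsub>M\<^esub>"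
    "(f \<oplus>\<^bsub>End M\<^esub> g) m = f m \<otimes>\<^bsub>M\<^esub> g m"
  using assms by (simp_all add: End_simps compose_def)

lemma End_eqI:
  "f \<in> carrier (End M) \<Longrightarrow> g \<in> carrier (End M) \<Longrightarrow> (\<And>m. m \<in> carrier M \<Longrightarrow> f m = g m) \<Longrightarrow> f = g"
  by (auto simp: End_simps intro: extensionalityI)

lemma End_memI: "monoid M \<Longrightarrow> f \<in> hom M M \<Longrightarrow> restrict f (carrier M) \<in> carrier (End M)"
  by (simp add: End_simps hom_restrictI)

lemma End_ring:
  assumes "comm_group M" shows "ring (End M)"
proof -
  interpret M: comm_group M by fact
  have cl: "f m \<in> carrier M" if "f \<in> carrier (End M)" "m \<in> carrier M" for f m
    using that by (auto simp: End_simps hom_def)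
  have add: "f \<oplus>\<^bsub>End M\<^esub> g \<in> carrier (End M)" if "f \<in> carrier (End M)" "g \<in> carrier (End M)" for f g
    using that hom_pointwise_mult[of f M M g]
    by (simp add: End_simps hom_restrictI assms M.monoid_axioms)
  have mult: "f \<otimes>\<^bsub>End M\<^esub> g \<in> carrier (End M)" if "f \<in> carrier (End M)" "g \<in> carrier (End M)" for f g
    using that by (auto simp: End_simps hom_def compose_def Pi_iff)
  have one: "\<one>\<^bsub>End M\<^esub> \<in> carrier (End M)" and zero: "\<zero>\<^bsub>End M\<^esub> \<in> carrier (End M)"
    by (auto simp: End_simps hom_def)
  have neg: "\<exists>g\<in>carrier (End M). g \<oplus>\<^bsub>End M\<^esub> f = \<zero>\<^bsub>End M\<^esub>" if f: "f \<in> carrier (End M)" for f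
  proof
    show "(\<lambda>m\<in>carrier M. inv\<^bsub>M\<^esub> f m) \<in> carrier (End M)"
      using f by (auto simp: End_simps hom_def M.inv_mult Pi_iff)
    show "(\<lambda>m\<in>carrier M. inv\<^bsub>M\<^esub> f m) \<oplus>\<^bsub>End M\<^esub> f = \<zero>\<^bsub>End M\<^esub>"
      using cl[OF f] by (auto simp: End_simps)
  qed
  show ?thesis
  proof (rule ringI)
    show "abelian_group (End M)"
      by (rule abelian_groupI)
        (use add zero neg in \<open>auto intro!: End_eqI[where M = M] simp: cl End_apply M.m_ac\<close>)
    show "monoid (End M)"
      by (rule monoidI) (use mult one in \<open>auto intro!: End_eqI[where M = M] simp: cl End_apply\<close>)
    show "(x \<oplus>\<^bsub>End M\<^esub> y) \<otimes>\<^bsub>End M\<^esub> z = x \<otimes>\<^bsub>End M\<^esub> z \<oplus>\<^bsub>End M\<^esub> y \<otimes>\<^bsub>End M\<^esub> z"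
      if "x \<in> carrier (End M)" "y \<in> carrier (End M)" "z \<in> carrier (End M)" for x y z
      using that add mult by (intro End_eqI) (auto simp: cl End_apply)
    show "z \<otimes>\<^bsub>End M\<^esub> (x \<oplus>\<^bsub>End M\<^esub> y) = z \<otimes>\<^bsub>End M\<^esub> x \<oplus>\<^bsub>End M\<^esub> z \<otimes>\<^bsub>End M\<^esub> y"
      if "x \<in> carrier (End M)" "y \<in> carrier (End M)" "z \<in> carrier (End M)" for x y z
    proof (rule End_eqI)
      have "z \<in> hom M M" using that by (simp add: End_simps)
      then show "(z \<otimes>\<^bsub>End M\<^esub> (x \<oplus>\<^bsub>End M\<^esub> y)) m = (z \<otimes>\<^bsub>End M\<^esub> x \<oplus>\<^bsub>End M\<^esub> z \<otimes>\<^bsub>End M\<^esub> y) m"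
        if "m \<in> carrier M" for m
        using that \<open>x \<in> _\<close> \<open>y \<in> _\<close> by (simp add: End_apply cl hom_mult)
    qed (use that add mult in auto)
  qed
qed

section \<open>Tensor products of bimodules\<close>

lemma bimod_lact_hom: "bimodule R M \<Longrightarrow> r \<in> carrier R \<Longrightarrow> (\<lambda>m. r \<rhd>\<^bsub>M\<^esub> m) \<in> hom M M"
  by (rule homI) (auto simp: bimodule.lact_closed bimodule.lact_add_right)

lemma bimod_ract_hom: "bimodule R M \<Longrightarrow> r \<in> carrier R \<Longrightarrow> (\<lambda>m. m \<lhd>\<^bsub>M\<^esub> r) \<in> hom M M"
  by (rule homI) (auto simp: bimodule.ract_closed bimodule.ract_add_left)

section \<open>Tensor products as presented groups\<close>

definition tens_T :: "('r, 'm) bimod \<Rightarrow> ('r, 'n) bimod \<Rightarrow> (('m \<times> 'n) \<times> ('m \<times> 'n) \<times> ('m \<times> 'n)) set" where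
  "tens_T M N = {((m \<otimes>\<^bsub>M\<^esub> m', n), (m, n), (m', n)) | m m' n.
      m \<in> carrier M \<and> m' \<in> carrier M \<and> n \<in> carrier N} \<union>
    {((m, n \<otimes>\<^bsub>N\<^esub> n'), (m, n), (m, n')) | m n n'.
      m \<in> carrier M \<and> n \<in> carrier N \<and> n' \<in> carrier N}"

definition tens_U ::
  "('r, 'rx) ring_scheme \<Rightarrow> ('r, 'm) bimod \<Rightarrow> ('r, 'n) bimod \<Rightarrow> (('m \<times> 'n) \<times> ('m \<times> 'n)) set" where
  "tens_U R M N = {((m \<lhd>\<^bsub>M\<^esub> r, n), (m, r \<rhd>\<^bsub>N\<^esub> n)) | m r n.
      m \<in> carrier M \<and> r \<in> carrier R \<and> n \<in> carrier N}"

lemma Collect_triple_Un: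
  "{F a b c | a b c. (a, b, c) \<in> A \<union> B} =
    {F a b c | a b c. (a, b, c) \<in> A} \<union> {F a b c | a b c. (a, b, c) \<in> B}"
  by blast

lemma tensor_rel_relators: "tensor_rel R M N = relators (tens_T M N) (tens_U R M N)"
  unfolding tensor_rel_def relators_def tens_T_def tens_U_def Collect_triple_Un
  by (intro arg_cong2[where f = "(\<union>)"]; simp; intro Collect_cong; metis)

text \<open>The curried form of \<open>compat\<close> for the relators of a tensor product.
  Additivity is phrased through \<open>hom\<close>, so that closure comes with it and composites can
  be recognised by \<open>hom_comp\<close>.\<close>

definition balanced ::
  "('r, 'rx) ring_scheme \<Rightarrow> ('r, 'm) bimod \<Rightarrow> ('r, 'n) bimod \<Rightarrow> ('g, 'gx) monoid_scheme
    \<Rightarrow> ('m \<Rightarrow> 'n \<Rightarrow> 'g) \<Rightarrow> bool" where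
  "balanced R M N G \<beta> \<longleftrightarrow> (\<forall>m\<in>carrier M. (\<lambda>n. \<beta> m n) \<in> hom N G) \<and>
     (\<forall>n\<in>carrier N. (\<lambda>m. \<beta> m n) \<in> hom M G) \<and>
     (\<forall>m\<in>carrier M. \<forall>r\<in>carrier R. \<forall>n\<in>carrier N. \<beta> (m \<lhd>\<^bsub>M\<^esub> r) n = \<beta> m (r \<rhd>\<^bsub>N\<^esub> n))"

lemma balancedI:
  assumes "\<And>m. m \<in> carrier M \<Longrightarrow> (\<lambda>n. \<beta> m n) \<in> hom N G"
    and "\<And>n. n \<in> carrier N \<Longrightarrow> (\<lambda>m. \<beta> m n) \<in> hom M G"
    and "\<And>m r n. m \<in> carrier M \<Longrightarrow> r \<in> carrier R \<Longrightarrow> n \<in> carrier N \<Longrightarrow>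
      \<beta> (m \<lhd>\<^bsub>M\<^esub> r) n = \<beta> m (r \<rhd>\<^bsub>N\<^esub> n)"
  shows "balanced R M N G \<beta>"
  using assms unfolding balanced_def by blast

lemma balanced_closed:
  "balanced R M N G \<beta> \<Longrightarrow> m \<in> carrier M \<Longrightarrow> n \<in> carrier N \<Longrightarrow> \<beta> m n \<in> carrier G"
  unfolding balanced_def by (blast dest: hom_in_carrier)

lemma balanced_compat:
  assumes "balanced R M N G \<beta>"
  shows "compat (tens_T M N) (tens_U R M N) G (\<lambda>(m, n). \<beta> m n)"
  using assms unfolding balanced_def compat_def tens_T_def tens_U_def
  by (auto simp: hom_mult[of "\<beta> _"] hom_mult[of "\<lambda>m. \<beta> m _"])

lemma tensor_presentation:
  assumes "bimodule R M" "bimodule R N"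
  shows "presentation (carrier M \<times> carrier N) (tens_T M N) (tens_U R M N)"
proof -
  interpret M: bimodule R M by fact
  interpret N: bimodule R N by fact
  interpret MG: comm_group M by (rule M.group)
  interpret NG: comm_group N by (rule N.group)
  show ?thesis
    by unfold_locales (auto simp: tens_T_def tens_U_def M.ract_closed N.lact_closed)
qed

lemma tensor_group_simps:
  "carrier (M \<boxtimes>\<^bsub>R\<^esub> N) = carrier (tensor_group R M N)"
  "x \<otimes>\<^bsub>M \<boxtimes>\<^bsub>R\<^esub> N\<^esub> y = x \<otimes>\<^bsub>tensor_group R M N\<^esub> y" "\<one>\<^bsub>M \<boxtimes>\<^bsub>R\<^esub> N\<^esub> = \<one>\<^bsub>tensor_group R M N\<^esub>"
  by (simp_all add: tensor_def)

lemma hom_tensor: "hom (M \<boxtimes>\<^bsub>R\<^esub> N) G = hom (tensor_group R M N) G"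
  "hom G (M \<boxtimes>\<^bsub>R\<^esub> N) = hom G (tensor_group R M N)"
  by (simp_all add: hom_def tensor_group_simps)

text \<open>\<open>lift\<close> sees only the carrier and the product of its target. The actions on
  a tensor product are defined by lifts into \<open>tensor_group\<close>; this lets the bimodule
  itself take its place.\<close>

lemma lift_cong_group:
  "carrier G = carrier G' \<Longrightarrow> (\<And>x y. x \<otimes>\<^bsub>G\<^esub> y = x \<otimes>\<^bsub>G'\<^esub> y) \<Longrightarrow> lift S Rel G f = lift S Rel G' f"
  unfolding lift_def hom_def by simp

lemma comm_group_transfer:
  assumes "comm_group G" "carrier H = carrier G" "\<And>x y. x \<otimes>\<^bsub>H\<^esub> y = x \<otimes>\<^bsub>G\<^esub> y" "\<one>\<^bsub>H\<^esub> = \<one>\<^bsub>G\<^esub>"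
  shows "comm_group H"
proof -
  interpret G: comm_group G by fact
  have "\<exists>y\<in>carrier H. y \<otimes>\<^bsub>H\<^esub> x = \<one>\<^bsub>H\<^esub>" if "x \<in> carrier H" for x
    using that assms G.l_inv_ex[of x] by simp
  then show ?thesis
    by (intro comm_groupI) (auto simp: assms G.m_ac)
qed

context
  fixes R :: "('r, 'rx) ring_scheme" (structure) and M :: "('r, 'm) bimod" and N :: "('r, 'n) bimod"
  assumes M: "bimodule R M" and N: "bimodule R N"
begin

interpretation presentation "carrier M \<times> carrier N" "tens_T M N" "tens_U R M N"
  by (rule tensor_presentation[OF M N])

interpretation M: bimodule R M by (rule M)
interpretation N: bimodule R N by (rule N)

lemma tensor_group_comm_group: "comm_group (tensor_group R M N)"
  unfolding tensor_group_def tensor_rel_relators by (rule P_group)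

lemma tensor_comm_group: "comm_group (M \<boxtimes> N)"
  by (rule comm_group_transfer[OF tensor_group_comm_group]) (simp_all add: tensor_group_simps)

lemma elt_closed: "m \<in> carrier M \<Longrightarrow> n \<in> carrier N \<Longrightarrow> elt R M N m n \<in> carrier (M \<boxtimes> N)"
  unfolding tensor_group_simps tensor_group_def elt_def tensor_rel_relators
  by (rule gen_closed) simp

lemma elt_compat:
  "compat (tens_T M N) (tens_U R M N) (M \<boxtimes> N) (\<lambda>(m, n). elt R M N m n)"
  using gen_compat
  by (simp add: compat_def elt_def tensor_group_simps tensor_group_def tensor_rel_relators split_beta)

lemma elt_hom_right: "m \<in> carrier M \<Longrightarrow> (\<lambda>n. elt R M N m n) \<in> hom N (M \<boxtimes> N)"
  using elt_compat by (intro homI elt_closed) (auto simp: compat_def tens_T_def)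

lemma elt_hom_left: "n \<in> carrier N \<Longrightarrow> (\<lambda>m. elt R M N m n) \<in> hom M (M \<boxtimes> N)"
  using elt_compat by (intro homI elt_closed) (auto simp: compat_def tens_T_def)

lemma elt_balance:
  "m \<in> carrier M \<Longrightarrow> r \<in> carrier R \<Longrightarrow> n \<in> carrier N \<Longrightarrow>
    elt R M N (m \<lhd>\<^bsub>M\<^esub> r) n = elt R M N m (r \<rhd>\<^bsub>N\<^esub> n)"
  using elt_compat unfolding compat_def tens_U_def by fast

lemma tensor_lift_hom:
  assumes "comm_group G" "balanced R M N G \<beta>"
  shows "tensor_lift R M N G \<beta> \<in> hom (M \<boxtimes> N) G"
  unfolding tensor_lift_def hom_tensor tensor_group_def tensor_rel_relators
  by (rule lift_hom[OF assms(1) _ balanced_compat[OF assms(2)]])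
    (auto simp: balanced_closed[OF assms(2)])

lemma tensor_lift_elt:
  assumes "comm_group G" "balanced R M N G \<beta>" "m \<in> carrier M" "n \<in> carrier N"
  shows "tensor_lift R M N G \<beta> (elt R M N m n) = \<beta> m n"
  unfolding tensor_lift_def elt_def tensor_rel_relators
  using assms(3,4) by (subst lift_gen[OF assms(1) _ balanced_compat[OF assms(2)]])
    (auto simp: balanced_closed[OF assms(2)])

lemma tensor_lift_extensional:
  assumes "comm_group G" "balanced R M N G \<beta>"
  shows "tensor_lift R M N G \<beta> \<in> extensional (carrier (M \<boxtimes> N))"
  unfolding tensor_lift_def tensor_group_simps tensor_group_def tensor_rel_relators
  by (rule lift_extensional[OF assms(1) _ balanced_compat[OF assms(2)]])
    (auto simp: balanced_closed[OF assms(2)])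

lemma tensor_hom_eqI:
  assumes "f \<in> hom (M \<boxtimes> N) G" "g \<in> hom (M \<boxtimes> N) G" "comm_group G"
    and eq: "\<And>m n. m \<in> carrier M \<Longrightarrow> n \<in> carrier N \<Longrightarrow> f (elt R M N m n) = g (elt R M N m n)"
    and "t \<in> carrier (M \<boxtimes> N)"
  shows "f t = g t"
proof -
  note unfolds = hom_tensor tensor_group_simps tensor_group_def elt_def tensor_rel_relators
  show ?thesis
    by (rule P_hom_eqI[OF assms(1)[unfolded unfolds] assms(2)[unfolded unfolds] assms(3)
          _ assms(5)[unfolded unfolds]])
      (use eq in \<open>auto simp: unfolds\<close>)
qed

lemma tensor_lact_eq:
  "r \<rhd>\<^bsub>M \<boxtimes> N\<^esub> t = tensor_lift R M N (M \<boxtimes> N) (\<lambda>m n. elt R M N (r \<rhd>\<^bsub>M\<^esub> m) n) t"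
  unfolding tensor_lift_def
  by (subst lift_cong_group[of "M \<boxtimes> N" "tensor_group R M N"])
    (auto simp: tensor_def tensor_lift_def)

lemma tensor_ract_eq:
  "t \<lhd>\<^bsub>M \<boxtimes> N\<^esub> r = tensor_lift R M N (M \<boxtimes> N) (\<lambda>m n. elt R M N m (n \<lhd>\<^bsub>N\<^esub> r)) t"
  unfolding tensor_lift_def
  by (subst lift_cong_group[of "M \<boxtimes> N" "tensor_group R M N"])
    (auto simp: tensor_def tensor_lift_def)

text \<open>Acting on the outer side respects the balancing on the inner side because the left and
  right actions on \<open>M\<close> commute.\<close>

lemma balanced_lact:
  "r \<in> carrier R \<Longrightarrow> balanced R M N (M \<boxtimes> N) (\<lambda>m n. elt R M N (r \<rhd>\<^bsub>M\<^esub> m) n)"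
  by (intro balancedI elt_hom_right hom_comp[OF bimod_lact_hom[OF M] elt_hom_left])
    (simp_all add: M.lact_closed elt_balance flip: M.lact_ract)

lemma balanced_ract:
  "r \<in> carrier R \<Longrightarrow> balanced R M N (M \<boxtimes> N) (\<lambda>m n. elt R M N m (n \<lhd>\<^bsub>N\<^esub> r))"
  by (intro balancedI elt_hom_left hom_comp[OF bimod_ract_hom[OF N] elt_hom_right])
    (auto simp: N.ract_closed N.lact_ract elt_balance)

lemma tensor_lact_elt:
  "r \<in> carrier R \<Longrightarrow> m \<in> carrier M \<Longrightarrow> n \<in> carrier N \<Longrightarrow>
    r \<rhd>\<^bsub>M \<boxtimes> N\<^esub> elt R M N m n = elt R M N (r \<rhd>\<^bsub>M\<^esub> m) n"
  unfolding tensor_lact_eq by (intro tensor_lift_elt tensor_comm_group balanced_lact)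

lemma tensor_ract_elt:
  "r \<in> carrier R \<Longrightarrow> m \<in> carrier M \<Longrightarrow> n \<in> carrier N \<Longrightarrow>
    elt R M N m n \<lhd>\<^bsub>M \<boxtimes> N\<^esub> r = elt R M N m (n \<lhd>\<^bsub>N\<^esub> r)"
  unfolding tensor_ract_eq by (intro tensor_lift_elt tensor_comm_group balanced_ract)

lemma tensor_lact_hom: "r \<in> carrier R \<Longrightarrow> (\<lambda>t. r \<rhd>\<^bsub>M \<boxtimes> N\<^esub> t) \<in> hom (M \<boxtimes> N) (M \<boxtimes> N)"
  unfolding tensor_lact_eq using tensor_lift_hom[OF tensor_comm_group balanced_lact]
  by (simp add: eta_contract_eq)

lemma tensor_ract_hom: "r \<in> carrier R \<Longrightarrow> (\<lambda>t. t \<lhd>\<^bsub>M \<boxtimes> N\<^esub> r) \<in> hom (M \<boxtimes> N) (M \<boxtimes> N)"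
  unfolding tensor_ract_eq using tensor_lift_hom[OF tensor_comm_group balanced_ract]
  by (simp add: eta_contract_eq)

lemma tensor_bimodule: "bimodule R (M \<boxtimes> N)"
proof (rule bimodule.intro)
  interpret R: ring R by (rule M.ring)
  note G = tensor_comm_group
  note [simp] = tensor_lact_elt tensor_ract_elt M.lact_closed M.ract_closed N.lact_closed N.ract_closed
  show "ring R" "comm_group (M \<boxtimes> N)" by (rule R.ring_axioms, rule tensor_comm_group)
  fix r assume r: "r \<in> carrier R"
  show "r \<rhd>\<^bsub>M \<boxtimes> N\<^esub> t \<in> carrier (M \<boxtimes> N)" "t \<lhd>\<^bsub>M \<boxtimes> N\<^esub> r \<in> carrier (M \<boxtimes> N)"
    if "t \<in> carrier (M \<boxtimes> N)" for t
    using r that tensor_lact_hom tensor_ract_hom by (auto dest: hom_in_carrier)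
  show "r \<rhd>\<^bsub>M \<boxtimes> N\<^esub> (t \<otimes>\<^bsub>M \<boxtimes> N\<^esub> u) = (r \<rhd>\<^bsub>M \<boxtimes> N\<^esub> t) \<otimes>\<^bsub>M \<boxtimes> N\<^esub> (r \<rhd>\<^bsub>M \<boxtimes> N\<^esub> u)"
      "(t \<otimes>\<^bsub>M \<boxtimes> N\<^esub> u) \<lhd>\<^bsub>M \<boxtimes> N\<^esub> r = (t \<lhd>\<^bsub>M \<boxtimes> N\<^esub> r) \<otimes>\<^bsub>M \<boxtimes> N\<^esub> (u \<lhd>\<^bsub>M \<boxtimes> N\<^esub> r)"
    if "t \<in> carrier (M \<boxtimes> N)" "u \<in> carrier (M \<boxtimes> N)" for t u
    using hom_mult[OF tensor_lact_hom[OF r]] hom_mult[OF tensor_ract_hom[OF r]] that by auto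
  fix s assume s: "s \<in> carrier R"
  fix t assume t: "t \<in> carrier (M \<boxtimes> N)"
  have rs: "r \<oplus> s \<in> carrier R" "r \<otimes> s \<in> carrier R" using r s by auto
  show "(r \<oplus> s) \<rhd>\<^bsub>M \<boxtimes> N\<^esub> t = (r \<rhd>\<^bsub>M \<boxtimes> N\<^esub> t) \<otimes>\<^bsub>M \<boxtimes> N\<^esub> (s \<rhd>\<^bsub>M \<boxtimes> N\<^esub> t)"
    by (rule tensor_hom_eqI[OF tensor_lact_hom[OF rs(1)]
          hom_pointwise_mult[OF tensor_lact_hom[OF r] tensor_lact_hom[OF s] G] G _ t])
      (use r s rs in \<open>simp add: M.lact_add_left hom_mult[OF elt_hom_left]\<close>)
  show "t \<lhd>\<^bsub>M \<boxtimes> N\<^esub> (r \<oplus> s) = (t \<lhd>\<^bsub>M \<boxtimes> N\<^esub> r) \<otimes>\<^bsub>M \<boxtimes> N\<^esub> (t \<lhd>\<^bsub>M \<boxtimes> N\<^esub> s)"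
    by (rule tensor_hom_eqI[OF tensor_ract_hom[OF rs(1)]
          hom_pointwise_mult[OF tensor_ract_hom[OF r] tensor_ract_hom[OF s] G] G _ t])
      (use r s rs in \<open>simp add: N.ract_add_right hom_mult[OF elt_hom_right]\<close>)
  show "(r \<otimes> s) \<rhd>\<^bsub>M \<boxtimes> N\<^esub> t = r \<rhd>\<^bsub>M \<boxtimes> N\<^esub> (s \<rhd>\<^bsub>M \<boxtimes> N\<^esub> t)"
    by (rule tensor_hom_eqI[OF tensor_lact_hom[OF rs(2)]
          hom_comp[OF tensor_lact_hom[OF s] tensor_lact_hom[OF r]] G _ t])
      (use r s rs in \<open>simp add: M.lact_mult\<close>)
  show "t \<lhd>\<^bsub>M \<boxtimes> N\<^esub> (r \<otimes> s) = (t \<lhd>\<^bsub>M \<boxtimes> N\<^esub> r) \<lhd>\<^bsub>M \<boxtimes> N\<^esub> s"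
    by (rule tensor_hom_eqI[OF tensor_ract_hom[OF rs(2)]
          hom_comp[OF tensor_ract_hom[OF r] tensor_ract_hom[OF s]] G _ t])
      (use r s rs in \<open>simp add: N.ract_mult\<close>)
  show "(r \<rhd>\<^bsub>M \<boxtimes> N\<^esub> t) \<lhd>\<^bsub>M \<boxtimes> N\<^esub> s = r \<rhd>\<^bsub>M \<boxtimes> N\<^esub> (t \<lhd>\<^bsub>M \<boxtimes> N\<^esub> s)"
    by (rule tensor_hom_eqI[OF hom_comp[OF tensor_lact_hom[OF r] tensor_ract_hom[OF s]]
          hom_comp[OF tensor_ract_hom[OF s] tensor_lact_hom[OF r]] G _ t])
      (use r s in simp)
next
  interpret R: ring R by (rule M.ring)
  note G = tensor_comm_group
  fix t assume t: "t \<in> carrier (M \<boxtimes> N)"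
  show "\<one> \<rhd>\<^bsub>M \<boxtimes> N\<^esub> t = t"
    by (rule tensor_hom_eqI[OF tensor_lact_hom _ G _ t])
      (auto simp: tensor_lact_elt M.lact_one intro: homI)
  show "t \<lhd>\<^bsub>M \<boxtimes> N\<^esub> \<one> = t"
    by (rule tensor_hom_eqI[OF tensor_ract_hom _ G _ t])
      (auto simp: tensor_ract_elt N.ract_one intro: homI)
qed

end

text \<open>The neutral element requires no case of its own: it is the elementary tensor of the two
  neutral elements times its inverse.\<close>

lemma tensor_induct [consumes 3, case_names elt mult inv]:
  assumes M: "bimodule R M" and N: "bimodule R N" and t: "t \<in> carrier (M \<boxtimes>\<^bsub>R\<^esub> N)"
    and elt: "\<And>m n. m \<in> carrier M \<Longrightarrow> n \<in> carrier N \<Longrightarrow> Q (elt R M N m n)"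
    and mult: "\<And>t u. t \<in> carrier (M \<boxtimes>\<^bsub>R\<^esub> N) \<Longrightarrow> u \<in> carrier (M \<boxtimes>\<^bsub>R\<^esub> N) \<Longrightarrow> Q t \<Longrightarrow> Q u \<Longrightarrow>
      Q (t \<otimes>\<^bsub>M \<boxtimes>\<^bsub>R\<^esub> N\<^esub> u)"
    and inv: "\<And>t. t \<in> carrier (M \<boxtimes>\<^bsub>R\<^esub> N) \<Longrightarrow> Q t \<Longrightarrow> Q (inv\<^bsub>M \<boxtimes>\<^bsub>R\<^esub> N\<^esub> t)"
  shows "Q t"
proof -
  interpret presentation "carrier M \<times> carrier N" "tens_T M N" "tens_U R M N"
    by (rule tensor_presentation[OF M N])
  interpret MG: comm_group M by (rule bimodule.group[OF M])
  interpret NG: comm_group N by (rule bimodule.group[OF N])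
  interpret TG: comm_group "M \<boxtimes>\<^bsub>R\<^esub> N" by (rule tensor_comm_group[OF M N])
  have P: "carrier (M \<boxtimes>\<^bsub>R\<^esub> N) = carrier P" "x \<otimes>\<^bsub>M \<boxtimes>\<^bsub>R\<^esub> N\<^esub> y = x \<otimes>\<^bsub>P\<^esub> y"
    "\<one>\<^bsub>M \<boxtimes>\<^bsub>R\<^esub> N\<^esub> = \<one>\<^bsub>P\<^esub>" "inv\<^bsub>M \<boxtimes>\<^bsub>R\<^esub> N\<^esub> x = inv\<^bsub>P\<^esub> x" for x y
    by (simp_all add: tensor_group_simps tensor_group_def tensor_rel_relators m_inv_def)
  have 0: "elt R M N \<one>\<^bsub>M\<^esub> \<one>\<^bsub>N\<^esub> \<in> carrier (M \<boxtimes>\<^bsub>R\<^esub> N)" by (simp add: elt_closed[OF M N])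
  have "Q (elt R M N \<one>\<^bsub>M\<^esub> \<one>\<^bsub>N\<^esub> \<otimes>\<^bsub>M \<boxtimes>\<^bsub>R\<^esub> N\<^esub> inv\<^bsub>M \<boxtimes>\<^bsub>R\<^esub> N\<^esub> elt R M N \<one>\<^bsub>M\<^esub> \<one>\<^bsub>N\<^esub>)"
    by (intro mult inv elt 0 TG.inv_closed) auto
  then have one: "Q \<one>\<^bsub>P\<^esub>" using TG.r_inv[OF 0] by (simp add: P(3))
  show ?thesis
    using t[unfolded P]
  proof (induction t rule: P_induct)
    case (gen s)
    then show ?case using elt[of "fst s" "snd s"] by (auto simp: elt_def tensor_rel_relators)
  next
    case (diff t u)
    then show ?case using mult[of t "inv\<^bsub>P\<^esub> u"] inv[of u] TG.inv_closed[of u] by (simp add: P)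
  qed (rule one)
qed

section \<open>Biadditive maps on a pair of tensor products\<close>

locale tensor_bilift = M: bimodule R M + N: bimodule R N + M': bimodule R' M' + N': bimodule R' N'
  for R :: "('r, 'rx) ring_scheme" and M :: "('r, 'm) bimod" and N :: "('r, 'n) bimod"
    and R' :: "('s, 'sx) ring_scheme" and M' :: "('s, 'p) bimod" and N' :: "('s, 'q) bimod" +
  fixes G :: "('g, 'gx) monoid_scheme" and \<gamma> :: "'m \<Rightarrow> 'n \<Rightarrow> 'p \<Rightarrow> 'q \<Rightarrow> 'g"
  assumes G: "comm_group G"
    and bal_left: "\<And>p q. p \<in> carrier M' \<Longrightarrow> q \<in> carrier N' \<Longrightarrow> balanced R M N G (\<lambda>m n. \<gamma> m n p q)"
    and bal_right: "\<And>m n. m \<in> carrier M \<Longrightarrow> n \<in> carrier N \<Longrightarrow> balanced R' M' N' G (\<gamma> m n)"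
begin

text \<open>The shape of the nested lifts in \<open>env_bimod\<close>: the outer tensor is the
  acting element of the enveloping algebra, the inner one the vector acted upon.\<close>

definition "lift2 e t = tensor_lift R M N G (\<lambda>m n. tensor_lift R' M' N' G (\<gamma> m n) t) e"

text \<open>For fixed \<open>t\<close> every condition compares two homomorphisms in
  \<open>t\<close>, which are checked on elementary tensors; there it is the assumption
  \<open>bal_left\<close>.\<close>

lemma inner_balanced:
  assumes t: "t \<in> carrier (M' \<boxtimes>\<^bsub>R'\<^esub> N')"
  shows "balanced R M N G (\<lambda>m n. tensor_lift R' M' N' G (\<gamma> m n) t)"
proof -
  interpret MG: comm_group M by (rule M.group)
  interpret NG: comm_group N by (rule N.group)
  note hom = tensor_lift_hom[OF M'.bimodule_axioms N'.bimodule_axioms G bal_right]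
  note eltv = tensor_lift_elt[OF M'.bimodule_axioms N'.bimodule_axioms G bal_right]
  note eqI = tensor_hom_eqI[OF M'.bimodule_axioms N'.bimodule_axioms _ _ G]
  have L: "\<gamma> (m \<otimes>\<^bsub>M\<^esub> m') n p q = \<gamma> m n p q \<otimes>\<^bsub>G\<^esub> \<gamma> m' n p q"
    if "m \<in> carrier M" "m' \<in> carrier M" "n \<in> carrier N" "p \<in> carrier M'" "q \<in> carrier N'" for m m' n p q
    using bal_left[of p q] that hom_mult[of "\<lambda>m. \<gamma> m n p q" M G] unfolding balanced_def by auto
  have L': "\<gamma> m (n \<otimes>\<^bsub>N\<^esub> n') p q = \<gamma> m n p q \<otimes>\<^bsub>G\<^esub> \<gamma> m n' p q"
    if "m \<in> carrier M" "n \<in> carrier N" "n' \<in> carrier N" "p \<in> carrier M'" "q \<in> carrier N'" for m n n' p q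
    using bal_left[of p q] that hom_mult[of "\<lambda>n. \<gamma> m n p q" N G] unfolding balanced_def by auto
  have B: "\<gamma> (m \<lhd>\<^bsub>M\<^esub> r) n p q = \<gamma> m (r \<rhd>\<^bsub>N\<^esub> n) p q"
    if "m \<in> carrier M" "r \<in> carrier R" "n \<in> carrier N" "p \<in> carrier M'" "q \<in> carrier N'" for m r n p q
    using bal_left[of p q] that unfolding balanced_def by auto
  show ?thesis
  proof (intro balancedI homI)
    fix m n assume m: "m \<in> carrier M" and n: "n \<in> carrier N"
    show "tensor_lift R' M' N' G (\<gamma> m n) t \<in> carrier G"
      by (rule hom_in_carrier[OF hom[OF m n] t])
    then show "tensor_lift R' M' N' G (\<gamma> m n) t \<in> carrier G" .
    show "tensor_lift R' M' N' G (\<gamma> m (n \<otimes>\<^bsub>N\<^esub> n')) t =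
        tensor_lift R' M' N' G (\<gamma> m n) t \<otimes>\<^bsub>G\<^esub> tensor_lift R' M' N' G (\<gamma> m n') t"
      if n': "n' \<in> carrier N" for n'
      by (rule eqI[OF hom[OF m NG.m_closed[OF n n']] hom_pointwise_mult[OF hom[OF m n] hom[OF m n'] G] _ t])
        (use m n n' in \<open>simp add: eltv L'\<close>)
    show "tensor_lift R' M' N' G (\<gamma> (m \<otimes>\<^bsub>M\<^esub> m') n) t =
        tensor_lift R' M' N' G (\<gamma> m n) t \<otimes>\<^bsub>G\<^esub> tensor_lift R' M' N' G (\<gamma> m' n) t"
      if m': "m' \<in> carrier M" for m'
      by (rule eqI[OF hom[OF MG.m_closed[OF m m'] n] hom_pointwise_mult[OF hom[OF m n] hom[OF m' n] G] _ t])
        (use m n m' in \<open>simp add: eltv L\<close>)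
    show "tensor_lift R' M' N' G (\<gamma> (m \<lhd>\<^bsub>M\<^esub> r) n) t = tensor_lift R' M' N' G (\<gamma> m (r \<rhd>\<^bsub>N\<^esub> n)) t"
      if r: "r \<in> carrier R" for r
      by (rule eqI[OF hom[OF M.ract_closed[OF r m] n] hom[OF m N.lact_closed[OF r n]] _ t])
        (use m n r in \<open>simp add: eltv B M.ract_closed N.lact_closed\<close>)
  qed
qed

lemma lift2_hom_left: "t \<in> carrier (M' \<boxtimes>\<^bsub>R'\<^esub> N') \<Longrightarrow> (\<lambda>e. lift2 e t) \<in> hom (M \<boxtimes>\<^bsub>R\<^esub> N) G"
  unfolding lift2_def
  by (rule tensor_lift_hom[OF M.bimodule_axioms N.bimodule_axioms G inner_balanced])

lemma lift2_elt_left: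
  "m \<in> carrier M \<Longrightarrow> n \<in> carrier N \<Longrightarrow> t \<in> carrier (M' \<boxtimes>\<^bsub>R'\<^esub> N') \<Longrightarrow>
    lift2 (elt R M N m n) t = tensor_lift R' M' N' G (\<gamma> m n) t"
  unfolding lift2_def
  by (rule tensor_lift_elt[OF M.bimodule_axioms N.bimodule_axioms G inner_balanced])

lemma lift2_elt:
  "m \<in> carrier M \<Longrightarrow> n \<in> carrier N \<Longrightarrow> p \<in> carrier M' \<Longrightarrow> q \<in> carrier N' \<Longrightarrow>
    lift2 (elt R M N m n) (elt R' M' N' p q) = \<gamma> m n p q"
  by (simp add: lift2_elt_left elt_closed M'.bimodule_axioms N'.bimodule_axioms
      tensor_lift_elt[OF M'.bimodule_axioms N'.bimodule_axioms G bal_right])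

lemma lift2_hom_right:
  assumes e: "e \<in> carrier (M \<boxtimes>\<^bsub>R\<^esub> N)" shows "lift2 e \<in> hom (M' \<boxtimes>\<^bsub>R'\<^esub> N') G"
proof (rule homI)
  interpret TG: comm_group "M' \<boxtimes>\<^bsub>R'\<^esub> N'"
    by (rule tensor_comm_group[OF M'.bimodule_axioms N'.bimodule_axioms])
  show "lift2 e t \<in> carrier G" if "t \<in> carrier (M' \<boxtimes>\<^bsub>R'\<^esub> N')" for t
    by (rule hom_in_carrier[OF lift2_hom_left[OF that] e])
  fix t u assume tu: "t \<in> carrier (M' \<boxtimes>\<^bsub>R'\<^esub> N')" "u \<in> carrier (M' \<boxtimes>\<^bsub>R'\<^esub> N')"
  show "lift2 e (t \<otimes>\<^bsub>M' \<boxtimes>\<^bsub>R'\<^esub> N'\<^esub> u) = lift2 e t \<otimes>\<^bsub>G\<^esub> lift2 e u"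
  proof (rule tensor_hom_eqI[OF M.bimodule_axioms N.bimodule_axioms lift2_hom_left[OF TG.m_closed[OF tu]]
        hom_pointwise_mult[OF lift2_hom_left[OF tu(1)] lift2_hom_left[OF tu(2)] G] G _ e])
    fix m n assume mn: "m \<in> carrier M" "n \<in> carrier N"
    show "lift2 (elt R M N m n) (t \<otimes>\<^bsub>M' \<boxtimes>\<^bsub>R'\<^esub> N'\<^esub> u) =
        lift2 (elt R M N m n) t \<otimes>\<^bsub>G\<^esub> lift2 (elt R M N m n) u"
      using hom_mult[OF tensor_lift_hom[OF M'.bimodule_axioms N'.bimodule_axioms G bal_right[OF mn]] tu]
        tu mn by (simp add: lift2_elt_left)
  qed
qed

end

section \<open>The enveloping algebra\<close>

lemma regular_bimodule: "ring A \<Longrightarrow> bimodule A (regular A)"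
proof -
  assume A: "ring A"
  interpret A: ring A by fact
  show ?thesis
    by (rule bimodule.intro)
      (auto simp: regular_def A A.l_distr A.r_distr A.m_assoc
        intro: comm_group_transfer[OF A.a_comm_group])
qed

lemma regular_simps: "carrier (regular A) = carrier A" "x \<otimes>\<^bsub>regular A\<^esub> y = x \<oplus>\<^bsub>A\<^esub> y"
    "\<one>\<^bsub>regular A\<^esub> = \<zero>\<^bsub>A\<^esub>" "a \<rhd>\<^bsub>regular A\<^esub> x = a \<otimes>\<^bsub>A\<^esub> x" "x \<lhd>\<^bsub>regular A\<^esub> a = x \<otimes>\<^bsub>A\<^esub> a"
  by (simp_all add: regular_def)

lemma scalars_simps: "carrier (scalars A M) = carrier M" "x \<otimes>\<^bsub>scalars A M\<^esub> y = x \<otimes>\<^bsub>M\<^esub> y"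
    "\<one>\<^bsub>scalars A M\<^esub> = \<one>\<^bsub>M\<^esub>" "c \<rhd>\<^bsub>scalars A M\<^esub> m = (c \<odot>\<^bsub>A\<^esub> \<one>\<^bsub>A\<^esub>) \<rhd>\<^bsub>M\<^esub> m"
    "m \<lhd>\<^bsub>scalars A M\<^esub> c = m \<lhd>\<^bsub>M\<^esub> (c \<odot>\<^bsub>A\<^esub> \<one>\<^bsub>A\<^esub>)"
  by (simp_all add: scalars_def)

lemma hom_scalars: "hom (scalars A M) G = hom M G" "hom G (scalars A M) = hom G M"
  by (simp_all add: hom_def scalars_simps)

lemma opp_simps: "carrier (opp A) = carrier A" "x \<otimes>\<^bsub>opp A\<^esub> y = y \<otimes>\<^bsub>A\<^esub> x" "\<one>\<^bsub>opp A\<^esub> = \<one>\<^bsub>A\<^esub>"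
    "\<zero>\<^bsub>opp A\<^esub> = \<zero>\<^bsub>A\<^esub>" "x \<oplus>\<^bsub>opp A\<^esub> y = x \<oplus>\<^bsub>A\<^esub> y" "c \<odot>\<^bsub>opp A\<^esub> x = c \<odot>\<^bsub>A\<^esub> x"
  by (simp_all add: opp_def)

context assoc_algebra
begin

interpretation A: ring A by (rule ring)
interpretation K: field K by (rule scalar_field)
interpretation V: module K A by (rule vector_space)

lemma scalar_closed: "c \<in> carrier K \<Longrightarrow> c \<odot>\<^bsub>A\<^esub> \<one>\<^bsub>A\<^esub> \<in> carrier A"
  by simp

lemma scalar_add: "c \<in> carrier K \<Longrightarrow> d \<in> carrier K \<Longrightarrow>
    (c \<oplus>\<^bsub>K\<^esub> d) \<odot>\<^bsub>A\<^esub> \<one>\<^bsub>A\<^esub> = (c \<odot>\<^bsub>A\<^esub> \<one>\<^bsub>A\<^esub>) \<oplus>\<^bsub>A\<^esub> (d \<odot>\<^bsub>A\<^esub> \<one>\<^bsub>A\<^esub>)"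
  by (simp add: V.smult_l_distr)

lemma scalar_mult: "c \<in> carrier K \<Longrightarrow> d \<in> carrier K \<Longrightarrow>
    (c \<otimes>\<^bsub>K\<^esub> d) \<odot>\<^bsub>A\<^esub> \<one>\<^bsub>A\<^esub> = (c \<odot>\<^bsub>A\<^esub> \<one>\<^bsub>A\<^esub>) \<otimes>\<^bsub>A\<^esub> (d \<odot>\<^bsub>A\<^esub> \<one>\<^bsub>A\<^esub>)"
  by (simp add: V.smult_assoc1 smult_mult_left)

lemma scalar_one: "\<one>\<^bsub>K\<^esub> \<odot>\<^bsub>A\<^esub> \<one>\<^bsub>A\<^esub> = \<one>\<^bsub>A\<^esub>"
  by simp

lemma scalar_commute: "c \<in> carrier K \<Longrightarrow> a \<in> carrier A \<Longrightarrow>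
    (c \<odot>\<^bsub>A\<^esub> \<one>\<^bsub>A\<^esub>) \<otimes>\<^bsub>A\<^esub> a = a \<otimes>\<^bsub>A\<^esub> (c \<odot>\<^bsub>A\<^esub> \<one>\<^bsub>A\<^esub>)"
  by (simp add: smult_mult_left smult_mult_right)

text \<open>The second tensor factor of \<open>env\<close> is built from \<open>opp A\<close>, so
  the facts on scalars are also wanted for the opposite algebra.\<close>

lemma assoc_algebra_opp: "assoc_algebra K (opp A)"
proof (rule assoc_algebra.intro)
  show "ring (opp A)"
  proof (rule ringI)
    show "abelian_group (opp A)"
      by (rule comm_group_abelian_groupI, rule comm_group_transfer[OF A.a_comm_group])
        (simp_all add: opp_simps)
    show "monoid (opp A)" by (rule monoidI) (simp_all add: opp_simps A.m_assoc)
  qed (simp_all add: opp_simps A.l_distr A.r_distr)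
  then interpret O: ring "opp A" .
  show "module K (opp A)"
    by (rule module.intro[OF K.is_cring O.abelian_group_axioms])
      (simp add: module_axioms_def opp_simps V.smult_l_distr V.smult_r_distr V.smult_assoc1)
qed (simp_all add: opp_simps scalar_field smult_mult_left smult_mult_right)

lemma scalars_bimodule:
  assumes "bimodule A M" shows "bimodule K (scalars A M)"
proof -
  interpret M: bimodule A M by fact
  have "comm_group (scalars A M)"
    by (rule comm_group_transfer[OF M.group]) (simp_all add: scalars_simps)
  then show ?thesis
    by (intro bimodule.intro)
      (auto simp: scalars_simps scalar_closed scalar_add scalar_mult scalar_one K.ring_axioms
        M.lact_closed M.lact_add_left M.lact_add_right M.lact_mult M.lact_one
        M.ract_closed M.ract_add_left M.ract_add_right M.ract_mult M.ract_one M.lact_ract)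
qed

abbreviation "A1 \<equiv> scalars A (regular A)"
abbreviation "A2 \<equiv> scalars (opp A) (regular (opp A))"

lemma A1: "bimodule K A1"
  by (rule scalars_bimodule[OF regular_bimodule[OF ring]])

lemma A2: "bimodule K A2"
  by (rule assoc_algebra.scalars_bimodule[OF assoc_algebra_opp])
    (rule regular_bimodule[OF assoc_algebra.ring[OF assoc_algebra_opp]])

abbreviation "ES \<equiv> carrier A1 \<times> carrier A2"
abbreviation "ET \<equiv> tens_T A1 A2"
abbreviation "EU \<equiv> tens_U K A1 A2"

definition "env_mul p q = (fst p \<otimes>\<^bsub>A\<^esub> fst q, snd q \<otimes>\<^bsub>A\<^esub> snd p)"

abbreviation "\<epsilon> \<equiv> env_elt K A"

lemma env_elt_closed: "a \<in> carrier A \<Longrightarrow> b \<in> carrier A \<Longrightarrow> \<epsilon> a b \<in> carrier (env_group K A)"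
  using elt_closed[OF A1 A2, of a b]
  by (simp add: env_elt_def env_group_def tensor_group_simps scalars_simps regular_simps opp_simps)

lemma env_elt_add_left:
  "a \<in> carrier A \<Longrightarrow> a' \<in> carrier A \<Longrightarrow> b \<in> carrier A \<Longrightarrow>
    \<epsilon> (a \<oplus>\<^bsub>A\<^esub> a') b = \<epsilon> a b \<otimes>\<^bsub>env_group K A\<^esub> \<epsilon> a' b"
  using hom_mult[OF elt_hom_left[OF A1 A2, of b], of a a']
  by (simp add: env_elt_def env_group_def tensor_group_simps scalars_simps regular_simps opp_simps)

lemma env_elt_add_right:
  "a \<in> carrier A \<Longrightarrow> b \<in> carrier A \<Longrightarrow> b' \<in> carrier A \<Longrightarrow>
    \<epsilon> a (b \<oplus>\<^bsub>A\<^esub> b') = \<epsilon> a b \<otimes>\<^bsub>env_group K A\<^esub> \<epsilon> a b'"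
  using hom_mult[OF elt_hom_right[OF A1 A2, of a], of b b']
  by (simp add: env_elt_def env_group_def tensor_group_simps scalars_simps regular_simps opp_simps)

lemma env_elt_balance:
  "a \<in> carrier A \<Longrightarrow> c \<in> carrier K \<Longrightarrow> b \<in> carrier A \<Longrightarrow>
    \<epsilon> (a \<otimes>\<^bsub>A\<^esub> (c \<odot>\<^bsub>A\<^esub> \<one>\<^bsub>A\<^esub>)) b = \<epsilon> a (b \<otimes>\<^bsub>A\<^esub> (c \<odot>\<^bsub>A\<^esub> \<one>\<^bsub>A\<^esub>))"
  using elt_balance[OF A1 A2, of a c b]
  by (simp add: env_elt_def env_group_def tensor_group_simps scalars_simps regular_simps opp_simps)

lemma env_presentation: "presentation ES ET EU"
  by (rule tensor_presentation[OF A1 A2])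

lemma env_group_eq: "env_group K A = presented_group ES (relators ET EU)"
  by (simp add: env_group_def tensor_group_def tensor_rel_relators)

lemma env_elt_eq: "\<epsilon> a b = generator ES (relators ET EU) (a, b)"
  by (simp add: env_elt_def elt_def tensor_rel_relators)

text \<open>Additivity relators are preserved by distributivity. For the balancing relators a scalar
  has to be carried past the new factor, and this works because scalars are central in
  \<open>A\<close>.\<close>

lemma env_ring_presentation: "ring_presentation ES ET EU env_mul (\<one>\<^bsub>A\<^esub>, \<one>\<^bsub>A\<^esub>)"
proof -
  note simps = scalars_simps regular_simps opp_simps
  show ?thesis
  proof (intro ring_presentation.intro ring_presentation_axioms.intro env_presentation)
    fix p q assume "p \<in> ES" "q \<in> ES"
    then show "env_mul p q \<in> ES" by (auto simp: env_mul_def simps)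
    fix r assume "r \<in> ES"
    then show "env_mul (env_mul p q) r = env_mul p (env_mul q r)"
      using \<open>p \<in> ES\<close> \<open>q \<in> ES\<close> by (auto simp: env_mul_def simps A.m_assoc)
  next
    show "(\<one>\<^bsub>A\<^esub>, \<one>\<^bsub>A\<^esub>) \<in> ES" by (simp add: simps)
    fix p assume p: "p \<in> ES"
    then show "env_mul (\<one>\<^bsub>A\<^esub>, \<one>\<^bsub>A\<^esub>) p = p" "env_mul p (\<one>\<^bsub>A\<^esub>, \<one>\<^bsub>A\<^esub>) = p"
      by (auto simp: env_mul_def simps)
    obtain a b where ab: "p = (a, b)" "a \<in> carrier A" "b \<in> carrier A" using p by (auto simp: simps)
    have swap: "c \<odot>\<^bsub>A\<^esub> \<one>\<^bsub>A\<^esub> \<otimes>\<^bsub>A\<^esub> x = x \<otimes>\<^bsub>A\<^esub> (c \<odot>\<^bsub>A\<^esub> \<one>\<^bsub>A\<^esub>)"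
      "x \<otimes>\<^bsub>A\<^esub> (c \<odot>\<^bsub>A\<^esub> \<one>\<^bsub>A\<^esub>) \<otimes>\<^bsub>A\<^esub> y = x \<otimes>\<^bsub>A\<^esub> y \<otimes>\<^bsub>A\<^esub> (c \<odot>\<^bsub>A\<^esub> \<one>\<^bsub>A\<^esub>)"
      if "c \<in> carrier K" "x \<in> carrier A" "y \<in> carrier A" for c x y
      using that by (simp_all add: scalar_commute A.m_assoc scalar_closed)
    have L: "\<epsilon> (a \<otimes>\<^bsub>A\<^esub> (x \<otimes>\<^bsub>A\<^esub> (c \<odot>\<^bsub>A\<^esub> \<one>\<^bsub>A\<^esub>))) (y \<otimes>\<^bsub>A\<^esub> b) =
        \<epsilon> (a \<otimes>\<^bsub>A\<^esub> x) (y \<otimes>\<^bsub>A\<^esub> (c \<odot>\<^bsub>A\<^esub> \<one>\<^bsub>A\<^esub>) \<otimes>\<^bsub>A\<^esub> b)"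
      if "c \<in> carrier K" "x \<in> carrier A" "y \<in> carrier A" for c x y
      using env_elt_balance[of "a \<otimes>\<^bsub>A\<^esub> x" c "y \<otimes>\<^bsub>A\<^esub> b"] that ab
      by (simp only: A.m_assoc[symmetric] scalar_closed swap A.m_closed)
    show "compat ET EU (presented_group ES (relators ET EU))
        (\<lambda>q. generator ES (relators ET EU) (env_mul p q))"
      unfolding compat_def env_group_eq[symmetric] env_mul_def env_elt_eq[symmetric]
      using ab L by (auto simp: tens_T_def tens_U_def simps A.r_distr A.l_distr env_elt_add_left env_elt_add_right)
    have R: "\<epsilon> (x \<otimes>\<^bsub>A\<^esub> (c \<odot>\<^bsub>A\<^esub> \<one>\<^bsub>A\<^esub>) \<otimes>\<^bsub>A\<^esub> a) (b \<otimes>\<^bsub>A\<^esub> y) =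
        \<epsilon> (x \<otimes>\<^bsub>A\<^esub> a) (b \<otimes>\<^bsub>A\<^esub> (y \<otimes>\<^bsub>A\<^esub> (c \<odot>\<^bsub>A\<^esub> \<one>\<^bsub>A\<^esub>)))"
      if "c \<in> carrier K" "x \<in> carrier A" "y \<in> carrier A" for c x y
      using env_elt_balance[of "x \<otimes>\<^bsub>A\<^esub> a" c "b \<otimes>\<^bsub>A\<^esub> y"] that ab
      by (simp only: A.m_assoc[symmetric] scalar_closed swap A.m_closed)
    show "compat ET EU (presented_group ES (relators ET EU))
        (\<lambda>q. generator ES (relators ET EU) (env_mul q p))"
      unfolding compat_def env_group_eq[symmetric] env_mul_def env_elt_eq[symmetric]
      using ab R by (auto simp: tens_T_def tens_U_def simps A.r_distr A.l_distr env_elt_add_left env_elt_add_right)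
  qed
qed

sublocale env: ring_presentation ES ET EU env_mul "(\<one>\<^bsub>A\<^esub>, \<one>\<^bsub>A\<^esub>)"
  by (rule env_ring_presentation)

lemma env_eq_PR: "env K A = env.PR"
  unfolding env_def env.PR_def env_lift_def tensor_lift_def env_group_eq env_elt_eq env_mul_def
    tensor_rel_relators opp_simps
  by (simp add: case_prod_beta')

lemma env_ring: "ring (env K A)"
  unfolding env_eq_PR by (rule env.PR_ring)

lemma carrier_env: "carrier (env K A) = carrier (env_group K A)"
  and add_env: "x \<oplus>\<^bsub>env K A\<^esub> y = x \<otimes>\<^bsub>env_group K A\<^esub> y"
  and one_env: "\<one>\<^bsub>env K A\<^esub> = \<epsilon> \<one>\<^bsub>A\<^esub> \<one>\<^bsub>A\<^esub>"
  by (simp_all add: env_def)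

lemma hom_env_group: "hom (env_group K A) G = hom (add_monoid (env K A)) G"
  by (simp add: hom_def carrier_env add_env)

lemma env_elt_mult:
  "a \<in> carrier A \<Longrightarrow> b \<in> carrier A \<Longrightarrow> a' \<in> carrier A \<Longrightarrow> b' \<in> carrier A \<Longrightarrow>
    \<epsilon> a b \<otimes>\<^bsub>env K A\<^esub> \<epsilon> a' b' = \<epsilon> (a \<otimes>\<^bsub>A\<^esub> a') (b' \<otimes>\<^bsub>A\<^esub> b)"
  unfolding env_eq_PR env_elt_eq
  by (subst env.PR_gen_mult) (auto simp: scalars_simps regular_simps opp_simps env_mul_def)

lemma env_induct [consumes 1, case_names elt add neg]:
  assumes "t \<in> carrier (env K A)" "\<And>a b. a \<in> carrier A \<Longrightarrow> b \<in> carrier A \<Longrightarrow> Q (\<epsilon> a b)"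
    and "\<And>x y. x \<in> carrier (env K A) \<Longrightarrow> y \<in> carrier (env K A) \<Longrightarrow> Q x \<Longrightarrow> Q y \<Longrightarrow> Q (x \<oplus>\<^bsub>env K A\<^esub> y)"
    and "\<And>x. x \<in> carrier (env K A) \<Longrightarrow> Q x \<Longrightarrow> Q (\<ominus>\<^bsub>env K A\<^esub> x)"
  shows "Q t"
  using assms(1)[unfolded env_eq_PR]
proof (induction t rule: env.PR_induct)
  case (gen s)
  then show ?case
    using assms(2)[of "fst s" "snd s"] by (auto simp: env_elt_eq scalars_simps regular_simps opp_simps)
qed (use assms(3,4) in \<open>simp_all add: env_eq_PR\<close>)

end

text \<open>The universal property of the enveloping algebra. In \<open>mult\<close> the second
  arguments are multiplied in reversed order because they stand for elements of the opposite
  algebra.\<close>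

lemma (in assoc_algebra) env_ring_hom:
  assumes Q: "ring Q"
    and closed: "\<And>a b. a \<in> carrier A \<Longrightarrow> b \<in> carrier A \<Longrightarrow> f a b \<in> carrier Q"
    and add_left: "\<And>a a' b. a \<in> carrier A \<Longrightarrow> a' \<in> carrier A \<Longrightarrow> b \<in> carrier A \<Longrightarrow>
      f (a \<oplus>\<^bsub>A\<^esub> a') b = f a b \<oplus>\<^bsub>Q\<^esub> f a' b"
    and add_right: "\<And>a b b'. a \<in> carrier A \<Longrightarrow> b \<in> carrier A \<Longrightarrow> b' \<in> carrier A \<Longrightarrow>
      f a (b \<oplus>\<^bsub>A\<^esub> b') = f a b \<oplus>\<^bsub>Q\<^esub> f a b'"
    and balance: "\<And>a b c. a \<in> carrier A \<Longrightarrow> b \<in> carrier A \<Longrightarrow> c \<in> carrier K \<Longrightarrow>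
      f (a \<otimes>\<^bsub>A\<^esub> (c \<odot>\<^bsub>A\<^esub> \<one>\<^bsub>A\<^esub>)) b = f a (b \<otimes>\<^bsub>A\<^esub> (c \<odot>\<^bsub>A\<^esub> \<one>\<^bsub>A\<^esub>))"
    and mult: "\<And>a b a' b'. a \<in> carrier A \<Longrightarrow> b \<in> carrier A \<Longrightarrow> a' \<in> carrier A \<Longrightarrow> b' \<in> carrier A \<Longrightarrow>
      f (a \<otimes>\<^bsub>A\<^esub> a') (b' \<otimes>\<^bsub>A\<^esub> b) = f a b \<otimes>\<^bsub>Q\<^esub> f a' b'"
    and one: "f \<one>\<^bsub>A\<^esub> \<one>\<^bsub>A\<^esub> = \<one>\<^bsub>Q\<^esub>"
  shows "\<exists>\<Phi>\<in>ring_hom (env K A) Q. \<forall>a\<in>carrier A. \<forall>b\<in>carrier A. \<Phi> (env_elt K A a b) = f a b"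
proof -
  interpret Q: ring Q by fact
  note simps = scalars_simps regular_simps opp_simps
  let ?f = "\<lambda>(a, b). f a b"
  have cl: "?f \<in> ES \<rightarrow> carrier Q" using closed by (auto simp: simps)
  have co: "compat ET EU (add_monoid Q) ?f"
    unfolding compat_def tens_T_def tens_U_def using add_left add_right balance by (auto simp: simps)
  let ?\<Phi> = "lift ES (relators ET EU) (add_monoid Q) ?f"
  have "?\<Phi> \<in> ring_hom (env K A) Q"
    unfolding env_eq_PR
    by (rule env.lift_ring_hom[OF Q cl co]) (auto simp: simps env_mul_def mult one)
  moreover have "?\<Phi> (env_elt K A a b) = f a b" if "a \<in> carrier A" "b \<in> carrier A" for a b
    unfolding env_elt_eq using cl that
    by (subst env.lift_gen[OF Q.a_comm_group _ co]) (auto simp: simps)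
  ultimately show ?thesis by blast
qed

section \<open>Tensor algebras\<close>

definition word_T ::
  "('r, 'rx) ring_scheme \<Rightarrow> ('r, 'v) bimod \<Rightarrow> (('r \<times> 'v list) \<times> ('r \<times> 'v list) \<times> ('r \<times> 'v list)) set" where
  "word_T R V = {((r \<oplus>\<^bsub>R\<^esub> s, vs), (r, vs), (s, vs)) | r s vs.
      r \<in> carrier R \<and> s \<in> carrier R \<and> vs \<in> lists (carrier V)} \<union>
    {((r, us @ [v \<otimes>\<^bsub>V\<^esub> v'] @ vs), (r, us @ [v] @ vs), (r, us @ [v'] @ vs)) | r us v v' vs.
      r \<in> carrier R \<and> us \<in> lists (carrier V) \<and> vs \<in> lists (carrier V) \<and>
      v \<in> carrier V \<and> v' \<in> carrier V}"

definition word_U ::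
  "('r, 'rx) ring_scheme \<Rightarrow> ('r, 'v) bimod \<Rightarrow> (('r \<times> 'v list) \<times> ('r \<times> 'v list)) set" where
  "word_U R V = {((r \<otimes>\<^bsub>R\<^esub> s, v # vs), (r, (s \<rhd>\<^bsub>V\<^esub> v) # vs)) | r s v vs.
      r \<in> carrier R \<and> s \<in> carrier R \<and> v \<in> carrier V \<and> vs \<in> lists (carrier V)} \<union>
    {((r, us @ [v \<lhd>\<^bsub>V\<^esub> s, v'] @ vs), (r, us @ [v, s \<rhd>\<^bsub>V\<^esub> v'] @ vs)) | r us v s v' vs.
      r \<in> carrier R \<and> s \<in> carrier R \<and> us \<in> lists (carrier V) \<and>
      vs \<in> lists (carrier V) \<and> v \<in> carrier V \<and> v' \<in> carrier V}"

lemma relatorsI: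
  "(a, b, c) \<in> T \<Longrightarrow> frag_of a - frag_of b - frag_of c \<in> relators T U"
  "(a, b) \<in> U \<Longrightarrow> frag_of a - frag_of b \<in> relators T U"
  unfolding relators_def by blast+

lemma word_TI:
  "r \<in> carrier R \<Longrightarrow> s \<in> carrier R \<Longrightarrow> vs \<in> lists (carrier V) \<Longrightarrow>
    ((r \<oplus>\<^bsub>R\<^esub> s, vs), (r, vs), (s, vs)) \<in> word_T R V"
  "r \<in> carrier R \<Longrightarrow> us \<in> lists (carrier V) \<Longrightarrow> vs \<in> lists (carrier V) \<Longrightarrow>
    v \<in> carrier V \<Longrightarrow> v' \<in> carrier V \<Longrightarrow>
    ((r, us @ [v \<otimes>\<^bsub>V\<^esub> v'] @ vs), (r, us @ [v] @ vs), (r, us @ [v'] @ vs)) \<in> word_T R V"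
  unfolding word_T_def by blast+

lemma word_UI:
  "r \<in> carrier R \<Longrightarrow> s \<in> carrier R \<Longrightarrow> v \<in> carrier V \<Longrightarrow> vs \<in> lists (carrier V) \<Longrightarrow>
    ((r \<otimes>\<^bsub>R\<^esub> s, v # vs), (r, (s \<rhd>\<^bsub>V\<^esub> v) # vs)) \<in> word_U R V"
  "r \<in> carrier R \<Longrightarrow> s \<in> carrier R \<Longrightarrow> us \<in> lists (carrier V) \<Longrightarrow> vs \<in> lists (carrier V) \<Longrightarrow>
    v \<in> carrier V \<Longrightarrow> v' \<in> carrier V \<Longrightarrow>
    ((r, us @ [v \<lhd>\<^bsub>V\<^esub> s, v'] @ vs), (r, us @ [v, s \<rhd>\<^bsub>V\<^esub> v'] @ vs)) \<in> word_U R V"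
  unfolding word_U_def by blast+

lemma tensor_word_relI:
  "r \<in> carrier R \<Longrightarrow> s \<in> carrier R \<Longrightarrow> vs \<in> lists (carrier V) \<Longrightarrow>
    frag_of (r \<oplus>\<^bsub>R\<^esub> s, vs) - frag_of (r, vs) - frag_of (s, vs) \<in> tensor_word_rel R V"
  "r \<in> carrier R \<Longrightarrow> us \<in> lists (carrier V) \<Longrightarrow> vs \<in> lists (carrier V) \<Longrightarrow>
    v \<in> carrier V \<Longrightarrow> v' \<in> carrier V \<Longrightarrow>
    frag_of (r, us @ [v \<otimes>\<^bsub>V\<^esub> v'] @ vs) - frag_of (r, us @ [v] @ vs) - frag_of (r, us @ [v'] @ vs)
      \<in> tensor_word_rel R V"
  "r \<in> carrier R \<Longrightarrow> s \<in> carrier R \<Longrightarrow> v \<in> carrier V \<Longrightarrow> vs \<in> lists (carrier V) \<Longrightarrow>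
    frag_of (r \<otimes>\<^bsub>R\<^esub> s, v # vs) - frag_of (r, (s \<rhd>\<^bsub>V\<^esub> v) # vs) \<in> tensor_word_rel R V"
  "r \<in> carrier R \<Longrightarrow> s \<in> carrier R \<Longrightarrow> us \<in> lists (carrier V) \<Longrightarrow> vs \<in> lists (carrier V) \<Longrightarrow>
    v \<in> carrier V \<Longrightarrow> v' \<in> carrier V \<Longrightarrow>
    frag_of (r, us @ [v \<lhd>\<^bsub>V\<^esub> s, v'] @ vs) - frag_of (r, us @ [v, s \<rhd>\<^bsub>V\<^esub> v'] @ vs)
      \<in> tensor_word_rel R V"
  unfolding tensor_word_rel_def by blast+

lemma tensor_word_rel_relators: "tensor_word_rel R V = relators (word_T R V) (word_U R V)"
proof (intro subset_antisym subsetI)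
  fix x assume x: "x \<in> tensor_word_rel R V"
  show "x \<in> relators (word_T R V) (word_U R V)"
    using x[unfolded tensor_word_rel_def]
    by (elim UnE CollectE exE conjE)
      (simp_all only: relatorsI(1)[OF word_TI(1)] relatorsI(1)[OF word_TI(2)]
        relatorsI(2)[OF word_UI(1)] relatorsI(2)[OF word_UI(2)])
next
  fix x assume x: "x \<in> relators (word_T R V) (word_U R V)"
  show "x \<in> tensor_word_rel R V"
    using x[unfolded relators_def word_T_def word_U_def]
    by (elim UnE CollectE exE conjE; unfold prod.inject; elim conjE)
      (simp_all only: tensor_word_relI)
qed

lemma compat_wordI:
  assumes "\<And>r s vs. r \<in> carrier R \<Longrightarrow> s \<in> carrier R \<Longrightarrow> vs \<in> lists (carrier V) \<Longrightarrow>
      f (r \<oplus>\<^bsub>R\<^esub> s, vs) = f (r, vs) \<otimes>\<^bsub>G\<^esub> f (s, vs)"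
    and "\<And>r us v v' vs. r \<in> carrier R \<Longrightarrow> us \<in> lists (carrier V) \<Longrightarrow> vs \<in> lists (carrier V) \<Longrightarrow>
      v \<in> carrier V \<Longrightarrow> v' \<in> carrier V \<Longrightarrow>
      f (r, us @ [v \<otimes>\<^bsub>V\<^esub> v'] @ vs) = f (r, us @ [v] @ vs) \<otimes>\<^bsub>G\<^esub> f (r, us @ [v'] @ vs)"
    and "\<And>r s v vs. r \<in> carrier R \<Longrightarrow> s \<in> carrier R \<Longrightarrow> v \<in> carrier V \<Longrightarrow> vs \<in> lists (carrier V) \<Longrightarrow>
      f (r \<otimes>\<^bsub>R\<^esub> s, v # vs) = f (r, (s \<rhd>\<^bsub>V\<^esub> v) # vs)"
    and "\<And>r us v s v' vs. r \<in> carrier R \<Longrightarrow> s \<in> carrier R \<Longrightarrow> us \<in> lists (carrier V) \<Longrightarrow>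
      vs \<in> lists (carrier V) \<Longrightarrow> v \<in> carrier V \<Longrightarrow> v' \<in> carrier V \<Longrightarrow>
      f (r, us @ [v \<lhd>\<^bsub>V\<^esub> s, v'] @ vs) = f (r, us @ [v, s \<rhd>\<^bsub>V\<^esub> v'] @ vs)"
  shows "compat (word_T R V) (word_U R V) G f"
proof -
  have "f a = f b \<otimes>\<^bsub>G\<^esub> f c" if "(a, b, c) \<in> word_T R V" for a b c
    using that assms(1,2) unfolding word_T_def by blast
  moreover have "f a = f b" if "(a, b) \<in> word_U R V" for a b
    using that assms(3,4) unfolding word_U_def by blast
  ultimately show ?thesis unfolding compat_def by blast
qed

lemma compatD:
  assumes "compat T U G f"
  shows "(a, b, c) \<in> T \<Longrightarrow> f a = f b \<otimes>\<^bsub>G\<^esub> f c" "(a, b) \<in> U \<Longrightarrow> f a = f b"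
  using assms unfolding compat_def by blast+

lemma compat_wordD:
  assumes "compat (word_T R V) (word_U R V) G f"
  shows "\<And>r s vs. r \<in> carrier R \<Longrightarrow> s \<in> carrier R \<Longrightarrow> vs \<in> lists (carrier V) \<Longrightarrow>
      f (r \<oplus>\<^bsub>R\<^esub> s, vs) = f (r, vs) \<otimes>\<^bsub>G\<^esub> f (s, vs)"
    and "\<And>r us v v' vs. r \<in> carrier R \<Longrightarrow> us \<in> lists (carrier V) \<Longrightarrow> vs \<in> lists (carrier V) \<Longrightarrow>
      v \<in> carrier V \<Longrightarrow> v' \<in> carrier V \<Longrightarrow>
      f (r, us @ [v \<otimes>\<^bsub>V\<^esub> v'] @ vs) = f (r, us @ [v] @ vs) \<otimes>\<^bsub>G\<^esub> f (r, us @ [v'] @ vs)"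
    and "\<And>r s v vs. r \<in> carrier R \<Longrightarrow> s \<in> carrier R \<Longrightarrow> v \<in> carrier V \<Longrightarrow> vs \<in> lists (carrier V) \<Longrightarrow>
      f (r \<otimes>\<^bsub>R\<^esub> s, v # vs) = f (r, (s \<rhd>\<^bsub>V\<^esub> v) # vs)"
    and "\<And>r us v s v' vs. r \<in> carrier R \<Longrightarrow> s \<in> carrier R \<Longrightarrow> us \<in> lists (carrier V) \<Longrightarrow>
      vs \<in> lists (carrier V) \<Longrightarrow> v \<in> carrier V \<Longrightarrow> v' \<in> carrier V \<Longrightarrow>
      f (r, us @ [v \<lhd>\<^bsub>V\<^esub> s, v'] @ vs) = f (r, us @ [v, s \<rhd>\<^bsub>V\<^esub> v'] @ vs)"
  by (rule compatD[OF assms], rule word_TI word_UI; assumption)+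

lemma word_mult_simps:
  "word_mult R V (r, []) (s, vs) = (r \<otimes>\<^bsub>R\<^esub> s, vs)"
  "word_mult R V (r, us @ [u]) (s, vs) = (r, us @ [u \<lhd>\<^bsub>V\<^esub> s] @ vs)"
  "word_mult R V (r, us @ [u, u']) (s, vs) = (r, us @ [u, u' \<lhd>\<^bsub>V\<^esub> s] @ vs)"
  "word_mult R V (r, [u]) (s, vs) = (r, [u \<lhd>\<^bsub>V\<^esub> s] @ vs)"
  by (simp_all add: word_mult_def butlast_append)

context bimodule
begin

interpretation R: ring R by (rule ring)
interpretation V: comm_group M by (rule group)

abbreviation "WS \<equiv> tensor_words R M"
abbreviation "WT \<equiv> word_T R M"
abbreviation "WU \<equiv> word_U R M"
abbreviation "TA \<equiv> tensor_algebra R M"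
abbreviation "word \<equiv> tensor_word R M"

lemma word_presentation: "presentation WS WT WU"
proof
  show "WT \<subseteq> WS \<times> WS \<times> WS"
    unfolding word_T_def tensor_words_def by auto
  show "WU \<subseteq> WS \<times> WS"
    unfolding word_U_def tensor_words_def by (auto simp: lact_closed ract_closed)
qed

interpretation W: presentation WS WT WU by (rule word_presentation)

lemma word_eq: "word = W.gen"
  by (simp add: tensor_word_def tensor_word_rel_relators fun_eq_iff)

lemma word_mult_closed: "p \<in> WS \<Longrightarrow> q \<in> WS \<Longrightarrow> word_mult R M p q \<in> WS"
  by (cases p; cases q; cases "snd p" rule: rev_cases)
    (auto simp: tensor_words_def word_mult_simps ract_closed)

text \<open>The coefficient of a word is absorbed by the last letter before it, or by the
  coefficient before it if there is no letter. Thus the law depends only on which of the first two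
  words are empty, and rests on associativity in \<open>R\<close> or on
  \<open>ract_mult\<close>.\<close>

lemma word_mult_assoc:
  assumes "p \<in> WS" "q \<in> WS" "t \<in> WS"
  shows "word_mult R M (word_mult R M p q) t = word_mult R M p (word_mult R M q t)"
proof -
  obtain r us where p: "p = (r, us)" by (cases p)
  obtain s vs where q: "q = (s, vs)" by (cases q)
  obtain s' ws where t: "t = (s', ws)" by (cases t)
  show ?thesis
  proof (cases us rule: rev_cases)
    case Nil
    then show ?thesis using assms unfolding p q t
      by (cases vs rule: rev_cases) (auto simp: word_mult_simps tensor_words_def R.m_assoc)
  next
    case (snoc us' u)
    show ?thesis
    proof (cases vs rule: rev_cases)
      case Nil
      then show ?thesis using assms snoc unfolding p q t
        by (auto simp: word_mult_simps tensor_words_def ract_mult)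
    next
      case vs: (snoc vs' v)
      \<comment> \<open>The list is regrouped so as to expose its last letter, the one that absorbs
        the coefficient \<open>s'\<close>.\<close>
      have "word_mult R M (r, (us' @ [u \<lhd>\<^bsub>M\<^esub> s] @ vs') @ [v]) (s', ws) =
          (r, (us' @ [u \<lhd>\<^bsub>M\<^esub> s] @ vs') @ [v \<lhd>\<^bsub>M\<^esub> s'] @ ws)"
        by (rule word_mult_simps)
      then show ?thesis using snoc vs unfolding p q t by (simp add: word_mult_simps)
    qed
  qed
qed

lemma word_compat: "compat WT WU W.P word"
  using W.gen_compat unfolding word_eq .

text \<open>If the prefix ends in a letter, the coefficient of \<open>q\<close> turns into a right
  action on that letter. Relators about coefficients then become relators about letters: additivity
  of the coefficient becomes additivity in a letter, and balancing at the leading coefficient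
  becomes balancing between adjacent letters.\<close>

lemma word_mult_left_compat:
  assumes p: "p \<in> WS" shows "compat WT WU W.P (\<lambda>q. word (word_mult R M p q))"
proof -
  note w = compat_wordD[OF word_compat]
  obtain r us where p': "p = (r, us)" by (cases p)
  have r: "r \<in> carrier R" and us: "us \<in> lists (carrier M)" using p p' by (auto simp: tensor_words_def)
  show ?thesis
  proof (cases us rule: rev_cases)
    case Nil
    show ?thesis unfolding p' Nil
      by (rule compat_wordI)
        (use r w in \<open>simp_all only: word_mult_simps R.r_distr R.m_closed R.m_assoc[symmetric]\<close>)
  next
    case (snoc us' u)
    have u: "u \<in> carrier M" "us' \<in> lists (carrier M)" using us snoc by auto
    show ?thesis unfolding p' snoc
    proof (rule compat_wordI; unfold word_mult_simps)
      fix s s' vs assume *: "s \<in> carrier R" "s' \<in> carrier R" "vs \<in> lists (carrier M)"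
      show "word (r, us' @ [u \<lhd>\<^bsub>M\<^esub> (s \<oplus>\<^bsub>R\<^esub> s')] @ vs) =
          word (r, us' @ [u \<lhd>\<^bsub>M\<^esub> s] @ vs) \<otimes>\<^bsub>W.P\<^esub> word (r, us' @ [u \<lhd>\<^bsub>M\<^esub> s'] @ vs)"
        using w(2)[of r us' vs "u \<lhd>\<^bsub>M\<^esub> s" "u \<lhd>\<^bsub>M\<^esub> s'"] * u r by (simp add: ract_add_right ract_closed)
    next
      fix s ws v v' vs assume *: "s \<in> carrier R" "ws \<in> lists (carrier M)" "vs \<in> lists (carrier M)"
        "v \<in> carrier M" "v' \<in> carrier M"
      show "word (r, us' @ [u \<lhd>\<^bsub>M\<^esub> s] @ ws @ [v \<otimes>\<^bsub>M\<^esub> v'] @ vs) =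
          word (r, us' @ [u \<lhd>\<^bsub>M\<^esub> s] @ ws @ [v] @ vs) \<otimes>\<^bsub>W.P\<^esub> word (r, us' @ [u \<lhd>\<^bsub>M\<^esub> s] @ ws @ [v'] @ vs)"
        using w(2)[of r "us' @ [u \<lhd>\<^bsub>M\<^esub> s] @ ws" vs v v'] * u r by (simp add: ract_closed)
    next
      fix s s' v vs assume *: "s \<in> carrier R" "s' \<in> carrier R" "v \<in> carrier M" "vs \<in> lists (carrier M)"
      show "word (r, us' @ [u \<lhd>\<^bsub>M\<^esub> (s \<otimes>\<^bsub>R\<^esub> s')] @ v # vs) = word (r, us' @ [u \<lhd>\<^bsub>M\<^esub> s] @ (s' \<rhd>\<^bsub>M\<^esub> v) # vs)"
        using w(4)[of r s' us' vs "u \<lhd>\<^bsub>M\<^esub> s" v] * u r by (simp add: ract_closed ract_mult)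
    next
      fix s ws v s' v' vs assume *: "s \<in> carrier R" "s' \<in> carrier R" "ws \<in> lists (carrier M)"
        "vs \<in> lists (carrier M)" "v \<in> carrier M" "v' \<in> carrier M"
      show "word (r, us' @ [u \<lhd>\<^bsub>M\<^esub> s] @ ws @ [v \<lhd>\<^bsub>M\<^esub> s', v'] @ vs) =
          word (r, us' @ [u \<lhd>\<^bsub>M\<^esub> s] @ ws @ [v, s' \<rhd>\<^bsub>M\<^esub> v'] @ vs)"
        using w(4)[of r s' "us' @ [u \<lhd>\<^bsub>M\<^esub> s] @ ws" vs v v'] * u r by (simp add: ract_closed)
    qed
  qed
qed

text \<open>Appending a word alters the last letter, or the coefficient if there is none, so every
  relator is carried to one of the same kind. The case distinctions ask whether the letter that the
  relator concerns is the one altered.\<close>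

lemma word_mult_right_compat:
  assumes p: "p \<in> WS" shows "compat WT WU W.P (\<lambda>q. word (word_mult R M q p))"
proof -
  note w = compat_wordD[OF word_compat]
  obtain t ws where p': "p = (t, ws)" by (cases p)
  have t: "t \<in> carrier R" and ws: "ws \<in> lists (carrier M)" using p p' by (auto simp: tensor_words_def)
  show ?thesis unfolding p'
  proof (rule compat_wordI)
    fix r s vs assume *: "r \<in> carrier R" "s \<in> carrier R" "vs \<in> lists (carrier M)"
    show "word (word_mult R M (r \<oplus>\<^bsub>R\<^esub> s, vs) (t, ws)) =
        word (word_mult R M (r, vs) (t, ws)) \<otimes>\<^bsub>W.P\<^esub> word (word_mult R M (s, vs) (t, ws))"
    proof (cases vs rule: rev_cases)
      case Nil
      then show ?thesis using w(1)[of "r \<otimes>\<^bsub>R\<^esub> t" "s \<otimes>\<^bsub>R\<^esub> t" ws] * t ws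
        by (simp add: word_mult_simps R.l_distr)
    next
      case (snoc vs' v)
      then show ?thesis using w(1)[of r s "vs' @ [v \<lhd>\<^bsub>M\<^esub> t] @ ws"] * t ws
        by (simp add: word_mult_simps ract_closed)
    qed
  next
    fix r us v v' vs assume *: "r \<in> carrier R" "us \<in> lists (carrier M)" "vs \<in> lists (carrier M)"
        "v \<in> carrier M" "v' \<in> carrier M"
    show "word (word_mult R M (r, us @ [v \<otimes>\<^bsub>M\<^esub> v'] @ vs) (t, ws)) =
        word (word_mult R M (r, us @ [v] @ vs) (t, ws)) \<otimes>\<^bsub>W.P\<^esub> word (word_mult R M (r, us @ [v'] @ vs) (t, ws))"
    proof (cases vs rule: rev_cases)
      case Nil
      then show ?thesis using w(2)[of r us ws "v \<lhd>\<^bsub>M\<^esub> t" "v' \<lhd>\<^bsub>M\<^esub> t"] * t ws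
        by (simp add: word_mult_simps ract_add_left ract_closed)
    next
      case (snoc vs' z)
      have eq: "word_mult R M (r, us @ [x] @ vs' @ [z]) (t, ws) = (r, us @ [x] @ vs' @ [z \<lhd>\<^bsub>M\<^esub> t] @ ws)" for x
        using word_mult_simps(2)[of R M r "us @ [x] @ vs'" z t ws] by simp
      show ?thesis unfolding snoc eq
        by (rule w(2)) (use * t ws snoc in \<open>auto simp: ract_closed\<close>)
    qed
  next
    fix r s v vs assume *: "r \<in> carrier R" "s \<in> carrier R" "v \<in> carrier M" "vs \<in> lists (carrier M)"
    show "word (word_mult R M (r \<otimes>\<^bsub>R\<^esub> s, v # vs) (t, ws)) = word (word_mult R M (r, (s \<rhd>\<^bsub>M\<^esub> v) # vs) (t, ws))"
    proof (cases vs rule: rev_cases)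
      case Nil
      then show ?thesis using w(3)[of r s "v \<lhd>\<^bsub>M\<^esub> t" ws] * t ws
        by (simp add: word_mult_simps lact_ract ract_closed)
    next
      case (snoc vs' z)
      have eq: "word_mult R M (r, x # vs' @ [z]) (t, ws) = (r, x # vs' @ [z \<lhd>\<^bsub>M\<^esub> t] @ ws)" for r x
        using word_mult_simps(2)[of R M r "x # vs'" z t ws] by simp
      show ?thesis unfolding snoc eq
        by (rule w(3)) (use * t ws snoc in \<open>auto simp: ract_closed\<close>)
    qed
  next
    fix r us v s v' vs assume *: "r \<in> carrier R" "s \<in> carrier R" "us \<in> lists (carrier M)"
        "vs \<in> lists (carrier M)" "v \<in> carrier M" "v' \<in> carrier M"
    show "word (word_mult R M (r, us @ [v \<lhd>\<^bsub>M\<^esub> s, v'] @ vs) (t, ws)) =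
        word (word_mult R M (r, us @ [v, s \<rhd>\<^bsub>M\<^esub> v'] @ vs) (t, ws))"
    proof (cases vs rule: rev_cases)
      case Nil
      then show ?thesis using w(4)[of r s us ws v "v' \<lhd>\<^bsub>M\<^esub> t"] * t ws
        by (simp add: word_mult_simps lact_ract ract_closed)
    next
      case (snoc vs' z)
      have eq: "word_mult R M (r, us @ [x, y] @ vs' @ [z]) (t, ws) = (r, us @ [x, y] @ vs' @ [z \<lhd>\<^bsub>M\<^esub> t] @ ws)" for x y
        using word_mult_simps(2)[of R M r "us @ [x, y] @ vs'" z t ws] by simp
      show ?thesis unfolding snoc eq
        by (rule w(4)) (use * t ws snoc in \<open>auto simp: ract_closed\<close>)
    qed
  qed
qed

lemma tensor_algebra_presentation: "ring_presentation WS WT WU (word_mult R M) (\<one>\<^bsub>R\<^esub>, [])"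
proof (intro ring_presentation.intro ring_presentation_axioms.intro word_presentation)
  show "(\<one>\<^bsub>R\<^esub>, []) \<in> WS" by (simp add: tensor_words_def)
  fix p assume p: "p \<in> WS"
  show "word_mult R M (\<one>\<^bsub>R\<^esub>, []) p = p"
    using p by (cases p) (auto simp: word_mult_simps tensor_words_def)
  show "word_mult R M p (\<one>\<^bsub>R\<^esub>, []) = p"
    using p by (cases p; cases "snd p" rule: rev_cases) (auto simp: word_mult_simps tensor_words_def ract_one)
qed (use word_mult_closed word_mult_assoc word_mult_left_compat word_mult_right_compat
    in \<open>auto simp: word_eq\<close>)

sublocale TA: ring_presentation WS WT WU "word_mult R M" "(\<one>\<^bsub>R\<^esub>, [])"
  by (rule tensor_algebra_presentation)

lemma TA_eq_PR: "TA = TA.PR"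
  unfolding tensor_algebra_def TA.PR_def Let_def tensor_word_def tensor_word_rel_relators ..

lemma TA_ring: "ring TA"
  unfolding TA_eq_PR by (rule TA.PR_ring)

lemma word_closed: "r \<in> carrier R \<Longrightarrow> vs \<in> lists (carrier M) \<Longrightarrow> word (r, vs) \<in> carrier TA"
  unfolding TA_eq_PR word_eq TA.PR_simps by (rule W.gen_closed) (simp add: tensor_words_def)

lemma word_mult:
  "r \<in> carrier R \<Longrightarrow> us \<in> lists (carrier M) \<Longrightarrow> s \<in> carrier R \<Longrightarrow> vs \<in> lists (carrier M) \<Longrightarrow>
    word (r, us) \<otimes>\<^bsub>TA\<^esub> word (s, vs) = word (word_mult R M (r, us) (s, vs))"
  unfolding TA_eq_PR word_eq by (rule TA.PR_gen_mult) (simp_all add: tensor_words_def)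

lemma word_one: "\<one>\<^bsub>TA\<^esub> = word (\<one>\<^bsub>R\<^esub>, [])"
  unfolding TA_eq_PR word_eq TA.PR_simps ..

lemma word_scalar_ring_hom: "(\<lambda>r. word (r, [])) \<in> ring_hom R TA"
proof (rule ring_hom_memI)
  show "word (r \<oplus>\<^bsub>R\<^esub> s, []) = word (r, []) \<oplus>\<^bsub>TA\<^esub> word (s, [])" if "r \<in> carrier R" "s \<in> carrier R" for r s
    using compat_wordD(1)[OF word_compat, of r s "[]"] that unfolding TA_eq_PR TA.PR_simps by simp
qed (auto simp: word_closed word_mult word_mult_simps word_one)

lemma word_vector_hom: "(\<lambda>v. word (\<one>\<^bsub>R\<^esub>, [v])) \<in> hom M (add_monoid TA)"
proof (rule homI)
  show "word (\<one>\<^bsub>R\<^esub>, [v \<otimes>\<^bsub>M\<^esub> v']) = word (\<one>\<^bsub>R\<^esub>, [v]) \<otimes>\<^bsub>add_monoid TA\<^esub> word (\<one>\<^bsub>R\<^esub>, [v'])"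
    if "v \<in> carrier M" "v' \<in> carrier M" for v v'
    using compat_wordD(2)[OF word_compat, of "\<one>\<^bsub>R\<^esub>" "[]" "[]" v v'] that
    unfolding TA_eq_PR by (simp add: TA.PR_simps)
qed (simp add: word_closed)

lemma word_lact: "r \<in> carrier R \<Longrightarrow> v \<in> carrier M \<Longrightarrow>
    word (r, []) \<otimes>\<^bsub>TA\<^esub> word (\<one>\<^bsub>R\<^esub>, [v]) = word (\<one>\<^bsub>R\<^esub>, [r \<rhd>\<^bsub>M\<^esub> v])"
  using compat_wordD(3)[OF word_compat, of "\<one>\<^bsub>R\<^esub>" r v "[]"] by (simp add: word_mult word_mult_simps)

lemma word_ract: "r \<in> carrier R \<Longrightarrow> v \<in> carrier M \<Longrightarrow>
    word (\<one>\<^bsub>R\<^esub>, [v]) \<otimes>\<^bsub>TA\<^esub> word (r, []) = word (\<one>\<^bsub>R\<^esub>, [v \<lhd>\<^bsub>M\<^esub> r])"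
  by (simp add: word_mult word_mult_simps)

text \<open>A word is the product of its coefficient and its letters, so the elements of degree zero
  and one generate the tensor algebra as a ring.\<close>

lemma TA_induct [consumes 1, case_names scalar vector add neg mult]:
  assumes t: "t \<in> carrier TA"
    and scalar: "\<And>r. r \<in> carrier R \<Longrightarrow> Q (word (r, []))"
    and vector: "\<And>v. v \<in> carrier M \<Longrightarrow> Q (word (\<one>\<^bsub>R\<^esub>, [v]))"
    and add: "\<And>x y. x \<in> carrier TA \<Longrightarrow> y \<in> carrier TA \<Longrightarrow> Q x \<Longrightarrow> Q y \<Longrightarrow> Q (x \<oplus>\<^bsub>TA\<^esub> y)"
    and neg: "\<And>x. x \<in> carrier TA \<Longrightarrow> Q x \<Longrightarrow> Q (\<ominus>\<^bsub>TA\<^esub> x)"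
    and mult: "\<And>x y. x \<in> carrier TA \<Longrightarrow> y \<in> carrier TA \<Longrightarrow> Q x \<Longrightarrow> Q y \<Longrightarrow> Q (x \<otimes>\<^bsub>TA\<^esub> y)"
  shows "Q t"
proof -
  have word: "Q (word (r, vs))" if "r \<in> carrier R" "vs \<in> lists (carrier M)" for r vs
    using that(2)
  proof (induction vs rule: rev_induct)
    case Nil
    then show ?case using scalar that by simp
  next
    case (snoc v vs)
    then have "word (r, vs @ [v]) = word (r, vs) \<otimes>\<^bsub>TA\<^esub> word (\<one>\<^bsub>R\<^esub>, [v])"
      using that(1)
      by (cases vs rule: rev_cases) (auto simp: word_mult word_mult_simps ract_one)
    then show ?case using snoc that(1) by (auto intro!: mult vector word_closed)
  qed
  show ?thesis
    using t unfolding TA_eq_PR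
  proof (induction t rule: TA.PR_induct)
    case (gen s)
    then show ?case using word[of "fst s" "snd s"] unfolding tensor_words_def word_eq
      by (metis mem_Times_iff prod.collapse)
  qed (use add neg in \<open>simp_all add: TA_eq_PR\<close>)
qed

text \<open>A word goes to the value of its coefficient times the product of the values of its
  letters. The assumptions \<open>lact\<close> and \<open>ract\<close> are what the balancing
  relators require, both at the coefficient and between adjacent letters.\<close>

lemma TA_ring_hom:
  assumes Q: "ring Q" and f: "f \<in> ring_hom R Q" and g: "g \<in> hom M (add_monoid Q)"
    and lact: "\<And>r v. r \<in> carrier R \<Longrightarrow> v \<in> carrier M \<Longrightarrow> g (r \<rhd>\<^bsub>M\<^esub> v) = f r \<otimes>\<^bsub>Q\<^esub> g v"
    and ract: "\<And>r v. r \<in> carrier R \<Longrightarrow> v \<in> carrier M \<Longrightarrow> g (v \<lhd>\<^bsub>M\<^esub> r) = g v \<otimes>\<^bsub>Q\<^esub> f r"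
  shows "\<exists>\<Phi>\<in>ring_hom TA Q. (\<forall>r\<in>carrier R. \<Phi> (word (r, [])) = f r) \<and>
    (\<forall>v\<in>carrier M. \<Phi> (word (\<one>\<^bsub>R\<^esub>, [v])) = g v)"
proof -
  interpret Q: ring Q by fact
  define pr where "pr vs = foldr (\<lambda>v q. g v \<otimes>\<^bsub>Q\<^esub> q) vs \<one>\<^bsub>Q\<^esub>" for vs
  define val where "val p = f (fst p) \<otimes>\<^bsub>Q\<^esub> pr (snd p)" for p
  have [simp]: "f r \<in> carrier Q" if "r \<in> carrier R" for r using ring_hom_closed[OF f that] .
  have [simp]: "g v \<in> carrier Q" if "v \<in> carrier M" for v using hom_in_carrier[OF g that] by simp
  have gadd: "g (v \<otimes>\<^bsub>M\<^esub> v') = g v \<oplus>\<^bsub>Q\<^esub> g v'" if "v \<in> carrier M" "v' \<in> carrier M" for v v'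
    using hom_mult[OF g that] by simp
  have [simp]: "pr [] = \<one>\<^bsub>Q\<^esub>" "pr (v # vs) = g v \<otimes>\<^bsub>Q\<^esub> pr vs" for v vs by (simp_all add: pr_def)
  have prc [simp]: "vs \<in> lists (carrier M) \<Longrightarrow> pr vs \<in> carrier Q" for vs by (induction vs) auto
  note [simp] = prc [unfolded in_lists_conv_set]
  have pra: "us \<in> lists (carrier M) \<Longrightarrow> vs \<in> lists (carrier M) \<Longrightarrow> pr (us @ vs) = pr us \<otimes>\<^bsub>Q\<^esub> pr vs" for us vs
    by (induction us) (auto simp: Q.m_assoc)
  have co: "compat WT WU (add_monoid Q) val"
    by (rule compat_wordI)
      (auto simp: val_def pra ring_hom_add[OF f] ring_hom_mult[OF f] gadd lact ract Q.l_distr Q.r_distr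
        Q.m_assoc lact_closed ract_closed)
  have cl: "val \<in> WS \<rightarrow> carrier Q" by (auto simp: val_def tensor_words_def)
  have mul: "val (word_mult R M p q) = val p \<otimes>\<^bsub>Q\<^esub> val q" if "p \<in> WS" "q \<in> WS" for p q
    using that
    by (cases p; cases q; cases "snd p" rule: rev_cases)
      (auto simp: word_mult_simps val_def tensor_words_def ring_hom_mult[OF f] pra ract Q.m_assoc ract_closed)
  let ?\<Phi> = "lift WS (relators WT WU) (add_monoid Q) val"
  have val: "?\<Phi> (word p) = val p" if "p \<in> WS" for p
    unfolding word_eq using cl that by (subst W.lift_gen[OF Q.a_comm_group _ co]) auto
  have "?\<Phi> \<in> ring_hom TA Q" unfolding TA_eq_PR
    by (rule TA.lift_ring_hom[OF Q cl co mul]) (auto simp: val_def ring_hom_one[OF f])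
  moreover have "?\<Phi> (word (r, [])) = f r" if "r \<in> carrier R" for r
    using that by (subst val) (auto simp: tensor_words_def val_def)
  moreover have "?\<Phi> (word (\<one>\<^bsub>R\<^esub>, [v])) = g v" if "v \<in> carrier M" for v
    using that by (subst val) (auto simp: tensor_words_def val_def ring_hom_one[OF f])
  ultimately show ?thesis by blast
qed

end

section \<open>Bimodules over the enveloping algebra\<close>

lemma (in assoc_algebra) env_hom_eqI:
  assumes "f \<in> hom (add_monoid (env K A)) G" "g \<in> hom (add_monoid (env K A)) G" "comm_group G"
    and "\<And>a b. a \<in> carrier A \<Longrightarrow> b \<in> carrier A \<Longrightarrow> f (env_elt K A a b) = g (env_elt K A a b)"
    and "e \<in> carrier (env K A)"
  shows "f e = g e"
proof (rule tensor_hom_eqI[OF A1 A2 _ _ assms(3)])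
  show "f \<in> hom (A1 \<boxtimes>\<^bsub>K\<^esub> A2) G" "g \<in> hom (A1 \<boxtimes>\<^bsub>K\<^esub> A2) G"
    using assms(1,2) unfolding hom_tensor env_group_def[symmetric] hom_env_group .
  show "e \<in> carrier (A1 \<boxtimes>\<^bsub>K\<^esub> A2)"
    using assms(5) unfolding tensor_group_simps env_group_def[symmetric] carrier_env .
qed (use assms(4) in \<open>simp add: env_elt_def scalars_simps regular_simps opp_simps\<close>)

section \<open>The tensor product of two bimodules over the field, as a bimodule over the enveloping
  algebra\<close>

locale algebra_bimodule_pair = assoc_algebra K A + P: algebra_bimodule K A P + Q: algebra_bimodule K A Q
  for K :: "('k, 'kx) ring_scheme" and A :: "('k, 'a, 'ax) module_scheme" (structure)
    and P :: "('a, 'p) bimod" and Q :: "('a, 'q) bimod"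
begin

interpretation A: ring A by (rule ring)

abbreviation "sP \<equiv> scalars A P"
abbreviation "sQ \<equiv> scalars A Q"
abbreviation "EB \<equiv> env_bimod K A P Q"
abbreviation "\<kappa> \<equiv> kelt K A P Q"
abbreviation "G \<equiv> tensor_group K sP sQ"

lemma sP: "bimodule K sP" and sQ: "bimodule K sQ"
  by (rule scalars_bimodule[OF P.bimodule_axioms], rule scalars_bimodule[OF Q.bimodule_axioms])

lemma EB_simps: "carrier EB = carrier G" "x \<otimes>\<^bsub>EB\<^esub> y = x \<otimes>\<^bsub>G\<^esub> y" "\<one>\<^bsub>EB\<^esub> = \<one>\<^bsub>G\<^esub>"
  by (simp_all add: env_bimod_def Let_def)

lemma hom_EB: "hom EB L = hom G L" "hom L EB = hom L G"
  by (simp_all add: hom_def EB_simps)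

lemma G_group: "comm_group G" by (rule tensor_group_comm_group[OF sP sQ])

lemma EB_group: "comm_group EB"
  by (rule comm_group_transfer[OF G_group]) (simp_all add: EB_simps)

lemma kelt_closed: "p \<in> carrier P \<Longrightarrow> q \<in> carrier Q \<Longrightarrow> \<kappa> p q \<in> carrier EB"
  using elt_closed[OF sP sQ] by (simp add: EB_simps tensor_group_simps kelt_def scalars_simps)

lemma kelt_hom_right: "p \<in> carrier P \<Longrightarrow> \<kappa> p \<in> hom Q EB"
  using elt_hom_right[OF sP sQ, of p]
  by (simp add: hom_EB hom_tensor kelt_def[abs_def] scalars_simps hom_scalars)

lemma kelt_hom_left: "q \<in> carrier Q \<Longrightarrow> (\<lambda>p. \<kappa> p q) \<in> hom P EB"
  using elt_hom_left[OF sP sQ, of q]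
  by (simp add: hom_EB hom_tensor kelt_def[abs_def] scalars_simps hom_scalars)

lemma kelt_balance:
  "p \<in> carrier P \<Longrightarrow> c \<in> carrier K \<Longrightarrow> q \<in> carrier Q \<Longrightarrow>
    \<kappa> (p \<lhd>\<^bsub>P\<^esub> (c \<odot> \<one>)) q = \<kappa> p ((c \<odot> \<one>) \<rhd>\<^bsub>Q\<^esub> q)"
  using elt_balance[OF sP sQ, of p c q] by (simp add: kelt_def scalars_simps)

lemma kelt_hom_right_G: "p \<in> carrier P \<Longrightarrow> (\<lambda>q. \<kappa> p q) \<in> hom Q G"
  using kelt_hom_right[of p] by (simp add: hom_EB)

lemma kelt_hom_left_G: "q \<in> carrier Q \<Longrightarrow> (\<lambda>p. \<kappa> p q) \<in> hom P G"
  using kelt_hom_left[of q] by (simp add: hom_EB)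

lemma EB_hom_eqI:
  assumes "f \<in> hom EB L" "g \<in> hom EB L" "comm_group L"
    and "\<And>p q. p \<in> carrier P \<Longrightarrow> q \<in> carrier Q \<Longrightarrow> f (\<kappa> p q) = g (\<kappa> p q)"
    and "t \<in> carrier EB"
  shows "f t = g t"
proof (rule tensor_hom_eqI[OF sP sQ _ _ assms(3)])
  show "f \<in> hom (sP \<boxtimes>\<^bsub>K\<^esub> sQ) L" "g \<in> hom (sP \<boxtimes>\<^bsub>K\<^esub> sQ) L"
    using assms(1,2) unfolding hom_tensor hom_EB .
  show "t \<in> carrier (sP \<boxtimes>\<^bsub>K\<^esub> sQ)"
    using assms(5) unfolding tensor_group_simps EB_simps .
qed (use assms(4) in \<open>simp add: kelt_def scalars_simps\<close>)

lemma lact_hom_scalar: "p \<in> carrier P \<Longrightarrow> (\<lambda>a. a \<rhd>\<^bsub>P\<^esub> p) \<in> hom A1 P"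
    "q \<in> carrier Q \<Longrightarrow> (\<lambda>a. q \<lhd>\<^bsub>Q\<^esub> a) \<in> hom A2 Q"
    "p \<in> carrier P \<Longrightarrow> (\<lambda>a. p \<lhd>\<^bsub>P\<^esub> a) \<in> hom A1 P"
    "q \<in> carrier Q \<Longrightarrow> (\<lambda>a. a \<rhd>\<^bsub>Q\<^esub> q) \<in> hom A2 Q"
  by (auto intro!: homI simp: scalars_simps regular_simps opp_simps P.lact_closed P.lact_add_left
      P.ract_closed P.ract_add_right Q.lact_closed Q.lact_add_left Q.ract_closed Q.ract_add_right)

lemmas simps = scalars_simps regular_simps opp_simps

text \<open>Balancing in the acting element moves a scalar from the left action on \<open>P\<close>
  to the right action on \<open>Q\<close>, whereas \<open>kelt_balance\<close> moves it from the
  right side of \<open>P\<close> to the left side of \<open>Q\<close>. The property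
  \<open>central\<close> of both bimodules bridges the two.\<close>

lemma left_bilift: "tensor_bilift K A1 A2 K sP sQ G (\<lambda>a a' p q. \<kappa> (a \<rhd>\<^bsub>P\<^esub> p) (q \<lhd>\<^bsub>Q\<^esub> a'))"
proof (intro tensor_bilift.intro tensor_bilift_axioms.intro A1 A2 sP sQ G_group)
  note [simp] = P.lact_closed P.ract_closed Q.lact_closed Q.ract_closed scalar_closed
  fix p q assume "p \<in> carrier sP" "q \<in> carrier sQ"
  then have pq: "p \<in> carrier P" "q \<in> carrier Q" by (simp_all add: simps)
  show "balanced K A1 A2 G (\<lambda>a a'. \<kappa> (a \<rhd>\<^bsub>P\<^esub> p) (q \<lhd>\<^bsub>Q\<^esub> a'))"
  proof (rule balancedI; unfold simps)
    show "(\<lambda>a'. \<kappa> (a \<rhd>\<^bsub>P\<^esub> p) (q \<lhd>\<^bsub>Q\<^esub> a')) \<in> hom A2 G" if "a \<in> carrier A" for a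
      using pq that by (intro hom_comp[OF lact_hom_scalar(2) kelt_hom_right_G]) auto
    show "(\<lambda>a. \<kappa> (a \<rhd>\<^bsub>P\<^esub> p) (q \<lhd>\<^bsub>Q\<^esub> a')) \<in> hom A1 G" if "a' \<in> carrier A" for a'
      using pq that by (intro hom_comp[OF lact_hom_scalar(1) kelt_hom_left_G]) auto
    fix a c a' assume *: "a \<in> carrier A" "c \<in> carrier K" "a' \<in> carrier A"
    have "(a \<otimes> (c \<odot> \<one>)) \<rhd>\<^bsub>P\<^esub> p = (a \<rhd>\<^bsub>P\<^esub> p) \<lhd>\<^bsub>P\<^esub> (c \<odot> \<one>)"
      using * pq by (simp add: P.lact_mult P.central P.lact_ract)
    moreover have "q \<lhd>\<^bsub>Q\<^esub> (a' \<otimes> (c \<odot> \<one>)) = (c \<odot> \<one>) \<rhd>\<^bsub>Q\<^esub> (q \<lhd>\<^bsub>Q\<^esub> a')"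
      using * pq by (simp add: Q.ract_mult Q.central)
    ultimately show "\<kappa> ((a \<otimes> (c \<odot> \<one>)) \<rhd>\<^bsub>P\<^esub> p) (q \<lhd>\<^bsub>Q\<^esub> a') =
        \<kappa> (a \<rhd>\<^bsub>P\<^esub> p) (q \<lhd>\<^bsub>Q\<^esub> (a' \<otimes> (c \<odot> \<one>)))"
      using * pq by (simp add: kelt_balance)
  qed
next
  note [simp] = P.lact_closed P.ract_closed Q.lact_closed Q.ract_closed scalar_closed
  fix a a' assume "a \<in> carrier A1" "a' \<in> carrier A2"
  then have aa: "a \<in> carrier A" "a' \<in> carrier A" by (simp_all add: simps)
  show "balanced K sP sQ G (\<lambda>p q. \<kappa> (a \<rhd>\<^bsub>P\<^esub> p) (q \<lhd>\<^bsub>Q\<^esub> a'))"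
  proof (rule balancedI; unfold simps hom_scalars)
    show "(\<lambda>q. \<kappa> (a \<rhd>\<^bsub>P\<^esub> p) (q \<lhd>\<^bsub>Q\<^esub> a')) \<in> hom Q G" if "p \<in> carrier P" for p
      using aa that by (intro hom_comp[OF bimod_ract_hom[OF Q.bimodule_axioms] kelt_hom_right_G]) auto
    show "(\<lambda>p. \<kappa> (a \<rhd>\<^bsub>P\<^esub> p) (q \<lhd>\<^bsub>Q\<^esub> a')) \<in> hom P G" if "q \<in> carrier Q" for q
      using aa that by (intro hom_comp[OF bimod_lact_hom[OF P.bimodule_axioms] kelt_hom_left_G]) auto
    fix p c q assume *: "p \<in> carrier P" "c \<in> carrier K" "q \<in> carrier Q"
    show "\<kappa> (a \<rhd>\<^bsub>P\<^esub> (p \<lhd>\<^bsub>P\<^esub> (c \<odot> \<one>))) (q \<lhd>\<^bsub>Q\<^esub> a') =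
        \<kappa> (a \<rhd>\<^bsub>P\<^esub> p) (((c \<odot> \<one>) \<rhd>\<^bsub>Q\<^esub> q) \<lhd>\<^bsub>Q\<^esub> a')"
      using * aa kelt_balance[of "a \<rhd>\<^bsub>P\<^esub> p" c "q \<lhd>\<^bsub>Q\<^esub> a'"] by (simp add: P.lact_ract Q.lact_ract)
  qed
qed

lemma right_bilift: "tensor_bilift K A1 A2 K sP sQ G (\<lambda>b b' p q. \<kappa> (p \<lhd>\<^bsub>P\<^esub> b) (b' \<rhd>\<^bsub>Q\<^esub> q))"
proof (intro tensor_bilift.intro tensor_bilift_axioms.intro A1 A2 sP sQ G_group)
  note [simp] = P.lact_closed P.ract_closed Q.lact_closed Q.ract_closed scalar_closed
  fix p q assume "p \<in> carrier sP" "q \<in> carrier sQ"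
  then have pq: "p \<in> carrier P" "q \<in> carrier Q" by (simp_all add: simps)
  show "balanced K A1 A2 G (\<lambda>b b'. \<kappa> (p \<lhd>\<^bsub>P\<^esub> b) (b' \<rhd>\<^bsub>Q\<^esub> q))"
  proof (rule balancedI; unfold simps)
    show "(\<lambda>b'. \<kappa> (p \<lhd>\<^bsub>P\<^esub> b) (b' \<rhd>\<^bsub>Q\<^esub> q)) \<in> hom A2 G" if "b \<in> carrier A" for b
      using pq that by (intro hom_comp[OF lact_hom_scalar(4) kelt_hom_right_G]) auto
    show "(\<lambda>b. \<kappa> (p \<lhd>\<^bsub>P\<^esub> b) (b' \<rhd>\<^bsub>Q\<^esub> q)) \<in> hom A1 G" if "b' \<in> carrier A" for b'
      using pq that by (intro hom_comp[OF lact_hom_scalar(3) kelt_hom_left_G]) auto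
    fix b c b' assume *: "b \<in> carrier A" "c \<in> carrier K" "b' \<in> carrier A"
    show "\<kappa> (p \<lhd>\<^bsub>P\<^esub> (b \<otimes> (c \<odot> \<one>))) (b' \<rhd>\<^bsub>Q\<^esub> q) =
        \<kappa> (p \<lhd>\<^bsub>P\<^esub> b) ((b' \<otimes> (c \<odot> \<one>)) \<rhd>\<^bsub>Q\<^esub> q)"
      using * pq
      by (simp add: kelt_balance P.ract_mult Q.lact_mult[symmetric] scalar_commute del: Q.lact_mult)
  qed
next
  note [simp] = P.lact_closed P.ract_closed Q.lact_closed Q.ract_closed scalar_closed
  fix b b' assume "b \<in> carrier A1" "b' \<in> carrier A2"
  then have bb: "b \<in> carrier A" "b' \<in> carrier A" by (simp_all add: simps)
  show "balanced K sP sQ G (\<lambda>p q. \<kappa> (p \<lhd>\<^bsub>P\<^esub> b) (b' \<rhd>\<^bsub>Q\<^esub> q))"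
  proof (rule balancedI; unfold simps hom_scalars)
    show "(\<lambda>q. \<kappa> (p \<lhd>\<^bsub>P\<^esub> b) (b' \<rhd>\<^bsub>Q\<^esub> q)) \<in> hom Q G" if "p \<in> carrier P" for p
      using bb that by (intro hom_comp[OF bimod_lact_hom[OF Q.bimodule_axioms] kelt_hom_right_G]) auto
    show "(\<lambda>p. \<kappa> (p \<lhd>\<^bsub>P\<^esub> b) (b' \<rhd>\<^bsub>Q\<^esub> q)) \<in> hom P G" if "q \<in> carrier Q" for q
      using bb that by (intro hom_comp[OF bimod_ract_hom[OF P.bimodule_axioms] kelt_hom_left_G]) auto
    fix p c q assume *: "p \<in> carrier P" "c \<in> carrier K" "q \<in> carrier Q"
    have "p \<lhd>\<^bsub>P\<^esub> (c \<odot> \<one>) \<lhd>\<^bsub>P\<^esub> b = p \<lhd>\<^bsub>P\<^esub> b \<lhd>\<^bsub>P\<^esub> (c \<odot> \<one>)"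
      using * bb by (simp add: P.ract_mult[symmetric] scalar_commute)
    moreover have "b' \<rhd>\<^bsub>Q\<^esub> ((c \<odot> \<one>) \<rhd>\<^bsub>Q\<^esub> q) = (c \<odot> \<one>) \<rhd>\<^bsub>Q\<^esub> (b' \<rhd>\<^bsub>Q\<^esub> q)"
      using * bb by (simp add: Q.lact_mult[symmetric] scalar_commute)
    ultimately show "\<kappa> (p \<lhd>\<^bsub>P\<^esub> (c \<odot> \<one>) \<lhd>\<^bsub>P\<^esub> b) (b' \<rhd>\<^bsub>Q\<^esub> q) =
        \<kappa> (p \<lhd>\<^bsub>P\<^esub> b) (b' \<rhd>\<^bsub>Q\<^esub> ((c \<odot> \<one>) \<rhd>\<^bsub>Q\<^esub> q))"
      using * bb by (simp add: kelt_balance)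
  qed
qed

interpretation L: tensor_bilift K A1 A2 K sP sQ G "\<lambda>a a' p q. \<kappa> (a \<rhd>\<^bsub>P\<^esub> p) (q \<lhd>\<^bsub>Q\<^esub> a')"
  by (rule left_bilift)

interpretation R: tensor_bilift K A1 A2 K sP sQ G "\<lambda>b b' p q. \<kappa> (p \<lhd>\<^bsub>P\<^esub> b) (b' \<rhd>\<^bsub>Q\<^esub> q)"
  by (rule right_bilift)

lemma EB_acts: "e \<rhd>\<^bsub>EB\<^esub> t = L.lift2 e t" "t \<lhd>\<^bsub>EB\<^esub> e = R.lift2 e t"
  by (simp_all add: env_bimod_def Let_def env_lift_def L.lift2_def R.lift2_def)

lemma EB_carrier: "carrier EB = carrier (sP \<boxtimes>\<^bsub>K\<^esub> sQ)" "carrier (env K A) = carrier (A1 \<boxtimes>\<^bsub>K\<^esub> A2)"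
  by (simp_all add: EB_simps tensor_group_simps carrier_env env_group_def)

lemma hom_env: "hom (A1 \<boxtimes>\<^bsub>K\<^esub> A2) L = hom (add_monoid (env K A)) L"
  unfolding hom_tensor env_group_def[symmetric] hom_env_group ..

lemma EB_hom_scalar:
  assumes "t \<in> carrier EB"
  shows "(\<lambda>e. e \<rhd>\<^bsub>EB\<^esub> t) \<in> hom (add_monoid (env K A)) EB"
    and "(\<lambda>e. t \<lhd>\<^bsub>EB\<^esub> e) \<in> hom (add_monoid (env K A)) EB"
  using L.lift2_hom_left[of t] R.lift2_hom_left[of t] assms
  unfolding EB_acts EB_carrier hom_env hom_EB by blast+

lemma EB_hom_vector:
  assumes "e \<in> carrier (env K A)"
  shows "(\<lambda>t. e \<rhd>\<^bsub>EB\<^esub> t) \<in> hom EB EB" "(\<lambda>t. t \<lhd>\<^bsub>EB\<^esub> e) \<in> hom EB EB"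
  using L.lift2_hom_right[of e] R.lift2_hom_right[of e] assms
  unfolding EB_acts EB_carrier hom_EB hom_tensor eta_contract_eq by blast+

lemma EB_lact_kelt: "a \<in> carrier A \<Longrightarrow> a' \<in> carrier A \<Longrightarrow> p \<in> carrier P \<Longrightarrow> q \<in> carrier Q \<Longrightarrow>
    env_elt K A a a' \<rhd>\<^bsub>EB\<^esub> \<kappa> p q = \<kappa> (a \<rhd>\<^bsub>P\<^esub> p) (q \<lhd>\<^bsub>Q\<^esub> a')"
  using L.lift2_elt[of a a' p q] by (simp add: EB_acts env_elt_def kelt_def[of K A P Q p q] simps)

lemma EB_ract_kelt: "b \<in> carrier A \<Longrightarrow> b' \<in> carrier A \<Longrightarrow> p \<in> carrier P \<Longrightarrow> q \<in> carrier Q \<Longrightarrow>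
    \<kappa> p q \<lhd>\<^bsub>EB\<^esub> env_elt K A b b' = \<kappa> (p \<lhd>\<^bsub>P\<^esub> b) (b' \<rhd>\<^bsub>Q\<^esub> q)"
  using R.lift2_elt[of b b' p q] by (simp add: EB_acts env_elt_def kelt_def[of K A P Q p q] simps)

text \<open>The laws with a product or both actions are additive in the ring elements and in the
  vector, hence may be tested on \<open>env_elt\<close> and \<open>kelt\<close>. There the left
  action uses the right action on \<open>Q\<close>, whose order of composition fits the reversed
  product in the second factor of \<open>env\<close>.\<close>

lemma EB_bimodule: "bimodule (env K A) EB"
proof -
  interpret E: ring "env K A" by (rule env_ring)
  note closed [simp] = hom_in_carrier[OF EB_hom_vector(1)] hom_in_carrier[OF EB_hom_vector(2)]
    P.lact_closed P.ract_closed Q.lact_closed Q.ract_closed kelt_closed EB_lact_kelt EB_ract_kelt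
    env_elt_mult
  have ec [simp]: "env_elt K A a b \<in> carrier (env K A)" if "a \<in> carrier A" "b \<in> carrier A" for a b
    using env_elt_closed that by (simp add: carrier_env)
  note hl = EB_hom_scalar(1) and hr = EB_hom_scalar(2) and vl = EB_hom_vector(1) and vr = EB_hom_vector(2)
  have ml: "(\<lambda>r. r \<otimes>\<^bsub>env K A\<^esub> s) \<in> hom (add_monoid (env K A)) (add_monoid (env K A))"
    and mr: "(\<lambda>r. s \<otimes>\<^bsub>env K A\<^esub> r) \<in> hom (add_monoid (env K A)) (add_monoid (env K A))"
    if "s \<in> carrier (env K A)" for s
    using that by (auto intro!: homI simp: E.l_distr E.r_distr)
  note eqE = env_hom_eqI[OF _ _ EB_group] and eqB = EB_hom_eqI[OF _ _ EB_group]
  show ?thesis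
  proof (intro bimodule.intro E.ring_axioms EB_group)
    fix r s t u assume r: "r \<in> carrier (env K A)" and s: "s \<in> carrier (env K A)"
      and t: "t \<in> carrier EB"
    show "(r \<oplus>\<^bsub>env K A\<^esub> s) \<rhd>\<^bsub>EB\<^esub> t = (r \<rhd>\<^bsub>EB\<^esub> t) \<otimes>\<^bsub>EB\<^esub> (s \<rhd>\<^bsub>EB\<^esub> t)"
      "t \<lhd>\<^bsub>EB\<^esub> (r \<oplus>\<^bsub>env K A\<^esub> s) = (t \<lhd>\<^bsub>EB\<^esub> r) \<otimes>\<^bsub>EB\<^esub> (t \<lhd>\<^bsub>EB\<^esub> s)"
      using hom_mult[OF hl[OF t], of r s] hom_mult[OF hr[OF t], of r s] r s by simp_all
    show "(r \<otimes>\<^bsub>env K A\<^esub> s) \<rhd>\<^bsub>EB\<^esub> t = r \<rhd>\<^bsub>EB\<^esub> (s \<rhd>\<^bsub>EB\<^esub> t)"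
    proof (rule eqE[OF hom_comp[OF ml[OF s] hl[OF t]] hl _ r])
      show "s \<rhd>\<^bsub>EB\<^esub> t \<in> carrier EB" using s t by simp
      fix a a' assume a: "a \<in> carrier A" "a' \<in> carrier A"
      let ?e = "env_elt K A a a'"
      have e: "?e \<in> carrier (env K A)" using a by simp
      show "(?e \<otimes>\<^bsub>env K A\<^esub> s) \<rhd>\<^bsub>EB\<^esub> t = ?e \<rhd>\<^bsub>EB\<^esub> (s \<rhd>\<^bsub>EB\<^esub> t)"
      proof (rule eqE[OF hom_comp[OF mr[OF e] hl[OF t]] hom_comp[OF hl[OF t] vl[OF e]] _ s])
        fix b b' assume b: "b \<in> carrier A" "b' \<in> carrier A"
        let ?f = "env_elt K A b b'"
        have f: "?f \<in> carrier (env K A)" using b by simp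
        show "(?e \<otimes>\<^bsub>env K A\<^esub> ?f) \<rhd>\<^bsub>EB\<^esub> t = ?e \<rhd>\<^bsub>EB\<^esub> (?f \<rhd>\<^bsub>EB\<^esub> t)"
          by (rule eqB[OF vl hom_comp[OF vl[OF f] vl[OF e]] _ t])
            (use a b in \<open>simp_all add: P.lact_mult Q.ract_mult\<close>)
      qed
    qed
    show "t \<lhd>\<^bsub>EB\<^esub> (r \<otimes>\<^bsub>env K A\<^esub> s) = t \<lhd>\<^bsub>EB\<^esub> r \<lhd>\<^bsub>EB\<^esub> s"
    proof (rule eqE[OF hom_comp[OF ml[OF s] hr[OF t]] hom_comp[OF hr[OF t] vr[OF s]] _ r])
      fix a a' assume a: "a \<in> carrier A" "a' \<in> carrier A"
      let ?e = "env_elt K A a a'"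
      have e: "?e \<in> carrier (env K A)" using a by simp
      show "t \<lhd>\<^bsub>EB\<^esub> (?e \<otimes>\<^bsub>env K A\<^esub> s) = t \<lhd>\<^bsub>EB\<^esub> ?e \<lhd>\<^bsub>EB\<^esub> s"
      proof (rule eqE[OF hom_comp[OF mr[OF e] hr[OF t]] hr _ s])
        show "t \<lhd>\<^bsub>EB\<^esub> ?e \<in> carrier EB" using e t by simp
        fix b b' assume b: "b \<in> carrier A" "b' \<in> carrier A"
        let ?f = "env_elt K A b b'"
        have f: "?f \<in> carrier (env K A)" using b by simp
        show "t \<lhd>\<^bsub>EB\<^esub> (?e \<otimes>\<^bsub>env K A\<^esub> ?f) = t \<lhd>\<^bsub>EB\<^esub> ?e \<lhd>\<^bsub>EB\<^esub> ?f"
          by (rule eqB[OF vr hom_comp[OF vr[OF e] vr[OF f]] _ t])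
            (use a b in \<open>simp_all add: P.ract_mult Q.lact_mult\<close>)
      qed
    qed
    show "(r \<rhd>\<^bsub>EB\<^esub> t) \<lhd>\<^bsub>EB\<^esub> s = r \<rhd>\<^bsub>EB\<^esub> (t \<lhd>\<^bsub>EB\<^esub> s)"
    proof (rule eqE[OF hom_comp[OF hl[OF t] vr[OF s]] hl _ r])
      show "t \<lhd>\<^bsub>EB\<^esub> s \<in> carrier EB" using s t by simp
      fix a a' assume a: "a \<in> carrier A" "a' \<in> carrier A"
      let ?e = "env_elt K A a a'"
      have e: "?e \<in> carrier (env K A)" using a by simp
      show "(?e \<rhd>\<^bsub>EB\<^esub> t) \<lhd>\<^bsub>EB\<^esub> s = ?e \<rhd>\<^bsub>EB\<^esub> (t \<lhd>\<^bsub>EB\<^esub> s)"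
      proof (rule eqE[OF hr hom_comp[OF hr[OF t] vl[OF e]] _ s])
        show "?e \<rhd>\<^bsub>EB\<^esub> t \<in> carrier EB" using e t by simp
        fix b b' assume b: "b \<in> carrier A" "b' \<in> carrier A"
        let ?f = "env_elt K A b b'"
        have f: "?f \<in> carrier (env K A)" using b by simp
        show "(?e \<rhd>\<^bsub>EB\<^esub> t) \<lhd>\<^bsub>EB\<^esub> ?f = ?e \<rhd>\<^bsub>EB\<^esub> (t \<lhd>\<^bsub>EB\<^esub> ?f)"
          by (rule eqB[OF hom_comp[OF vl[OF e] vr[OF f]] hom_comp[OF vr[OF f] vl[OF e]] _ t])
            (use a b in \<open>simp_all add: P.lact_ract Q.lact_ract\<close>)
      qed
    qed
  next
    fix r t u assume r: "r \<in> carrier (env K A)" and t: "t \<in> carrier EB" and u: "u \<in> carrier EB"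
    show "r \<rhd>\<^bsub>EB\<^esub> (t \<otimes>\<^bsub>EB\<^esub> u) = (r \<rhd>\<^bsub>EB\<^esub> t) \<otimes>\<^bsub>EB\<^esub> (r \<rhd>\<^bsub>EB\<^esub> u)"
      "(t \<otimes>\<^bsub>EB\<^esub> u) \<lhd>\<^bsub>EB\<^esub> r = (t \<lhd>\<^bsub>EB\<^esub> r) \<otimes>\<^bsub>EB\<^esub> (u \<lhd>\<^bsub>EB\<^esub> r)"
      using hom_mult[OF vl[OF r] t u] hom_mult[OF vr[OF r] t u] by simp_all
  next
    fix t assume t: "t \<in> carrier EB"
    have one: "env_elt K A \<one> \<one> \<in> carrier (env K A)" by simp
    show "\<one>\<^bsub>env K A\<^esub> \<rhd>\<^bsub>EB\<^esub> t = t" "t \<lhd>\<^bsub>EB\<^esub> \<one>\<^bsub>env K A\<^esub> = t"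
      unfolding one_env
      by (rule eqB[OF vl[OF one] _ _ t]; simp add: P.lact_one Q.ract_one homI)
        (rule eqB[OF vr[OF one] _ _ t]; simp add: P.ract_one Q.lact_one homI)
  qed simp_all
qed

end

lemma bimod_sum_bimodule:
  assumes "bimodule R M" "bimodule R N" shows "bimodule R (bimod_sum M N)"
proof -
  interpret M: bimodule R M by fact
  interpret N: bimodule R N by fact
  interpret MG: comm_group M by (rule M.group)
  interpret NG: comm_group N by (rule N.group)
  interpret S: group "M \<times>\<times> N" by (rule DirProd_group[OF MG.is_group NG.is_group])
  have "comm_group (M \<times>\<times> N)"
    by (rule S.group_comm_groupI) (auto simp: DirProd_def MG.m_comm NG.m_comm)
  then have "comm_group (bimod_sum M N)"
    by (rule comm_group_transfer) (simp_all add: bimod_sum_def)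
  then show ?thesis
    by (intro bimodule.intro M.ring)
      (auto simp: bimod_sum_def DirProd_def M.lact_closed M.lact_add_left M.lact_add_right M.lact_mult
        M.lact_one M.ract_closed M.ract_add_left M.ract_add_right M.ract_mult M.ract_one M.lact_ract
        N.lact_closed N.lact_add_left N.lact_add_right N.lact_mult
        N.lact_one N.ract_closed N.ract_add_left N.ract_add_right N.ract_mult N.ract_one N.lact_ract)
qed

lemma finsum_finprod: "finsum R f I = finprod (add_monoid R) f I"
  by (simp add: finsum_def)

lemma (in algebra_bimodule_pair) EB_induct [consumes 1, case_names kelt mult inv]:
  assumes t: "t \<in> carrier EB"
    and kelt: "\<And>p q. p \<in> carrier P \<Longrightarrow> q \<in> carrier Q \<Longrightarrow> S (\<kappa> p q)"
    and mult: "\<And>t u. t \<in> carrier EB \<Longrightarrow> u \<in> carrier EB \<Longrightarrow> S t \<Longrightarrow> S u \<Longrightarrow> S (t \<otimes>\<^bsub>EB\<^esub> u)"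
    and inv: "\<And>t. t \<in> carrier EB \<Longrightarrow> S t \<Longrightarrow> S (inv\<^bsub>EB\<^esub> t)"
  shows "S t"
proof -
  have EB: "carrier (sP \<boxtimes>\<^bsub>K\<^esub> sQ) = carrier EB" "x \<otimes>\<^bsub>sP \<boxtimes>\<^bsub>K\<^esub> sQ\<^esub> y = x \<otimes>\<^bsub>EB\<^esub> y"
    "inv\<^bsub>sP \<boxtimes>\<^bsub>K\<^esub> sQ\<^esub> x = inv\<^bsub>EB\<^esub> x" for x y
    by (simp_all add: tensor_group_simps EB_simps m_inv_def)
  show ?thesis
    using sP sQ t[unfolded EB(1)[symmetric]]
  proof (induction t rule: tensor_induct)
    case (elt m n)
    then show ?case using kelt[of m n] by (simp add: kelt_def scalars_simps)
  qed (use mult inv in \<open>simp_all add: EB\<close>)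
qed

section \<open>The algebra \<open>H\<close>\<close>

locale pivotal_setup = assoc_algebra K A + W: algebra_bimodule K A W + pivotal_dual K A W D
  for K :: "('k, 'kx) ring_scheme" and A :: "('k, 'a, 'ax) module_scheme" (structure)
    and W :: "('a, 'w) bimod" and D :: "('a, 'w, 'x) dual_data"
begin

abbreviation "X \<equiv> dualX D"

sublocale X: algebra_bimodule K A X by (rule dual_bimodule)
sublocale XW: algebra_bimodule_pair K A X W ..
sublocale WX: algebra_bimodule_pair K A W X ..

abbreviation "Z \<equiv> Z_bimod K A W D"
abbreviation "T \<equiv> TZ K A W D"
abbreviation "H \<equiv> H_algebra K A W D"
abbreviation "inA \<equiv> in_A K A W D"
abbreviation "inO \<equiv> in_Aop K A W D"
abbreviation "xw \<equiv> gen_xw K A W D"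
abbreviation "wx \<equiv> gen_wx K A W D"

sublocale Z: bimodule "env K A" Z
  unfolding Z_bimod_def by (rule bimod_sum_bimodule[OF XW.EB_bimodule WX.EB_bimodule])

interpretation A: ring A by (rule ring)
interpretation K: field K by (rule scalar_field)
interpretation E: ring "env K A" by (rule env_ring)
interpretation XWG: comm_group XW.EB by (rule XW.EB_group)
interpretation WXG: comm_group WX.EB by (rule WX.EB_group)

lemma T_eq: "T = Z.TA" by (simp add: TZ_def)

lemma T_ring: "ring T" unfolding T_eq by (rule Z.TA_ring)

interpretation T: ring T by (rule T_ring)

lemma Z_simps: "carrier Z = carrier XW.EB \<times> carrier WX.EB"
    "(s, t) \<otimes>\<^bsub>Z\<^esub> (s', t') = (s \<otimes>\<^bsub>XW.EB\<^esub> s', t \<otimes>\<^bsub>WX.EB\<^esub> t')"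
    "e \<rhd>\<^bsub>Z\<^esub> (s, t) = (e \<rhd>\<^bsub>XW.EB\<^esub> s, e \<rhd>\<^bsub>WX.EB\<^esub> t)"
    "(s, t) \<lhd>\<^bsub>Z\<^esub> e = (s \<lhd>\<^bsub>XW.EB\<^esub> e, t \<lhd>\<^bsub>WX.EB\<^esub> e)"
  by (simp_all add: Z_bimod_def bimod_sum_def DirProd_def)

abbreviation "word0 e \<equiv> Z.word (e, [])"
abbreviation "word1 z \<equiv> Z.word (\<one>\<^bsub>env K A\<^esub>, [z])"

text \<open>With \<open>vec2\<close>, the inclusions of the two summands of \<open>Z\<close> into
  degree one of \<open>T\<close>.\<close>

definition "vec1 t = word1 (t, \<one>\<^bsub>WX.EB\<^esub>)"
definition "vec2 t = word1 (\<one>\<^bsub>XW.EB\<^esub>, t)"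

lemma gen_vec: "xw x w = vec1 (XW.\<kappa> x w)" "wx w x = vec2 (WX.\<kappa> w x)"
  by (simp_all add: gen_xw_def gen_wx_def vec1_def vec2_def)

lemma in_word: "inA a = word0 (\<epsilon> a \<one>)" "inO a = word0 (\<epsilon> \<one> a)"
  by (simp_all add: in_A_def in_Aop_def)

lemma epsilon_closed: "a \<in> carrier A \<Longrightarrow> b \<in> carrier A \<Longrightarrow> \<epsilon> a b \<in> carrier (env K A)"
  using env_elt_closed by (simp add: carrier_env)

lemma word0_ring_hom: "word0 \<in> ring_hom (env K A) T"
  unfolding T_eq by (rule Z.word_scalar_ring_hom)

lemma act_one:
  "e \<in> carrier (env K A) \<Longrightarrow> e \<rhd>\<^bsub>XW.EB\<^esub> \<one>\<^bsub>XW.EB\<^esub> = \<one>\<^bsub>XW.EB\<^esub>"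
  "e \<in> carrier (env K A) \<Longrightarrow> e \<rhd>\<^bsub>WX.EB\<^esub> \<one>\<^bsub>WX.EB\<^esub> = \<one>\<^bsub>WX.EB\<^esub>"
  "e \<in> carrier (env K A) \<Longrightarrow> \<one>\<^bsub>XW.EB\<^esub> \<lhd>\<^bsub>XW.EB\<^esub> e = \<one>\<^bsub>XW.EB\<^esub>"
  "e \<in> carrier (env K A) \<Longrightarrow> \<one>\<^bsub>WX.EB\<^esub> \<lhd>\<^bsub>WX.EB\<^esub> e = \<one>\<^bsub>WX.EB\<^esub>"
  by (rule hom_one_comm[OF XW.EB_hom_vector(1) XW.EB_group XW.EB_group]
      hom_one_comm[OF WX.EB_hom_vector(1) WX.EB_group WX.EB_group]
      hom_one_comm[OF XW.EB_hom_vector(2) XW.EB_group XW.EB_group]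
      hom_one_comm[OF WX.EB_hom_vector(2) WX.EB_group WX.EB_group]; assumption)+

lemma vec_hom: "vec1 \<in> hom XW.EB (add_monoid T)" "vec2 \<in> hom WX.EB (add_monoid T)"
proof -
  have h: "word1 \<in> hom Z (add_monoid T)" unfolding T_eq by (rule Z.word_vector_hom)
  have 1: "(\<lambda>t. (t, \<one>\<^bsub>WX.EB\<^esub>)) \<in> hom XW.EB Z" and 2: "(\<lambda>t. (\<one>\<^bsub>XW.EB\<^esub>, t)) \<in> hom WX.EB Z"
    by (auto intro!: homI simp: Z_simps)
  show "vec1 \<in> hom XW.EB (add_monoid T)" "vec2 \<in> hom WX.EB (add_monoid T)"
    using hom_comp[OF 1 h] hom_comp[OF 2 h] by (simp_all add: vec1_def[abs_def] vec2_def[abs_def])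
qed

lemma vec_closed: "t \<in> carrier XW.EB \<Longrightarrow> vec1 t \<in> carrier T" "u \<in> carrier WX.EB \<Longrightarrow> vec2 u \<in> carrier T"
  using hom_in_carrier[OF vec_hom(1), of t] hom_in_carrier[OF vec_hom(2), of u] by simp_all

lemma vec_lact:
  "e \<in> carrier (env K A) \<Longrightarrow> t \<in> carrier XW.EB \<Longrightarrow> word0 e \<otimes>\<^bsub>T\<^esub> vec1 t = vec1 (e \<rhd>\<^bsub>XW.EB\<^esub> t)"
  "e \<in> carrier (env K A) \<Longrightarrow> u \<in> carrier WX.EB \<Longrightarrow> word0 e \<otimes>\<^bsub>T\<^esub> vec2 u = vec2 (e \<rhd>\<^bsub>WX.EB\<^esub> u)"
  using Z.word_lact[of e "(t, \<one>\<^bsub>WX.EB\<^esub>)"] Z.word_lact[of e "(\<one>\<^bsub>XW.EB\<^esub>, u)"]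
  by (simp_all add: T_eq vec1_def vec2_def Z_simps act_one)

lemma vec_ract:
  "e \<in> carrier (env K A) \<Longrightarrow> t \<in> carrier XW.EB \<Longrightarrow> vec1 t \<otimes>\<^bsub>T\<^esub> word0 e = vec1 (t \<lhd>\<^bsub>XW.EB\<^esub> e)"
  "e \<in> carrier (env K A) \<Longrightarrow> u \<in> carrier WX.EB \<Longrightarrow> vec2 u \<otimes>\<^bsub>T\<^esub> word0 e = vec2 (u \<lhd>\<^bsub>WX.EB\<^esub> e)"
  using Z.word_ract[of e "(t, \<one>\<^bsub>WX.EB\<^esub>)"] Z.word_ract[of e "(\<one>\<^bsub>XW.EB\<^esub>, u)"]
  by (simp_all add: T_eq vec1_def vec2_def Z_simps act_one)

lemma gens_closed [simp]:
  "a \<in> carrier A \<Longrightarrow> inA a \<in> carrier T" "a \<in> carrier A \<Longrightarrow> inO a \<in> carrier T"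
  "x \<in> carrier X \<Longrightarrow> w \<in> carrier W \<Longrightarrow> xw x w \<in> carrier T"
  "x \<in> carrier X \<Longrightarrow> w \<in> carrier W \<Longrightarrow> wx w x \<in> carrier T"
  using ring_hom_closed[OF word0_ring_hom]
  by (simp_all add: in_word gen_vec epsilon_closed vec_closed XW.kelt_closed WX.kelt_closed)

lemma in_one: "inA \<one> = \<one>\<^bsub>T\<^esub>" "inO \<one> = \<one>\<^bsub>T\<^esub>"
  using ring_hom_one[OF word0_ring_hom] by (simp_all add: in_word one_env)

lemma in_add: "a \<in> carrier A \<Longrightarrow> b \<in> carrier A \<Longrightarrow> inA (a \<oplus> b) = inA a \<oplus>\<^bsub>T\<^esub> inA b"
  "a \<in> carrier A \<Longrightarrow> b \<in> carrier A \<Longrightarrow> inO (a \<oplus> b) = inO a \<oplus>\<^bsub>T\<^esub> inO b"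
  using ring_hom_add[OF word0_ring_hom epsilon_closed epsilon_closed]
  by (simp_all add: in_word add_env env_elt_add_left env_elt_add_right)

lemma in_mult: "a \<in> carrier A \<Longrightarrow> b \<in> carrier A \<Longrightarrow> inA a \<otimes>\<^bsub>T\<^esub> inA b = inA (a \<otimes> b)"
  "a \<in> carrier A \<Longrightarrow> b \<in> carrier A \<Longrightarrow> inO b \<otimes>\<^bsub>T\<^esub> inO a = inO (a \<otimes> b)"
  "a \<in> carrier A \<Longrightarrow> b \<in> carrier A \<Longrightarrow> inA a \<otimes>\<^bsub>T\<^esub> inO b = word0 (\<epsilon> a b)"
  "a \<in> carrier A \<Longrightarrow> b \<in> carrier A \<Longrightarrow> inO b \<otimes>\<^bsub>T\<^esub> inA a = word0 (\<epsilon> a b)"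
  by (simp_all add: in_word env_elt_mult epsilon_closed flip: ring_hom_mult[OF word0_ring_hom])

lemma in_scalar: "c \<in> carrier K \<Longrightarrow> inA (c \<odot> \<one>) = inO (c \<odot> \<one>)"
  using env_elt_balance[of "\<one>" c "\<one>"] by (simp add: in_word scalar_closed)

lemma gen_hom:
  "w \<in> carrier W \<Longrightarrow> (\<lambda>x. xw x w) \<in> hom X (add_monoid T)"
  "x \<in> carrier X \<Longrightarrow> (\<lambda>w. xw x w) \<in> hom W (add_monoid T)"
  "w \<in> carrier W \<Longrightarrow> (\<lambda>x. wx w x) \<in> hom X (add_monoid T)"
  "x \<in> carrier X \<Longrightarrow> (\<lambda>w. wx w x) \<in> hom W (add_monoid T)"
  unfolding gen_vec
  by (rule hom_comp[OF XW.kelt_hom_left vec_hom(1)] hom_comp[OF XW.kelt_hom_right vec_hom(1)]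
      hom_comp[OF WX.kelt_hom_left vec_hom(2)] hom_comp[OF WX.kelt_hom_right vec_hom(2)]; assumption)+

context
  fixes a x w assumes a: "a \<in> carrier A" and x: "x \<in> carrier X" and w: "w \<in> carrier W"
begin

lemma in_gen:
  "inA a \<otimes>\<^bsub>T\<^esub> xw x w = xw (a \<rhd>\<^bsub>X\<^esub> x) w" "inO a \<otimes>\<^bsub>T\<^esub> xw x w = xw x (w \<lhd>\<^bsub>W\<^esub> a)"
  "inA a \<otimes>\<^bsub>T\<^esub> wx w x = wx (a \<rhd>\<^bsub>W\<^esub> w) x" "inO a \<otimes>\<^bsub>T\<^esub> wx w x = wx w (x \<lhd>\<^bsub>X\<^esub> a)"
  using a x w
  by (simp_all add: in_word gen_vec vec_lact epsilon_closed XW.kelt_closed WX.kelt_closed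
      XW.EB_lact_kelt WX.EB_lact_kelt X.lact_one W.lact_one X.ract_one W.ract_one)

lemma gen_in:
  "xw x w \<otimes>\<^bsub>T\<^esub> inA a = xw (x \<lhd>\<^bsub>X\<^esub> a) w" "xw x w \<otimes>\<^bsub>T\<^esub> inO a = xw x (a \<rhd>\<^bsub>W\<^esub> w)"
  "wx w x \<otimes>\<^bsub>T\<^esub> inA a = wx (w \<lhd>\<^bsub>W\<^esub> a) x" "wx w x \<otimes>\<^bsub>T\<^esub> inO a = wx w (a \<rhd>\<^bsub>X\<^esub> x)"
  using a x w
  by (simp_all add: in_word gen_vec vec_ract epsilon_closed XW.kelt_closed WX.kelt_closed
      XW.EB_ract_kelt WX.EB_ract_kelt X.lact_one W.lact_one X.ract_one W.ract_one)

end

lemma hom_inv_neg: "f \<in> hom G (add_monoid T) \<Longrightarrow> comm_group G \<Longrightarrow> t \<in> carrier G \<Longrightarrow>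
    f (inv\<^bsub>G\<^esub> t) = \<ominus>\<^bsub>T\<^esub> f t"
  using group_hom.hom_inv[of G "add_monoid T" f t] T.a_comm_group
  by (simp add: group_hom_def group_hom_axioms_def comm_group.axioms(2) a_inv_def)

text \<open>The image of \<open>\<epsilon> a b\<close> is \<open>inA a\<close> times
  \<open>inO b\<close>, and a vector of \<open>Z\<close> is the sum of its components in the two
  summands, each generated additively by its pairs. So the four families generate \<open>T\<close>
  as a ring.\<close>

lemma T_induct [consumes 1, case_names inA inO xw wx add neg mult]:
  assumes t: "t \<in> carrier T"
    and inA: "\<And>a. a \<in> carrier A \<Longrightarrow> Q (inA a)" and inO: "\<And>a. a \<in> carrier A \<Longrightarrow> Q (inO a)"
    and xw: "\<And>x w. x \<in> carrier X \<Longrightarrow> w \<in> carrier W \<Longrightarrow> Q (xw x w)"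
    and wx: "\<And>x w. x \<in> carrier X \<Longrightarrow> w \<in> carrier W \<Longrightarrow> Q (wx w x)"
    and add: "\<And>x y. x \<in> carrier T \<Longrightarrow> y \<in> carrier T \<Longrightarrow> Q x \<Longrightarrow> Q y \<Longrightarrow> Q (x \<oplus>\<^bsub>T\<^esub> y)"
    and neg: "\<And>x. x \<in> carrier T \<Longrightarrow> Q x \<Longrightarrow> Q (\<ominus>\<^bsub>T\<^esub> x)"
    and mult: "\<And>x y. x \<in> carrier T \<Longrightarrow> y \<in> carrier T \<Longrightarrow> Q x \<Longrightarrow> Q y \<Longrightarrow> Q (x \<otimes>\<^bsub>T\<^esub> y)"
  shows "Q t"
proof -
  have w0c: "word0 e \<in> carrier T" if "e \<in> carrier (env K A)" for e
    using ring_hom_closed[OF word0_ring_hom that] .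
  have "word0 \<in> hom (add_monoid (env K A)) (add_monoid T)"
    using w0c ring_hom_add[OF word0_ring_hom] by (auto intro!: homI)
  then have w0n: "word0 (\<ominus>\<^bsub>env K A\<^esub> e) = \<ominus>\<^bsub>T\<^esub> word0 e" if "e \<in> carrier (env K A)" for e
    using hom_inv_neg[of word0 "add_monoid (env K A)" e] that E.a_comm_group by (simp add: a_inv_def)
  have scalar: "Q (word0 e)" if "e \<in> carrier (env K A)" for e
    using that
  proof (induction e rule: env_induct)
    case (elt a b)
    then show ?case using mult[of "inA a" "inO b"] inA inO by (simp add: in_mult)
  next
    case (add x y)
    then show ?case using assms(6)[of "word0 x" "word0 y"] w0c ring_hom_add[OF word0_ring_hom] by simp
  next
    case (neg x)
    then show ?case using assms(7)[of "word0 x"] w0c w0n by simp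
  qed
  have v1: "Q (vec1 s)" if "s \<in> carrier XW.EB" for s
    using that
  proof (induction s rule: XW.EB_induct)
    case (kelt p q)
    then show ?case using xw by (simp add: gen_vec)
  next
    case (mult t u)
    then show ?case using add[of "vec1 t" "vec1 u"] vec_closed hom_mult[OF vec_hom(1)] by simp
  next
    case (inv t)
    then show ?case using neg[of "vec1 t"] vec_closed hom_inv_neg[OF vec_hom(1) XW.EB_group] by simp
  qed
  have v2: "Q (vec2 s)" if "s \<in> carrier WX.EB" for s
    using that
  proof (induction s rule: WX.EB_induct)
    case (kelt p q)
    then show ?case using wx by (simp add: gen_vec)
  next
    case (mult t u)
    then show ?case using add[of "vec2 t" "vec2 u"] vec_closed hom_mult[OF vec_hom(2)] by simp
  next
    case (inv t)
    then show ?case using neg[of "vec2 t"] vec_closed hom_inv_neg[OF vec_hom(2) WX.EB_group] by simp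
  qed
  show ?thesis
    using t[unfolded T_eq]
  proof (induction t rule: Z.TA_induct)
    case (vector v)
    then obtain s u where v: "v = (s, u)" "s \<in> carrier XW.EB" "u \<in> carrier WX.EB" by (auto simp: Z_simps)
    have "word1 v = vec1 s \<oplus>\<^bsub>T\<^esub> vec2 u"
      using hom_mult[OF Z.word_vector_hom, of "(s, \<one>\<^bsub>WX.EB\<^esub>)" "(\<one>\<^bsub>XW.EB\<^esub>, u)"] v
      by (simp add: Z_simps T_eq vec1_def vec2_def)
    then show ?case using add v1 v2 v vec_closed by simp
  qed (use scalar add neg mult in \<open>simp_all add: T_eq\<close>)
qed

section \<open>The defining relations and the quotient\<close>

abbreviation "I \<equiv> {..<coev_len D}"
abbreviation "J \<equiv> {..<ucoev_len D}"
abbreviation "om \<equiv> basis_omega D"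
abbreviation "xi \<equiv> basis_x D"
abbreviation "y \<equiv> basis_y D"
abbreviation "\<rho> \<equiv> basis_rho D"
abbreviation "evd \<equiv> ev2 A W D"
abbreviation "uevd \<equiv> uev2 A W D"

lemma evd_closed [simp]: "x \<in> carrier X \<Longrightarrow> w \<in> carrier W \<Longrightarrow> evd x w \<in> carrier A"
  and uevd_closed [simp]: "x \<in> carrier X \<Longrightarrow> w \<in> carrier W \<Longrightarrow> uevd w x \<in> carrier A"
  using ev_hom uev_hom elt_closed[OF X.bimodule_axioms W.bimodule_axioms]
    elt_closed[OF W.bimodule_axioms X.bimodule_axioms]
  by (auto simp: ev2_def uev2_def bimod_hom_def left_hom_def hom_def regular_simps)

lemma basis_closed [simp]:
  "i \<in> I \<Longrightarrow> om i \<in> carrier W" "i \<in> I \<Longrightarrow> xi i \<in> carrier X"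
  "j \<in> J \<Longrightarrow> y j \<in> carrier X" "j \<in> J \<Longrightarrow> \<rho> j \<in> carrier W"
  using basis_omega_closed basis_x_closed basis_y_closed basis_rho_closed by auto

text \<open>For \<open>k < 4\<close>, \<open>rel_sum k x w = rel_value k x w\<close> are the defining relations of \<open>H\<close>, in the order in
  which \<^const>\<open>H_relators\<close> lists them.\<close>

definition rel_sum where
  "rel_sum k x w = (if k = 0 then (\<Oplus>\<^bsub>T\<^esub>i\<in>I. wx (om i) x \<otimes>\<^bsub>T\<^esub> xw (xi i) w)
     else if k = 1 then (\<Oplus>\<^bsub>T\<^esub>j\<in>J. xw x (\<rho> j) \<otimes>\<^bsub>T\<^esub> wx w (y j))
     else if k = 2 then (\<Oplus>\<^bsub>T\<^esub>j\<in>J. xw (y j) w \<otimes>\<^bsub>T\<^esub> wx (\<rho> j) x)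
     else (\<Oplus>\<^bsub>T\<^esub>i\<in>I. wx w (xi i) \<otimes>\<^bsub>T\<^esub> xw x (om i)))" for k :: nat

definition rel_value where
  "rel_value k x w = (if k = 0 then inO (uevd w x) else if k = 1 then inA (evd x w)
     else if k = 2 then inO (evd x w) else inA (uevd w x))" for k :: nat

lemma H_relators_eq:
  "H_relators K A W D = {rel_sum k x w \<ominus>\<^bsub>T\<^esub> rel_value k x w | k x w.
     k < 4 \<and> x \<in> carrier X \<and> w \<in> carrier W}" (is "?L = ?R")
proof -
  have 4: "(k < 4) = (k = 0 \<or> k = 1 \<or> k = 2 \<or> k = 3)" for k :: nat by auto
  have "?L = (\<Union>x\<in>carrier X. \<Union>w\<in>carrier W. (\<lambda>k. rel_sum k x w \<ominus>\<^bsub>T\<^esub> rel_value k x w) ` {0, 1, 2, 3})"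
    by (simp add: H_relators_def Let_def rel_sum_def rel_value_def)
  also have "\<dots> = ?R" unfolding 4 by blast
  finally show ?thesis .
qed

lemma rel_closed [simp]:
  "x \<in> carrier X \<Longrightarrow> w \<in> carrier W \<Longrightarrow> rel_sum k x w \<in> carrier T"
  "x \<in> carrier X \<Longrightarrow> w \<in> carrier W \<Longrightarrow> rel_value k x w \<in> carrier T"
  by (auto simp: rel_sum_def rel_value_def intro!: T.finsum_closed)

abbreviation "HI \<equiv> genideal T (H_relators K A W D)"

lemma H_relators_closed: "H_relators K A W D \<subseteq> carrier T"
  by (auto simp: H_relators_eq)

lemma HI_ideal: "ideal HI T"
  by (rule T.genideal_ideal[OF H_relators_closed])

interpretation HI: ideal HI T by (rule HI_ideal)

lemma H_eq: "H = T Quot HI" by (simp add: H_algebra_def)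

lemma H_ring: "ring H" unfolding H_eq by (rule HI.quotient_is_ring)

definition "\<pi> t = HI +>\<^bsub>T\<^esub> t"

lemma pi_ring_hom: "\<pi> \<in> ring_hom T H"
  using HI.rcos_ring_hom by (simp add: H_eq \<pi>_def[abs_def] eta_contract_eq)

lemma pi_surj: "h \<in> carrier H \<Longrightarrow> \<exists>t\<in>carrier T. h = \<pi> t"
  by (auto simp: H_eq FactRing_def A_RCOSETS_defs \<pi>_def a_r_coset_def)

lemma pi_eq_iff: "s \<in> carrier T \<Longrightarrow> t \<in> carrier T \<Longrightarrow> \<pi> s = \<pi> t \<longleftrightarrow> s \<ominus>\<^bsub>T\<^esub> t \<in> HI"
  unfolding \<pi>_def by (rule T.quotient_eq_iff_same_a_r_cos[OF HI_ideal, symmetric])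

lemma pi_rel:
  assumes "k < 4" "x \<in> carrier X" "w \<in> carrier W"
  shows "\<pi> (rel_sum k x w) = \<pi> (rel_value k x w)"
proof -
  have "rel_sum k x w \<ominus>\<^bsub>T\<^esub> rel_value k x w \<in> HI"
    using T.genideal_self[OF H_relators_closed] assms unfolding H_relators_eq by blast
  then show ?thesis using assms by (simp add: pi_eq_iff)
qed

text \<open>The kernel of \<Phi> is an ideal containing the relators, hence contains
  \<open>HI\<close>. So \<Phi> is constant on cosets, and \<Psi> can be defined through an
  arbitrarily chosen representative.\<close>

lemma H_hom_factor:
  assumes Q: "ring Q" and \<Phi>: "\<Phi> \<in> ring_hom T Q"
    and rel: "\<And>k x w. k < 4 \<Longrightarrow> x \<in> carrier X \<Longrightarrow> w \<in> carrier W \<Longrightarrow> \<Phi> (rel_sum k x w) = \<Phi> (rel_value k x w)"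
  shows "\<exists>\<Psi>\<in>ring_hom H Q. \<forall>t\<in>carrier T. \<Psi> (\<pi> t) = \<Phi> t"
proof -
  interpret Q: ring Q by fact
  interpret \<Phi>: ring_hom_ring T Q \<Phi>
    using \<Phi> by (intro ring_hom_ringI2 T_ring Q)
  have "H_relators K A W D \<subseteq> a_kernel T Q \<Phi>"
  proof
    fix r assume "r \<in> H_relators K A W D"
    then obtain k x w where r: "r = rel_sum k x w \<ominus>\<^bsub>T\<^esub> rel_value k x w"
        "k < 4" "x \<in> carrier X" "w \<in> carrier W"
      unfolding H_relators_eq by blast
    then have "\<Phi> r = \<Phi> (rel_value k x w) \<ominus>\<^bsub>Q\<^esub> \<Phi> (rel_value k x w)"
      by (simp add: a_minus_def rel)
    moreover have "\<Phi> (rel_value k x w) \<in> carrier Q" "r \<in> carrier T" using r by simp_all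
    ultimately show "r \<in> a_kernel T Q \<Phi>"
      unfolding a_kernel_def' by (simp add: a_minus_def Q.r_neg)
  qed
  then have ker: "HI \<subseteq> a_kernel T Q \<Phi>"
    by (rule T.genideal_minimal[OF \<Phi>.kernel_is_ideal])
  have wd: "\<Phi> s = \<Phi> t" if "s \<in> carrier T" "t \<in> carrier T" "\<pi> s = \<pi> t" for s t
  proof -
    have "s \<ominus>\<^bsub>T\<^esub> t \<in> a_kernel T Q \<Phi>" using that ker by (auto simp: pi_eq_iff)
    then have "\<Phi> s \<ominus>\<^bsub>Q\<^esub> \<Phi> t = \<zero>\<^bsub>Q\<^esub>" 
      using that unfolding a_kernel_def' by (simp add: a_minus_def)
    then show ?thesis
      using that Q.add.mult_inv_eq_one_iff[of "\<Phi> s" "\<Phi> t"] by (simp add: a_minus_def)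
  qed
  define \<Psi> where "\<Psi> h = \<Phi> (SOME t. t \<in> carrier T \<and> h = \<pi> t)" for h
  have \<Psi>: "\<Psi> (\<pi> t) = \<Phi> t" if "t \<in> carrier T" for t
    unfolding \<Psi>_def using that by (rule_tac someI2[of _ t]) (blast intro: wd[OF _ that sym])+
  have "\<Psi> \<in> ring_hom H Q"
  proof (rule ring_hom_memI)
    show "\<Psi> h \<in> carrier Q" if "h \<in> carrier H" for h
      using pi_surj[OF that] \<Psi> by auto
    show "\<Psi> (h \<otimes>\<^bsub>H\<^esub> k) = \<Psi> h \<otimes>\<^bsub>Q\<^esub> \<Psi> k" "\<Psi> (h \<oplus>\<^bsub>H\<^esub> k) = \<Psi> h \<oplus>\<^bsub>Q\<^esub> \<Psi> k"
      if "h \<in> carrier H" "k \<in> carrier H" for h k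
      using pi_surj[OF that(1)] pi_surj[OF that(2)] \<Psi>
      by (auto simp flip: ring_hom_mult[OF pi_ring_hom] ring_hom_add[OF pi_ring_hom])
    show "\<Psi> \<one>\<^bsub>H\<^esub> = \<one>\<^bsub>Q\<^esub>"
      using \<Psi>[of "\<one>\<^bsub>T\<^esub>"] ring_hom_one[OF pi_ring_hom] by simp
  qed
  then show ?thesis using \<Psi> by blast
qed

end

section \<open>Modules from systems of operators\<close>

lemma End_closed: "f \<in> carrier (End M) \<Longrightarrow> m \<in> carrier M \<Longrightarrow> f m \<in> carrier M"
  by (auto simp: End_simps hom_def)

lemma End_eval_hom: "m \<in> carrier M \<Longrightarrow> (\<lambda>f. f m) \<in> hom (add_monoid (End M)) M"
  by (rule homI) (auto simp: End_closed End_apply)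

lemma End_finsum_apply:
  assumes "comm_group M" "\<And>i. i \<in> I \<Longrightarrow> f i \<in> carrier (End M)" "m \<in> carrier M"
  shows "finsum (End M) f I m = finprod M (\<lambda>i. f i m) I"
proof -
  interpret E: ring "End M" by (rule End_ring) fact
  show ?thesis
    unfolding finsum_finprod
    by (rule hom_finprod[OF End_eval_hom]) (use assms E.a_comm_group in auto)
qed

text \<open>The action is cut off outside the carriers, as the objects of
  \<open>lmod_category\<close> demand.\<close>

definition ring_action_module ::
  "('r, 'rx) ring_scheme \<Rightarrow> ('m, 'mx) monoid_scheme \<Rightarrow> ('r \<Rightarrow> 'm \<Rightarrow> 'm) \<Rightarrow> ('r, 'm) lmod" where
  "ring_action_module R M \<Psi> = \<lparr>carrier = carrier M, monoid.mult = monoid.mult M, one = one M,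
     act = (\<lambda>r m. if r \<in> carrier R \<and> m \<in> carrier M then \<Psi> r m else undefined)\<rparr>"

lemma left_module_ring_action_module:
  assumes R: "ring R" and M: "comm_group M" and \<Psi>: "\<Psi> \<in> ring_hom R (End M)"
  shows "left_module R (ring_action_module R M \<Psi>)"
proof -
  interpret R: ring R by fact
  interpret M: comm_group M by fact
  have c: "\<Psi> r \<in> carrier (End M)" if "r \<in> carrier R" for r
    using ring_hom_closed[OF \<Psi> that] .
  then have h: "\<Psi> r \<in> hom M M" if "r \<in> carrier R" for r
    using that by (simp add: End_simps)
  have "comm_group (ring_action_module R M \<Psi>)"
    by (rule comm_group_transfer[OF M]) (simp_all add: ring_action_module_def)
  then show ?thesis
    by (intro left_module.intro R)
      (simp_all add: ring_action_module_def End_closed[OF c] ring_hom_add[OF \<Psi>] ring_hom_mult[OF \<Psi>]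
        ring_hom_one[OF \<Psi>] End_apply hom_mult[OF h])
qed

text \<open>A bimodule as a left module over the enveloping algebra. That the assignment respects
  the balancing over the field is the point where \<open>central\<close> enters.\<close>

lemma (in assoc_algebra) env_action:
  assumes "algebra_bimodule K A M"
  shows "\<exists>f\<in>ring_hom (env K A) (End M). \<forall>a\<in>carrier A. \<forall>b\<in>carrier A.
    f (env_elt K A a b) = (\<lambda>m\<in>carrier M. (a \<rhd>\<^bsub>M\<^esub> m) \<lhd>\<^bsub>M\<^esub> b)"
proof -
  interpret A: ring A by (rule ring)
  interpret M: algebra_bimodule K A M by fact
  interpret MG: comm_group M by (rule M.group)
  note [simp] = M.lact_closed M.ract_closed scalar_closed End_apply
  have c: "(\<lambda>m\<in>carrier M. (a \<rhd>\<^bsub>M\<^esub> m) \<lhd>\<^bsub>M\<^esub> b) \<in> carrier (End M)" if "a \<in> carrier A" "b \<in> carrier A" for a b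
    using hom_comp[OF bimod_lact_hom[OF M.bimodule_axioms that(1)] bimod_ract_hom[OF M.bimodule_axioms that(2)]]
    by (rule End_memI[OF MG.monoid_axioms])
  interpret EM: ring "End M" by (rule End_ring[OF M.group])
  show ?thesis
  proof (rule env_ring_hom[OF EM.ring_axioms c])
    fix a a' b b' assume a: "a \<in> carrier A" "a' \<in> carrier A" and b: "b \<in> carrier A" "b' \<in> carrier A"
    show "(\<lambda>m\<in>carrier M. ((a \<oplus>\<^bsub>A\<^esub> a') \<rhd>\<^bsub>M\<^esub> m) \<lhd>\<^bsub>M\<^esub> b) =
        (\<lambda>m\<in>carrier M. (a \<rhd>\<^bsub>M\<^esub> m) \<lhd>\<^bsub>M\<^esub> b) \<oplus>\<^bsub>End M\<^esub> (\<lambda>m\<in>carrier M. (a' \<rhd>\<^bsub>M\<^esub> m) \<lhd>\<^bsub>M\<^esub> b)"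
      by (rule End_eqI[of _ M]) (use a b c in \<open>simp_all add: M.lact_add_left M.ract_add_left\<close>)
    show "(\<lambda>m\<in>carrier M. (a \<rhd>\<^bsub>M\<^esub> m) \<lhd>\<^bsub>M\<^esub> (b \<oplus>\<^bsub>A\<^esub> b')) =
        (\<lambda>m\<in>carrier M. (a \<rhd>\<^bsub>M\<^esub> m) \<lhd>\<^bsub>M\<^esub> b) \<oplus>\<^bsub>End M\<^esub> (\<lambda>m\<in>carrier M. (a \<rhd>\<^bsub>M\<^esub> m) \<lhd>\<^bsub>M\<^esub> b')"
      by (rule End_eqI[of _ M]) (use a b c in \<open>simp_all add: M.ract_add_right\<close>)
    show "(\<lambda>m\<in>carrier M. ((a \<otimes>\<^bsub>A\<^esub> a') \<rhd>\<^bsub>M\<^esub> m) \<lhd>\<^bsub>M\<^esub> (b' \<otimes>\<^bsub>A\<^esub> b)) =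
        (\<lambda>m\<in>carrier M. (a \<rhd>\<^bsub>M\<^esub> m) \<lhd>\<^bsub>M\<^esub> b) \<otimes>\<^bsub>End M\<^esub> (\<lambda>m\<in>carrier M. (a' \<rhd>\<^bsub>M\<^esub> m) \<lhd>\<^bsub>M\<^esub> b')"
      by (rule End_eqI[of _ M]) (use a b c in \<open>simp_all add: M.lact_mult M.ract_mult M.lact_ract\<close>)
  next
    fix a b c' assume *: "a \<in> carrier A" "b \<in> carrier A" "c' \<in> carrier K"
    show "(\<lambda>m\<in>carrier M. ((a \<otimes>\<^bsub>A\<^esub> (c' \<odot>\<^bsub>A\<^esub> \<one>\<^bsub>A\<^esub>)) \<rhd>\<^bsub>M\<^esub> m) \<lhd>\<^bsub>M\<^esub> b) =
        (\<lambda>m\<in>carrier M. (a \<rhd>\<^bsub>M\<^esub> m) \<lhd>\<^bsub>M\<^esub> (b \<otimes>\<^bsub>A\<^esub> (c' \<odot>\<^bsub>A\<^esub> \<one>\<^bsub>A\<^esub>)))"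
      by (rule End_eqI[of _ M])
        (use * c in \<open>simp_all add: M.lact_mult M.central M.lact_ract scalar_commute[symmetric] M.ract_mult\<close>)
  next
    show "(\<lambda>m\<in>carrier M. (\<one>\<^bsub>A\<^esub> \<rhd>\<^bsub>M\<^esub> m) \<lhd>\<^bsub>M\<^esub> \<one>\<^bsub>A\<^esub>) = \<one>\<^bsub>End M\<^esub>"
      by (rule End_eqI[of _ M]) (use c in \<open>simp_all add: M.lact_one M.ract_one\<close>)
  qed
qed

text \<open>\<open>E p q\<close> is the operator by which the generator \<open>(p, q)\<close> of a summand of the bimodule \<open>Z\<close>
  acts on \<open>M\<close>.\<close>

locale operator_system = algebra_bimodule_pair K A P Q + M: algebra_bimodule K A M
  for K :: "('k, 'kx) ring_scheme" and A :: "('k, 'a, 'ax) module_scheme" (structure)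
    and P :: "('a, 'p) bimod" and Q :: "('a, 'q) bimod" and M :: "('a, 'm) bimod" +
  fixes E :: "'p \<Rightarrow> 'q \<Rightarrow> 'm \<Rightarrow> 'm"
  assumes hom_m: "p \<in> carrier P \<Longrightarrow> q \<in> carrier Q \<Longrightarrow> E p q \<in> hom M M"
    and hom_p: "q \<in> carrier Q \<Longrightarrow> m \<in> carrier M \<Longrightarrow> (\<lambda>p. E p q m) \<in> hom P M"
    and hom_q: "p \<in> carrier P \<Longrightarrow> m \<in> carrier M \<Longrightarrow> (\<lambda>q. E p q m) \<in> hom Q M"
    and lact_out: "a \<in> carrier A \<Longrightarrow> p \<in> carrier P \<Longrightarrow> q \<in> carrier Q \<Longrightarrow> m \<in> carrier M \<Longrightarrow>
      E (a \<rhd>\<^bsub>P\<^esub> p) q m = a \<rhd>\<^bsub>M\<^esub> E p q m"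
    and ract_out: "a \<in> carrier A \<Longrightarrow> p \<in> carrier P \<Longrightarrow> q \<in> carrier Q \<Longrightarrow> m \<in> carrier M \<Longrightarrow>
      E p (q \<lhd>\<^bsub>Q\<^esub> a) m = E p q m \<lhd>\<^bsub>M\<^esub> a"
    and lact_in: "a \<in> carrier A \<Longrightarrow> p \<in> carrier P \<Longrightarrow> q \<in> carrier Q \<Longrightarrow> m \<in> carrier M \<Longrightarrow>
      E (p \<lhd>\<^bsub>P\<^esub> a) q m = E p q (a \<rhd>\<^bsub>M\<^esub> m)"
    and ract_in: "a \<in> carrier A \<Longrightarrow> p \<in> carrier P \<Longrightarrow> q \<in> carrier Q \<Longrightarrow> m \<in> carrier M \<Longrightarrow>
      E p (a \<rhd>\<^bsub>Q\<^esub> q) m = E p q (m \<lhd>\<^bsub>M\<^esub> a)"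
begin

interpretation A: ring A by (rule ring)
interpretation MG: comm_group M by (rule M.group)
interpretation PG: comm_group P by (rule P.group)
interpretation QG: comm_group Q by (rule Q.group)
interpretation EM: ring "End M" by (rule End_ring[OF M.group])

lemma E_closed [simp]: "p \<in> carrier P \<Longrightarrow> q \<in> carrier Q \<Longrightarrow> m \<in> carrier M \<Longrightarrow> E p q m \<in> carrier M"
  using hom_in_carrier[OF hom_m] .

lemma op_End: "p \<in> carrier P \<Longrightarrow> q \<in> carrier Q \<Longrightarrow> restrict (E p q) (carrier M) \<in> carrier (End M)"
  by (rule End_memI[OF MG.monoid_axioms hom_m])

text \<open>A scalar between \<open>p\<close> and \<open>q\<close> is moved onto the vector by
  \<open>lact_in\<close> from one side and by \<open>ract_in\<close> from the other; the two results
  agree because scalars act on \<open>M\<close> centrally.\<close>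

lemma op_balanced: "balanced K sP sQ (add_monoid (End M)) (\<lambda>p q. restrict (E p q) (carrier M))"
proof (rule balancedI; unfold hom_scalars scalars_simps)
  note [simp] = op_End End_apply
  fix p q assume p: "p \<in> carrier P" and q: "q \<in> carrier Q"
  show "restrict (E (p \<lhd>\<^bsub>P\<^esub> (c \<odot> \<one>)) q) (carrier M) =
      restrict (E p ((c \<odot> \<one>) \<rhd>\<^bsub>Q\<^esub> q)) (carrier M)" if "c \<in> carrier K" for c
    by (rule End_eqI[of _ M])
      (use p q that in \<open>simp_all add: scalar_closed P.ract_closed Q.lact_closed lact_in ract_in M.central\<close>)
next
  note [simp] = op_End End_apply
  fix p assume p: "p \<in> carrier P"
  show "(\<lambda>q. restrict (E p q) (carrier M)) \<in> hom Q (add_monoid (End M))"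
  proof (rule homI; simp add: p)
    fix q q' assume "q \<in> carrier Q" "q' \<in> carrier Q"
    then show "restrict (E p (q \<otimes>\<^bsub>Q\<^esub> q')) (carrier M) =
      restrict (E p q) (carrier M) \<oplus>\<^bsub>End M\<^esub> restrict (E p q') (carrier M)"
      by (intro End_eqI[of _ M]) (use p in \<open>simp_all add: hom_mult[OF hom_q]\<close>)
  qed
next
  note [simp] = op_End End_apply
  fix q assume q: "q \<in> carrier Q"
  show "(\<lambda>p. restrict (E p q) (carrier M)) \<in> hom P (add_monoid (End M))"
  proof (rule homI; simp add: q)
    fix p p' assume "p \<in> carrier P" "p' \<in> carrier P"
    then show "restrict (E (p \<otimes>\<^bsub>P\<^esub> p') q) (carrier M) =
      restrict (E p q) (carrier M) \<oplus>\<^bsub>End M\<^esub> restrict (E p' q) (carrier M)"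
      by (intro End_eqI[of _ M]) (use q in \<open>simp_all add: hom_mult[OF hom_p]\<close>)
  qed
qed

text \<open>The operators extend additively to all of \<open>EB\<close>. The two rules about outputs
  make the extension left linear over \<open>env\<close>, the two rules about inputs make it right
  linear, with \<open>f\<close> giving the action of \<open>env\<close> on \<open>M\<close>.\<close>

lemma env_bimod_action:
  assumes f: "f \<in> ring_hom (env K A) (End M)"
    and f_elt: "\<And>a b. a \<in> carrier A \<Longrightarrow> b \<in> carrier A \<Longrightarrow>
      f (env_elt K A a b) = (\<lambda>m\<in>carrier M. (a \<rhd>\<^bsub>M\<^esub> m) \<lhd>\<^bsub>M\<^esub> b)"
  shows "\<exists>g\<in>hom EB (add_monoid (End M)).
    (\<forall>p\<in>carrier P. \<forall>q\<in>carrier Q. g (\<kappa> p q) = restrict (E p q) (carrier M)) \<and>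
    (\<forall>e\<in>carrier (env K A). \<forall>t\<in>carrier EB.
      g (e \<rhd>\<^bsub>EB\<^esub> t) = f e \<otimes>\<^bsub>End M\<^esub> g t \<and> g (t \<lhd>\<^bsub>EB\<^esub> e) = g t \<otimes>\<^bsub>End M\<^esub> f e)"
proof -
  note Q = EM.a_comm_group
  define g where "g = tensor_lift K sP sQ (add_monoid (End M)) (\<lambda>p q. restrict (E p q) (carrier M))"
  have g: "g \<in> hom EB (add_monoid (End M))"
    using tensor_lift_hom[OF sP sQ Q op_balanced] by (simp add: g_def hom_EB hom_tensor)
  have gc: "g t \<in> carrier (End M)" if "t \<in> carrier EB" for t
    using hom_in_carrier[OF g that] by simp
  have fc: "f e \<in> carrier (End M)" if "e \<in> carrier (env K A)" for e
    using ring_hom_closed[OF f that] .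
  have fh: "f \<in> hom (add_monoid (env K A)) (add_monoid (End M))"
    using ring_hom_add[OF f] fc by (auto intro!: homI)
  have gk: "g (\<kappa> p q) = restrict (E p q) (carrier M)" if "p \<in> carrier P" "q \<in> carrier Q" for p q
    unfolding kelt_def g_def using that by (subst tensor_lift_elt[OF sP sQ Q op_balanced]) (simp_all add: scalars_simps)
  have lm: "(\<lambda>x. x \<otimes>\<^bsub>End M\<^esub> c) \<in> hom (add_monoid (End M)) (add_monoid (End M))"
    and rm: "(\<lambda>x. c \<otimes>\<^bsub>End M\<^esub> x) \<in> hom (add_monoid (End M)) (add_monoid (End M))"
    if "c \<in> carrier (End M)" for c
    using that by (auto intro!: homI simp: EM.l_distr EM.r_distr)
  have ec [simp]: "env_elt K A a b \<in> carrier (env K A)" if "a \<in> carrier A" "b \<in> carrier A" for a b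
    using env_elt_closed that by (simp add: carrier_env)
  note [simp] = op_End End_apply P.lact_closed P.ract_closed Q.lact_closed Q.ract_closed
    M.lact_closed M.ract_closed
  have "g (e \<rhd>\<^bsub>EB\<^esub> t) = f e \<otimes>\<^bsub>End M\<^esub> g t"
    if e: "e \<in> carrier (env K A)" and t: "t \<in> carrier EB" for e t
  proof (rule env_hom_eqI[OF hom_comp[OF EB_hom_scalar(1)[OF t] g] hom_comp[OF fh lm[OF gc[OF t]]] Q _ e])
    fix a b assume a: "a \<in> carrier A" and b: "b \<in> carrier A"
    show "g (env_elt K A a b \<rhd>\<^bsub>EB\<^esub> t) = f (env_elt K A a b) \<otimes>\<^bsub>End M\<^esub> g t"
    proof (rule EB_hom_eqI[OF hom_comp[OF EB_hom_vector(1)[OF ec[OF a b]] g]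
          hom_comp[OF g rm[OF fc[OF ec[OF a b]]]] Q _ t])
      fix p q assume p: "p \<in> carrier P" and q: "q \<in> carrier Q"
      show "g (env_elt K A a b \<rhd>\<^bsub>EB\<^esub> \<kappa> p q) = f (env_elt K A a b) \<otimes>\<^bsub>End M\<^esub> g (\<kappa> p q)"
        by (rule End_eqI[of _ M])
          (use a b p q fc[OF ec[OF a b]] in \<open>simp_all add: EM.m_closed EB_lact_kelt gk f_elt lact_out ract_out M.lact_ract\<close>)
    qed
  qed
  moreover have "g (t \<lhd>\<^bsub>EB\<^esub> e) = g t \<otimes>\<^bsub>End M\<^esub> f e"
    if e: "e \<in> carrier (env K A)" and t: "t \<in> carrier EB" for e t
  proof (rule env_hom_eqI[OF hom_comp[OF EB_hom_scalar(2)[OF t] g] hom_comp[OF fh rm[OF gc[OF t]]] Q _ e])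
    fix a b assume a: "a \<in> carrier A" and b: "b \<in> carrier A"
    show "g (t \<lhd>\<^bsub>EB\<^esub> env_elt K A a b) = g t \<otimes>\<^bsub>End M\<^esub> f (env_elt K A a b)"
    proof (rule EB_hom_eqI[OF hom_comp[OF EB_hom_vector(2)[OF ec[OF a b]] g]
          hom_comp[OF g lm[OF fc[OF ec[OF a b]]]] Q _ t])
      fix p q assume p: "p \<in> carrier P" and q: "q \<in> carrier Q"
      show "g (\<kappa> p q \<lhd>\<^bsub>EB\<^esub> env_elt K A a b) = g (\<kappa> p q) \<otimes>\<^bsub>End M\<^esub> f (env_elt K A a b)"
        by (rule End_eqI[of _ M])
          (use a b p q fc[OF ec[OF a b]] in \<open>simp_all add: EM.m_closed EB_ract_kelt gk f_elt lact_in ract_in M.lact_ract\<close>)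
    qed
  qed
  ultimately show ?thesis using g gk by blast
qed

end

text \<open>The four relations of \<open>H\<close> read as identities between operators, in the
  order of \<open>rel_sum\<close>; elements of the opposite algebra act on the right.\<close>

locale pivotal_rep = pivotal_setup K A W D + E: operator_system K A "dualX D" W M E +
    F: operator_system K A W "dualX D" M F
  for K :: "('k, 'kx) ring_scheme" and A :: "('k, 'a, 'ax) module_scheme" (structure)
    and W :: "('a, 'w) bimod" and D :: "('a, 'w, 'x) dual_data" and M :: "('a, 'm) bimod"
    and E :: "'x \<Rightarrow> 'w \<Rightarrow> 'm \<Rightarrow> 'm" and F :: "'w \<Rightarrow> 'x \<Rightarrow> 'm \<Rightarrow> 'm" +
  assumes rel_FE: "x \<in> carrier X \<Longrightarrow> w \<in> carrier W \<Longrightarrow> m \<in> carrier M \<Longrightarrow>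
      finprod M (\<lambda>i. F (om i) x (E (xi i) w m)) I = m \<lhd>\<^bsub>M\<^esub> uevd w x"
    and rel_EF: "x \<in> carrier X \<Longrightarrow> w \<in> carrier W \<Longrightarrow> m \<in> carrier M \<Longrightarrow>
      finprod M (\<lambda>j. E x (\<rho> j) (F w (y j) m)) J = evd x w \<rhd>\<^bsub>M\<^esub> m"
    and rel_EF': "x \<in> carrier X \<Longrightarrow> w \<in> carrier W \<Longrightarrow> m \<in> carrier M \<Longrightarrow>
      finprod M (\<lambda>j. E (y j) w (F (\<rho> j) x m)) J = m \<lhd>\<^bsub>M\<^esub> evd x w"
    and rel_FE': "x \<in> carrier X \<Longrightarrow> w \<in> carrier W \<Longrightarrow> m \<in> carrier M \<Longrightarrow>
      finprod M (\<lambda>i. F w (xi i) (E x (om i) m)) I = uevd w x \<rhd>\<^bsub>M\<^esub> m"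
begin

interpretation A: ring A by (rule ring)
interpretation T: ring T by (rule T_ring)
interpretation MG: comm_group M by (rule E.M.group)
interpretation EM: ring "End M" by (rule End_ring[OF E.M.group])

lemma H_action:
  "\<exists>\<Psi>\<in>ring_hom H (End M).
    (\<forall>a\<in>carrier A. \<forall>m\<in>carrier M. \<Psi> (\<pi> (inA a)) m = a \<rhd>\<^bsub>M\<^esub> m \<and> \<Psi> (\<pi> (inO a)) m = m \<lhd>\<^bsub>M\<^esub> a) \<and>
    (\<forall>x\<in>carrier X. \<forall>w\<in>carrier W. \<forall>m\<in>carrier M.
      \<Psi> (\<pi> (xw x w)) m = E x w m \<and> \<Psi> (\<pi> (wx w x)) m = F w x m)"
proof -
  obtain f where f: "f \<in> ring_hom (env K A) (End M)"
    and f_elt: "\<And>a b. a \<in> carrier A \<Longrightarrow> b \<in> carrier A \<Longrightarrow>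
      f (env_elt K A a b) = (\<lambda>m\<in>carrier M. (a \<rhd>\<^bsub>M\<^esub> m) \<lhd>\<^bsub>M\<^esub> b)"
    using env_action[OF E.M.algebra_bimodule_axioms] by blast
  obtain g where g: "g \<in> hom XW.EB (add_monoid (End M))"
    and gk: "\<And>p q. p \<in> carrier X \<Longrightarrow> q \<in> carrier W \<Longrightarrow> g (XW.\<kappa> p q) = restrict (E p q) (carrier M)"
    and ga: "\<And>e t. e \<in> carrier (env K A) \<Longrightarrow> t \<in> carrier XW.EB \<Longrightarrow>
      g (e \<rhd>\<^bsub>XW.EB\<^esub> t) = f e \<otimes>\<^bsub>End M\<^esub> g t \<and> g (t \<lhd>\<^bsub>XW.EB\<^esub> e) = g t \<otimes>\<^bsub>End M\<^esub> f e"
    using E.env_bimod_action[OF f f_elt] by blast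
  obtain h where h: "h \<in> hom WX.EB (add_monoid (End M))"
    and hk: "\<And>p q. p \<in> carrier W \<Longrightarrow> q \<in> carrier X \<Longrightarrow> h (WX.\<kappa> p q) = restrict (F p q) (carrier M)"
    and ha: "\<And>e t. e \<in> carrier (env K A) \<Longrightarrow> t \<in> carrier WX.EB \<Longrightarrow>
      h (e \<rhd>\<^bsub>WX.EB\<^esub> t) = f e \<otimes>\<^bsub>End M\<^esub> h t \<and> h (t \<lhd>\<^bsub>WX.EB\<^esub> e) = h t \<otimes>\<^bsub>End M\<^esub> f e"
    using F.env_bimod_action[OF f f_elt] by blast
  have [simp]: "g s \<in> carrier (End M)" if "s \<in> carrier XW.EB" for s
    using hom_in_carrier[OF g that] by simp
  have [simp]: "h s \<in> carrier (End M)" if "s \<in> carrier WX.EB" for s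
    using hom_in_carrier[OF h that] by simp
  have [simp]: "f e \<in> carrier (End M)" if "e \<in> carrier (env K A)" for e
    using ring_hom_closed[OF f that] .
  \<comment> \<open>A vector of \<open>Z\<close> is a pair, and the operators for its components are
    added. A generator has a neutral second component, so it acts by its own operator alone.\<close>
  let ?k = "\<lambda>(s, t). g s \<oplus>\<^bsub>End M\<^esub> h t"
  have k: "?k \<in> hom Z (add_monoid (End M))"
  proof (rule homI)
    fix z z' assume "z \<in> carrier Z" "z' \<in> carrier Z"
    then obtain s t s' t' where z: "z = (s, t)" "z' = (s', t')" "s \<in> carrier XW.EB" "t \<in> carrier WX.EB"
      "s' \<in> carrier XW.EB" "t' \<in> carrier WX.EB" by (auto simp: Z_simps)
    then show "?k (z \<otimes>\<^bsub>Z\<^esub> z') = ?k z \<otimes>\<^bsub>add_monoid (End M)\<^esub> ?k z'"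
      using hom_mult[OF g] hom_mult[OF h] by (simp add: Z_simps EM.a_ac)
  qed (auto simp: Z_simps)
  obtain \<Phi> where \<Phi>: "\<Phi> \<in> ring_hom T (End M)"
    and \<Phi>0: "\<And>r. r \<in> carrier (env K A) \<Longrightarrow> \<Phi> (word0 r) = f r"
    and \<Phi>1: "\<And>v. v \<in> carrier Z \<Longrightarrow> \<Phi> (word1 v) = ?k v"
  proof -
    have "\<exists>\<Phi>\<in>ring_hom Z.TA (End M). (\<forall>r\<in>carrier (env K A). \<Phi> (word0 r) = f r) \<and>
        (\<forall>v\<in>carrier Z. \<Phi> (word1 v) = ?k v)"
    proof (rule Z.TA_ring_hom[OF EM.ring_axioms f k])
      fix r v assume r: "r \<in> carrier (env K A)" and "v \<in> carrier Z"
      then obtain s t where v: "v = (s, t)" "s \<in> carrier XW.EB" "t \<in> carrier WX.EB" by (auto simp: Z_simps)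
      show "?k (r \<rhd>\<^bsub>Z\<^esub> v) = f r \<otimes>\<^bsub>End M\<^esub> ?k v" "?k (v \<lhd>\<^bsub>Z\<^esub> r) = ?k v \<otimes>\<^bsub>End M\<^esub> f r"
        using r v ga ha by (simp_all add: Z_simps EM.r_distr EM.l_distr)
    qed
    then show thesis using that unfolding T_eq by blast
  qed
  have one: "g \<one>\<^bsub>XW.EB\<^esub> = \<zero>\<^bsub>End M\<^esub>" "h \<one>\<^bsub>WX.EB\<^esub> = \<zero>\<^bsub>End M\<^esub>"
    using hom_one_comm[OF g XW.EB_group EM.a_comm_group] hom_one_comm[OF h WX.EB_group EM.a_comm_group] by simp_all
  interpret XWG: comm_group XW.EB by (rule XW.EB_group)
  interpret WXG: comm_group WX.EB by (rule WX.EB_group)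
  note [simp] = E.M.lact_one E.M.ract_one E.M.lact_closed E.M.ract_closed
  have A: "\<Phi> (inA a) m = a \<rhd>\<^bsub>M\<^esub> m" "\<Phi> (inO a) m = m \<lhd>\<^bsub>M\<^esub> a" if "a \<in> carrier A" "m \<in> carrier M" for a m
    using that by (simp_all add: in_word \<Phi>0 epsilon_closed f_elt)
  have EE: "\<Phi> (xw x w) m = E x w m" if "x \<in> carrier X" "w \<in> carrier W" "m \<in> carrier M" for x w m
    using that by (simp add: gen_vec vec1_def \<Phi>1 Z_simps XW.kelt_closed gk one EM.r_zero E.op_End)
  have FF: "\<Phi> (wx w x) m = F w x m" if "x \<in> carrier X" "w \<in> carrier W" "m \<in> carrier M" for x w m
    using that by (simp add: gen_vec vec2_def \<Phi>1 Z_simps WX.kelt_closed hk one EM.l_zero F.op_End)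
  have \<Phi>c: "\<Phi> t \<in> carrier (End M)" if "t \<in> carrier T" for t
    using ring_hom_closed[OF \<Phi> that] .
  have \<Phi>h: "\<Phi> \<in> hom (add_monoid T) (add_monoid (End M))"
    using \<Phi>c ring_hom_add[OF \<Phi>] by (auto intro!: homI)
  have sum: "\<Phi> (finsum T u S) m = finprod M (\<lambda>i. \<Phi> (u i) m) S"
    if "\<And>i. i \<in> S \<Longrightarrow> u i \<in> carrier T" "m \<in> carrier M" for u m and S :: "nat set"
  proof -
    have "\<Phi> (finsum T u S) = finsum (End M) (\<lambda>i. \<Phi> (u i)) S"
      unfolding finsum_finprod
      by (rule hom_finprod[OF \<Phi>h]) (use that T.a_comm_group EM.a_comm_group in auto)
    then show ?thesis using that End_finsum_apply[OF E.M.group, of S "\<lambda>i. \<Phi> (u i)" m] \<Phi>c by simp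
  qed
  have mult: "\<Phi> (s \<otimes>\<^bsub>T\<^esub> t) m = \<Phi> s (\<Phi> t m)" if "s \<in> carrier T" "t \<in> carrier T" "m \<in> carrier M" for s t m
    using that by (simp add: ring_hom_mult[OF \<Phi>] End_apply)
  \<comment> \<open>Pushed through sums and products, each defining relation becomes one of the four
    assumptions on E and F.\<close>
  have "\<Phi> (rel_sum k x w) = \<Phi> (rel_value k x w)"
    if k: "k < 4" and x: "x \<in> carrier X" and w: "w \<in> carrier W" for k x w
  proof (rule End_eqI[OF \<Phi>c \<Phi>c])
    fix m assume m: "m \<in> carrier M"
    from k consider "k = 0" | "k = 1" | "k = 2" | "k = 3" by linarith
    then show "\<Phi> (rel_sum k x w) m = \<Phi> (rel_value k x w) m"
    proof cases
      case 1
      have "\<Phi> (rel_sum k x w) m = finprod M (\<lambda>i. \<Phi> (wx (om i) x \<otimes>\<^bsub>T\<^esub> xw (xi i) w) m) I"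
        using sum[OF _ m, of I] sum[OF _ m, of J] m x w by (simp add: 1 rel_sum_def)
      also have "\<dots> = finprod M (\<lambda>i. F (om i) x (E (xi i) w m)) I"
        by (rule MG.finprod_cong') (use m x w in \<open>auto simp: mult EE FF\<close>)
      finally show ?thesis unfolding 1 rel_value_def using m x w by (simp add: rel_FE A)
    next
      case 2
      have "\<Phi> (rel_sum k x w) m = finprod M (\<lambda>j. \<Phi> (xw x (\<rho> j) \<otimes>\<^bsub>T\<^esub> wx w (y j)) m) J"
        using sum[OF _ m, of I] sum[OF _ m, of J] m x w by (simp add: 2 rel_sum_def)
      also have "\<dots> = finprod M (\<lambda>j. E x (\<rho> j) (F w (y j) m)) J"
        by (rule MG.finprod_cong') (use m x w in \<open>auto simp: mult EE FF\<close>)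
      finally show ?thesis unfolding 2 rel_value_def using m x w by (simp add: rel_EF A)
    next
      case 3
      have "\<Phi> (rel_sum k x w) m = finprod M (\<lambda>j. \<Phi> (xw (y j) w \<otimes>\<^bsub>T\<^esub> wx (\<rho> j) x) m) J"
        using sum[OF _ m, of I] sum[OF _ m, of J] m x w by (simp add: 3 rel_sum_def)
      also have "\<dots> = finprod M (\<lambda>j. E (y j) w (F (\<rho> j) x m)) J"
        by (rule MG.finprod_cong') (use m x w in \<open>auto simp: mult EE FF\<close>)
      finally show ?thesis unfolding 3 rel_value_def using m x w by (simp add: rel_EF' A)
    next
      case 4
      have "\<Phi> (rel_sum k x w) m = finprod M (\<lambda>i. \<Phi> (wx w (xi i) \<otimes>\<^bsub>T\<^esub> xw x (om i)) m) I"
        using sum[OF _ m, of I] sum[OF _ m, of J] m x w by (simp add: 4 rel_sum_def)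
      also have "\<dots> = finprod M (\<lambda>i. F w (xi i) (E x (om i) m)) I"
        by (rule MG.finprod_cong') (use m x w in \<open>auto simp: mult EE FF\<close>)
      finally show ?thesis unfolding 4 rel_value_def using m x w by (simp add: rel_FE' A)
    qed
  qed (use x w in simp_all)
  then obtain \<Psi> where "\<Psi> \<in> ring_hom H (End M)" "\<forall>t\<in>carrier T. \<Psi> (\<pi> t) = \<Phi> t"
    using H_hom_factor[OF EM.ring_axioms \<Phi>] by blast
  then show ?thesis using A EE FF by (intro bexI[of _ \<Psi>]) auto
qed

end

section \<open>From a module over \<open>H\<close> to operators on a bimodule\<close>

locale H_module = pivotal_setup K A W D + N: left_module "H_algebra K A W D" N
  for K :: "('k, 'kx) ring_scheme" and A :: "('k, 'a, 'ax) module_scheme" (structure)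
    and W :: "('a, 'w) bimod" and D :: "('a, 'w, 'x) dual_data"
    and N :: "(('a, 'w, 'x) tz set, 'm) lmod"
begin

interpretation A: ring A by (rule ring)
interpretation T: ring T by (rule T_ring)
interpretation H: ring H by (rule H_ring)

text \<open>Acting through representatives in \<open>T\<close> keeps the generators visible; as
  \<pi> is surjective, this still describes the whole action of \<open>H\<close>.\<close>

definition "\<theta> t m = act N (\<pi> t) m"

text \<open>The bimodule underlying \<open>N\<close>: an element of the opposite algebra acts as a
  right multiplication. The guards produce the values that \<open>bimod_extensional\<close> asks
  for.\<close>

definition BN :: "('a, 'm) bimod" where
  "BN = \<lparr>carrier = carrier N, monoid.mult = monoid.mult N, one = one N,
     lact = (\<lambda>a m. if a \<in> carrier A \<and> m \<in> carrier N then \<theta> (inA a) m else undefined),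
     ract = (\<lambda>m a. if a \<in> carrier A \<and> m \<in> carrier N then \<theta> (inO a) m else undefined)\<rparr>"

lemma BN_simps: "carrier BN = carrier N" "m \<otimes>\<^bsub>BN\<^esub> n = m \<otimes>\<^bsub>N\<^esub> n" "\<one>\<^bsub>BN\<^esub> = \<one>\<^bsub>N\<^esub>"
    "a \<in> carrier A \<Longrightarrow> m \<in> carrier N \<Longrightarrow> a \<rhd>\<^bsub>BN\<^esub> m = \<theta> (inA a) m"
    "a \<in> carrier A \<Longrightarrow> m \<in> carrier N \<Longrightarrow> m \<lhd>\<^bsub>BN\<^esub> a = \<theta> (inO a) m"
  by (simp_all add: BN_def)

lemma BN_group: "comm_group BN"
  by (rule comm_group_transfer[OF N.group]) (simp_all add: BN_simps)

lemma pi_closed: "t \<in> carrier T \<Longrightarrow> \<pi> t \<in> carrier H"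
  by (rule ring_hom_closed[OF pi_ring_hom])

lemma \<theta>_closed [simp]: "t \<in> carrier T \<Longrightarrow> m \<in> carrier N \<Longrightarrow> \<theta> t m \<in> carrier N"
  by (simp add: \<theta>_def N.act_closed pi_closed)

lemma \<theta>_add: "s \<in> carrier T \<Longrightarrow> t \<in> carrier T \<Longrightarrow> m \<in> carrier N \<Longrightarrow>
    \<theta> (s \<oplus>\<^bsub>T\<^esub> t) m = \<theta> s m \<otimes>\<^bsub>N\<^esub> \<theta> t m"
  by (simp add: \<theta>_def ring_hom_add[OF pi_ring_hom] N.act_add_left pi_closed)

lemma \<theta>_mult: "s \<in> carrier T \<Longrightarrow> t \<in> carrier T \<Longrightarrow> m \<in> carrier N \<Longrightarrow> \<theta> s (\<theta> t m) = \<theta> (s \<otimes>\<^bsub>T\<^esub> t) m"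
  by (simp add: \<theta>_def ring_hom_mult[OF pi_ring_hom] N.act_mult pi_closed)

lemma \<theta>_one: "m \<in> carrier N \<Longrightarrow> \<theta> \<one>\<^bsub>T\<^esub> m = m"
  by (simp add: \<theta>_def ring_hom_one[OF pi_ring_hom] N.act_one)

lemma \<theta>_hom_m: "t \<in> carrier T \<Longrightarrow> \<theta> t \<in> hom BN BN"
  by (rule homI) (simp_all add: BN_simps, simp add: \<theta>_def pi_closed N.act_add_right)

lemma \<theta>_hom_t: "m \<in> carrier N \<Longrightarrow> (\<lambda>t. \<theta> t m) \<in> hom (add_monoid T) BN"
  by (rule homI) (simp_all add: BN_simps \<theta>_add)

lemma \<theta>_sum:
  assumes "m \<in> carrier N" "\<And>i. i \<in> S \<Longrightarrow> u i \<in> carrier T"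
  shows "\<theta> (finsum T u S) m = finprod BN (\<lambda>i. \<theta> (u i) m) S"
  unfolding finsum_finprod
  by (rule hom_finprod[OF \<theta>_hom_t]) (use assms T.a_comm_group BN_group in auto)

lemma \<theta>_rel: "k < 4 \<Longrightarrow> x \<in> carrier X \<Longrightarrow> w \<in> carrier W \<Longrightarrow>
    \<theta> (rel_sum k x w) m = \<theta> (rel_value k x w) m"
  by (simp add: \<theta>_def pi_rel)

text \<open>That the two actions commute and that scalars act equally on both sides is inherited
  from the enveloping algebra through \<open>in_mult\<close> and \<open>in_scalar\<close>.\<close>

lemma BN_bimodule: "algebra_bimodule K A BN"
proof (intro algebra_bimodule.intro algebra_bimodule_axioms.intro bimodule.intro A.ring_axioms BN_group)
  fix r s m n assume rsm: "r \<in> carrier A" "s \<in> carrier A" "m \<in> carrier BN"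
  then have m: "m \<in> carrier N" by (simp add: BN_simps)
  show "(r \<oplus> s) \<rhd>\<^bsub>BN\<^esub> m = (r \<rhd>\<^bsub>BN\<^esub> m) \<otimes>\<^bsub>BN\<^esub> (s \<rhd>\<^bsub>BN\<^esub> m)"
    "m \<lhd>\<^bsub>BN\<^esub> (r \<oplus> s) = (m \<lhd>\<^bsub>BN\<^esub> r) \<otimes>\<^bsub>BN\<^esub> (m \<lhd>\<^bsub>BN\<^esub> s)"
    "(r \<otimes> s) \<rhd>\<^bsub>BN\<^esub> m = r \<rhd>\<^bsub>BN\<^esub> (s \<rhd>\<^bsub>BN\<^esub> m)"
    "m \<lhd>\<^bsub>BN\<^esub> (r \<otimes> s) = (m \<lhd>\<^bsub>BN\<^esub> r) \<lhd>\<^bsub>BN\<^esub> s"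
    "(r \<rhd>\<^bsub>BN\<^esub> m) \<lhd>\<^bsub>BN\<^esub> s = r \<rhd>\<^bsub>BN\<^esub> (m \<lhd>\<^bsub>BN\<^esub> s)"
    using rsm m by (simp_all add: BN_simps in_add \<theta>_add \<theta>_mult in_mult)
next
  fix r m n assume rmn: "r \<in> carrier A" "m \<in> carrier BN" "n \<in> carrier BN"
  show "r \<rhd>\<^bsub>BN\<^esub> (m \<otimes>\<^bsub>BN\<^esub> n) = (r \<rhd>\<^bsub>BN\<^esub> m) \<otimes>\<^bsub>BN\<^esub> (r \<rhd>\<^bsub>BN\<^esub> n)"
    "(m \<otimes>\<^bsub>BN\<^esub> n) \<lhd>\<^bsub>BN\<^esub> r = (m \<lhd>\<^bsub>BN\<^esub> r) \<otimes>\<^bsub>BN\<^esub> (n \<lhd>\<^bsub>BN\<^esub> r)"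
    using hom_mult[OF \<theta>_hom_m, of _ m n] rmn comm_groupE(1)[OF N.group] by (simp_all add: BN_simps)
next
  fix c m assume "c \<in> carrier K" "m \<in> carrier BN"
  then show "(c \<odot> \<one>) \<rhd>\<^bsub>BN\<^esub> m = m \<lhd>\<^bsub>BN\<^esub> (c \<odot> \<one>)"
    by (simp add: BN_simps scalar_closed in_scalar)
qed (simp_all add: BN_simps in_one \<theta>_one)

sublocale BN: algebra_bimodule K A BN by (rule BN_bimodule)

abbreviation "EN x w \<equiv> \<theta> (xw x w)"
abbreviation "FN w x \<equiv> \<theta> (wx w x)"

lemma EN_system: "operator_system K A X W BN EN"
proof (intro operator_system.intro operator_system_axioms.intro XW.algebra_bimodule_pair_axioms BN_bimodule)
  fix p q m assume *: "p \<in> carrier X" "q \<in> carrier W" "m \<in> carrier BN"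
  then have m: "m \<in> carrier N" by (simp add: BN_simps)
  fix a assume a: "a \<in> carrier A"
  show "\<theta> (xw (a \<rhd>\<^bsub>X\<^esub> p) q) m = a \<rhd>\<^bsub>BN\<^esub> \<theta> (xw p q) m"
    "\<theta> (xw p (q \<lhd>\<^bsub>W\<^esub> a)) m = \<theta> (xw p q) m \<lhd>\<^bsub>BN\<^esub> a"
    "\<theta> (xw (p \<lhd>\<^bsub>X\<^esub> a) q) m = \<theta> (xw p q) (a \<rhd>\<^bsub>BN\<^esub> m)"
    "\<theta> (xw p (a \<rhd>\<^bsub>W\<^esub> q)) m = \<theta> (xw p q) (m \<lhd>\<^bsub>BN\<^esub> a)"
    using * a m by (simp_all add: BN_simps \<theta>_mult in_gen gen_in)
qed (auto simp: BN_simps intro!: \<theta>_hom_m hom_comp[OF gen_hom(1) \<theta>_hom_t] hom_comp[OF gen_hom(2) \<theta>_hom_t])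

lemma FN_system: "operator_system K A W X BN FN"
proof (intro operator_system.intro operator_system_axioms.intro WX.algebra_bimodule_pair_axioms BN_bimodule)
  fix p q m assume *: "p \<in> carrier W" "q \<in> carrier X" "m \<in> carrier BN"
  then have m: "m \<in> carrier N" by (simp add: BN_simps)
  fix a assume a: "a \<in> carrier A"
  show "\<theta> (wx (a \<rhd>\<^bsub>W\<^esub> p) q) m = a \<rhd>\<^bsub>BN\<^esub> \<theta> (wx p q) m"
    "\<theta> (wx p (q \<lhd>\<^bsub>X\<^esub> a)) m = \<theta> (wx p q) m \<lhd>\<^bsub>BN\<^esub> a"
    "\<theta> (wx (p \<lhd>\<^bsub>W\<^esub> a) q) m = \<theta> (wx p q) (a \<rhd>\<^bsub>BN\<^esub> m)"
    "\<theta> (wx p (a \<rhd>\<^bsub>X\<^esub> q)) m = \<theta> (wx p q) (m \<lhd>\<^bsub>BN\<^esub> a)"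
    using * a m by (simp_all add: BN_simps \<theta>_mult in_gen gen_in)
qed (auto simp: BN_simps intro!: \<theta>_hom_m hom_comp[OF gen_hom(3) \<theta>_hom_t] hom_comp[OF gen_hom(4) \<theta>_hom_t])

lemma N_rep: "pivotal_rep K A W D BN EN FN"
proof (intro pivotal_rep.intro pivotal_rep_axioms.intro pivotal_setup_axioms EN_system FN_system)
  interpret MG: comm_group BN by (rule BN_group)
  fix x w m assume x: "x \<in> carrier X" and w: "w \<in> carrier W" and "m \<in> carrier BN"
  then have m: "m \<in> carrier N" by (simp add: BN_simps)
  have I: "finprod BN (\<lambda>i. \<theta> (s i) (\<theta> (t i) m)) S = \<theta> (\<Oplus>\<^bsub>T\<^esub>i\<in>S. s i \<otimes>\<^bsub>T\<^esub> t i) m"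
    if "\<And>i. i \<in> S \<Longrightarrow> s i \<in> carrier T \<and> t i \<in> carrier T" for s t and S :: "nat set"
  proof -
    have "\<theta> (\<Oplus>\<^bsub>T\<^esub>i\<in>S. s i \<otimes>\<^bsub>T\<^esub> t i) m = finprod BN (\<lambda>i. \<theta> (s i \<otimes>\<^bsub>T\<^esub> t i) m) S"
      using that m by (intro \<theta>_sum) auto
    also have "\<dots> = finprod BN (\<lambda>i. \<theta> (s i) (\<theta> (t i) m)) S"
      by (rule MG.finprod_cong') (use that m in \<open>auto simp: \<theta>_mult BN_simps\<close>)
    finally show ?thesis by simp
  qed
  show "finprod BN (\<lambda>i. FN (om i) x (EN (xi i) w m)) I = m \<lhd>\<^bsub>BN\<^esub> uevd w x"
    using \<theta>_rel[of 0 x w m] x w m I[of I "\<lambda>i. wx (om i) x" "\<lambda>i. xw (xi i) w"]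
    by (simp add: rel_sum_def rel_value_def BN_simps)
  show "finprod BN (\<lambda>j. EN x (\<rho> j) (FN w (y j) m)) J = evd x w \<rhd>\<^bsub>BN\<^esub> m"
    using \<theta>_rel[of 1 x w m] x w m I[of J "\<lambda>j. xw x (\<rho> j)" "\<lambda>j. wx w (y j)"]
    by (simp add: rel_sum_def rel_value_def BN_simps)
  show "finprod BN (\<lambda>j. EN (y j) w (FN (\<rho> j) x m)) J = m \<lhd>\<^bsub>BN\<^esub> evd x w"
    using \<theta>_rel[of 2 x w m] x w m I[of J "\<lambda>j. xw (y j) w" "\<lambda>j. wx (\<rho> j) x"]
    by (simp add: rel_sum_def rel_value_def BN_simps)
  show "finprod BN (\<lambda>i. FN w (xi i) (EN x (om i) m)) I = uevd w x \<rhd>\<^bsub>BN\<^esub> m"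
    using \<theta>_rel[of 3 x w m] x w m I[of I "\<lambda>i. wx w (xi i)" "\<lambda>i. xw x (om i)"]
    by (simp add: rel_sum_def rel_value_def BN_simps)
qed

lemma BN_extensional: "lmod_extensional H N \<Longrightarrow> bimod_extensional A BN"
  by (auto simp: lmod_extensional_def bimod_extensional_def BN_def)

end

text \<open>Applied to the identity, this shows that the action of \<open>H\<close> is determined by the action of
  its generators.\<close>

lemma H_linear_iff:
  assumes N: "H_module K A W D N" and N': "H_module K A W D N'" and f: "f \<in> hom N N'"
  shows "(\<forall>h\<in>carrier (H_algebra K A W D). \<forall>m\<in>carrier N. f (act N h m) = act N' h (f m)) \<longleftrightarrow>
    (\<forall>m\<in>carrier N.
      (\<forall>a\<in>carrier A. f (a \<rhd>\<^bsub>H_module.BN K A W D N\<^esub> m) = a \<rhd>\<^bsub>H_module.BN K A W D N'\<^esub> f m) \<and>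
      (\<forall>a\<in>carrier A. f (m \<lhd>\<^bsub>H_module.BN K A W D N\<^esub> a) = f m \<lhd>\<^bsub>H_module.BN K A W D N'\<^esub> a) \<and>
      (\<forall>x\<in>carrier (dualX D). \<forall>w\<in>carrier W.
        f (H_module.\<theta> K A W D N (gen_xw K A W D x w) m) = H_module.\<theta> K A W D N' (gen_xw K A W D x w) (f m) \<and>
        f (H_module.\<theta> K A W D N (gen_wx K A W D w x) m) = H_module.\<theta> K A W D N' (gen_wx K A W D w x) (f m)))"
    (is "?L = ?R")
proof
  interpret N: H_module K A W D N by fact
  interpret N': H_module K A W D N' by fact
  have fc [simp]: "f m \<in> carrier N'" if "m \<in> carrier N" for m
    using hom_in_carrier[OF f that] .
  { assume ?L
    then have "f (N.\<theta> t m) = N'.\<theta> t (f m)" if "t \<in> carrier N.T" "m \<in> carrier N" for t m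
      using N.pi_closed[OF that(1)] that by (simp add: N.\<theta>_def N'.\<theta>_def)
    then show ?R by (simp add: N.BN_simps N'.BN_simps) }
  assume R: ?R
  interpret T: ring N.T by (rule N.T_ring)
  interpret NG: comm_group N by (rule N.N.group)
  interpret NG': comm_group N' by (rule N'.N.group)
  have BG: "comm_group N.BN" "comm_group N'.BN" by (rule N.BN_group, rule N'.BN_group)
  \<comment> \<open>Negatives are one of the cases of \<open>T_induct\<close>; a module action turns
    them into inverses because it is additive in the ring element.\<close>
  have ninv: "N.\<theta> (\<ominus>\<^bsub>N.T\<^esub> t) m = inv\<^bsub>N\<^esub> N.\<theta> t m" if "t \<in> carrier N.T" "m \<in> carrier N" for t m
  proof -
    have "N.\<theta> (\<ominus>\<^bsub>N.T\<^esub> t) m \<otimes>\<^bsub>N\<^esub> N.\<theta> t m = N.\<theta> (\<zero>\<^bsub>N.T\<^esub>) m"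
      using that by (simp add: T.l_neg flip: N.\<theta>_add)
    also have "\<dots> = \<one>\<^bsub>N\<^esub>"
      using hom_one_comm[OF N.\<theta>_hom_t[OF that(2)] T.a_comm_group BG(1)] by (simp add: N.BN_simps)
    finally show ?thesis using that NG.inv_equality[of "N.\<theta> (\<ominus>\<^bsub>N.T\<^esub> t) m" "N.\<theta> t m"] by simp
  qed
  have ninv': "N'.\<theta> (\<ominus>\<^bsub>N.T\<^esub> t) m = inv\<^bsub>N'\<^esub> N'.\<theta> t m" if "t \<in> carrier N.T" "m \<in> carrier N'" for t m
  proof -
    have "N'.\<theta> (\<ominus>\<^bsub>N.T\<^esub> t) m \<otimes>\<^bsub>N'\<^esub> N'.\<theta> t m = N'.\<theta> (\<zero>\<^bsub>N.T\<^esub>) m"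
      using that by (simp add: T.l_neg flip: N'.\<theta>_add)
    also have "\<dots> = \<one>\<^bsub>N'\<^esub>"
      using hom_one_comm[OF N'.\<theta>_hom_t[OF that(2)] T.a_comm_group BG(2)] by (simp add: N'.BN_simps)
    finally show ?thesis using that NG'.inv_equality[of "N'.\<theta> (\<ominus>\<^bsub>N.T\<^esub> t) m" "N'.\<theta> t m"] by simp
  qed
  interpret f: group_hom N N' f using f by unfold_locales
  \<comment> \<open>The elements of \<open>T\<close> whose actions commute with \<open>f\<close>
    form a subring, so the four families of generators suffice.\<close>
  have *: "\<forall>m\<in>carrier N. f (N.\<theta> t m) = N'.\<theta> t (f m)" if "t \<in> carrier N.T" for t
    using that
  proof (induction t rule: N.T_induct)
    case (inA a)
    then show ?case using R by (simp add: N.BN_simps N'.BN_simps)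
  next
    case (inO a)
    then show ?case using R by (simp add: N.BN_simps N'.BN_simps)
  next
    case (add s t)
    then show ?case by (simp add: N.\<theta>_add N'.\<theta>_add)
  next
    case (neg t)
    then show ?case by (simp add: ninv ninv')
  next
    case (mult s t)
    then show ?case by (simp flip: N.\<theta>_mult N'.\<theta>_mult)
  qed (use R in simp_all)
  show ?L
  proof (intro ballI)
    fix h m assume "h \<in> carrier N.H" "m \<in> carrier N"
    then obtain t where "t \<in> carrier N.T" "h = N.\<pi> t" using N.pi_surj by blast
    then show "f (act N h m) = act N' h (f m)"
      using * \<open>m \<in> carrier N\<close> by (simp add: N.\<theta>_def N'.\<theta>_def)
  qed
qed

section \<open>Bimodule maps between tensor products\<close>

lemma left_homD: "f \<in> left_hom R M N \<Longrightarrow> f \<in> hom M N"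
    "f \<in> left_hom R M N \<Longrightarrow> r \<in> carrier R \<Longrightarrow> m \<in> carrier M \<Longrightarrow> f (r \<rhd>\<^bsub>M\<^esub> m) = r \<rhd>\<^bsub>N\<^esub> f m"
  by (simp_all add: left_hom_def)

lemma right_homD: "f \<in> right_hom R M N \<Longrightarrow> f \<in> hom M N"
    "f \<in> right_hom R M N \<Longrightarrow> r \<in> carrier R \<Longrightarrow> m \<in> carrier M \<Longrightarrow> f (m \<lhd>\<^bsub>M\<^esub> r) = f m \<lhd>\<^bsub>N\<^esub> r"
  by (simp_all add: right_hom_def)

lemma bimod_homD: "f \<in> bimod_hom R M N \<Longrightarrow> f \<in> left_hom R M N" "f \<in> bimod_hom R M N \<Longrightarrow> f \<in> right_hom R M N"
    "f \<in> bimod_hom R M N \<Longrightarrow> f \<in> hom M N"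
  by (simp_all add: bimod_hom_def left_hom_def)

lemma id_bimod_hom: "id \<in> bimod_hom R M M" "id \<in> left_hom R M M" "id \<in> right_hom R M M"
  by (auto simp: bimod_hom_def left_hom_def right_hom_def hom_def)

context
  fixes R :: "('r, 'rx) ring_scheme" (structure) and M :: "('r, 'm) bimod" and N :: "('r, 'n) bimod"
    and G :: "('r, 'g) bimod"
  assumes M: "bimodule R M" and N: "bimodule R N" and G: "bimodule R G"
begin

interpretation M: bimodule R M by (rule M)
interpretation N: bimodule R N by (rule N)
interpretation G: bimodule R G by (rule G)

lemma tensor_left_homI:
  assumes h: "h \<in> hom (M \<boxtimes> N) G"
    and "\<And>r m n. r \<in> carrier R \<Longrightarrow> m \<in> carrier M \<Longrightarrow> n \<in> carrier N \<Longrightarrow>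
      h (elt R M N (r \<rhd>\<^bsub>M\<^esub> m) n) = r \<rhd>\<^bsub>G\<^esub> h (elt R M N m n)"
  shows "h \<in> left_hom R (M \<boxtimes> N) G"
  unfolding left_hom_def
proof (intro CollectI conjI h ballI)
  fix r t assume r: "r \<in> carrier R" and t: "t \<in> carrier (M \<boxtimes> N)"
  show "h (r \<rhd>\<^bsub>M \<boxtimes> N\<^esub> t) = r \<rhd>\<^bsub>G\<^esub> h t"
    by (rule tensor_hom_eqI[OF M N hom_comp[OF tensor_lact_hom[OF M N r] h]
          hom_comp[OF h bimod_lact_hom[OF G r]] G.group _ t])
      (simp add: tensor_lact_elt[OF M N] r assms(2))
qed

lemma tensor_right_homI:
  assumes h: "h \<in> hom (M \<boxtimes> N) G"
    and "\<And>r m n. r \<in> carrier R \<Longrightarrow> m \<in> carrier M \<Longrightarrow> n \<in> carrier N \<Longrightarrow>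
      h (elt R M N m (n \<lhd>\<^bsub>N\<^esub> r)) = h (elt R M N m n) \<lhd>\<^bsub>G\<^esub> r"
  shows "h \<in> right_hom R (M \<boxtimes> N) G"
  unfolding right_hom_def
proof (intro CollectI conjI h ballI)
  fix r t assume r: "r \<in> carrier R" and t: "t \<in> carrier (M \<boxtimes> N)"
  show "h (t \<lhd>\<^bsub>M \<boxtimes> N\<^esub> r) = h t \<lhd>\<^bsub>G\<^esub> r"
    by (rule tensor_hom_eqI[OF M N hom_comp[OF tensor_ract_hom[OF M N r] h]
          hom_comp[OF h bimod_ract_hom[OF G r]] G.group _ t])
      (simp add: tensor_ract_elt[OF M N] r assms(2))
qed

end

context
  fixes R :: "('r, 'rx) ring_scheme" (structure) and M :: "('r, 'm) bimod" and N :: "('r, 'n) bimod"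
    and M' :: "('r, 'p) bimod" and N' :: "('r, 'q) bimod" and f g
  assumes M: "bimodule R M" and N: "bimodule R N" and M': "bimodule R M'" and N': "bimodule R N'"
    and f: "f \<in> right_hom R M M'" and g: "g \<in> left_hom R N N'"
begin

text \<open>The inner side of a tensor product involves the right action on the first factor and the
  left action on the second, whence the one-sided linearity of \<open>f\<close> and
  \<open>g\<close>.\<close>

lemma tensor_map_balanced: "balanced R M N (M' \<boxtimes> N') (\<lambda>m n. elt R M' N' (f m) (g n))"
proof (rule balancedI)
  note f' = hom_in_carrier[OF right_homD(1)[OF f]] and g' = hom_in_carrier[OF left_homD(1)[OF g]]
  show "(\<lambda>n. elt R M' N' (f m) (g n)) \<in> hom N (M' \<boxtimes> N')" if "m \<in> carrier M" for m
    by (rule hom_comp[OF left_homD(1)[OF g] elt_hom_right[OF M' N' f'[OF that]]])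
  show "(\<lambda>m. elt R M' N' (f m) (g n)) \<in> hom M (M' \<boxtimes> N')" if "n \<in> carrier N" for n
    by (rule hom_comp[OF right_homD(1)[OF f] elt_hom_left[OF M' N' g'[OF that]]])
  show "elt R M' N' (f (m \<lhd>\<^bsub>M\<^esub> r)) (g n) = elt R M' N' (f m) (g (r \<rhd>\<^bsub>N\<^esub> n))"
    if "m \<in> carrier M" "r \<in> carrier R" "n \<in> carrier N" for m r n
    using that elt_balance[OF M' N'] f' g' by (simp add: right_homD(2)[OF f] left_homD(2)[OF g])
qed

lemma tensor_map_hom: "tensor_map R M N M' N' f g \<in> hom (M \<boxtimes> N) (M' \<boxtimes> N')"
  unfolding tensor_map_def
  by (rule tensor_lift_hom[OF M N tensor_comm_group[OF M' N'] tensor_map_balanced])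

lemma tensor_map_elt: "m \<in> carrier M \<Longrightarrow> n \<in> carrier N \<Longrightarrow>
    tensor_map R M N M' N' f g (elt R M N m n) = elt R M' N' (f m) (g n)"
  unfolding tensor_map_def
  by (rule tensor_lift_elt[OF M N tensor_comm_group[OF M' N'] tensor_map_balanced])

lemma tensor_map_right_hom:
  assumes "g \<in> right_hom R N N'"
  shows "tensor_map R M N M' N' f g \<in> right_hom R (M \<boxtimes> N) (M' \<boxtimes> N')"
  using hom_in_carrier[OF right_homD(1)[OF f]] hom_in_carrier[OF left_homD(1)[OF g]]
  by (intro tensor_right_homI[OF M N tensor_bimodule[OF M' N'] tensor_map_hom])
    (simp add: tensor_map_elt bimodule.ract_closed[OF N] tensor_ract_elt[OF M' N'] right_homD(2)[OF assms])

end

text \<open>The inner lifts in the definitions of the associativity maps.\<close>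

context
  fixes R :: "('r, 'rx) ring_scheme" (structure) and L :: "('r, 'l) bimod" and M :: "('r, 'm) bimod"
    and N :: "('r, 'n) bimod" and G :: "('r, 'g) bimod"
  assumes L: "bimodule R L" and M: "bimodule R M" and N: "bimodule R N" and G: "comm_group G"
begin

text \<open>Every condition is additive in \<open>t\<close>, so it is enough to look at elementary
  tensors, where the assumptions on \<gamma> give it. For fixed \<open>n\<close> the balancing
  between the first two factors is used up in forming the inner lift.\<close>

lemma balanced_inner_left:
  assumes bal: "\<And>n. n \<in> carrier N \<Longrightarrow> balanced R L M G (\<lambda>l m. \<gamma> l m n)"
    and hom: "\<And>l m. l \<in> carrier L \<Longrightarrow> m \<in> carrier M \<Longrightarrow> (\<lambda>n. \<gamma> l m n) \<in> hom N G"
    and mid: "\<And>l m n r. l \<in> carrier L \<Longrightarrow> m \<in> carrier M \<Longrightarrow> n \<in> carrier N \<Longrightarrow> r \<in> carrier R \<Longrightarrow>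
      \<gamma> l (m \<lhd>\<^bsub>M\<^esub> r) n = \<gamma> l m (r \<rhd>\<^bsub>N\<^esub> n)"
  shows "balanced R (L \<boxtimes> M) N G (\<lambda>t n. tensor_lift R L M G (\<lambda>l m. \<gamma> l m n) t)"
proof (rule balancedI)
  interpret M: bimodule R M by (rule M)
  interpret N: bimodule R N by (rule N)
  interpret NG: comm_group N by (rule N.group)
  let ?B = "\<lambda>n. tensor_lift R L M G (\<lambda>l m. \<gamma> l m n)"
  have h: "?B n \<in> hom (L \<boxtimes> M) G" if "n \<in> carrier N" for n
    by (rule tensor_lift_hom[OF L M G bal[OF that]])
  have e: "?B n (elt R L M l m) = \<gamma> l m n" if "n \<in> carrier N" "l \<in> carrier L" "m \<in> carrier M" for l m n
    by (rule tensor_lift_elt[OF L M G bal[OF that(1)] that(2,3)])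
  show "(\<lambda>t. ?B n t) \<in> hom (L \<boxtimes> M) G" if "n \<in> carrier N" for n using h[OF that] .
  show "(\<lambda>n. ?B n t) \<in> hom N G" if t: "t \<in> carrier (L \<boxtimes> M)" for t
  proof (rule homI)
    fix n n' assume n: "n \<in> carrier N" "n' \<in> carrier N"
    show "?B n t \<in> carrier G" by (rule hom_in_carrier[OF h[OF n(1)] t])
    show "?B (n \<otimes>\<^bsub>N\<^esub> n') t = ?B n t \<otimes>\<^bsub>G\<^esub> ?B n' t"
      by (rule tensor_hom_eqI[OF L M h[OF NG.m_closed[OF n]] hom_pointwise_mult[OF h[OF n(1)] h[OF n(2)] G] G _ t])
        (use n in \<open>simp add: e hom_mult[OF hom]\<close>)
  qed
  show "?B n (t \<lhd>\<^bsub>L \<boxtimes> M\<^esub> r) = ?B (r \<rhd>\<^bsub>N\<^esub> n) t"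
    if t: "t \<in> carrier (L \<boxtimes> M)" and r: "r \<in> carrier R" and n: "n \<in> carrier N" for t r n
    by (rule tensor_hom_eqI[OF L M hom_comp[OF tensor_ract_hom[OF L M r] h[OF n]] h[OF N.lact_closed[OF r n]] G _ t])
      (use n r in \<open>simp add: tensor_ract_elt[OF L M] e mid M.ract_closed N.lact_closed\<close>)
qed

lemma balanced_inner_right:
  assumes bal: "\<And>l. l \<in> carrier L \<Longrightarrow> balanced R M N G (\<gamma> l)"
    and hom: "\<And>m n. m \<in> carrier M \<Longrightarrow> n \<in> carrier N \<Longrightarrow> (\<lambda>l. \<gamma> l m n) \<in> hom L G"
    and mid: "\<And>l m n r. l \<in> carrier L \<Longrightarrow> m \<in> carrier M \<Longrightarrow> n \<in> carrier N \<Longrightarrow> r \<in> carrier R \<Longrightarrow>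
      \<gamma> (l \<lhd>\<^bsub>L\<^esub> r) m n = \<gamma> l (r \<rhd>\<^bsub>M\<^esub> m) n"
  shows "balanced R L (M \<boxtimes> N) G (\<lambda>l t. tensor_lift R M N G (\<gamma> l) t)"
proof (rule balancedI)
  interpret M: bimodule R M by (rule M)
  interpret L: bimodule R L by (rule L)
  interpret LG: comm_group L by (rule L.group)
  let ?B = "\<lambda>l. tensor_lift R M N G (\<gamma> l)"
  have h: "?B l \<in> hom (M \<boxtimes> N) G" if "l \<in> carrier L" for l
    by (rule tensor_lift_hom[OF M N G bal[OF that]])
  have e: "?B l (elt R M N m n) = \<gamma> l m n" if "l \<in> carrier L" "m \<in> carrier M" "n \<in> carrier N" for l m n
    by (rule tensor_lift_elt[OF M N G bal[OF that(1)] that(2,3)])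
  show "(\<lambda>t. ?B l t) \<in> hom (M \<boxtimes> N) G" if "l \<in> carrier L" for l using h[OF that] .
  show "(\<lambda>l. ?B l t) \<in> hom L G" if t: "t \<in> carrier (M \<boxtimes> N)" for t
  proof (rule homI)
    fix l l' assume l: "l \<in> carrier L" "l' \<in> carrier L"
    show "?B l t \<in> carrier G" by (rule hom_in_carrier[OF h[OF l(1)] t])
    show "?B (l \<otimes>\<^bsub>L\<^esub> l') t = ?B l t \<otimes>\<^bsub>G\<^esub> ?B l' t"
      by (rule tensor_hom_eqI[OF M N h[OF LG.m_closed[OF l]] hom_pointwise_mult[OF h[OF l(1)] h[OF l(2)] G] G _ t])
        (use l in \<open>simp add: e hom_mult[OF hom]\<close>)
  qed
  show "?B (l \<lhd>\<^bsub>L\<^esub> r) t = ?B l (r \<rhd>\<^bsub>M \<boxtimes> N\<^esub> t)"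
    if l: "l \<in> carrier L" and r: "r \<in> carrier R" and t: "t \<in> carrier (M \<boxtimes> N)" for t r l
    by (rule tensor_hom_eqI[OF M N h[OF L.ract_closed[OF r l]] hom_comp[OF tensor_lact_hom[OF M N r] h[OF l]] G _ t])
      (use l r in \<open>simp add: tensor_lact_elt[OF M N] e mid L.ract_closed M.lact_closed\<close>)
qed

end

context
  fixes R :: "('r, 'rx) ring_scheme" (structure) and L :: "('r, 'l) bimod" and M :: "('r, 'm) bimod"
    and N :: "('r, 'n) bimod"
  assumes L: "bimodule R L" and M: "bimodule R M" and N: "bimodule R N"
begin

interpretation L: bimodule R L by (rule L)
interpretation M: bimodule R M by (rule M)
interpretation N: bimodule R N by (rule N)

private lemmas LM = tensor_bimodule[OF L M]
private lemmas MN = tensor_bimodule[OF M N]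
private lemmas G1 = tensor_comm_group[OF L MN]
private lemmas G2 = tensor_comm_group[OF LM N]

lemma assoc_inner_balanced:
  "n \<in> carrier N \<Longrightarrow> balanced R L M (L \<boxtimes> (M \<boxtimes> N)) (\<lambda>l m. elt R L (M \<boxtimes> N) l (elt R M N m n))"
  by (rule balancedI)
    (auto intro!: hom_comp[OF elt_hom_left[OF M N] elt_hom_right[OF L MN]] elt_hom_left[OF L MN]
      elt_closed[OF M N] simp: elt_balance[OF L MN] elt_closed[OF M N] tensor_lact_elt[OF M N])

lemma assoc_balanced:
  "balanced R (L \<boxtimes> M) N (L \<boxtimes> (M \<boxtimes> N)) (\<lambda>t n. tensor_lift R L M (L \<boxtimes> (M \<boxtimes> N))
       (\<lambda>l m. elt R L (M \<boxtimes> N) l (elt R M N m n)) t)"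
  by (rule balanced_inner_left[OF L M N G1 assoc_inner_balanced])
    (auto intro!: hom_comp[OF elt_hom_right[OF M N] elt_hom_right[OF L MN]] simp: elt_balance[OF M N])

lemma assoc_hom: "assoc R L M N \<in> hom ((L \<boxtimes> M) \<boxtimes> N) (L \<boxtimes> (M \<boxtimes> N))"
  unfolding assoc_def by (rule tensor_lift_hom[OF LM N G1 assoc_balanced])

lemma assoc_elt:
  assumes "l \<in> carrier L" "m \<in> carrier M" "n \<in> carrier N"
  shows "assoc R L M N (elt R (L \<boxtimes> M) N (elt R L M l m) n) = elt R L (M \<boxtimes> N) l (elt R M N m n)"
  unfolding assoc_def
  by (simp add: tensor_lift_elt[OF LM N G1 assoc_balanced] elt_closed[OF L M] assms
      tensor_lift_elt[OF L M G1 assoc_inner_balanced])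

text \<open>In the maps of the theorem the associator is tensored on the right with the identity of
  the dual, and there \<open>tensor_map\<close> wants its first map to be right linear.\<close>

lemma assoc_right_hom: "assoc R L M N \<in> right_hom R ((L \<boxtimes> M) \<boxtimes> N) (L \<boxtimes> (M \<boxtimes> N))"
proof (rule tensor_right_homI[OF LM N tensor_bimodule[OF L MN] assoc_hom])
  fix r t n assume r: "r \<in> carrier R" and t: "t \<in> carrier (L \<boxtimes> M)" and n: "n \<in> carrier N"
  have nr: "n \<lhd>\<^bsub>N\<^esub> r \<in> carrier N" using r n by (rule N.ract_closed)
  show "assoc R L M N (elt R (L \<boxtimes> M) N t (n \<lhd>\<^bsub>N\<^esub> r)) =
      assoc R L M N (elt R (L \<boxtimes> M) N t n) \<lhd>\<^bsub>L \<boxtimes> (M \<boxtimes> N)\<^esub> r"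
    by (rule tensor_hom_eqI[OF L M hom_comp[OF elt_hom_left[OF LM N nr] assoc_hom]
          hom_comp[OF hom_comp[OF elt_hom_left[OF LM N n] assoc_hom] tensor_ract_hom[OF L MN r]] G1 _ t])
      (use r n nr in \<open>simp add: assoc_elt tensor_ract_elt[OF L MN] tensor_ract_elt[OF M N] elt_closed[OF M N]\<close>)
qed

lemma assoc_inv_inner_balanced:
  "l \<in> carrier L \<Longrightarrow> balanced R M N ((L \<boxtimes> M) \<boxtimes> N) (\<lambda>m n. elt R (L \<boxtimes> M) N (elt R L M l m) n)"
  by (rule balancedI)
    (auto intro!: hom_comp[OF elt_hom_right[OF L M] elt_hom_left[OF LM N]] elt_hom_right[OF LM N]
      elt_closed[OF L M] simp: elt_balance[OF LM N, symmetric] elt_closed[OF L M] tensor_ract_elt[OF L M])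

lemma assoc_inv_balanced:
  "balanced R L (M \<boxtimes> N) ((L \<boxtimes> M) \<boxtimes> N) (\<lambda>l t. tensor_lift R M N ((L \<boxtimes> M) \<boxtimes> N)
       (\<lambda>m n. elt R (L \<boxtimes> M) N (elt R L M l m) n) t)"
  by (rule balanced_inner_right[OF L M N G2 assoc_inv_inner_balanced])
    (auto intro!: hom_comp[OF elt_hom_left[OF L M] elt_hom_left[OF LM N]] simp: elt_balance[OF L M])

lemma assoc_inv_hom: "assoc_inv R L M N \<in> hom (L \<boxtimes> (M \<boxtimes> N)) ((L \<boxtimes> M) \<boxtimes> N)"
  unfolding assoc_inv_def by (rule tensor_lift_hom[OF L MN G2 assoc_inv_balanced])

lemma assoc_inv_elt:
  assumes "l \<in> carrier L" "m \<in> carrier M" "n \<in> carrier N"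
  shows "assoc_inv R L M N (elt R L (M \<boxtimes> N) l (elt R M N m n)) = elt R (L \<boxtimes> M) N (elt R L M l m) n"
  unfolding assoc_inv_def
  by (simp add: tensor_lift_elt[OF L MN G2 assoc_inv_balanced] elt_closed[OF M N] assms
      tensor_lift_elt[OF M N G2 assoc_inv_inner_balanced])

lemma assoc_inv_right_hom:
  "assoc_inv R L M N \<in> right_hom R (L \<boxtimes> (M \<boxtimes> N)) ((L \<boxtimes> M) \<boxtimes> N)"
proof (rule tensor_right_homI[OF L MN tensor_bimodule[OF LM N] assoc_inv_hom])
  fix r l t assume r: "r \<in> carrier R" and l: "l \<in> carrier L" and t: "t \<in> carrier (M \<boxtimes> N)"
  show "assoc_inv R L M N (elt R L (M \<boxtimes> N) l (t \<lhd>\<^bsub>M \<boxtimes> N\<^esub> r)) =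
      assoc_inv R L M N (elt R L (M \<boxtimes> N) l t) \<lhd>\<^bsub>(L \<boxtimes> M) \<boxtimes> N\<^esub> r"
    by (rule tensor_hom_eqI[OF M N hom_comp[OF tensor_ract_hom[OF M N r] hom_comp[OF elt_hom_right[OF L MN l] assoc_inv_hom]]
          hom_comp[OF hom_comp[OF elt_hom_right[OF L MN l] assoc_inv_hom] tensor_ract_hom[OF LM N r]] G2 _ t])
      (use r l in \<open>simp add: assoc_inv_elt tensor_ract_elt[OF LM N] tensor_ract_elt[OF M N]
         elt_closed[OF L M] N.ract_closed\<close>)
qed

end

context
  fixes R :: "('r, 'rx) ring_scheme" (structure) and M :: "('r, 'm) bimod"
  assumes M: "bimodule R M"
begin

interpretation M: bimodule R M by (rule M)

private lemmas A = regular_bimodule[OF M.ring]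

lemma lunit_balanced: "balanced R (regular R) M M (\<lambda>r m. r \<rhd>\<^bsub>M\<^esub> m)"
  by (rule balancedI)
    (auto simp: regular_simps M.lact_mult M.lact_add_left M.lact_closed
      intro!: bimod_lact_hom[OF M] homI)

lemma lunit_hom: "lunit R M \<in> hom (regular R \<boxtimes> M) M"
  unfolding lunit_def by (rule tensor_lift_hom[OF A M M.group lunit_balanced])

lemma lunit_elt: "r \<in> carrier R \<Longrightarrow> m \<in> carrier M \<Longrightarrow> lunit R M (elt R (regular R) M r m) = r \<rhd>\<^bsub>M\<^esub> m"
  unfolding lunit_def by (rule tensor_lift_elt[OF A M M.group lunit_balanced]) (simp_all add: regular_simps)

lemma runit_balanced: "balanced R M (regular R) M (\<lambda>m r. m \<lhd>\<^bsub>M\<^esub> r)"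
  by (rule balancedI)
    (auto simp: regular_simps M.ract_mult M.ract_add_right M.ract_closed
      intro!: bimod_ract_hom[OF M] homI)

lemma runit_hom: "runit R M \<in> hom (M \<boxtimes> regular R) M"
  unfolding runit_def by (rule tensor_lift_hom[OF M A M.group runit_balanced])

lemma runit_elt: "r \<in> carrier R \<Longrightarrow> m \<in> carrier M \<Longrightarrow> runit R M (elt R M (regular R) m r) = m \<lhd>\<^bsub>M\<^esub> r"
  unfolding runit_def by (rule tensor_lift_elt[OF M A M.group runit_balanced]) (simp_all add: regular_simps)

lemma unit_inv_hom: "lunit_inv R M \<in> hom M (regular R \<boxtimes> M)" "runit_inv R M \<in> hom M (M \<boxtimes> regular R)"
proof -
  interpret R: ring R by (rule M.ring)
  have "\<one> \<in> carrier (regular R)" by (simp add: regular_simps)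
  then show "lunit_inv R M \<in> hom M (regular R \<boxtimes> M)" "runit_inv R M \<in> hom M (M \<boxtimes> regular R)"
    using elt_hom_right[OF A M] elt_hom_left[OF M A]
    unfolding lunit_inv_def[abs_def] runit_inv_def[abs_def] by blast+
qed

end

section \<open>The two mates of a braiding\<close>

context pivotal_setup
begin

lemmas Wb = W.bimodule_axioms
lemmas Xb = X.bimodule_axioms
lemmas Ab = regular_bimodule[OF ring]

lemma evd_hom: "w \<in> carrier W \<Longrightarrow> (\<lambda>x. evd x w) \<in> hom X (regular A)"
    "x \<in> carrier X \<Longrightarrow> (\<lambda>w. evd x w) \<in> hom W (regular A)"
  unfolding ev2_def
  by (rule hom_comp[OF elt_hom_left[OF Xb Wb] bimod_homD(3)[OF ev_hom]]
      hom_comp[OF elt_hom_right[OF Xb Wb] bimod_homD(3)[OF ev_hom]]; assumption)+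

lemma uevd_hom: "w \<in> carrier W \<Longrightarrow> (\<lambda>x. uevd w x) \<in> hom X (regular A)"
    "x \<in> carrier X \<Longrightarrow> (\<lambda>w. uevd w x) \<in> hom W (regular A)"
  unfolding uev2_def
  by (rule hom_comp[OF elt_hom_left[OF Wb Xb] bimod_homD(3)[OF uev_hom]]
      hom_comp[OF elt_hom_right[OF Wb Xb] bimod_homD(3)[OF uev_hom]]; assumption)+

context
  fixes a x w assumes axw: "a \<in> carrier A" "x \<in> carrier X" "w \<in> carrier W"
begin

lemma evd_lin: "evd (a \<rhd>\<^bsub>X\<^esub> x) w = a \<otimes> evd x w" "evd x (w \<lhd>\<^bsub>W\<^esub> a) = evd x w \<otimes> a"
    "evd (x \<lhd>\<^bsub>X\<^esub> a) w = evd x (a \<rhd>\<^bsub>W\<^esub> w)"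
  using axw left_homD(2)[OF bimod_homD(1)[OF ev_hom], of a "elt A X W x w"]
    right_homD(2)[OF bimod_homD(2)[OF ev_hom], of a "elt A X W x w"]
  by (simp_all add: ev2_def tensor_lact_elt[OF Xb Wb] tensor_ract_elt[OF Xb Wb] elt_closed[OF Xb Wb]
      regular_simps elt_balance[OF Xb Wb])

lemma uevd_lin: "uevd (a \<rhd>\<^bsub>W\<^esub> w) x = a \<otimes> uevd w x" "uevd w (x \<lhd>\<^bsub>X\<^esub> a) = uevd w x \<otimes> a"
    "uevd (w \<lhd>\<^bsub>W\<^esub> a) x = uevd w (a \<rhd>\<^bsub>X\<^esub> x)"
  using axw left_homD(2)[OF bimod_homD(1)[OF uev_hom], of a "elt A W X w x"]
    right_homD(2)[OF bimod_homD(2)[OF uev_hom], of a "elt A W X w x"]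
  by (simp_all add: uev2_def tensor_lact_elt[OF Wb Xb] tensor_ract_elt[OF Wb Xb] elt_closed[OF Wb Xb]
      regular_simps elt_balance[OF Wb Xb])

end

end

locale pivotal_module = pivotal_setup K A W D + M: algebra_bimodule K A M
  for K :: "('k, 'kx) ring_scheme" and A :: "('k, 'a, 'ax) module_scheme" (structure)
    and W :: "('a, 'w) bimod" and D :: "('a, 'w, 'x) dual_data" and M :: "('a, 'm) bimod"
begin

interpretation A: ring A by (rule ring)
interpretation MG: comm_group M by (rule M.group)

lemmas Mb = M.bimodule_axioms
lemmas acts [simp] = M.lact_closed M.ract_closed W.lact_closed W.ract_closed X.lact_closed X.ract_closed

lemma M_hom_scalar: "m \<in> carrier M \<Longrightarrow> (\<lambda>a. a \<rhd>\<^bsub>M\<^esub> m) \<in> hom (regular A) M"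
    "m \<in> carrier M \<Longrightarrow> (\<lambda>a. m \<lhd>\<^bsub>M\<^esub> a) \<in> hom (regular A) M"
  by (auto intro!: homI simp: regular_simps M.lact_add_left M.ract_add_right)

text \<open>The four contractions of a tensor t: \<open>evl x\<close> is (ev \<otimes> id)(x
  \<otimes> t), \<open>evr w\<close> is (id \<otimes> ev)(t \<otimes> w), and \<open>uevl w\<close>,
  \<open>uevr x\<close> are (uev \<otimes> id)(w \<otimes> t), (id \<otimes> uev)(t \<otimes> x).
  With the dual bases they serve as coordinates.\<close>

definition "evl x = tensor_lift A W M M (\<lambda>w m. evd x w \<rhd>\<^bsub>M\<^esub> m)"
definition "evr w = tensor_lift A M X M (\<lambda>m x. m \<lhd>\<^bsub>M\<^esub> evd x w)"
definition "uevl w = tensor_lift A X M M (\<lambda>x m. uevd w x \<rhd>\<^bsub>M\<^esub> m)"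
definition "uevr x = tensor_lift A M W M (\<lambda>m w. m \<lhd>\<^bsub>M\<^esub> uevd w x)"

lemma evl_balanced: "x \<in> carrier X \<Longrightarrow> balanced A W M M (\<lambda>w m. evd x w \<rhd>\<^bsub>M\<^esub> m)"
  by (rule balancedI)
    (auto intro!: bimod_lact_hom[OF Mb] hom_comp[OF evd_hom(2) M_hom_scalar(1)]
      simp: evd_lin M.lact_mult)

lemma evr_balanced: "w \<in> carrier W \<Longrightarrow> balanced A M X M (\<lambda>m x. m \<lhd>\<^bsub>M\<^esub> evd x w)"
  by (rule balancedI)
    (auto intro!: bimod_ract_hom[OF Mb] hom_comp[OF evd_hom(1) M_hom_scalar(2)]
      simp: evd_lin M.ract_mult)

lemma uevl_balanced: "w \<in> carrier W \<Longrightarrow> balanced A X M M (\<lambda>x m. uevd w x \<rhd>\<^bsub>M\<^esub> m)"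
  by (rule balancedI)
    (auto intro!: bimod_lact_hom[OF Mb] hom_comp[OF uevd_hom(1) M_hom_scalar(1)]
      simp: uevd_lin M.lact_mult)

lemma uevr_balanced: "x \<in> carrier X \<Longrightarrow> balanced A M W M (\<lambda>m w. m \<lhd>\<^bsub>M\<^esub> uevd w x)"
  by (rule balancedI)
    (auto intro!: bimod_ract_hom[OF Mb] hom_comp[OF uevd_hom(2) M_hom_scalar(2)]
      simp: uevd_lin M.ract_mult)

lemma ev_homs:
  "x \<in> carrier X \<Longrightarrow> evl x \<in> hom (W \<boxtimes> M) M" "w \<in> carrier W \<Longrightarrow> evr w \<in> hom (M \<boxtimes> X) M"
  "w \<in> carrier W \<Longrightarrow> uevl w \<in> hom (X \<boxtimes> M) M" "x \<in> carrier X \<Longrightarrow> uevr x \<in> hom (M \<boxtimes> W) M"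
  unfolding evl_def evr_def uevl_def uevr_def
  using tensor_lift_hom[OF Wb Mb M.group evl_balanced] tensor_lift_hom[OF Mb Xb M.group evr_balanced]
    tensor_lift_hom[OF Xb Mb M.group uevl_balanced] tensor_lift_hom[OF Mb Wb M.group uevr_balanced]
  by blast+

lemma ev_elts:
  "x \<in> carrier X \<Longrightarrow> w \<in> carrier W \<Longrightarrow> m \<in> carrier M \<Longrightarrow> evl x (elt A W M w m) = evd x w \<rhd>\<^bsub>M\<^esub> m"
  "x \<in> carrier X \<Longrightarrow> w \<in> carrier W \<Longrightarrow> m \<in> carrier M \<Longrightarrow> evr w (elt A M X m x) = m \<lhd>\<^bsub>M\<^esub> evd x w"
  "x \<in> carrier X \<Longrightarrow> w \<in> carrier W \<Longrightarrow> m \<in> carrier M \<Longrightarrow> uevl w (elt A X M x m) = uevd w x \<rhd>\<^bsub>M\<^esub> m"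
  "x \<in> carrier X \<Longrightarrow> w \<in> carrier W \<Longrightarrow> m \<in> carrier M \<Longrightarrow> uevr x (elt A M W m w) = m \<lhd>\<^bsub>M\<^esub> uevd w x"
  unfolding evl_def evr_def uevl_def uevr_def
  by (simp_all add: tensor_lift_elt[OF Wb Mb M.group evl_balanced] tensor_lift_elt[OF Mb Xb M.group evr_balanced]
    tensor_lift_elt[OF Xb Mb M.group uevl_balanced] tensor_lift_elt[OF Mb Wb M.group uevr_balanced])

lemmas ev_closed = ev_homs[THEN hom_in_carrier]

lemma evl_hom_x:
  assumes t: "t \<in> carrier (W \<boxtimes> M)" shows "(\<lambda>x. evl x t) \<in> hom X M"
proof (rule homI)
  interpret XG: comm_group X by (rule X.group)
  fix x x' assume x: "x \<in> carrier X" "x' \<in> carrier X"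
  show "evl x t \<in> carrier M" using x t by (simp add: ev_closed)
  show "evl (x \<otimes>\<^bsub>X\<^esub> x') t = evl x t \<otimes>\<^bsub>M\<^esub> evl x' t"
    by (rule tensor_hom_eqI[OF Wb Mb ev_homs(1)[OF XG.m_closed[OF x]]
          hom_pointwise_mult[OF ev_homs(1)[OF x(1)] ev_homs(1)[OF x(2)] M.group] M.group _ t])
      (use x in \<open>simp add: ev_elts hom_mult[OF evd_hom(1)] regular_simps M.lact_add_left\<close>)
qed

lemma uevr_hom_x:
  assumes t: "t \<in> carrier (M \<boxtimes> W)" shows "(\<lambda>x. uevr x t) \<in> hom X M"
proof (rule homI)
  interpret XG: comm_group X by (rule X.group)
  fix x x' assume x: "x \<in> carrier X" "x' \<in> carrier X"
  show "uevr x t \<in> carrier M" using x t by (simp add: ev_closed)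
  show "uevr (x \<otimes>\<^bsub>X\<^esub> x') t = uevr x t \<otimes>\<^bsub>M\<^esub> uevr x' t"
    by (rule tensor_hom_eqI[OF Mb Wb ev_homs(4)[OF XG.m_closed[OF x]]
          hom_pointwise_mult[OF ev_homs(4)[OF x(1)] ev_homs(4)[OF x(2)] M.group] M.group _ t])
      (use x in \<open>simp add: ev_elts hom_mult[OF uevd_hom(1)] regular_simps M.ract_add_right\<close>)
qed

lemma evl_lin:
  assumes a: "a \<in> carrier A" and x: "x \<in> carrier X" and t: "t \<in> carrier (W \<boxtimes> M)"
  shows "evl (a \<rhd>\<^bsub>X\<^esub> x) t = a \<rhd>\<^bsub>M\<^esub> evl x t" "evl (x \<lhd>\<^bsub>X\<^esub> a) t = evl x (a \<rhd>\<^bsub>W \<boxtimes> M\<^esub> t)"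
    "evl x (t \<lhd>\<^bsub>W \<boxtimes> M\<^esub> a) = evl x t \<lhd>\<^bsub>M\<^esub> a"
proof -
  note simps = ev_elts evd_lin M.lact_mult M.lact_ract tensor_lact_elt[OF Wb Mb] tensor_ract_elt[OF Wb Mb]
  note eq = tensor_hom_eqI[OF Wb Mb _ _ M.group _ t]
  show "evl (a \<rhd>\<^bsub>X\<^esub> x) t = a \<rhd>\<^bsub>M\<^esub> evl x t"
    by (rule eq[OF ev_homs(1) hom_comp[OF ev_homs(1) bimod_lact_hom[OF Mb]]]) (use a x in \<open>simp_all add: simps\<close>)
  show "evl (x \<lhd>\<^bsub>X\<^esub> a) t = evl x (a \<rhd>\<^bsub>W \<boxtimes> M\<^esub> t)"
    by (rule eq[OF ev_homs(1) hom_comp[OF tensor_lact_hom[OF Wb Mb] ev_homs(1)]]) (use a x in \<open>simp_all add: simps\<close>)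
  show "evl x (t \<lhd>\<^bsub>W \<boxtimes> M\<^esub> a) = evl x t \<lhd>\<^bsub>M\<^esub> a"
    by (rule eq[OF hom_comp[OF tensor_ract_hom[OF Wb Mb] ev_homs(1)] hom_comp[OF ev_homs(1) bimod_ract_hom[OF Mb]]])
      (use a x in \<open>simp_all add: simps\<close>)
qed

lemma uevr_lin:
  assumes a: "a \<in> carrier A" and x: "x \<in> carrier X" and t: "t \<in> carrier (M \<boxtimes> W)"
  shows "uevr (x \<lhd>\<^bsub>X\<^esub> a) t = uevr x t \<lhd>\<^bsub>M\<^esub> a" "uevr (a \<rhd>\<^bsub>X\<^esub> x) t = uevr x (t \<lhd>\<^bsub>M \<boxtimes> W\<^esub> a)"
    "uevr x (a \<rhd>\<^bsub>M \<boxtimes> W\<^esub> t) = a \<rhd>\<^bsub>M\<^esub> uevr x t"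
proof -
  note simps = ev_elts uevd_lin M.ract_mult M.lact_ract tensor_lact_elt[OF Mb Wb] tensor_ract_elt[OF Mb Wb]
  note eq = tensor_hom_eqI[OF Mb Wb _ _ M.group _ t]
  show "uevr (x \<lhd>\<^bsub>X\<^esub> a) t = uevr x t \<lhd>\<^bsub>M\<^esub> a"
    by (rule eq[OF ev_homs(4) hom_comp[OF ev_homs(4) bimod_ract_hom[OF Mb]]]) (use a x in \<open>simp_all add: simps\<close>)
  show "uevr (a \<rhd>\<^bsub>X\<^esub> x) t = uevr x (t \<lhd>\<^bsub>M \<boxtimes> W\<^esub> a)"
    by (rule eq[OF ev_homs(4) hom_comp[OF tensor_ract_hom[OF Mb Wb] ev_homs(4)]]) (use a x in \<open>simp_all add: simps\<close>)
  show "uevr x (a \<rhd>\<^bsub>M \<boxtimes> W\<^esub> t) = a \<rhd>\<^bsub>M\<^esub> uevr x t"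
    by (rule eq[OF hom_comp[OF tensor_lact_hom[OF Mb Wb] ev_homs(4)] hom_comp[OF ev_homs(4) bimod_lact_hom[OF Mb]]])
      (use a x in \<open>simp_all add: simps\<close>)
qed

lemma finprod_elt_right:
  assumes "bimodule A P" "bimodule A Q" "p \<in> carrier P" "\<And>i. i \<in> S \<Longrightarrow> q i \<in> carrier Q"
  shows "finprod (P \<boxtimes> Q) (\<lambda>i. elt A P Q p (q i)) S = elt A P Q p (finprod Q q S)"
  using hom_finprod[OF elt_hom_right[OF assms(1-3)] bimodule.group[OF assms(2)] tensor_comm_group[OF assms(1,2)], of S q]
    assms(4) by simp

lemma finprod_elt_left:
  assumes "bimodule A P" "bimodule A Q" "q \<in> carrier Q" "\<And>i. i \<in> S \<Longrightarrow> p i \<in> carrier P"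
  shows "finprod (P \<boxtimes> Q) (\<lambda>i. elt A P Q (p i) q) S = elt A P Q (finprod P p S) q"
  using hom_finprod[OF elt_hom_left[OF assms(1-3)] bimodule.group[OF assms(1)] tensor_comm_group[OF assms(1,2)], of S p]
    assms(4) by simp

text \<open>The dual basis identity \<open>omega_coev\<close> tensored with \<open>M\<close>: in the
  term for w \<otimes> m the scalar ev(x_i \<otimes> w) crosses the tensor sign, and the sum over i
  restores w.\<close>

lemma recon_WM:
  assumes t: "t \<in> carrier (W \<boxtimes> M)"
  shows "finprod (W \<boxtimes> M) (\<lambda>i. elt A W M (om i) (evl (xi i) t)) I = t"
proof (rule tensor_hom_eqI[OF Wb Mb _ _ tensor_comm_group[OF Wb Mb] _ t])
  interpret G: comm_group "W \<boxtimes> M" by (rule tensor_comm_group[OF Wb Mb])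
  show "(\<lambda>t. finprod (W \<boxtimes> M) (\<lambda>i. elt A W M (om i) (evl (xi i) t)) I) \<in> hom (W \<boxtimes> M) (W \<boxtimes> M)"
    by (rule hom_pointwise_finprod[OF hom_comp[OF ev_homs(1) elt_hom_right[OF Wb Mb]]])
      (use G.comm_group_axioms in auto)
  show "(\<lambda>t. t) \<in> hom (W \<boxtimes> M) (W \<boxtimes> M)" by (simp add: hom_def)
  fix w m assume w: "w \<in> carrier W" and m: "m \<in> carrier M"
  have "finprod (W \<boxtimes> M) (\<lambda>i. elt A W M (om i) (evl (xi i) (elt A W M w m))) I =
      finprod (W \<boxtimes> M) (\<lambda>i. elt A W M (om i \<lhd>\<^bsub>W\<^esub> evd (xi i) w) m) I"
    by (rule G.finprod_cong') (use w m in \<open>auto simp: ev_elts elt_balance[OF Wb Mb] elt_closed[OF Wb Mb]\<close>)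
  also have "\<dots> = elt A W M (finprod W (\<lambda>i. om i \<lhd>\<^bsub>W\<^esub> evd (xi i) w) I) m"
    by (rule finprod_elt_left[OF Wb Mb m]) (use w in auto)
  also have "finprod W (\<lambda>i. om i \<lhd>\<^bsub>W\<^esub> evd (xi i) w) I = w"
    by (rule omega_coev[OF w, symmetric])
  finally show "finprod (W \<boxtimes> M) (\<lambda>i. elt A W M (om i) (evl (xi i) (elt A W M w m))) I = elt A W M w m" .
qed

text \<open>The counterpart for the other order of the factors, resting on
  \<open>omega_ucoev\<close>.\<close>

lemma recon_MW:
  assumes t: "t \<in> carrier (M \<boxtimes> W)"
  shows "finprod (M \<boxtimes> W) (\<lambda>j. elt A M W (uevr (y j) t) (\<rho> j)) J = t"
proof (rule tensor_hom_eqI[OF Mb Wb _ _ tensor_comm_group[OF Mb Wb] _ t])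
  interpret G: comm_group "M \<boxtimes> W" by (rule tensor_comm_group[OF Mb Wb])
  show "(\<lambda>t. finprod (M \<boxtimes> W) (\<lambda>j. elt A M W (uevr (y j) t) (\<rho> j)) J) \<in> hom (M \<boxtimes> W) (M \<boxtimes> W)"
    by (rule hom_pointwise_finprod[OF hom_comp[OF ev_homs(4) elt_hom_left[OF Mb Wb]]])
      (use G.comm_group_axioms in auto)
  show "(\<lambda>t. t) \<in> hom (M \<boxtimes> W) (M \<boxtimes> W)" by (simp add: hom_def)
  fix m w assume m: "m \<in> carrier M" and w: "w \<in> carrier W"
  have "finprod (M \<boxtimes> W) (\<lambda>j. elt A M W (uevr (y j) (elt A M W m w)) (\<rho> j)) J =
      finprod (M \<boxtimes> W) (\<lambda>j. elt A M W m (uevd w (y j) \<rhd>\<^bsub>W\<^esub> \<rho> j)) J"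
    by (rule G.finprod_cong') (use w m in \<open>auto simp: ev_elts elt_balance[OF Mb Wb] elt_closed[OF Mb Wb]\<close>)
  also have "\<dots> = elt A M W m (finprod W (\<lambda>j. uevd w (y j) \<rhd>\<^bsub>W\<^esub> \<rho> j) J)"
    by (rule finprod_elt_right[OF Mb Wb m]) (use w in auto)
  also have "finprod W (\<lambda>j. uevd w (y j) \<rhd>\<^bsub>W\<^esub> \<rho> j) J = w"
    by (rule omega_ucoev[OF w, symmetric])
  finally show "finprod (M \<boxtimes> W) (\<lambda>j. elt A M W (uevr (y j) (elt A M W m w)) (\<rho> j)) J = elt A M W m w" .
qed

lemmas WM = tensor_bimodule[OF Wb Mb]
lemmas MW = tensor_bimodule[OF Mb Wb]
lemmas XM = tensor_bimodule[OF Xb Mb]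
lemmas MX = tensor_bimodule[OF Mb Xb]
lemmas bWX = tensor_bimodule[OF Wb Xb]
lemmas bXW = tensor_bimodule[OF Xb Wb]

section \<open>The first map of the theorem, evaluated on elementary tensors\<close>

context
  fixes \<sigma> assumes \<sigma>: "\<sigma> \<in> bimod_hom A (M \<boxtimes> W) (W \<boxtimes> M)"
begin

private lemma id_\<sigma>: "tensor_map A X (M \<boxtimes> W) X (W \<boxtimes> M) id \<sigma> \<in> right_hom A (X \<boxtimes> (M \<boxtimes> W)) (X \<boxtimes> (W \<boxtimes> M))"
  by (rule tensor_map_right_hom[OF Xb MW Xb WM id_bimod_hom(3) bimod_homD(1)[OF \<sigma>] bimod_homD(2)[OF \<sigma>]])

text \<open>The composite is cut after the coevaluation and after \<sigma>, the two places where an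
  elementary tensor ceases to be one.\<close>

private definition "tail =
       lunit A (M \<boxtimes> X)
     \<circ> tensor_map A (X \<boxtimes> W) (M \<boxtimes> X) (regular A) (M \<boxtimes> X) (ev D) id
     \<circ> assoc A (X \<boxtimes> W) M X
     \<circ> tensor_map A (X \<boxtimes> (W \<boxtimes> M)) X ((X \<boxtimes> W) \<boxtimes> M) X (assoc_inv A X W M) id"

private definition "middle =
       tensor_map A (X \<boxtimes> (M \<boxtimes> W)) X (X \<boxtimes> (W \<boxtimes> M)) X
         (tensor_map A X (M \<boxtimes> W) X (W \<boxtimes> M) id \<sigma>) id
     \<circ> tensor_map A ((X \<boxtimes> M) \<boxtimes> W) X (X \<boxtimes> (M \<boxtimes> W)) X (assoc A X M W) id
     \<circ> assoc_inv A (X \<boxtimes> M) W X"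

private definition "front =
       tensor_map A (X \<boxtimes> M) (regular A) (X \<boxtimes> M) (W \<boxtimes> X) id (coev D)
     \<circ> runit_inv A (X \<boxtimes> M)"

private lemma sigma_dual_split: "sigma_dual A W D M \<sigma> = tail \<circ> middle \<circ> front"
  unfolding sigma_dual_def tail_def middle_def front_def Let_def by (simp add: comp_assoc)

private lemma tail_hom: "tail \<in> hom ((X \<boxtimes> (W \<boxtimes> M)) \<boxtimes> X) (M \<boxtimes> X)"
  unfolding tail_def
  by (rule hom_compose[OF tensor_map_hom[OF tensor_bimodule[OF Xb WM] Xb tensor_bimodule[OF bXW Mb] Xb assoc_inv_right_hom[OF Xb Wb Mb] id_bimod_hom(2)]
      hom_compose[OF assoc_hom[OF bXW Mb Xb]
      hom_compose[OF tensor_map_hom[OF bXW MX Ab MX bimod_homD(2)[OF ev_hom] id_bimod_hom(2)]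
      lunit_hom[OF MX]]]])

private lemma middle_hom: "middle \<in> hom ((X \<boxtimes> M) \<boxtimes> (W \<boxtimes> X)) ((X \<boxtimes> (W \<boxtimes> M)) \<boxtimes> X)"
  unfolding middle_def
  by (rule hom_compose[OF assoc_inv_hom[OF XM Wb Xb]
      hom_compose[OF tensor_map_hom[OF tensor_bimodule[OF XM Wb] Xb tensor_bimodule[OF Xb MW] Xb assoc_right_hom[OF Xb Mb Wb] id_bimod_hom(2)]
      tensor_map_hom[OF tensor_bimodule[OF Xb MW] Xb tensor_bimodule[OF Xb WM] Xb id_\<sigma> id_bimod_hom(2)]]])

private lemma front_hom: "front \<in> hom (X \<boxtimes> M) ((X \<boxtimes> M) \<boxtimes> (W \<boxtimes> X))"
  unfolding front_def
  by (rule hom_compose[OF unit_inv_hom(2)[OF XM]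
      tensor_map_hom[OF XM Ab XM bWX id_bimod_hom(3) bimod_homD(1)[OF coev_hom]]])

lemma sigma_dual_hom: "sigma_dual A W D M \<sigma> \<in> hom (X \<boxtimes> M) (M \<boxtimes> X)"
  unfolding sigma_dual_split
  by (rule hom_compose[OF front_hom hom_compose[OF middle_hom tail_hom]])

text \<open>The tensor \<open>t\<close> stays a variable because it will be a value of \<sigma>.
  Additivity in \<open>t\<close> reduces the claim to w \<otimes> m, on which every structural map
  can be evaluated.\<close>

private lemma tail_elt:
  assumes x: "x \<in> carrier X" and x': "x' \<in> carrier X" and t: "t \<in> carrier (W \<boxtimes> M)"
  shows "tail (elt A (X \<boxtimes> (W \<boxtimes> M)) X (elt A X (W \<boxtimes> M) x t) x') = elt A M X (evl x t) x'"
proof (rule tensor_hom_eqI[OF Wb Mb _ _ tensor_comm_group[OF Mb Xb] _ t])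
  show "(\<lambda>t. tail (elt A (X \<boxtimes> (W \<boxtimes> M)) X (elt A X (W \<boxtimes> M) x t) x')) \<in> hom (W \<boxtimes> M) (M \<boxtimes> X)"
    by (rule hom_comp[OF hom_comp[OF elt_hom_right[OF Xb WM x] elt_hom_left[OF tensor_bimodule[OF Xb WM] Xb x']] tail_hom])
  show "(\<lambda>t. elt A M X (evl x t) x') \<in> hom (W \<boxtimes> M) (M \<boxtimes> X)"
    by (rule hom_comp[OF ev_homs(1)[OF x] elt_hom_left[OF Mb Xb x']])
  fix w m assume w: "w \<in> carrier W" and m: "m \<in> carrier M"
  show "tail (elt A (X \<boxtimes> (W \<boxtimes> M)) X (elt A X (W \<boxtimes> M) x (elt A W M w m)) x') =
      elt A M X (evl x (elt A W M w m)) x'"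
    using x x' w m
    by (simp add: tail_def tensor_map_elt[OF tensor_bimodule[OF Xb WM] Xb tensor_bimodule[OF bXW Mb] Xb
        assoc_inv_right_hom[OF Xb Wb Mb] id_bimod_hom(2)] elt_closed[OF Xb WM] elt_closed[OF Wb Mb]
        assoc_inv_elt[OF Xb Wb Mb] assoc_elt[OF bXW Mb Xb] elt_closed[OF Xb Wb]
        tensor_map_elt[OF bXW MX Ab MX bimod_homD(2)[OF ev_hom] id_bimod_hom(2)] elt_closed[OF Mb Xb]
        lunit_elt[OF MX] ev2_def[symmetric] tensor_lact_elt[OF Mb Xb] ev_elts)
qed

private lemma middle_elt:
  assumes "x \<in> carrier X" "m \<in> carrier M" "w \<in> carrier W" "x' \<in> carrier X"
  shows "middle (elt A (X \<boxtimes> M) (W \<boxtimes> X) (elt A X M x m) (elt A W X w x')) =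
    elt A (X \<boxtimes> (W \<boxtimes> M)) X (elt A X (W \<boxtimes> M) x (\<sigma> (elt A M W m w))) x'"
  using assms
  by (simp add: middle_def assoc_inv_elt[OF XM Wb Xb] elt_closed[OF Xb Mb]
      tensor_map_elt[OF tensor_bimodule[OF XM Wb] Xb tensor_bimodule[OF Xb MW] Xb
        assoc_right_hom[OF Xb Mb Wb] id_bimod_hom(2)] elt_closed[OF XM Wb] assoc_elt[OF Xb Mb Wb]
      tensor_map_elt[OF tensor_bimodule[OF Xb MW] Xb tensor_bimodule[OF Xb WM] Xb id_\<sigma> id_bimod_hom(2)]
      elt_closed[OF Xb MW] elt_closed[OF Mb Wb]
      tensor_map_elt[OF Xb MW Xb WM id_bimod_hom(3) bimod_homD(1)[OF \<sigma>]])

text \<open>Expanding coev(1) in the dual basis gives a sum of elementary inputs for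
  \<open>middle\<close>, and both remaining pieces are additive. The vector contracted with x is
  what will be the value of the operator (x, \<omega>_i) at m.\<close>

lemma sigma_dual_elt:
  assumes x: "x \<in> carrier X" and m: "m \<in> carrier M"
  shows "sigma_dual A W D M \<sigma> (elt A X M x m) =
    finprod (M \<boxtimes> X) (\<lambda>i. elt A M X (evl x (\<sigma> (elt A M W m (om i)))) (xi i)) I"
proof -
  let ?XM = "X \<boxtimes> M" and ?WX = "W \<boxtimes> X"
  interpret G: comm_group "M \<boxtimes> X" by (rule tensor_comm_group[OF Mb Xb])
  have t: "elt A X M x m \<in> carrier ?XM" using x m by (rule elt_closed[OF Xb Mb])
  have "front (elt A X M x m) = elt A ?XM ?WX (elt A X M x m) (coev D \<one>)"
    using t by (simp add: front_def runit_inv_def regular_simps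
        tensor_map_elt[OF XM Ab XM bWX id_bimod_hom(3) bimod_homD(1)[OF coev_hom]])
  also have "\<dots> = finprod (?XM \<boxtimes> ?WX) (\<lambda>i. elt A ?XM ?WX (elt A X M x m) (elt A W X (om i) (xi i))) I"
    unfolding coev_one by (rule finprod_elt_right[OF XM bWX t, symmetric]) (auto intro: elt_closed[OF Wb Xb])
  finally have "sigma_dual A W D M \<sigma> (elt A X M x m) =
      (tail \<circ> middle) (finprod (?XM \<boxtimes> ?WX) (\<lambda>i. elt A ?XM ?WX (elt A X M x m) (elt A W X (om i) (xi i))) I)"
    by (simp add: sigma_dual_split)
  also have "\<dots> = finprod (M \<boxtimes> X)
      (\<lambda>i. (tail \<circ> middle) (elt A ?XM ?WX (elt A X M x m) (elt A W X (om i) (xi i)))) I"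
    by (rule hom_finprod[OF hom_compose[OF middle_hom tail_hom] tensor_comm_group[OF XM bWX] G.comm_group_axioms])
      (use t in \<open>auto intro!: elt_closed[OF XM bWX] elt_closed[OF Wb Xb]\<close>)
  also have "\<dots> = finprod (M \<boxtimes> X) (\<lambda>i. elt A M X (evl x (\<sigma> (elt A M W m (om i)))) (xi i)) I"
  proof (rule G.finprod_cong')
    have c: "\<sigma> (elt A M W m (om i)) \<in> carrier (W \<boxtimes> M)" if "i \<in> I" for i
      using that m by (intro hom_in_carrier[OF bimod_homD(3)[OF \<sigma>]] elt_closed[OF Mb Wb]) auto
    show "(\<lambda>i. elt A M X (evl x (\<sigma> (elt A M W m (om i)))) (xi i)) \<in> I \<rightarrow> carrier (M \<boxtimes> X)"
      using x c by (auto intro!: elt_closed[OF Mb Xb] ev_closed)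
    show "(tail \<circ> middle) (elt A ?XM ?WX (elt A X M x m) (elt A W X (om i) (xi i))) =
        elt A M X (evl x (\<sigma> (elt A M W m (om i)))) (xi i)" if "i \<in> I" for i
      using that x m c by (simp add: middle_elt tail_elt)
  qed simp
  finally show ?thesis .
qed

end

section \<open>The second map of the theorem, evaluated on elementary tensors\<close>

context
  fixes \<tau> assumes \<tau>: "\<tau> \<in> bimod_hom A (W \<boxtimes> M) (M \<boxtimes> W)"
begin

private lemma id_\<tau>: "tensor_map A X (W \<boxtimes> M) X (M \<boxtimes> W) id \<tau> \<in> right_hom A (X \<boxtimes> (W \<boxtimes> M)) (X \<boxtimes> (M \<boxtimes> W))"
  by (rule tensor_map_right_hom[OF Xb WM Xb MW id_bimod_hom(3) bimod_homD(1)[OF \<tau>] bimod_homD(2)[OF \<tau>]])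

private definition "tail' =
       runit A (X \<boxtimes> M)
     \<circ> tensor_map A (X \<boxtimes> M) (W \<boxtimes> X) (X \<boxtimes> M) (regular A) id (uev D)
     \<circ> assoc A (X \<boxtimes> M) W X
     \<circ> tensor_map A (X \<boxtimes> (M \<boxtimes> W)) X ((X \<boxtimes> M) \<boxtimes> W) X (assoc_inv A X M W) id"

private definition "middle' =
       tensor_map A (X \<boxtimes> (W \<boxtimes> M)) X (X \<boxtimes> (M \<boxtimes> W)) X
         (tensor_map A X (W \<boxtimes> M) X (M \<boxtimes> W) id \<tau>) id
     \<circ> tensor_map A ((X \<boxtimes> W) \<boxtimes> M) X (X \<boxtimes> (W \<boxtimes> M)) X (assoc A X W M) id
     \<circ> assoc_inv A (X \<boxtimes> W) M X"

private definition "front' =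
       tensor_map A (regular A) (M \<boxtimes> X) (X \<boxtimes> W) (M \<boxtimes> X) (ucoev D) id
     \<circ> lunit_inv A (M \<boxtimes> X)"

private lemma sigma_inv_dual_split: "sigma_inv_dual A W D M \<tau> = tail' \<circ> middle' \<circ> front'"
  unfolding sigma_inv_dual_def tail'_def middle'_def front'_def Let_def by (simp add: comp_assoc)

private lemma tail'_hom: "tail' \<in> hom ((X \<boxtimes> (M \<boxtimes> W)) \<boxtimes> X) (X \<boxtimes> M)"
  unfolding tail'_def
  by (rule hom_compose[OF tensor_map_hom[OF tensor_bimodule[OF Xb MW] Xb tensor_bimodule[OF XM Wb] Xb assoc_inv_right_hom[OF Xb Mb Wb] id_bimod_hom(2)]
      hom_compose[OF assoc_hom[OF XM Wb Xb]
      hom_compose[OF tensor_map_hom[OF XM bWX XM Ab id_bimod_hom(3) bimod_homD(1)[OF uev_hom]]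
      runit_hom[OF XM]]]])

private lemma middle'_hom: "middle' \<in> hom ((X \<boxtimes> W) \<boxtimes> (M \<boxtimes> X)) ((X \<boxtimes> (M \<boxtimes> W)) \<boxtimes> X)"
  unfolding middle'_def
  by (rule hom_compose[OF assoc_inv_hom[OF bXW Mb Xb]
      hom_compose[OF tensor_map_hom[OF tensor_bimodule[OF bXW Mb] Xb tensor_bimodule[OF Xb WM] Xb assoc_right_hom[OF Xb Wb Mb] id_bimod_hom(2)]
      tensor_map_hom[OF tensor_bimodule[OF Xb WM] Xb tensor_bimodule[OF Xb MW] Xb id_\<tau> id_bimod_hom(2)]]])

private lemma front'_hom: "front' \<in> hom (M \<boxtimes> X) ((X \<boxtimes> W) \<boxtimes> (M \<boxtimes> X))"
  unfolding front'_def
  by (rule hom_compose[OF unit_inv_hom(1)[OF MX]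
      tensor_map_hom[OF Ab MX bXW MX bimod_homD(2)[OF ucoev_hom] id_bimod_hom(2)]])

lemma sigma_inv_dual_hom: "sigma_inv_dual A W D M \<tau> \<in> hom (M \<boxtimes> X) (X \<boxtimes> M)"
  unfolding sigma_inv_dual_split
  by (rule hom_compose[OF front'_hom hom_compose[OF middle'_hom tail'_hom]])

private lemma tail'_elt:
  assumes x: "x \<in> carrier X" and x': "x' \<in> carrier X" and t: "t \<in> carrier (M \<boxtimes> W)"
  shows "tail' (elt A (X \<boxtimes> (M \<boxtimes> W)) X (elt A X (M \<boxtimes> W) x t) x') = elt A X M x (uevr x' t)"
proof (rule tensor_hom_eqI[OF Mb Wb _ _ tensor_comm_group[OF Xb Mb] _ t])
  show "(\<lambda>t. tail' (elt A (X \<boxtimes> (M \<boxtimes> W)) X (elt A X (M \<boxtimes> W) x t) x')) \<in> hom (M \<boxtimes> W) (X \<boxtimes> M)"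
    by (rule hom_comp[OF hom_comp[OF elt_hom_right[OF Xb MW x] elt_hom_left[OF tensor_bimodule[OF Xb MW] Xb x']] tail'_hom])
  show "(\<lambda>t. elt A X M x (uevr x' t)) \<in> hom (M \<boxtimes> W) (X \<boxtimes> M)"
    by (rule hom_comp[OF ev_homs(4)[OF x'] elt_hom_right[OF Xb Mb x]])
  fix m w assume w: "w \<in> carrier W" and m: "m \<in> carrier M"
  show "tail' (elt A (X \<boxtimes> (M \<boxtimes> W)) X (elt A X (M \<boxtimes> W) x (elt A M W m w)) x') =
      elt A X M x (uevr x' (elt A M W m w))"
    using x x' w m
    by (simp add: tail'_def tensor_map_elt[OF tensor_bimodule[OF Xb MW] Xb tensor_bimodule[OF XM Wb] Xb
        assoc_inv_right_hom[OF Xb Mb Wb] id_bimod_hom(2)] elt_closed[OF Xb MW] elt_closed[OF Mb Wb]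
        assoc_inv_elt[OF Xb Mb Wb] assoc_elt[OF XM Wb Xb] elt_closed[OF Xb Mb]
        tensor_map_elt[OF XM bWX XM Ab id_bimod_hom(3) bimod_homD(1)[OF uev_hom]] elt_closed[OF Wb Xb]
        runit_elt[OF XM] uev2_def[symmetric] tensor_ract_elt[OF Xb Mb] ev_elts)
qed

private lemma middle'_elt:
  assumes "x \<in> carrier X" "m \<in> carrier M" "w \<in> carrier W" "x' \<in> carrier X"
  shows "middle' (elt A (X \<boxtimes> W) (M \<boxtimes> X) (elt A X W x w) (elt A M X m x')) =
    elt A (X \<boxtimes> (M \<boxtimes> W)) X (elt A X (M \<boxtimes> W) x (\<tau> (elt A W M w m))) x'"
  using assms
  by (simp add: middle'_def assoc_inv_elt[OF bXW Mb Xb] elt_closed[OF Xb Wb]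
      tensor_map_elt[OF tensor_bimodule[OF bXW Mb] Xb tensor_bimodule[OF Xb WM] Xb
        assoc_right_hom[OF Xb Wb Mb] id_bimod_hom(2)] elt_closed[OF bXW Mb] assoc_elt[OF Xb Wb Mb]
      tensor_map_elt[OF tensor_bimodule[OF Xb WM] Xb tensor_bimodule[OF Xb MW] Xb id_\<tau> id_bimod_hom(2)]
      elt_closed[OF Xb WM] elt_closed[OF Wb Mb]
      tensor_map_elt[OF Xb WM Xb MW id_bimod_hom(3) bimod_homD(1)[OF \<tau>]])

text \<open>The mirror image of \<open>sigma_dual_elt\<close>: ucoev(1) is inserted on the left, and
  uev contracts the value of \<tau> with x on the right.\<close>

lemma sigma_inv_dual_elt:
  assumes x: "x \<in> carrier X" and m: "m \<in> carrier M"
  shows "sigma_inv_dual A W D M \<tau> (elt A M X m x) =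
    finprod (X \<boxtimes> M) (\<lambda>j. elt A X M (y j) (uevr x (\<tau> (elt A W M (\<rho> j) m)))) J"
proof -
  let ?MX = "M \<boxtimes> X" and ?XW = "X \<boxtimes> W"
  interpret G: comm_group "X \<boxtimes> M" by (rule tensor_comm_group[OF Xb Mb])
  have t: "elt A M X m x \<in> carrier ?MX" using m x by (rule elt_closed[OF Mb Xb])
  have "front' (elt A M X m x) = elt A ?XW ?MX (ucoev D \<one>) (elt A M X m x)"
    using t by (simp add: front'_def lunit_inv_def regular_simps
        tensor_map_elt[OF Ab MX bXW MX bimod_homD(2)[OF ucoev_hom] id_bimod_hom(2)])
  also have "\<dots> = finprod (?XW \<boxtimes> ?MX) (\<lambda>j. elt A ?XW ?MX (elt A X W (y j) (\<rho> j)) (elt A M X m x)) J"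
    unfolding ucoev_one by (rule finprod_elt_left[OF bXW MX t, symmetric]) (auto intro: elt_closed[OF Xb Wb])
  finally have "sigma_inv_dual A W D M \<tau> (elt A M X m x) =
      (tail' \<circ> middle') (finprod (?XW \<boxtimes> ?MX) (\<lambda>j. elt A ?XW ?MX (elt A X W (y j) (\<rho> j)) (elt A M X m x)) J)"
    by (simp add: sigma_inv_dual_split)
  also have "\<dots> = finprod (X \<boxtimes> M)
      (\<lambda>j. (tail' \<circ> middle') (elt A ?XW ?MX (elt A X W (y j) (\<rho> j)) (elt A M X m x))) J"
    by (rule hom_finprod[OF hom_compose[OF middle'_hom tail'_hom] tensor_comm_group[OF bXW MX] G.comm_group_axioms])
      (use t in \<open>auto intro!: elt_closed[OF bXW MX] elt_closed[OF Xb Wb]\<close>)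
  also have "\<dots> = finprod (X \<boxtimes> M) (\<lambda>j. elt A X M (y j) (uevr x (\<tau> (elt A W M (\<rho> j) m)))) J"
  proof (rule G.finprod_cong')
    have c: "\<tau> (elt A W M (\<rho> j) m) \<in> carrier (M \<boxtimes> W)" if "j \<in> J" for j
      using that m by (intro hom_in_carrier[OF bimod_homD(3)[OF \<tau>]] elt_closed[OF Wb Mb]) auto
    show "(\<lambda>j. elt A X M (y j) (uevr x (\<tau> (elt A W M (\<rho> j) m)))) \<in> J \<rightarrow> carrier (X \<boxtimes> M)"
      using x c by (auto intro!: elt_closed[OF Xb Mb] ev_closed)
    show "(tail' \<circ> middle') (elt A ?XW ?MX (elt A X W (y j) (\<rho> j)) (elt A M X m x)) =
        elt A X M (y j) (uevr x (\<tau> (elt A W M (\<rho> j) m)))" if "j \<in> J" for j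
      using that x m c by (simp add: middle'_elt tail'_elt)
  qed simp
  finally show ?thesis .
qed

end

end

section \<open>Braidings and operator systems\<close>

context operator_system
begin

text \<open>An operator with one index frozen, as a map on tensors in the other index and the
  vector. In this form, and in that of \<open>lift_pm\<close>, operators can be applied to values of
  a braiding, of its inverse and of the two mates, which are sums of elementary tensors.\<close>

definition "lift_mq p = tensor_lift A M Q M (\<lambda>m q. E p q m)"
definition "lift_pm q = tensor_lift A P M M (\<lambda>p m. E p q m)"

lemma lift_mq_balanced: "p \<in> carrier P \<Longrightarrow> balanced A M Q M (\<lambda>m q. E p q m)"
  by (rule balancedI) (auto simp: ract_in hom_q eta_contract_eq hom_m)

lemma lift_pm_balanced: "q \<in> carrier Q \<Longrightarrow> balanced A P M M (\<lambda>p m. E p q m)"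
  by (rule balancedI) (auto simp: lact_in hom_p eta_contract_eq hom_m)

lemma lift_mq_hom: "p \<in> carrier P \<Longrightarrow> lift_mq p \<in> hom (M \<boxtimes> Q) M"
  unfolding lift_mq_def
  by (rule tensor_lift_hom[OF M.bimodule_axioms Q.bimodule_axioms M.group lift_mq_balanced])

lemma lift_pm_hom: "q \<in> carrier Q \<Longrightarrow> lift_pm q \<in> hom (P \<boxtimes> M) M"
  unfolding lift_pm_def
  by (rule tensor_lift_hom[OF P.bimodule_axioms M.bimodule_axioms M.group lift_pm_balanced])

lemma lift_mq_elt: "p \<in> carrier P \<Longrightarrow> q \<in> carrier Q \<Longrightarrow> m \<in> carrier M \<Longrightarrow>
    lift_mq p (elt A M Q m q) = E p q m"
  unfolding lift_mq_def
  by (rule tensor_lift_elt[OF M.bimodule_axioms Q.bimodule_axioms M.group lift_mq_balanced])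

lemma lift_pm_elt: "p \<in> carrier P \<Longrightarrow> q \<in> carrier Q \<Longrightarrow> m \<in> carrier M \<Longrightarrow>
    lift_pm q (elt A P M p m) = E p q m"
  unfolding lift_pm_def
  by (rule tensor_lift_elt[OF P.bimodule_axioms M.bimodule_axioms M.group lift_pm_balanced])

end

lemma inv_into_bimod_hom:
  assumes M: "bimodule R M" and \<sigma>: "\<sigma> \<in> bimod_hom R M N" and bij: "bij_betw \<sigma> (carrier M) (carrier N)"
  shows "inv_into (carrier M) \<sigma> \<in> bimod_hom R N M"
proof -
  interpret M: bimodule R M by fact
  interpret MG: comm_group M by (rule M.group)
  let ?\<tau> = "inv_into (carrier M) \<sigma>"
  have c: "?\<tau> n \<in> carrier M" if "n \<in> carrier N" for n
    using bij that by (simp add: bij_betw_def inv_into_into)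
  have st: "\<sigma> (?\<tau> n) = n" if "n \<in> carrier N" for n
    using bij that by (simp add: bij_betw_inv_into_right)
  have ts: "?\<tau> (\<sigma> m) = m" if "m \<in> carrier M" for m
    using bij that by (simp add: bij_betw_inv_into_left)
  have h: "\<sigma> \<in> hom M N" by (rule bimod_homD(3)[OF \<sigma>])
  have "?\<tau> (n \<otimes>\<^bsub>N\<^esub> n') = ?\<tau> n \<otimes>\<^bsub>M\<^esub> ?\<tau> n'" if "n \<in> carrier N" "n' \<in> carrier N" for n n'
    using ts[of "?\<tau> n \<otimes>\<^bsub>M\<^esub> ?\<tau> n'"] that c by (simp add: hom_mult[OF h] st)
  moreover have "?\<tau> (r \<rhd>\<^bsub>N\<^esub> n) = r \<rhd>\<^bsub>M\<^esub> ?\<tau> n" "?\<tau> (n \<lhd>\<^bsub>N\<^esub> r) = ?\<tau> n \<lhd>\<^bsub>M\<^esub> r"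
    if "r \<in> carrier R" "n \<in> carrier N" for r n
    using ts[of "r \<rhd>\<^bsub>M\<^esub> ?\<tau> n"] ts[of "?\<tau> n \<lhd>\<^bsub>M\<^esub> r"] that c
    by (simp_all add: left_homD(2)[OF bimod_homD(1)[OF \<sigma>]] right_homD(2)[OF bimod_homD(2)[OF \<sigma>]] st
        M.lact_closed M.ract_closed)
  ultimately show ?thesis
    using c by (auto simp: bimod_hom_def left_hom_def right_hom_def hom_def)
qed

section \<open>From a braiding to operators\<close>

locale braided_module = pivotal_module K A W D M
  for K :: "('k, 'kx) ring_scheme" and A :: "('k, 'a, 'ax) module_scheme" (structure)
    and W :: "('a, 'w) bimod" and D :: "('a, 'w, 'x) dual_data" and M :: "('a, 'm) bimod" +
  fixes \<sigma> :: "('m, 'w) tens \<Rightarrow> ('w, 'm) tens"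
  assumes \<sigma>: "\<sigma> \<in> bimod_hom A (M \<boxtimes> W) (W \<boxtimes> M)"
    and bij: "bij_betw \<sigma> (carrier (M \<boxtimes> W)) (carrier (W \<boxtimes> M))"
begin

abbreviation "\<tau> \<equiv> inv_into (carrier (M \<boxtimes> W)) \<sigma>"

lemma \<tau>: "\<tau> \<in> bimod_hom A (W \<boxtimes> M) (M \<boxtimes> W)"
  by (rule inv_into_bimod_hom[OF MW \<sigma> bij])

lemma \<sigma>\<tau>: "t \<in> carrier (W \<boxtimes> M) \<Longrightarrow> \<sigma> (\<tau> t) = t" and \<tau>\<sigma>: "s \<in> carrier (M \<boxtimes> W) \<Longrightarrow> \<tau> (\<sigma> s) = s"
  using bij by (simp_all add: bij_betw_inv_into_right bij_betw_inv_into_left)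

lemma \<sigma>_closed: "s \<in> carrier (M \<boxtimes> W) \<Longrightarrow> \<sigma> s \<in> carrier (W \<boxtimes> M)"
  and \<tau>_closed: "t \<in> carrier (W \<boxtimes> M) \<Longrightarrow> \<tau> t \<in> carrier (M \<boxtimes> W)"
  using hom_in_carrier[OF bimod_homD(3)[OF \<sigma>]] hom_in_carrier[OF bimod_homD(3)[OF \<tau>]] by blast+

definition "E\<sigma> x w m = evl x (\<sigma> (elt A M W m w))"
definition "F\<sigma> w x m = uevr x (\<tau> (elt A W M w m))"

lemmas MWc = elt_closed[OF Mb Wb]
lemmas WMc = elt_closed[OF Wb Mb]

text \<open>The rules about outputs combine linearity of the contraction with right linearity of
  \<sigma>; in those about inputs the scalar passes through \<sigma> or across the tensor sign of m
  \<otimes> w.\<close>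

lemma E_system: "operator_system K A X W M E\<sigma>"
proof (intro operator_system.intro operator_system_axioms.intro XW.algebra_bimodule_pair_axioms M.algebra_bimodule_axioms)
  show "E\<sigma> p q \<in> hom M M" if "p \<in> carrier X" "q \<in> carrier W" for p q
    unfolding E\<sigma>_def[abs_def]
    by (rule hom_comp[OF hom_comp[OF elt_hom_left[OF Mb Wb that(2)] bimod_homD(3)[OF \<sigma>]] ev_homs(1)[OF that(1)]])
  show "(\<lambda>p. E\<sigma> p q m) \<in> hom X M" if "q \<in> carrier W" "m \<in> carrier M" for q m
    unfolding E\<sigma>_def by (rule evl_hom_x[OF \<sigma>_closed[OF MWc]]) (use that in auto)
  show "(\<lambda>q. E\<sigma> p q m) \<in> hom W M" if "p \<in> carrier X" "m \<in> carrier M" for p m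
    unfolding E\<sigma>_def
    by (rule hom_comp[OF hom_comp[OF elt_hom_right[OF Mb Wb that(2)] bimod_homD(3)[OF \<sigma>]] ev_homs(1)[OF that(1)]])
  fix a p q m assume *: "a \<in> carrier A" "p \<in> carrier X" "q \<in> carrier W" "m \<in> carrier M"
  then have t: "elt A M W m q \<in> carrier (M \<boxtimes> W)" by (simp add: MWc)
  note L = left_homD(2)[OF bimod_homD(1)[OF \<sigma>] *(1) t] and R = right_homD(2)[OF bimod_homD(2)[OF \<sigma>] *(1) t]
  show "E\<sigma> (a \<rhd>\<^bsub>X\<^esub> p) q m = a \<rhd>\<^bsub>M\<^esub> E\<sigma> p q m" "E\<sigma> p (q \<lhd>\<^bsub>W\<^esub> a) m = E\<sigma> p q m \<lhd>\<^bsub>M\<^esub> a"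
    "E\<sigma> (p \<lhd>\<^bsub>X\<^esub> a) q m = E\<sigma> p q (a \<rhd>\<^bsub>M\<^esub> m)" "E\<sigma> p (a \<rhd>\<^bsub>W\<^esub> q) m = E\<sigma> p q (m \<lhd>\<^bsub>M\<^esub> a)"
    using * L R t
    by (simp_all add: E\<sigma>_def evl_lin \<sigma>_closed tensor_lact_elt[OF Mb Wb] tensor_ract_elt[OF Mb Wb]
        elt_balance[OF Mb Wb])
qed

lemma F_system: "operator_system K A W X M F\<sigma>"
proof (intro operator_system.intro operator_system_axioms.intro WX.algebra_bimodule_pair_axioms M.algebra_bimodule_axioms)
  show "F\<sigma> p q \<in> hom M M" if "p \<in> carrier W" "q \<in> carrier X" for p q
    unfolding F\<sigma>_def[abs_def]
    by (rule hom_comp[OF hom_comp[OF elt_hom_right[OF Wb Mb that(1)] bimod_homD(3)[OF \<tau>]] ev_homs(4)[OF that(2)]])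
  show "(\<lambda>q. F\<sigma> p q m) \<in> hom X M" if "p \<in> carrier W" "m \<in> carrier M" for p m
    unfolding F\<sigma>_def by (rule uevr_hom_x[OF \<tau>_closed[OF WMc]]) (use that in auto)
  show "(\<lambda>p. F\<sigma> p q m) \<in> hom W M" if "q \<in> carrier X" "m \<in> carrier M" for q m
    unfolding F\<sigma>_def
    by (rule hom_comp[OF hom_comp[OF elt_hom_left[OF Wb Mb that(2)] bimod_homD(3)[OF \<tau>]] ev_homs(4)[OF that(1)]])
  fix a p q m assume *: "a \<in> carrier A" "p \<in> carrier W" "q \<in> carrier X" "m \<in> carrier M"
  then have t: "elt A W M p m \<in> carrier (W \<boxtimes> M)" by (simp add: WMc)
  note L = left_homD(2)[OF bimod_homD(1)[OF \<tau>] *(1) t] and R = right_homD(2)[OF bimod_homD(2)[OF \<tau>] *(1) t]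
  show "F\<sigma> (a \<rhd>\<^bsub>W\<^esub> p) q m = a \<rhd>\<^bsub>M\<^esub> F\<sigma> p q m" "F\<sigma> p (q \<lhd>\<^bsub>X\<^esub> a) m = F\<sigma> p q m \<lhd>\<^bsub>M\<^esub> a"
    "F\<sigma> (p \<lhd>\<^bsub>W\<^esub> a) q m = F\<sigma> p q (a \<rhd>\<^bsub>M\<^esub> m)" "F\<sigma> p (a \<rhd>\<^bsub>X\<^esub> q) m = F\<sigma> p q (m \<lhd>\<^bsub>M\<^esub> a)"
    using * L R t
    by (simp_all add: F\<sigma>_def uevr_lin \<tau>_closed tensor_lact_elt[OF Wb Mb] tensor_ract_elt[OF Wb Mb]
        elt_balance[OF Wb Mb])
qed

sublocale E: operator_system K A X W M E\<sigma> by (rule E_system)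
sublocale F: operator_system K A W X M F\<sigma> by (rule F_system)

interpretation MG: comm_group M by (rule M.group)

abbreviation "\<phi> \<equiv> sigma_dual A W D M \<sigma>"
abbreviation "\<psi> \<equiv> sigma_inv_dual A W D M \<tau>"

lemma phi_elt: "x \<in> carrier X \<Longrightarrow> m \<in> carrier M \<Longrightarrow>
    \<phi> (elt A X M x m) = finprod (M \<boxtimes> X) (\<lambda>i. elt A M X (E\<sigma> x (om i) m) (xi i)) I"
  unfolding E\<sigma>_def by (rule sigma_dual_elt[OF \<sigma>])

lemma psi_elt: "x \<in> carrier X \<Longrightarrow> m \<in> carrier M \<Longrightarrow>
    \<psi> (elt A M X m x) = finprod (X \<boxtimes> M) (\<lambda>j. elt A X M (y j) (F\<sigma> (\<rho> j) x m)) J"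
  unfolding F\<sigma>_def by (rule sigma_inv_dual_elt[OF \<tau>])

text \<open>By \<open>recon_WM\<close> the sum over i reassembles \<sigma>(m \<otimes> w) from its
  contractions, so the left side is a contraction of \<tau>(\<sigma>(m \<otimes> w)) = m \<otimes>
  w.\<close>

lemma rel_FE_\<sigma>:
  assumes "x \<in> carrier X" "w \<in> carrier W" "m \<in> carrier M"
  shows "finprod M (\<lambda>i. F\<sigma> (om i) x (E\<sigma> (xi i) w m)) I = m \<lhd>\<^bsub>M\<^esub> uevd w x"
proof -
  let ?s = "\<sigma> (elt A M W m w)"
  have s: "?s \<in> carrier (W \<boxtimes> M)" using assms by (simp add: \<sigma>_closed MWc)
  have "finprod M (\<lambda>i. uevr x (\<tau> (elt A W M (om i) (evl (xi i) ?s)))) I =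
      uevr x (\<tau> (finprod (W \<boxtimes> M) (\<lambda>i. elt A W M (om i) (evl (xi i) ?s)) I))"
    by (rule hom_finprod[OF hom_comp[OF bimod_homD(3)[OF \<tau>] ev_homs(4)[OF assms(1)]]
          tensor_comm_group[OF Wb Mb] M.group, symmetric])
      (use s in \<open>auto intro!: WMc ev_closed\<close>)
  also have "\<dots> = uevr x (\<tau> ?s)" by (simp only: recon_WM[OF s])
  also have "\<dots> = m \<lhd>\<^bsub>M\<^esub> uevd w x" using assms by (simp add: \<tau>\<sigma> MWc ev_elts)
  finally show ?thesis by (simp add: E\<sigma>_def F\<sigma>_def)
qed

text \<open>As for \<open>rel_FE_\<sigma>\<close>, with \<open>recon_MW\<close> reassembling
  \<tau>(w \<otimes> m), to which \<sigma> is then applied.\<close>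

lemma rel_EF_\<sigma>:
  assumes "x \<in> carrier X" "w \<in> carrier W" "m \<in> carrier M"
  shows "finprod M (\<lambda>j. E\<sigma> x (\<rho> j) (F\<sigma> w (y j) m)) J = evd x w \<rhd>\<^bsub>M\<^esub> m"
proof -
  let ?s = "\<tau> (elt A W M w m)"
  have s: "?s \<in> carrier (M \<boxtimes> W)" using assms by (simp add: \<tau>_closed WMc)
  have "finprod M (\<lambda>j. evl x (\<sigma> (elt A M W (uevr (y j) ?s) (\<rho> j)))) J =
      evl x (\<sigma> (finprod (M \<boxtimes> W) (\<lambda>j. elt A M W (uevr (y j) ?s) (\<rho> j)) J))"
    by (rule hom_finprod[OF hom_comp[OF bimod_homD(3)[OF \<sigma>] ev_homs(1)[OF assms(1)]]
          tensor_comm_group[OF Mb Wb] M.group, symmetric])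
      (use s in \<open>auto intro!: MWc ev_closed\<close>)
  also have "\<dots> = evl x (\<sigma> ?s)" by (simp only: recon_MW[OF s])
  also have "\<dots> = evd x w \<rhd>\<^bsub>M\<^esub> m" using assms by (simp add: \<sigma>\<tau> WMc ev_elts)
  finally show ?thesis by (simp add: E\<sigma>_def F\<sigma>_def)
qed

text \<open>Contraction with w turns each y_j into the coefficient uev(w \<otimes> y_j), which the
  operator absorbs into its index \<rho>_j; the dual basis identity for w collapses the sum. So the
  operators can be read off from the mate \<psi> as well as from \<tau>, which gives access to the
  last two relations.\<close>

lemma uevl_psi:
  assumes x: "x \<in> carrier X" and w: "w \<in> carrier W" and m: "m \<in> carrier M"
  shows "uevl w (\<psi> (elt A M X m x)) = F\<sigma> w x m"
proof -
  have "uevl w (\<psi> (elt A M X m x)) = finprod M (\<lambda>j. uevl w (elt A X M (y j) (F\<sigma> (\<rho> j) x m))) J"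
    unfolding psi_elt[OF x m]
    by (rule hom_finprod[OF ev_homs(3)[OF w] tensor_comm_group[OF Xb Mb] M.group])
      (use x m in \<open>auto intro!: elt_closed[OF Xb Mb]\<close>)
  also have "\<dots> = finprod M (\<lambda>j. F\<sigma> (uevd w (y j) \<rhd>\<^bsub>W\<^esub> \<rho> j) x m) J"
    by (rule MG.finprod_cong') (use x w m in \<open>auto simp: ev_elts F.lact_out\<close>)
  also have "\<dots> = F\<sigma> (finprod W (\<lambda>j. uevd w (y j) \<rhd>\<^bsub>W\<^esub> \<rho> j) J) x m"
    by (rule hom_finprod[OF F.hom_p[OF x m] W.group M.group, symmetric]) (use w in auto)
  also have "finprod W (\<lambda>j. uevd w (y j) \<rhd>\<^bsub>W\<^esub> \<rho> j) J = w" by (rule omega_ucoev[OF w, symmetric])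
  finally show ?thesis .
qed

text \<open>The same reading for \<phi>: the coefficients ev(x_i \<otimes> w) are absorbed into
  \<omega>_i, and \<open>omega_coev\<close> collapses the sum.\<close>

lemma evr_phi:
  assumes x: "x \<in> carrier X" and w: "w \<in> carrier W" and m: "m \<in> carrier M"
  shows "evr w (\<phi> (elt A X M x m)) = E\<sigma> x w m"
proof -
  have "evr w (\<phi> (elt A X M x m)) = finprod M (\<lambda>i. evr w (elt A M X (E\<sigma> x (om i) m) (xi i))) I"
    unfolding phi_elt[OF x m]
    by (rule hom_finprod[OF ev_homs(2)[OF w] tensor_comm_group[OF Mb Xb] M.group])
      (use x m in \<open>auto intro!: elt_closed[OF Mb Xb]\<close>)
  also have "\<dots> = finprod M (\<lambda>i. E\<sigma> x (om i \<lhd>\<^bsub>W\<^esub> evd (xi i) w) m) I"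
    by (rule MG.finprod_cong') (use x w m in \<open>auto simp: ev_elts E.ract_out\<close>)
  also have "\<dots> = E\<sigma> x (finprod W (\<lambda>i. om i \<lhd>\<^bsub>W\<^esub> evd (xi i) w) I) m"
    by (rule hom_finprod[OF E.hom_q[OF x m] W.group M.group, symmetric]) (use w in auto)
  also have "finprod W (\<lambda>i. om i \<lhd>\<^bsub>W\<^esub> evd (xi i) w) I = w" by (rule omega_coev[OF w, symmetric])
  finally show ?thesis .
qed

text \<open>In the last two relations the outer operator is written as a contraction of \<psi> or
  \<phi>. The sum then moves inside and becomes \<phi>(x \<otimes> m) or \<psi>(m \<otimes> x), and
  the hypotheses cancel the two mates.\<close>

lemma braided_rep:
  assumes \<psi>\<phi>: "\<And>t. t \<in> carrier (X \<boxtimes> M) \<Longrightarrow> \<psi> (\<phi> t) = t"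
    and \<phi>\<psi>: "\<And>t. t \<in> carrier (M \<boxtimes> X) \<Longrightarrow> \<phi> (\<psi> t) = t"
  shows "pivotal_rep K A W D M E\<sigma> F\<sigma>"
proof (intro pivotal_rep.intro pivotal_rep_axioms.intro pivotal_setup_axioms E_system F_system rel_FE_\<sigma> rel_EF_\<sigma>)
  fix x w m assume x: "x \<in> carrier X" and w: "w \<in> carrier W" and m: "m \<in> carrier M"
  have "finprod M (\<lambda>i. F\<sigma> w (xi i) (E\<sigma> x (om i) m)) I =
      finprod M (\<lambda>i. uevl w (\<psi> (elt A M X (E\<sigma> x (om i) m) (xi i)))) I"
    by (rule MG.finprod_cong') (use x w m in \<open>auto simp: uevl_psi\<close>)
  also have "\<dots> = uevl w (\<psi> (finprod (M \<boxtimes> X) (\<lambda>i. elt A M X (E\<sigma> x (om i) m) (xi i)) I))"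
    by (rule hom_finprod[OF hom_comp[OF sigma_inv_dual_hom[OF \<tau>] ev_homs(3)[OF w]]
          tensor_comm_group[OF Mb Xb] M.group, symmetric])
      (use x m in \<open>auto intro!: elt_closed[OF Mb Xb]\<close>)
  also have "\<dots> = uevl w (elt A X M x m)"
    unfolding phi_elt[OF x m, symmetric] using x m by (simp add: \<psi>\<phi> elt_closed[OF Xb Mb])
  finally show "finprod M (\<lambda>i. F\<sigma> w (xi i) (E\<sigma> x (om i) m)) I = uevd w x \<rhd>\<^bsub>M\<^esub> m"
    using x w m by (simp add: ev_elts)
  have "finprod M (\<lambda>j. E\<sigma> (y j) w (F\<sigma> (\<rho> j) x m)) J =
      finprod M (\<lambda>j. evr w (\<phi> (elt A X M (y j) (F\<sigma> (\<rho> j) x m)))) J"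
    by (rule MG.finprod_cong') (use x w m in \<open>auto simp: evr_phi\<close>)
  also have "\<dots> = evr w (\<phi> (finprod (X \<boxtimes> M) (\<lambda>j. elt A X M (y j) (F\<sigma> (\<rho> j) x m)) J))"
    by (rule hom_finprod[OF hom_comp[OF sigma_dual_hom[OF \<sigma>] ev_homs(2)[OF w]]
          tensor_comm_group[OF Xb Mb] M.group, symmetric])
      (use x m in \<open>auto intro!: elt_closed[OF Xb Mb]\<close>)
  also have "\<dots> = evr w (elt A M X m x)"
    unfolding psi_elt[OF x m, symmetric] using x m by (simp add: \<phi>\<psi> elt_closed[OF Mb Xb])
  finally show "finprod M (\<lambda>j. E\<sigma> (y j) w (F\<sigma> (\<rho> j) x m)) J = m \<lhd>\<^bsub>M\<^esub> evd x w"
    using x w m by (simp add: ev_elts)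
qed

end

section \<open>From operators to a braiding\<close>

definition (in pivotal_setup) rep_braiding ::
  "('a, 'm) bimod \<Rightarrow> ('x \<Rightarrow> 'w \<Rightarrow> 'm \<Rightarrow> 'm) \<Rightarrow> ('m, 'w) tens \<Rightarrow> ('w, 'm) tens" where
  "rep_braiding M E = tensor_lift A M W (W \<boxtimes> M)
     (\<lambda>m w. finprod (W \<boxtimes> M) (\<lambda>i. elt A W M (om i) (E (xi i) w m)) I)"

context pivotal_rep
begin

sublocale PM: pivotal_module K A W D M
  by (intro pivotal_module.intro pivotal_setup_axioms E.M.algebra_bimodule_axioms)

interpretation MG: comm_group M by (rule E.M.group)
interpretation A: ring A by (rule ring)

lemmas Mb = PM.Mb
lemmas [simp] = PM.acts
lemmas WMG = tensor_comm_group[OF Wb Mb]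
lemmas MWG = tensor_comm_group[OF Mb Wb]

abbreviation "\<sigma> \<equiv> rep_braiding M E"

text \<open>A scalar crossing from m to w is the rule \<open>ract_in\<close>, applied in each
  summand; additivity is that of the operators in the vector and in w.\<close>

lemma braiding_balanced:
  "balanced A M W (W \<boxtimes> M) (\<lambda>m w. finprod (W \<boxtimes> M) (\<lambda>i. elt A W M (om i) (E (xi i) w m)) I)"
proof (rule balancedI)
  show "(\<lambda>w. finprod (W \<boxtimes> M) (\<lambda>i. elt A W M (om i) (E (xi i) w m)) I) \<in> hom W (W \<boxtimes> M)"
    if "m \<in> carrier M" for m
    by (rule hom_pointwise_finprod[OF hom_comp[OF E.hom_q elt_hom_right[OF Wb Mb]] W.group WMG])
      (use that in auto)
  show "(\<lambda>m. finprod (W \<boxtimes> M) (\<lambda>i. elt A W M (om i) (E (xi i) w m)) I) \<in> hom M (W \<boxtimes> M)"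
    if "w \<in> carrier W" for w
    by (rule hom_pointwise_finprod[OF hom_comp[OF E.hom_m elt_hom_right[OF Wb Mb]] E.M.group WMG])
      (use that in auto)
  interpret G: comm_group "W \<boxtimes> M" by (rule WMG)
  show "finprod (W \<boxtimes> M) (\<lambda>i. elt A W M (om i) (E (xi i) w (m \<lhd>\<^bsub>M\<^esub> a))) I =
      finprod (W \<boxtimes> M) (\<lambda>i. elt A W M (om i) (E (xi i) (a \<rhd>\<^bsub>W\<^esub> w) m)) I"
    if "m \<in> carrier M" "a \<in> carrier A" "w \<in> carrier W" for m a w
    by (rule G.finprod_cong') (use that in \<open>auto simp: E.ract_in intro!: elt_closed[OF Wb Mb]\<close>)
qed

lemma \<sigma>_hom: "\<sigma> \<in> hom (M \<boxtimes> W) (W \<boxtimes> M)"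
  unfolding rep_braiding_def by (rule tensor_lift_hom[OF Mb Wb WMG braiding_balanced])

lemma \<sigma>_elt: "m \<in> carrier M \<Longrightarrow> w \<in> carrier W \<Longrightarrow>
    \<sigma> (elt A M W m w) = finprod (W \<boxtimes> M) (\<lambda>i. elt A W M (om i) (E (xi i) w m)) I"
  unfolding rep_braiding_def by (rule tensor_lift_elt[OF Mb Wb WMG braiding_balanced])

lemma \<sigma>_extensional: "\<sigma> \<in> extensional (carrier (M \<boxtimes> W))"
  unfolding rep_braiding_def by (rule tensor_lift_extensional[OF Mb Wb WMG braiding_balanced])

lemma \<sigma>_closed: "t \<in> carrier (M \<boxtimes> W) \<Longrightarrow> \<sigma> t \<in> carrier (W \<boxtimes> M)"
  by (rule hom_in_carrier[OF \<sigma>_hom])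

text \<open>Left linearity amounts to \<open>coev(1) a = a coev(1)\<close>.\<close>

lemma \<sigma>_lact:
  assumes a: "a \<in> carrier A" and m: "m \<in> carrier M" and w: "w \<in> carrier W"
  shows "\<sigma> (elt A M W (a \<rhd>\<^bsub>M\<^esub> m) w) = a \<rhd>\<^bsub>W \<boxtimes> M\<^esub> \<sigma> (elt A M W m w)"
proof -
  interpret G: comm_group "W \<boxtimes> M" by (rule WMG)
  interpret B: bimodule A "W \<boxtimes> X" by (rule PM.bWX)
  have bal: "balanced A W X (W \<boxtimes> M) (\<lambda>w' x. elt A W M w' (E x w m))"
    by (rule balancedI)
      (use m w in \<open>auto intro!: hom_comp[OF E.hom_p elt_hom_right[OF Wb Mb]] elt_hom_left[OF Wb Mb]
        simp: E.lact_out elt_balance[OF Wb Mb]\<close>)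
  \<comment> \<open>With m and w frozen, the sum that defines \<sigma>(m \<otimes> w) is the value
    at coev(1) of this map. The map is left linear, while \<open>lact_in\<close> lets a left factor
    of m appear as a right factor of coev(1).\<close>
  define h where "h = tensor_lift A W X (W \<boxtimes> M) (\<lambda>w' x. elt A W M w' (E x w m))"
  have h: "h \<in> hom (W \<boxtimes> X) (W \<boxtimes> M)"
    unfolding h_def by (rule tensor_lift_hom[OF Wb Xb WMG bal])
  have he: "h (elt A W X w' x) = elt A W M w' (E x w m)" if "w' \<in> carrier W" "x \<in> carrier X" for w' x
    unfolding h_def by (rule tensor_lift_elt[OF Wb Xb WMG bal that])
  have c1: "coev D \<one> \<in> carrier (W \<boxtimes> X)"
    using hom_in_carrier[OF bimod_homD(3)[OF coev_hom], of "\<one>"] by (simp add: regular_simps)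
  \<comment> \<open>Both sides are coev(a), since coev is linear on either side.\<close>
  have swap: "a \<rhd>\<^bsub>W \<boxtimes> X\<^esub> coev D \<one> = coev D \<one> \<lhd>\<^bsub>W \<boxtimes> X\<^esub> a"
    using left_homD(2)[OF bimod_homD(1)[OF coev_hom] a, of "\<one>"]
      right_homD(2)[OF bimod_homD(2)[OF coev_hom] a, of "\<one>"] a by (simp add: regular_simps)
  have sum: "f (coev D \<one>) = finprod (W \<boxtimes> M) (\<lambda>i. f (elt A W X (om i) (xi i))) I"
    if "f \<in> hom (W \<boxtimes> X) (W \<boxtimes> M)" for f
    unfolding coev_one by (rule hom_finprod[OF that tensor_comm_group[OF Wb Xb] WMG]) (auto intro: elt_closed[OF Wb Xb])
  have "h (coev D \<one> \<lhd>\<^bsub>W \<boxtimes> X\<^esub> a) =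
      finprod (W \<boxtimes> M) (\<lambda>i. h (elt A W X (om i) (xi i) \<lhd>\<^bsub>W \<boxtimes> X\<^esub> a)) I"
    by (rule sum[OF hom_comp[OF tensor_ract_hom[OF Wb Xb a] h]])
  also have "\<dots> = \<sigma> (elt A M W (a \<rhd>\<^bsub>M\<^esub> m) w)"
    unfolding \<sigma>_elt[OF E.M.lact_closed[OF a m] w]
    by (rule G.finprod_cong')
      (use a m w in \<open>auto simp: tensor_ract_elt[OF Wb Xb] he E.lact_in intro!: elt_closed[OF Wb Mb]\<close>)
  finally have 1: "\<sigma> (elt A M W (a \<rhd>\<^bsub>M\<^esub> m) w) = h (coev D \<one> \<lhd>\<^bsub>W \<boxtimes> X\<^esub> a)" by simp
  have "h (a \<rhd>\<^bsub>W \<boxtimes> X\<^esub> coev D \<one>) = a \<rhd>\<^bsub>W \<boxtimes> M\<^esub> h (coev D \<one>)"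
    by (rule tensor_hom_eqI[OF Wb Xb hom_comp[OF tensor_lact_hom[OF Wb Xb a] h]
          hom_comp[OF h tensor_lact_hom[OF Wb Mb a]] WMG _ c1])
      (use a m w in \<open>simp add: tensor_lact_elt[OF Wb Xb] tensor_lact_elt[OF Wb Mb] he\<close>)
  moreover have "h (coev D \<one>) = \<sigma> (elt A M W m w)"
    unfolding \<sigma>_elt[OF m w] sum[OF h]
    by (rule G.finprod_cong') (use m w in \<open>auto simp: he intro!: elt_closed[OF Wb Mb]\<close>)
  ultimately show ?thesis using 1 swap by simp
qed

lemma \<sigma>_bimod_hom: "\<sigma> \<in> bimod_hom A (M \<boxtimes> W) (W \<boxtimes> M)"
  unfolding bimod_hom_def
proof (intro IntI tensor_left_homI[OF Mb Wb PM.WM \<sigma>_hom] tensor_right_homI[OF Mb Wb PM.WM \<sigma>_hom] \<sigma>_lact)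
  interpret G: comm_group "W \<boxtimes> M" by (rule WMG)
  fix a m w assume a: "a \<in> carrier A" and m: "m \<in> carrier M" and w: "w \<in> carrier W"
  have "\<sigma> (elt A M W m w) \<lhd>\<^bsub>W \<boxtimes> M\<^esub> a =
      finprod (W \<boxtimes> M) (\<lambda>i. elt A W M (om i) (E (xi i) w m) \<lhd>\<^bsub>W \<boxtimes> M\<^esub> a) I"
    unfolding \<sigma>_elt[OF m w]
    by (rule hom_finprod[OF tensor_ract_hom[OF Wb Mb a] WMG WMG]) (use m w in \<open>auto intro!: elt_closed[OF Wb Mb]\<close>)
  also have "\<dots> = \<sigma> (elt A M W m (w \<lhd>\<^bsub>W\<^esub> a))"
    unfolding \<sigma>_elt[OF m W.ract_closed[OF a w]]
    by (rule G.finprod_cong')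
      (use a m w in \<open>auto simp: tensor_ract_elt[OF Wb Mb] E.ract_out intro!: elt_closed[OF Wb Mb]\<close>)
  finally show "\<sigma> (elt A M W m (w \<lhd>\<^bsub>W\<^esub> a)) = \<sigma> (elt A M W m w) \<lhd>\<^bsub>W \<boxtimes> M\<^esub> a" by simp
qed

text \<open>The candidate for the inverse of \<sigma>, available before \<sigma> is known to be
  invertible; \<open>lift_pm\<close> extends the formula on w \<otimes> m to all tensors.\<close>

definition "\<tau>0 s = finprod (M \<boxtimes> W) (\<lambda>j. elt A M W (F.lift_pm (y j) s) (\<rho> j)) J"

lemma \<tau>0_hom: "\<tau>0 \<in> hom (W \<boxtimes> M) (M \<boxtimes> W)"
  unfolding \<tau>0_def[abs_def]
  by (rule hom_pointwise_finprod[OF hom_comp[OF F.lift_pm_hom elt_hom_left[OF Mb Wb]] WMG MWG]) auto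

text \<open>The formula for \<sigma> at a general tensor, in the form in which it can be applied to
  values of \<open>\<tau>0\<close>.\<close>

lemma \<sigma>_sum: "t \<in> carrier (M \<boxtimes> W) \<Longrightarrow>
    \<sigma> t = finprod (W \<boxtimes> M) (\<lambda>i. elt A W M (om i) (E.lift_mq (xi i) t)) I"
proof (rule tensor_hom_eqI[OF Mb Wb \<sigma>_hom _ WMG])
  interpret G: comm_group "W \<boxtimes> M" by (rule WMG)
  show "(\<lambda>t. finprod (W \<boxtimes> M) (\<lambda>i. elt A W M (om i) (E.lift_mq (xi i) t)) I) \<in> hom (M \<boxtimes> W) (W \<boxtimes> M)"
    by (rule hom_pointwise_finprod[OF hom_comp[OF E.lift_mq_hom elt_hom_right[OF Wb Mb]] MWG WMG]) auto
  show "\<sigma> (elt A M W m w) = finprod (W \<boxtimes> M) (\<lambda>i. elt A W M (om i) (E.lift_mq (xi i) (elt A M W m w))) I"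
    if "m \<in> carrier M" "w \<in> carrier W" for m w
    unfolding \<sigma>_elt[OF that]
    by (rule G.finprod_cong') (use that in \<open>auto simp: E.lift_mq_elt intro!: elt_closed[OF Wb Mb]\<close>)
qed

text \<open>The coefficients ev(x \<otimes> \<omega>_i) are absorbed into the first index of the
  operator, where \<open>x_coev\<close> sums them to x. This recovers E from \<sigma>.\<close>

lemma evl_\<sigma>:
  assumes x: "x \<in> carrier X" and m: "m \<in> carrier M" and w: "w \<in> carrier W"
  shows "PM.evl x (\<sigma> (elt A M W m w)) = E x w m"
proof -
  have "PM.evl x (\<sigma> (elt A M W m w)) = finprod M (\<lambda>i. PM.evl x (elt A W M (om i) (E (xi i) w m))) I"
    unfolding \<sigma>_elt[OF m w]
    by (rule hom_finprod[OF PM.ev_homs(1)[OF x] WMG E.M.group]) (use m w in \<open>auto intro!: elt_closed[OF Wb Mb]\<close>)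
  also have "\<dots> = finprod M (\<lambda>i. E (evd x (om i) \<rhd>\<^bsub>X\<^esub> xi i) w m) I"
    by (rule MG.finprod_cong') (use x w m in \<open>auto simp: PM.ev_elts E.lact_out\<close>)
  also have "\<dots> = E (finprod X (\<lambda>i. evd x (om i) \<rhd>\<^bsub>X\<^esub> xi i) I) w m"
    by (rule hom_finprod[OF E.hom_p[OF w m] X.group E.M.group, symmetric]) (use x in auto)
  also have "finprod X (\<lambda>i. evd x (om i) \<rhd>\<^bsub>X\<^esub> xi i) I = x" by (rule x_coev[OF x, symmetric])
  finally show ?thesis .
qed

text \<open>The coefficients uev(\<rho>_j \<otimes> x) are absorbed on the right of y_j, where
  \<open>x_ucoev\<close> sums them to x.\<close>

lemma uevr_\<tau>0:
  assumes x: "x \<in> carrier X" and m: "m \<in> carrier M" and w: "w \<in> carrier W"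
  shows "PM.uevr x (\<tau>0 (elt A W M w m)) = F w x m"
proof -
  have t: "elt A W M w m \<in> carrier (W \<boxtimes> M)" by (rule elt_closed[OF Wb Mb w m])
  have "PM.uevr x (\<tau>0 (elt A W M w m)) =
      finprod M (\<lambda>j. PM.uevr x (elt A M W (F.lift_pm (y j) (elt A W M w m)) (\<rho> j))) J"
    unfolding \<tau>0_def
    by (rule hom_finprod[OF PM.ev_homs(4)[OF x] MWG E.M.group])
      (use m w in \<open>auto simp: F.lift_pm_elt intro!: elt_closed[OF Mb Wb]\<close>)
  also have "\<dots> = finprod M (\<lambda>j. F w (y j \<lhd>\<^bsub>X\<^esub> uevd (\<rho> j) x) m) J"
    by (rule MG.finprod_cong') (use x w m in \<open>auto simp: PM.ev_elts F.lift_pm_elt F.ract_out\<close>)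
  also have "\<dots> = F w (finprod X (\<lambda>j. y j \<lhd>\<^bsub>X\<^esub> uevd (\<rho> j) x) J) m"
    by (rule hom_finprod[OF F.hom_q[OF w m] X.group E.M.group, symmetric]) (use x in auto)
  also have "finprod X (\<lambda>j. y j \<lhd>\<^bsub>X\<^esub> uevd (\<rho> j) x) J = x" by (rule x_ucoev[OF x, symmetric])
  finally show ?thesis .
qed

text \<open>Applying F to the summands of \<sigma>(m \<otimes> w) produces the left side of
  \<open>rel_FE\<close>, that is, m times a scalar uev(w \<otimes> y_j). The scalar crosses to
  \<rho>_j, and \<open>omega_ucoev\<close> restores w.\<close>

lemma \<tau>0_\<sigma>: "t \<in> carrier (M \<boxtimes> W) \<Longrightarrow> \<tau>0 (\<sigma> t) = t"
proof (rule tensor_hom_eqI[OF Mb Wb hom_comp[OF \<sigma>_hom \<tau>0_hom] _ MWG])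
  interpret G: comm_group "M \<boxtimes> W" by (rule MWG)
  show "(\<lambda>t. t) \<in> hom (M \<boxtimes> W) (M \<boxtimes> W)" by (simp add: hom_def)
  fix m w assume m: "m \<in> carrier M" and w: "w \<in> carrier W"
  have 1: "F.lift_pm x (\<sigma> (elt A M W m w)) = m \<lhd>\<^bsub>M\<^esub> uevd w x" if x: "x \<in> carrier X" for x
  proof -
    have "F.lift_pm x (\<sigma> (elt A M W m w)) = finprod M (\<lambda>i. F.lift_pm x (elt A W M (om i) (E (xi i) w m))) I"
      unfolding \<sigma>_elt[OF m w]
      by (rule hom_finprod[OF F.lift_pm_hom[OF x] WMG E.M.group]) (use m w in \<open>auto intro!: elt_closed[OF Wb Mb]\<close>)
    also have "\<dots> = finprod M (\<lambda>i. F (om i) x (E (xi i) w m)) I"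
      by (rule MG.finprod_cong') (use x w m in \<open>auto simp: F.lift_pm_elt\<close>)
    finally show ?thesis using x w m by (simp add: rel_FE)
  qed
  have "\<tau>0 (\<sigma> (elt A M W m w)) = finprod (M \<boxtimes> W) (\<lambda>j. elt A M W m (uevd w (y j) \<rhd>\<^bsub>W\<^esub> \<rho> j)) J"
    unfolding \<tau>0_def
    by (rule G.finprod_cong') (use m w in \<open>auto simp: 1 elt_balance[OF Mb Wb] intro!: elt_closed[OF Mb Wb]\<close>)
  also have "\<dots> = elt A M W m (finprod W (\<lambda>j. uevd w (y j) \<rhd>\<^bsub>W\<^esub> \<rho> j) J)"
    by (rule PM.finprod_elt_right[OF Mb Wb m]) (use w in auto)
  also have "finprod W (\<lambda>j. uevd w (y j) \<rhd>\<^bsub>W\<^esub> \<rho> j) J = w" by (rule omega_ucoev[OF w, symmetric])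
  finally show "\<tau>0 (\<sigma> (elt A M W m w)) = elt A M W m w" .
qed

text \<open>The same argument with \<open>rel_EF\<close> in place of \<open>rel_FE\<close>: the
  scalar ev(x_i \<otimes> w) crosses to \<omega>_i, and \<open>omega_coev\<close> restores
  w.\<close>

lemma \<sigma>_\<tau>0: "t \<in> carrier (W \<boxtimes> M) \<Longrightarrow> \<sigma> (\<tau>0 t) = t"
proof (rule tensor_hom_eqI[OF Wb Mb hom_comp[OF \<tau>0_hom \<sigma>_hom] _ WMG])
  interpret G: comm_group "W \<boxtimes> M" by (rule WMG)
  show "(\<lambda>t. t) \<in> hom (W \<boxtimes> M) (W \<boxtimes> M)" by (simp add: hom_def)
  fix w m assume w: "w \<in> carrier W" and m: "m \<in> carrier M"
  have t: "elt A W M w m \<in> carrier (W \<boxtimes> M)" by (rule elt_closed[OF Wb Mb w m])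
  have tc: "\<tau>0 (elt A W M w m) \<in> carrier (M \<boxtimes> W)" by (rule hom_in_carrier[OF \<tau>0_hom t])
  have 1: "E.lift_mq x (\<tau>0 (elt A W M w m)) = evd x w \<rhd>\<^bsub>M\<^esub> m" if x: "x \<in> carrier X" for x
  proof -
    have "E.lift_mq x (\<tau>0 (elt A W M w m)) =
        finprod M (\<lambda>j. E.lift_mq x (elt A M W (F.lift_pm (y j) (elt A W M w m)) (\<rho> j))) J"
      unfolding \<tau>0_def
      by (rule hom_finprod[OF E.lift_mq_hom[OF x] MWG E.M.group])
        (use m w in \<open>auto simp: F.lift_pm_elt intro!: elt_closed[OF Mb Wb]\<close>)
    also have "\<dots> = finprod M (\<lambda>j. E x (\<rho> j) (F w (y j) m)) J"
      by (rule MG.finprod_cong') (use x w m in \<open>auto simp: F.lift_pm_elt E.lift_mq_elt\<close>)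
    finally show ?thesis using x w m by (simp add: rel_EF)
  qed
  have "\<sigma> (\<tau>0 (elt A W M w m)) = finprod (W \<boxtimes> M) (\<lambda>i. elt A W M (om i \<lhd>\<^bsub>W\<^esub> evd (xi i) w) m) I"
    unfolding \<sigma>_sum[OF tc]
    by (rule G.finprod_cong') (use m w in \<open>auto simp: 1 elt_balance[OF Wb Mb] intro!: elt_closed[OF Wb Mb]\<close>)
  also have "\<dots> = elt A W M (finprod W (\<lambda>i. om i \<lhd>\<^bsub>W\<^esub> evd (xi i) w) I) m"
    by (rule PM.finprod_elt_left[OF Wb Mb m]) (use w in auto)
  also have "finprod W (\<lambda>i. om i \<lhd>\<^bsub>W\<^esub> evd (xi i) w) I = w" by (rule omega_coev[OF w, symmetric])
  finally show "\<sigma> (\<tau>0 (elt A W M w m)) = elt A W M w m" .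
qed

lemma \<sigma>_bij: "bij_betw \<sigma> (carrier (M \<boxtimes> W)) (carrier (W \<boxtimes> M))"
  by (rule bij_betwI[of _ _ _ \<tau>0])
    (auto simp: \<tau>0_\<sigma> \<sigma>_\<tau>0 hom_in_carrier[OF \<sigma>_hom] hom_in_carrier[OF \<tau>0_hom])

sublocale B: braided_module K A W D M \<sigma>
  by (intro braided_module.intro braided_module_axioms.intro PM.pivotal_module_axioms \<sigma>_bimod_hom \<sigma>_bij)

lemma \<tau>_eq: "t \<in> carrier (W \<boxtimes> M) \<Longrightarrow> B.\<tau> t = \<tau>0 t"
  using B.\<tau>\<sigma>[of "\<tau>0 t"] hom_in_carrier[OF \<tau>0_hom, of t] by (simp add: \<sigma>_\<tau>0)

text \<open>One half of the correspondence: operators turned into a braiding and back are unchanged.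
  For F this rests on identifying the inverse of \<sigma> with \<open>\<tau>0\<close>.\<close>

lemma ops_recovered:
  assumes "x \<in> carrier X" "w \<in> carrier W" "m \<in> carrier M"
  shows "B.E\<sigma> x w m = E x w m" "B.F\<sigma> w x m = F w x m"
  using assms by (simp_all add: B.E\<sigma>_def B.F\<sigma>_def evl_\<sigma> \<tau>_eq elt_closed[OF Wb Mb] uevr_\<tau>0)

text \<open>Applying F to the summands of \<phi>(x \<otimes> m) produces the left side of
  \<open>rel_FE'\<close>, so the coefficient at y_j is uev(\<rho>_j \<otimes> x) times m. After it
  crosses to y_j, \<open>x_ucoev\<close> restores x.\<close>

lemma psi_phi: "t \<in> carrier (X \<boxtimes> M) \<Longrightarrow> B.\<psi> (B.\<phi> t) = t"
proof (rule tensor_hom_eqI[OF Xb Mb hom_comp[OF PM.sigma_dual_hom[OF B.\<sigma>] PM.sigma_inv_dual_hom[OF B.\<tau>]] _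
      tensor_comm_group[OF Xb Mb]])
  interpret G: comm_group "X \<boxtimes> M" by (rule tensor_comm_group[OF Xb Mb])
  show "(\<lambda>t. t) \<in> hom (X \<boxtimes> M) (X \<boxtimes> M)" by (simp add: hom_def)
  \<comment> \<open>\<open>B.psi_elt\<close> covers elementary tensors only, whereas \<phi>(x
    \<otimes> m) is a sum of them.\<close>
  have psi: "B.\<psi> s = finprod (X \<boxtimes> M) (\<lambda>j. elt A X M (y j) (F.lift_mq (\<rho> j) s)) J"
    if "s \<in> carrier (M \<boxtimes> X)" for s
  proof (rule tensor_hom_eqI[OF Mb Xb PM.sigma_inv_dual_hom[OF B.\<tau>] _ G.comm_group_axioms _ that])
    show "(\<lambda>s. finprod (X \<boxtimes> M) (\<lambda>j. elt A X M (y j) (F.lift_mq (\<rho> j) s)) J) \<in> hom (M \<boxtimes> X) (X \<boxtimes> M)"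
      by (rule hom_pointwise_finprod[OF hom_comp[OF F.lift_mq_hom elt_hom_right[OF Xb Mb]]
            tensor_comm_group[OF Mb Xb] G.comm_group_axioms]) auto
    show "B.\<psi> (elt A M X m x) = finprod (X \<boxtimes> M) (\<lambda>j. elt A X M (y j) (F.lift_mq (\<rho> j) (elt A M X m x))) J"
      if "m \<in> carrier M" "x \<in> carrier X" for m x
      unfolding B.psi_elt[OF that(2,1)]
      by (rule G.finprod_cong') (use that in \<open>auto simp: F.lift_mq_elt ops_recovered intro!: elt_closed[OF Xb Mb]\<close>)
  qed
  fix x m assume x: "x \<in> carrier X" and m: "m \<in> carrier M"
  have 1: "F.lift_mq w (B.\<phi> (elt A X M x m)) = uevd w x \<rhd>\<^bsub>M\<^esub> m" if w: "w \<in> carrier W" for w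
  proof -
    have "F.lift_mq w (B.\<phi> (elt A X M x m)) = finprod M (\<lambda>i. F.lift_mq w (elt A M X (B.E\<sigma> x (om i) m) (xi i))) I"
      unfolding B.phi_elt[OF x m]
      by (rule hom_finprod[OF F.lift_mq_hom[OF w] tensor_comm_group[OF Mb Xb] E.M.group])
        (use x m in \<open>auto intro!: elt_closed[OF Mb Xb]\<close>)
    also have "\<dots> = finprod M (\<lambda>i. F w (xi i) (E x (om i) m)) I"
      by (rule MG.finprod_cong') (use x w m in \<open>auto simp: F.lift_mq_elt ops_recovered\<close>)
    finally show ?thesis using x w m by (simp add: rel_FE')
  qed
  have c: "B.\<phi> (elt A X M x m) \<in> carrier (M \<boxtimes> X)"
    by (rule hom_in_carrier[OF PM.sigma_dual_hom[OF B.\<sigma>] elt_closed[OF Xb Mb x m]])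
  have "B.\<psi> (B.\<phi> (elt A X M x m)) = finprod (X \<boxtimes> M) (\<lambda>j. elt A X M (y j \<lhd>\<^bsub>X\<^esub> uevd (\<rho> j) x) m) J"
    unfolding psi[OF c]
    by (rule G.finprod_cong') (use x m in \<open>auto simp: 1 elt_balance[OF Xb Mb] intro!: elt_closed[OF Xb Mb]\<close>)
  also have "\<dots> = elt A X M (finprod X (\<lambda>j. y j \<lhd>\<^bsub>X\<^esub> uevd (\<rho> j) x) J) m"
    by (rule PM.finprod_elt_left[OF Xb Mb m]) (use x in auto)
  also have "finprod X (\<lambda>j. y j \<lhd>\<^bsub>X\<^esub> uevd (\<rho> j) x) J = x" by (rule x_ucoev[OF x, symmetric])
  finally show "B.\<psi> (B.\<phi> (elt A X M x m)) = elt A X M x m" .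
qed

text \<open>The counterpart of \<open>psi_phi\<close>, by \<open>rel_EF'\<close> and
  \<open>x_coev\<close>.\<close>

lemma phi_psi: "t \<in> carrier (M \<boxtimes> X) \<Longrightarrow> B.\<phi> (B.\<psi> t) = t"
proof (rule tensor_hom_eqI[OF Mb Xb hom_comp[OF PM.sigma_inv_dual_hom[OF B.\<tau>] PM.sigma_dual_hom[OF B.\<sigma>]] _
      tensor_comm_group[OF Mb Xb]])
  interpret G: comm_group "M \<boxtimes> X" by (rule tensor_comm_group[OF Mb Xb])
  show "(\<lambda>t. t) \<in> hom (M \<boxtimes> X) (M \<boxtimes> X)" by (simp add: hom_def)
  have phi: "B.\<phi> s = finprod (M \<boxtimes> X) (\<lambda>i. elt A M X (E.lift_pm (om i) s) (xi i)) I"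
    if "s \<in> carrier (X \<boxtimes> M)" for s
  proof (rule tensor_hom_eqI[OF Xb Mb PM.sigma_dual_hom[OF B.\<sigma>] _ G.comm_group_axioms _ that])
    show "(\<lambda>s. finprod (M \<boxtimes> X) (\<lambda>i. elt A M X (E.lift_pm (om i) s) (xi i)) I) \<in> hom (X \<boxtimes> M) (M \<boxtimes> X)"
      by (rule hom_pointwise_finprod[OF hom_comp[OF E.lift_pm_hom elt_hom_left[OF Mb Xb]]
            tensor_comm_group[OF Xb Mb] G.comm_group_axioms]) auto
    show "B.\<phi> (elt A X M x m) = finprod (M \<boxtimes> X) (\<lambda>i. elt A M X (E.lift_pm (om i) (elt A X M x m)) (xi i)) I"
      if "x \<in> carrier X" "m \<in> carrier M" for x m
      unfolding B.phi_elt[OF that]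
      by (rule G.finprod_cong') (use that in \<open>auto simp: E.lift_pm_elt ops_recovered intro!: elt_closed[OF Mb Xb]\<close>)
  qed
  fix m x assume m: "m \<in> carrier M" and x: "x \<in> carrier X"
  have 1: "E.lift_pm w (B.\<psi> (elt A M X m x)) = m \<lhd>\<^bsub>M\<^esub> evd x w" if w: "w \<in> carrier W" for w
  proof -
    have "E.lift_pm w (B.\<psi> (elt A M X m x)) = finprod M (\<lambda>j. E.lift_pm w (elt A X M (y j) (B.F\<sigma> (\<rho> j) x m))) J"
      unfolding B.psi_elt[OF x m]
      by (rule hom_finprod[OF E.lift_pm_hom[OF w] tensor_comm_group[OF Xb Mb] E.M.group])
        (use x m in \<open>auto intro!: elt_closed[OF Xb Mb]\<close>)
    also have "\<dots> = finprod M (\<lambda>j. E (y j) w (F (\<rho> j) x m)) J"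
      by (rule MG.finprod_cong') (use x w m in \<open>auto simp: E.lift_pm_elt ops_recovered\<close>)
    finally show ?thesis using x w m by (simp add: rel_EF')
  qed
  have c: "B.\<psi> (elt A M X m x) \<in> carrier (X \<boxtimes> M)"
    by (rule hom_in_carrier[OF PM.sigma_inv_dual_hom[OF B.\<tau>] elt_closed[OF Mb Xb m x]])
  have "B.\<phi> (B.\<psi> (elt A M X m x)) = finprod (M \<boxtimes> X) (\<lambda>i. elt A M X m (evd x (om i) \<rhd>\<^bsub>X\<^esub> xi i)) I"
    unfolding phi[OF c]
    by (rule G.finprod_cong') (use x m in \<open>auto simp: 1 elt_balance[OF Mb Xb] intro!: elt_closed[OF Mb Xb]\<close>)
  also have "\<dots> = elt A M X m (finprod X (\<lambda>i. evd x (om i) \<rhd>\<^bsub>X\<^esub> xi i) I)"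
    by (rule PM.finprod_elt_right[OF Mb Xb m]) (use x in auto)
  also have "finprod X (\<lambda>i. evd x (om i) \<rhd>\<^bsub>X\<^esub> xi i) I = x" by (rule x_coev[OF x, symmetric])
  finally show "B.\<phi> (B.\<psi> (elt A M X m x)) = elt A M X m x" .
qed

lemma IM_object: "bimod_extensional A M \<Longrightarrow> (M, \<sigma>) \<in> IM_objects K A W D"
  by (simp add: IM_objects_def Let_def E.M.algebra_bimodule_axioms \<sigma>_bimod_hom \<sigma>_extensional \<sigma>_bij
      psi_phi phi_psi)

end

section \<open>The isomorphism of categories\<close>

text \<open>Both functors are the identity on arrows. The category laws of \<open>D\<close> are
  transported from \<open>C\<close> along the bijection of objects, so only one of the two
  categories has to be verified directly.\<close>

lemma isomorphic_categoriesI: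
  assumes C: "category C" and bij: "bij_betw Fo (Obj C) (Obj D)"
    and hom: "\<And>X Y. X \<in> Obj C \<Longrightarrow> Y \<in> Obj C \<Longrightarrow> Hom D (Fo X) (Fo Y) = Hom C X Y"
    and comp: "\<And>X Y Z f g. X \<in> Obj C \<Longrightarrow> Y \<in> Obj C \<Longrightarrow> Z \<in> Obj C \<Longrightarrow>
      Comp D (Fo X) (Fo Y) (Fo Z) g f = Comp C X Y Z g f"
    and ident: "\<And>X. X \<in> Obj C \<Longrightarrow> Ident D (Fo X) = Ident C X"
  shows "isomorphic_categories C D"
proof -
  interpret C: category C by fact
  define Go where "Go = inv_into (Obj C) Fo"
  have Fo: "Fo X \<in> Obj D" if "X \<in> Obj C" for X
    using bij that by (auto simp: bij_betw_def)
  have Go: "Go X \<in> Obj C" "Fo (Go X) = X" if "X \<in> Obj D" for X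
    using bij that by (auto simp: bij_betw_def Go_def inv_into_into f_inv_into_f)
  have GF: "Go (Fo X) = X" if "X \<in> Obj C" for X
    using bij that by (simp add: Go_def bij_betw_inv_into_left)
  have hom': "Hom D X Y = Hom C (Go X) (Go Y)" if "X \<in> Obj D" "Y \<in> Obj D" for X Y
    using hom[of "Go X" "Go Y"] that by (simp add: Go)
  have comp': "Comp D X Y Z g f = Comp C (Go X) (Go Y) (Go Z) g f"
    if "X \<in> Obj D" "Y \<in> Obj D" "Z \<in> Obj D" for X Y Z f g
    using comp[of "Go X" "Go Y" "Go Z" g f] that by (simp add: Go)
  have ident': "Ident D X = Ident C (Go X)" if "X \<in> Obj D" for X
    using ident[of "Go X"] that by (simp add: Go)
  have D: "category D"
  proof (rule category.intro)
    show "Comp D V Y Z h (Comp D V X Y g f) = Comp D V X Z (Comp D X Y Z h g) f"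
      if "V \<in> Obj D" "X \<in> Obj D" "Y \<in> Obj D" "Z \<in> Obj D"
        "f \<in> Hom D V X" "g \<in> Hom D X Y" "h \<in> Hom D Y Z" for V X Y Z f g h
      using that C.comp_assoc[of "Go V" "Go X" "Go Y" "Go Z" f g h] by (simp add: hom' comp' Go)
  qed (simp_all add: hom' comp' ident' Go C.comp_closed C.ident_closed C.comp_ident_left C.comp_ident_right)
  have "category_functor C D Fo (\<lambda>_ _ f. f)"
    by (intro category_functor.intro category_functor_axioms.intro C D)
      (simp_all add: Fo hom comp ident)
  moreover have "category_functor D C Go (\<lambda>_ _ f. f)"
    by (intro category_functor.intro category_functor_axioms.intro C D)
      (simp_all add: Go hom' comp' ident')
  ultimately show ?thesis
    unfolding isomorphic_categories_def using GF Go by blast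
qed

lemma category_lmod_category:
  fixes R :: "('r, 'rx) ring_scheme"
  shows "category (lmod_category R :: (('r, 'm) lmod, 'm \<Rightarrow> 'm) cat)"
proof (rule category.intro; unfold lmod_category_def cat.simps)
  let ?Hom = "\<lambda>M N. {f \<in> hom M N \<inter> extensional (carrier M).
       \<forall>r\<in>carrier R. \<forall>m\<in>carrier M. f (act M r m) = act N r (f m)}"
  fix L M N :: "('r, 'm) lmod" and f g
  assume "L \<in> {M. left_module R M \<and> lmod_extensional R M}"
    and fg: "f \<in> ?Hom L M" "g \<in> ?Hom M N"
  then interpret L: left_module R L by simp
  interpret LG: comm_group L by (rule L.group)
  have "f m \<in> carrier M" if "m \<in> carrier L" for m
    using fg that by (auto simp: hom_def)
  then show "compose (carrier L) g f \<in> ?Hom L N"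
    using fg by (auto simp: hom_def compose_def L.act_closed Pi_iff)
next
  fix L M N V :: "('r, 'm) lmod" and f g h :: "'m \<Rightarrow> 'm"
  show "compose (carrier L) h (compose (carrier L) g f) = compose (carrier L) (compose (carrier M) h g) f"
    if "f \<in> {f \<in> hom L M \<inter> extensional (carrier L).
       \<forall>r\<in>carrier R. \<forall>m\<in>carrier L. f (act L r m) = act M r (f m)}"
    using that by (auto simp: compose_def hom_def fun_eq_iff)
next
  fix M :: "('r, 'm) lmod" assume "M \<in> {M. left_module R M \<and> lmod_extensional R M}"
  then interpret M: left_module R M by simp
  interpret MG: comm_group M by (rule M.group)
  show "(\<lambda>m\<in>carrier M. m) \<in> {f \<in> hom M M \<inter> extensional (carrier M).
       \<forall>r\<in>carrier R. \<forall>m\<in>carrier M. f (act M r m) = act M r (f m)}"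
    by (auto simp: hom_def M.act_closed)
qed (auto simp: compose_def hom_def extensional_def fun_eq_iff)

text \<open>A bimodule map commutes with the contractions that read the operators off \<sigma> and
  its inverse. Conversely, \<sigma> is a sum built from the operators E, so commuting with these is
  enough to commute with \<sigma>.\<close>

lemma braided_morphism_iff:
  fixes K :: "('k, 'kx) ring_scheme" and A :: "('k, 'a, 'ax) module_scheme" (structure)
    and W :: "('a, 'w) bimod" and D :: "('a, 'w, 'x) dual_data"
    and M :: "('a, 'm) bimod" and M' :: "('a, 'm) bimod"
  assumes R: "pivotal_rep K A W D M E F" and R': "pivotal_rep K A W D M' E' F'"
    and f: "f \<in> bimod_hom A M M'"
  defines "\<sigma> \<equiv> pivotal_setup.rep_braiding A W D M E" and "\<sigma>' \<equiv> pivotal_setup.rep_braiding A W D M' E'"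
  shows "(\<forall>t\<in>carrier (M \<boxtimes> W). \<sigma>' (tensor_map A M W M' W f id t) = tensor_map A W M W M' id f (\<sigma> t)) \<longleftrightarrow>
    (\<forall>x\<in>carrier (dualX D). \<forall>w\<in>carrier W. \<forall>m\<in>carrier M.
      f (E x w m) = E' x w (f m) \<and> f (F w x m) = F' w x (f m))" (is "?L = ?R")
proof -
  interpret R: pivotal_rep K A W D M E F by fact
  interpret R': pivotal_rep K A W D M' E' F' by fact
  have f': "f \<in> left_hom A M M'" "f \<in> right_hom A M M'" and fh: "f \<in> hom M M'"
    using bimod_homD[OF f] by auto
  note fc [simp] = hom_in_carrier[OF fh]
  note Wb = R.Wb and Mb = R.Mb and Mb' = R'.Mb
  note id = id_bimod_hom
  note fi_hom = tensor_map_hom[OF Mb Wb Mb' Wb f'(2) id(2)]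
    and fi_elt = tensor_map_elt[OF Mb Wb Mb' Wb f'(2) id(2)]
    and if_hom = tensor_map_hom[OF Wb Mb Wb Mb' id(3) f'(1)]
    and if_elt = tensor_map_elt[OF Wb Mb Wb Mb' id(3) f'(1)]
  let ?fi = "tensor_map A M W M' W f id" and ?if = "tensor_map A W M W M' id f"
  note MWc = elt_closed[OF Mb Wb] and WMc = elt_closed[OF Wb Mb]
  show ?thesis
  proof
    assume L: ?L
    have evl: "R'.PM.evl x (?if t) = f (R.PM.evl x t)"
      if x: "x \<in> carrier R.X" and t: "t \<in> carrier (W \<boxtimes> M)" for x t
      by (rule tensor_hom_eqI[OF Wb Mb hom_comp[OF if_hom R'.PM.ev_homs(1)[OF x]]
            hom_comp[OF R.PM.ev_homs(1)[OF x] fh] R'.E.M.group _ t])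
        (use x in \<open>simp add: if_elt R.PM.ev_elts R'.PM.ev_elts left_homD(2)[OF f'(1)]\<close>)
    have uevr: "R'.PM.uevr x (?fi t) = f (R.PM.uevr x t)"
      if x: "x \<in> carrier R.X" and t: "t \<in> carrier (M \<boxtimes> W)" for x t
      by (rule tensor_hom_eqI[OF Mb Wb hom_comp[OF fi_hom R'.PM.ev_homs(4)[OF x]]
            hom_comp[OF R.PM.ev_homs(4)[OF x] fh] R'.E.M.group _ t])
        (use x in \<open>simp add: fi_elt R.PM.ev_elts R'.PM.ev_elts right_homD(2)[OF f'(2)]\<close>)
    \<comment> \<open>The operators F are contractions of the inverse braidings, so compatibility
      with \<sigma> is first carried over to the inverses.\<close>
    have \<tau>: "R'.B.\<tau> (?if s) = ?fi (R.B.\<tau> s)" if s: "s \<in> carrier (W \<boxtimes> M)" for s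
    proof -
      have t: "R.B.\<tau> s \<in> carrier (M \<boxtimes> W)" by (rule R.B.\<tau>_closed[OF s])
      have "?if s = R'.\<sigma> (?fi (R.B.\<tau> s))"
        using L t R.B.\<sigma>\<tau>[OF s] by (simp add: \<sigma>_def \<sigma>'_def)
      then show ?thesis using R'.B.\<tau>\<sigma>[OF hom_in_carrier[OF fi_hom t]] by simp
    qed
    show ?R
    proof (intro ballI conjI)
      fix x w m assume x: "x \<in> carrier (dualX D)" and w: "w \<in> carrier W" and m: "m \<in> carrier M"
      have "E' x w (f m) = R'.PM.evl x (R'.\<sigma> (?fi (elt A M W m w)))"
        using x w m by (simp add: fi_elt R'.evl_\<sigma>)
      also have "\<dots> = R'.PM.evl x (?if (R.\<sigma> (elt A M W m w)))"
        using L MWc[OF m w] by (simp add: \<sigma>_def \<sigma>'_def)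
      also have "\<dots> = f (E x w m)"
        using x w m by (simp add: evl R.\<sigma>_closed MWc R.evl_\<sigma>)
      finally show "f (E x w m) = E' x w (f m)" by simp
      have "F' w x (f m) = R'.PM.uevr x (R'.B.\<tau> (?if (elt A W M w m)))"
        using R'.ops_recovered(2)[OF x w, of "f m"] x w m by (simp add: if_elt R'.B.F\<sigma>_def)
      also have "\<dots> = f (F w x m)"
        using R.ops_recovered(2)[OF x w m] x w m by (simp add: \<tau> uevr WMc R.B.\<tau>_closed R.B.F\<sigma>_def)
      finally show "f (F w x m) = F' w x (f m)" by simp
    qed
  next
    assume R: ?R
    interpret G: comm_group "W \<boxtimes> M'" by (rule R'.WMG)
    show ?L unfolding \<sigma>_def \<sigma>'_def
    proof
      fix t assume t: "t \<in> carrier (M \<boxtimes> W)"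
      show "R'.\<sigma> (?fi t) = ?if (R.\<sigma> t)"
      proof (rule tensor_hom_eqI[OF Mb Wb hom_comp[OF fi_hom R'.\<sigma>_hom] hom_comp[OF R.\<sigma>_hom if_hom] R'.WMG _ t])
        fix m w assume m: "m \<in> carrier M" and w: "w \<in> carrier W"
        have "?if (R.\<sigma> (elt A M W m w)) =
            finprod (W \<boxtimes> M') (\<lambda>i. ?if (elt A W M (R.om i) (E (R.xi i) w m))) R.I"
          unfolding R.\<sigma>_elt[OF m w]
          by (rule hom_finprod[OF if_hom R.WMG R'.WMG]) (use m w in \<open>auto intro!: WMc\<close>)
        also have "\<dots> = R'.\<sigma> (elt A M' W (f m) w)"
          unfolding R'.\<sigma>_elt[OF fc[OF m] w]
          by (rule G.finprod_cong')
            (use m w R in \<open>auto simp: if_elt intro!: elt_closed[OF Wb Mb']\<close>)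
        finally show "R'.\<sigma> (?fi (elt A M W m w)) = ?if (R.\<sigma> (elt A M W m w))"
          using fi_elt[OF m w] by simp
      qed
    qed
  qed
qed

section \<open>The bijection on objects and the equality of Hom sets\<close>

context pivotal_setup
begin

abbreviation "lmods \<equiv> Obj (lmod_category H :: ((('a, 'w, 'x) tz set, 'm) lmod, 'm \<Rightarrow> 'm) cat)"

definition to_IM :: "(('a, 'w, 'x) tz set, 'm) lmod \<Rightarrow> ('a, 'm, 'w) im_obj" where
  "to_IM N = (H_module.BN K A W D N,
     rep_braiding (H_module.BN K A W D N) (\<lambda>x w. H_module.\<theta> K A W D N (xw x w)))"

lemma lmods_iff: "N \<in> lmods \<longleftrightarrow> H_module K A W D N \<and> lmod_extensional H N"
  by (auto simp: lmod_category_def H_module_def pivotal_setup_axioms)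

lemma to_IM_closed: "N \<in> lmods \<Longrightarrow> to_IM N \<in> IM_objects K A W D"
proof -
  assume N: "N \<in> lmods"
  then interpret N: H_module K A W D N by (simp add: lmods_iff)
  interpret R: pivotal_rep K A W D N.BN N.EN N.FN by (rule N.N_rep)
  show ?thesis unfolding to_IM_def
    using N by (intro R.IM_object N.BN_extensional) (simp add: lmods_iff)
qed

text \<open>Equal bimodules with equal braidings have equal operators by
  \<open>ops_recovered\<close>, so the identity map commutes with all generators and
  \<open>H_linear_iff\<close> makes the two actions agree on the carriers. Elsewhere both are
  \<open>undefined\<close>.\<close>

lemma to_IM_inj: "inj_on to_IM lmods"
proof (rule inj_onI)
  fix N N' :: "(('a, 'w, 'x) tz set, 'm) lmod"
  assume N: "N \<in> lmods" and N': "N' \<in> lmods" and eq: "to_IM N = to_IM N'"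
  then interpret N: H_module K A W D N by (simp add: lmods_iff)
  interpret N': H_module K A W D N' using N' by (simp add: lmods_iff)
  interpret R: pivotal_rep K A W D N.BN N.EN N.FN by (rule N.N_rep)
  interpret R': pivotal_rep K A W D N'.BN N'.EN N'.FN by (rule N'.N_rep)
  have BN: "N.BN = N'.BN" and \<sigma>: "R.\<sigma> = R'.\<sigma>"
    using eq unfolding to_IM_def prod.inject by blast+
  note \<sigma> = \<sigma>[unfolded BN]
  have car: "carrier N = carrier N'" and mul: "monoid.mult N = monoid.mult N'" and one: "\<one>\<^bsub>N\<^esub> = \<one>\<^bsub>N'\<^esub>"
    using BN by (simp_all add: N.BN_def N'.BN_def)
  have idh: "(\<lambda>m. m) \<in> hom N N'" by (simp add: hom_def car mul)
  have "\<forall>h\<in>carrier H. \<forall>m\<in>carrier N. act N h m = act N' h m"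
  proof (subst H_linear_iff[OF N.H_module_axioms N'.H_module_axioms idh], intro ballI conjI)
    fix m assume "m \<in> carrier N"
    then have m: "m \<in> carrier N.BN" "m \<in> carrier N'.BN" by (simp_all add: N.BN_simps N'.BN_simps car)
    fix x w assume xw: "x \<in> carrier X" "w \<in> carrier W"
    show "N.EN x w m = N'.EN x w m" "N.FN w x m = N'.FN w x m"
      using R.ops_recovered[OF xw m(1)] R'.ops_recovered[OF xw m(2)] by (simp_all add: BN \<sigma>)
  qed (simp_all add: BN)
  then have "act N h m = act N' h m" for h m
    using N N' car by (cases "h \<in> carrier H \<and> m \<in> carrier N") (auto simp: lmods_iff lmod_extensional_def)
  then have "act N = act N'" by (simp add: fun_eq_iff)
  then show "N = N'" using car mul one by simp
qed

text \<open>The operators of the braiding define an action of \<open>H\<close> on \<open>M\<close>.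
  Its bimodule is \<open>M\<close> again, as a record, because \<open>M\<close> is extensional; its
  braiding is \<sigma> again because \<open>recon_WM\<close> rebuilds \<sigma>(m \<otimes> w) from
  its contractions.\<close>

lemma to_IM_surj:
  assumes "(M, \<sigma>) \<in> IM_objects K A W D"
  shows "\<exists>N\<in>lmods. to_IM N = (M, \<sigma>)"
proof -
  have M: "algebra_bimodule K A M" and ext: "bimod_extensional A M"
    and \<sigma>: "\<sigma> \<in> bimod_hom A (M \<boxtimes> W) (W \<boxtimes> M)" "\<sigma> \<in> extensional (carrier (M \<boxtimes> W))"
      "bij_betw \<sigma> (carrier (M \<boxtimes> W)) (carrier (W \<boxtimes> M))"
    using assms by (simp_all add: IM_objects_def Let_def)
  interpret B: braided_module K A W D M \<sigma>
    by (intro braided_module.intro braided_module_axioms.intro pivotal_module.intro pivotal_setup_axioms M \<sigma>)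
  have "pivotal_rep K A W D M B.E\<sigma> B.F\<sigma>"
    by (rule B.braided_rep) (use assms in \<open>simp_all add: IM_objects_def Let_def\<close>)
  then interpret R: pivotal_rep K A W D M B.E\<sigma> B.F\<sigma> .
  obtain \<Psi> where \<Psi>: "\<Psi> \<in> ring_hom H (End M)"
    and \<Psi>A: "\<And>a m. a \<in> carrier A \<Longrightarrow> m \<in> carrier M \<Longrightarrow> \<Psi> (\<pi> (inA a)) m = a \<rhd>\<^bsub>M\<^esub> m"
      "\<And>a m. a \<in> carrier A \<Longrightarrow> m \<in> carrier M \<Longrightarrow> \<Psi> (\<pi> (inO a)) m = m \<lhd>\<^bsub>M\<^esub> a"
    and \<Psi>E: "\<And>x w m. x \<in> carrier X \<Longrightarrow> w \<in> carrier W \<Longrightarrow> m \<in> carrier M \<Longrightarrow> \<Psi> (\<pi> (xw x w)) m = B.E\<sigma> x w m"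
    using R.H_action by blast
  define N where "N = ring_action_module H M \<Psi>"
  have N: "left_module H N" unfolding N_def by (rule left_module_ring_action_module[OF H_ring B.M.group \<Psi>])
  interpret N: H_module K A W D N
    by (intro H_module.intro pivotal_setup_axioms N)
  have NL: "N \<in> lmods"
    unfolding lmods_iff using ext N.H_module_axioms
    by (intro conjI) (simp, auto simp: lmod_extensional_def bimod_extensional_def N_def ring_action_module_def)
  have Ncar: "carrier N = carrier M" by (simp add: N_def ring_action_module_def)
  have \<theta>: "N.\<theta> t m = \<Psi> (\<pi> t) m" if "t \<in> carrier T" "m \<in> carrier M" for t m
    unfolding N.\<theta>_def using N.pi_closed[OF that(1)] that by (simp add: N_def ring_action_module_def)
  have BN: "N.BN = M"
  proof -
    have "lact N.BN = lact M" "ract N.BN = ract M"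
      using ext by (auto simp: N.BN_def Ncar \<theta> \<Psi>A bimod_extensional_def fun_eq_iff)
    moreover have "carrier N.BN = carrier M" "monoid.mult N.BN = monoid.mult M" "\<one>\<^bsub>N.BN\<^esub> = \<one>\<^bsub>M\<^esub>"
      unfolding N.BN_def by (simp_all add: N_def ring_action_module_def)
    ultimately show ?thesis by simp
  qed
  interpret R': pivotal_rep K A W D M N.EN N.FN using N.N_rep by (simp add: BN)
  interpret G: comm_group "W \<boxtimes> M" by (rule R.WMG)
  have "rep_braiding M N.EN = \<sigma>"
  proof (rule extensionalityI[OF R'.\<sigma>_extensional \<sigma>(2)])
    fix t assume t: "t \<in> carrier (M \<boxtimes> W)"
    show "rep_braiding M N.EN t = \<sigma> t"
    proof (rule tensor_hom_eqI[OF B.Mb Wb R'.\<sigma>_hom bimod_homD(3)[OF \<sigma>(1)] R.WMG _ t])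
      fix m w assume m: "m \<in> carrier M" and w: "w \<in> carrier W"
      have "rep_braiding M N.EN (elt A M W m w) =
          finprod (W \<boxtimes> M) (\<lambda>i. elt A W M (om i) (B.evl (xi i) (\<sigma> (elt A M W m w)))) I"
        unfolding R'.\<sigma>_elt[OF m w]
        by (rule G.finprod_cong')
          (use m w in \<open>auto simp: \<theta> \<Psi>E B.E\<sigma>_def[symmetric] intro!: elt_closed[OF Wb B.Mb]\<close>)
      also have "\<dots> = \<sigma> (elt A M W m w)" by (rule B.recon_WM[OF B.\<sigma>_closed[OF B.MWc[OF m w]]])
      finally show "rep_braiding M N.EN (elt A M W m w) = \<sigma> (elt A M W m w)" .
    qed
  qed
  then show ?thesis using NL by (intro bexI[of _ N]) (simp_all add: to_IM_def BN)
qed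

text \<open>Linearity over \<open>H\<close> is tested on generators: those from \<open>A\<close> and
  its opposite ask for a bimodule map, and the other two families ask for compatibility with the
  braidings by \<open>braided_morphism_iff\<close>.\<close>

lemma to_IM_Hom:
  assumes N: "N \<in> lmods" and N': "N' \<in> lmods"
  shows "Hom (IM_category K A W D) (to_IM N) (to_IM N') = Hom (lmod_category H) N N'"
proof -
  interpret N: H_module K A W D N using N by (simp add: lmods_iff)
  interpret N': H_module K A W D N' using N' by (simp add: lmods_iff)
  note iff = braided_morphism_iff[OF N.N_rep N'.N_rep]
  have hom: "hom N.BN N'.BN = hom N N'" by (simp add: hom_def N.BN_simps N'.BN_simps)
  have bim: "f \<in> bimod_hom A N.BN N'.BN \<longleftrightarrow> f \<in> hom N N' \<and>
      (\<forall>m\<in>carrier N. (\<forall>a\<in>carrier A. f (a \<rhd>\<^bsub>N.BN\<^esub> m) = a \<rhd>\<^bsub>N'.BN\<^esub> f m) \<and>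
        (\<forall>a\<in>carrier A. f (m \<lhd>\<^bsub>N.BN\<^esub> a) = f m \<lhd>\<^bsub>N'.BN\<^esub> a))" for f
    unfolding bimod_hom_def left_hom_def right_hom_def hom N.BN_simps(1) by blast
  have "f \<in> Hom (IM_category K A W D) (to_IM N) (to_IM N') \<longleftrightarrow> f \<in> Hom (lmod_category H) N N'" for f
  proof -
    have "f \<in> Hom (IM_category K A W D) (to_IM N) (to_IM N') \<longleftrightarrow>
        f \<in> bimod_hom A N.BN N'.BN \<and> f \<in> extensional (carrier N) \<and>
        (\<forall>x\<in>carrier X. \<forall>w\<in>carrier W. \<forall>m\<in>carrier N.
          f (N.EN x w m) = N'.EN x w (f m) \<and> f (N.FN w x m) = N'.FN w x (f m))"
      using iff[of f] by (auto simp: IM_category_def to_IM_def N.BN_simps(1))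
    also have "\<dots> \<longleftrightarrow> f \<in> hom N N' \<and> f \<in> extensional (carrier N) \<and>
        (\<forall>h\<in>carrier H. \<forall>m\<in>carrier N. f (act N h m) = act N' h (f m))"
      using H_linear_iff[OF N.H_module_axioms N'.H_module_axioms, of f] unfolding bim by blast
    also have "\<dots> \<longleftrightarrow> f \<in> Hom (lmod_category H) N N'"
      by (auto simp: lmod_category_def)
    finally show ?thesis .
  qed
  then show ?thesis by blast
qed

lemma to_IM_bij: "bij_betw to_IM lmods (IM_objects K A W D)"
  unfolding bij_betw_def using to_IM_inj to_IM_closed to_IM_surj by force

end

theorem theorem4p10:
  fixes K :: "('k, 'kx) ring_scheme" and A :: "('k, 'a, 'ax) module_scheme"
    and \<Omega> :: "('a, 'w) bimod" and D :: "('a, 'w, 'x) dual_data"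
  assumes "assoc_algebra K A"
    and "algebra_bimodule K A \<Omega>"
    and "pivotal A \<Omega>"
    and "pivotal_dual K A \<Omega> D"
  shows "isomorphic_categories
    (lmod_category (H_algebra K A \<Omega> D) :: ((('a, 'w, 'x) tz set, 'm) lmod, 'm \<Rightarrow> 'm) cat)
    (IM_category K A \<Omega> D :: (('a, 'm, 'w) im_obj, 'm \<Rightarrow> 'm) cat)"
proof -
  interpret pivotal_setup K A \<Omega> D
    using assms by (intro pivotal_setup.intro)
  \<comment> \<open>Composition and identities refer to the carriers alone, so equality of carriers
    makes them literally the same in both categories.\<close>
  have BN: "left_module H N \<Longrightarrow> carrier (H_module.BN K A \<Omega> D N) = carrier N"
    for N :: "(('a, 'w, 'x) tz set, 'm) lmod"
    by (intro H_module.BN_simps H_module.intro pivotal_setup_axioms)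
  show ?thesis
  proof (rule isomorphic_categoriesI[where Fo = to_IM])
    show "bij_betw to_IM lmods (Obj (IM_category K A \<Omega> D))"
      using to_IM_bij by (simp add: IM_category_def)
  qed (simp_all add: category_lmod_category to_IM_Hom,
      simp_all add: lmod_category_def IM_category_def to_IM_def BN)
qed

end
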